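(* Let $A=(a_1\,\cdots\,a_n)\in\mathbb{Z}^{d\times n}$ with $\sum_{j=1}^n\mathbb{Z}a_j=\mathbb{Z}^d$, and let $\tau$ be a facet of $\Gamma_A$ containing only $d$ columns of $A$. If $\beta\in\mathbb{C}^d$ is nonresonant, then the space of holomorphic solutions of $M_A(\beta)$ at a nonsingular point has a monodromy invariant subspace $S_\tau$ of dimension $\operatorname{vol}_{\mathbb{Z}^d}(\tau)$ whose elements can only have singularities along the zero set of the principal $\tau$-determinant $\mathcal{E}_\tau$. Moreover, if $T$ is any regular triangulation of $A$ refining $\Gamma_A$ and $\beta\in\mathbb{C}^d$ is very generic (with respect to $T$), then one can take $S_\tau$ to be the space generated by $\{\phi_\sigma^{\mathbf{k}}:\sigma\in T(\tau),\ \mathbf{k}\in\Omega_\sigma\}$, where $T(\tau)=\{\sigma\in T:\sigma\subseteq\tau\}$ ($\sigma$ ranging over maximal simplices).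
   Context: Hypergeometric system. $D=\mathbb{C}[x_1,\dots,x_n]\langle\partial_1,\dots,\partial_n\rangle$ is the Weyl algebra. $M_A(\beta)=D/DH_A(\beta)$, where $H_A(\beta)$ is the left ideal generated by $\partial^{u_+}-\partial^{u_-}$ for $u\in\mathbb{Z}^n$, $Au=0$ ($u=u_+-u_-$, $u_\pm\in\mathbb{N}^n$ with disjoint supports) and $\sum_j a_{ij}x_j\partial_j-\beta_i$, $i=1,\dots,d$. A nonsingular point is a point $p$ outside the singular locus $\mathscr{S}_A$ of $M_A(\beta)$. The solution space at $p$ is the space of germs at $p$ of holomorphic solutions; $\pi_1(\mathbb{C}^n\setminus\mathscr{S}_A,p)$ acts on it by analytic continuation, and "monodromy invariant" means stable under this action. "Can only have singularities along $\{\mathcal{E}_\tau=0\}$" means that every element extends to a multivalued holomorphic function on $\{x\in\mathbb{C}^n:\mathcal{E}_\tau(x_\tau)\ne0\}$. Nonresonance. $\beta$ is nonresonant if $\beta\notin\mathbb{Z}^d+\mathbb{C}F$ for every facet $F$ of $\operatorname{pos}(A)=\sum_j\mathbb{R}_{\ge0}a_j$ ($\mathbb{C}F$ = complex linear span). Combinatorics. For $\tau\subseteq\{1,\dots,n\}$: $A_\tau$ is the submatrix with columns $a_i$, $i\in\tau$; $\overline\tau=\{1,\dots,n\}\setminus\tau$; $\operatorname{pos}(\tau)=\sum_{i\in\tau}\mathbb{R}_{\ge0}a_i$; $\Delta_\tau=\operatorname{conv}(\{a_i:i\in\tau\}\cup\{\mathbf{0}\})$; $\operatorname{vol}_{\mathbb{Z}^d}(\tau)=d!\operatorname{vol}(\Delta_\tau)$;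 $x_\tau=(x_j)_{j\in\tau}$. For $\omega\in\mathbb{R}^n$, $T_\omega$ is the complex with $\tau\in T_\omega$ iff there is $\mathbf{c}\in\mathbb{R}^d$ with $\langle\mathbf{c},a_j\rangle=\omega_j$ for $j\in\tau$ and $\langle\mathbf{c},a_j\rangle<\omega_j$ for $j\notin\tau$; it is a regular subdivision of $A$ if $\operatorname{pos}(A)=\bigcup_{\tau\in T_\omega}\operatorname{pos}(\tau)$, and a regular triangulation if moreover it is an abstract simplicial complex. $T$ refines $T'$ if every element of $T$ is contained in an element of $T'$. $\Gamma_A:=T_{(1,\dots,1)}$; its maximal cells, called its facets, are the facets of $\Delta_A=\Delta_{\{1,\dots,n\}}$ not containing the origin (a facet is identified with the set of indices of the columns of $A$ lying on it). Principal determinant. For a facet $\tau$ of $\Gamma_A$, $\mathcal{E}_\tau=\mathcal{E}_{A_\tau}\in\mathbb{C}[x_\tau]$ is the Gelfand–Kapranov–Zelevinsky principal $A_\tau$-determinant. Only its zero set matters here: it is the set of $x_\tau\in\mathbb{C}^\tau$ for which there are a nonempty face $F$ of $\operatorname{conv}(a_i:i\in\tau)$ (possibly the whole polytope) and $t\in(\mathbb{C}^* )^d$ with $\sum_{j\in\tau,\,a_j\in F}x_jt^{a_j}a_j=0$. $\Gamma$-series. A simplex is a subset $\sigma$ such that the columns of $A_\sigma$ form a basis of $\mathbb{R}^d$. For $\mathbf{k}\in\mathbb{N}^{\overline\sigma}$ let $v=v_\sigma^{\mathbf{k}}\in\mathbb{C}^n$ be the vector with $Av=\beta$ and $v_j=k_j$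 for $j\notin\sigma$, and set $$\phi_\sigma^{\mathbf{k}}=\sum_{u\in\ker(A)\cap\mathbb{Z}^n}\frac{x^{v+u}}{\prod_{j=1}^n\Gamma(v_j+u_j+1)}\qquad(1/\Gamma=0\text{ at nonpositive integers}).$$ $\Omega_\sigma\subset\mathbb{N}^{\overline\sigma}$ is a set of representatives for the relation $\mathbf{k}\sim\mathbf{k}'$ iff $A_{\overline\sigma}\mathbf{k}-A_{\overline\sigma}\mathbf{k}'\in\mathbb{Z}A_\sigma$. Given a regular triangulation $T$, $\beta$ is very generic if $A_\sigma^{-1}(\beta-\sum_{i\notin\sigma}k_ia_i)$ has no integer coordinate for all maximal simplices $\sigma\in T$ and all $\mathbf{k}\in\Omega_\sigma$. If $T$ refines $\Gamma_A$ and $\beta$ is very generic, these series converge to (multivalued) solutions on $U_T(R)\cap(\mathbb{C}^* )^n$ for some $R>0$, where $U_T(R)=\bigcap_\sigma\{x:|x_j|<R|x_\sigma^{A_\sigma^{-1}a_j}|\ \forall j\notin\sigma\text{ with }|A_\sigma^{-1}a_j|=1\}$ over the maximal simplices $\sigma$ of $T$ ($|b|$ denotes the sum of the coordinates of $b\in\mathbb{R}^d$); at other nonsingular points they are understood via analytic continuation. *)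

theory Defs
  imports "HOL-Complex_Analysis.Complex_Analysis" "HOL-Library.Poly_Mapping"
begin

no_notation fps_nth (infixl "$" 75)

section \<open>The Weyl algebra\<close>

text \<open>
  An element of \<open>D = \<complex>[x]\<langle>\<partial>\<rangle>\<close> is given by its normally ordered expansion: the coefficient
  at \<open>(a, b)\<close> is that of \<open>x\<^sup>a \<partial>\<^sup>b\<close>.
\<close>

type_synonym 'n weyl = "((nat^'n) \<times> (nat^'n)) \<Rightarrow>\<^sub>0 complex"

text \<open>
  Leibniz rule:
  \<open>x\<^sup>a \<partial>\<^sup>b x\<^sup>c \<partial>\<^sup>e = \<Sum>k \<le> min(b,c). (\<Prod>i. (b\<^sub>i choose k\<^sub>i) (c\<^sub>i choose k\<^sub>i) k\<^sub>i!) x\<^bsup>a+c-k\<^esup> \<partial>\<^bsup>b+e-k\<^esup>\<close>.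
\<close>

definition weyl_monom_times ::
  "(nat^'n) \<times> (nat^'n) \<Rightarrow> (nat^'n) \<times> (nat^'n) \<Rightarrow> ('n::finite) weyl" where
  "weyl_monom_times m m' = (case (m, m') of ((a, b), (c, e)) \<Rightarrow>
     (\<Sum>k\<in>{k. \<forall>i. k$i \<le> min (b$i) (c$i)}.
        Poly_Mapping.single (\<chi> i. a$i + c$i - k$i, \<chi> i. b$i + e$i - k$i)
          (\<Prod>i\<in>UNIV. of_nat ((b$i choose k$i) * (c$i choose k$i) * fact (k$i)))))"

definition weyl_times :: "('n::finite) weyl \<Rightarrow> 'n weyl \<Rightarrow> 'n weyl" where
  "weyl_times P Q = (\<Sum>m\<in>Poly_Mapping.keys P. \<Sum>m'\<in>Poly_Mapping.keys Q.
     Poly_Mapping.map ((*) (Poly_Mapping.lookup P m * Poly_Mapping.lookup Q m'))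
       (weyl_monom_times m m'))"

definition weyl_left_ideal :: "('n::finite) weyl set \<Rightarrow> bool" where
  "weyl_left_ideal I \<longleftrightarrow> 0 \<in> I \<and> (\<forall>P\<in>I. \<forall>Q\<in>I. P + Q \<in> I) \<and> (\<forall>P. \<forall>Q\<in>I. weyl_times P Q \<in> I)"

definition mono_eval :: "complex^'n \<Rightarrow> nat^('n::finite) \<Rightarrow> complex" where
  "mono_eval x a = (\<Prod>i\<in>UNIV. (x$i) ^ (a$i))"

definition weyl_order :: "('n::finite) weyl \<Rightarrow> nat" where
  "weyl_order P = Max ((\<lambda>(a, b). \<Sum>i\<in>UNIV. b$i) ` Poly_Mapping.keys P)"

definition principal_symbol :: "('n::finite) weyl \<Rightarrow> complex^'n \<Rightarrow> complex^'n \<Rightarrow> complex" where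
  "principal_symbol P x \<xi> =
     (\<Sum>(a, b)\<in>{m \<in> Poly_Mapping.keys P. (\<Sum>i\<in>UNIV. snd m $ i) = weyl_order P}.
        Poly_Mapping.lookup P (a, b) * mono_eval x a * mono_eval \<xi> b)"

definition characteristic_variety :: "('n::finite) weyl set \<Rightarrow> ((complex^'n) \<times> (complex^'n)) set" where
  "characteristic_variety I = {(x, \<xi>). \<forall>P\<in>I. principal_symbol P x \<xi> = 0}"

text \<open>
  The singular locus of \<open>D/I\<close>: the projection to the base of the part of the characteristic
  variety outside the zero section. (It is closed, as the characteristic variety is conic in \<open>\<xi>\<close>.)
\<close>

definition singular_locus :: "('n::finite) weyl set \<Rightarrow> (complex^'n) set" where
  "singular_locus I = {x. \<exists>\<xi>. \<xi> \<noteq> 0 \<and> (x, \<xi>) \<in> characteristic_variety I}"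


section \<open>Holomorphic functions of several variables and their germs\<close>

definition mholomorphic_on :: "(complex^('n::finite) \<Rightarrow> complex) \<Rightarrow> (complex^'n) set \<Rightarrow> bool"
  (infixl "mholomorphic'_on" 50) where
  "f mholomorphic_on U \<longleftrightarrow>
     (\<forall>x\<in>U. \<exists>c::complex^'n. (f has_derivative (\<lambda>h. \<Sum>i\<in>UNIV. c$i * h$i)) (at x within U))"

definition cpartial :: "'n::finite \<Rightarrow> (complex^'n \<Rightarrow> complex) \<Rightarrow> complex^'n \<Rightarrow> complex" where
  "cpartial i f x = deriv (\<lambda>z. f (\<chi> j. if j = i then z else x$j)) (x$i)"

text \<open>
  \<open>\<partial>\<^sup>b f\<close>. The index type carries no order, so some order of differentiation is chosen; it does not
  matter where \<open>f\<close> is holomorphic, which is the only case in which this is used.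
\<close>

definition cpartials :: "nat^('n::finite) \<Rightarrow> (complex^'n \<Rightarrow> complex) \<Rightarrow> complex^'n \<Rightarrow> complex" where
  "cpartials b f = foldr cpartial (SOME l. \<forall>i. count_list l i = b$i) f"

definition weyl_apply :: "('n::finite) weyl \<Rightarrow> (complex^'n \<Rightarrow> complex) \<Rightarrow> complex^'n \<Rightarrow> complex" where
  "weyl_apply P f x =
     (\<Sum>(a, b)\<in>Poly_Mapping.keys P. Poly_Mapping.lookup P (a, b) * mono_eval x a * cpartials b f x)"

text \<open>
  Germs at all points are represented in one complex vector space, the space of germs at the origin,
  by translation.
\<close>

definition germ_rel :: "(complex^('n::finite) \<Rightarrow> complex) \<Rightarrow> (complex^'n \<Rightarrow> complex) \<Rightarrow> bool" where
  "germ_rel f g \<longleftrightarrow> (\<forall>\<^sub>F x in nhds 0. f x = g x)"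

quotient_type (overloaded) 'n germ = "complex^('n::finite) \<Rightarrow> complex" / germ_rel
proof (rule equivpI)
  show "reflp germ_rel" by (auto simp: reflp_def germ_rel_def)
  show "symp germ_rel" by (auto simp: symp_def germ_rel_def eq_commute)
  show "transp germ_rel"
    by (auto simp: transp_def germ_rel_def elim: eventually_elim2)
qed

instantiation germ :: (finite) ab_group_add
begin

lift_definition zero_germ :: "'a germ" is "\<lambda>_. 0" .
lift_definition plus_germ :: "'a germ \<Rightarrow> 'a germ \<Rightarrow> 'a germ" is "\<lambda>f g x. f x + g x"
  unfolding germ_rel_def by (rule eventually_elim2, assumption+) simp
lift_definition minus_germ :: "'a germ \<Rightarrow> 'a germ \<Rightarrow> 'a germ" is "\<lambda>f g x. f x - g x"
  unfolding germ_rel_def by (rule eventually_elim2, assumption+) simp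
lift_definition uminus_germ :: "'a germ \<Rightarrow> 'a germ" is "\<lambda>f x. - f x"
  unfolding germ_rel_def by (erule eventually_mono) simp

instance
  by standard (transfer; simp add: germ_rel_def algebra_simps)+

end

lift_definition germ_scale :: "complex \<Rightarrow> ('n::finite) germ \<Rightarrow> 'n germ" is "\<lambda>c f x. c * f x"
  unfolding germ_rel_def by (erule eventually_mono) simp

global_interpretation germ: vector_space "germ_scale :: complex \<Rightarrow> ('n::finite) germ \<Rightarrow> 'n germ"
  by unfold_locales (transfer; simp add: germ_rel_def algebra_simps)+

definition germ_at :: "complex^('n::finite) \<Rightarrow> (complex^'n \<Rightarrow> complex) \<Rightarrow> 'n germ" where
  "germ_at p f = abs_germ (\<lambda>x. f (p + x))"

lemma germ_at_eq_iff: "germ_at p f = germ_at p g \<longleftrightarrow> (\<forall>\<^sub>F x in nhds p. f x = g x)"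
proof -
  have "germ_at p f = germ_at p g \<longleftrightarrow> (\<forall>\<^sub>F x in nhds 0. f (p + x) = g (p + x))"
    unfolding germ_at_def by (simp add: germ.abs_eq_iff germ_rel_def)
  also have "\<dots> \<longleftrightarrow> (\<forall>\<^sub>F x in nhds p. f x = g x)"
    by (simp add: nhds_to_0[of p] eventually_filtermap add.commute)
  finally show ?thesis .
qed

definition solution_space :: "('n::finite) weyl set \<Rightarrow> complex^'n \<Rightarrow> 'n germ set" where
  "solution_space I p = {germ_at p f | f. \<exists>U. open U \<and> p \<in> U \<and> f mholomorphic_on U \<and>
     (\<forall>P\<in>I. \<forall>\<^sub>F x in nhds p. weyl_apply P f x = 0)}"

text \<open>
  \<open>F t\<close> is a germ at \<open>\<gamma> t\<close>, and locally in \<open>t\<close> these are the germs of one holomorphic function.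
\<close>

definition analytic_continuation ::
  "(real \<Rightarrow> complex^('n::finite)) \<Rightarrow> (real \<Rightarrow> 'n germ) \<Rightarrow> bool" where
  "analytic_continuation \<gamma> F \<longleftrightarrow> path \<gamma> \<and>
     (\<forall>t\<in>{0..1}. \<exists>U h. open U \<and> \<gamma> t \<in> U \<and> h mholomorphic_on U \<and>
        (\<exists>e>0. \<forall>s\<in>{0..1}. \<bar>s - t\<bar> < e \<longrightarrow> \<gamma> s \<in> U \<and> F s = germ_at (\<gamma> s) h))"

definition continues_along ::
  "(real \<Rightarrow> complex^('n::finite)) \<Rightarrow> 'n germ \<Rightarrow> 'n germ \<Rightarrow> bool" where
  "continues_along \<gamma> \<phi> \<psi> \<longleftrightarrow> (\<exists>F. analytic_continuation \<gamma> F \<and> F 0 = \<phi> \<and> F 1 = \<psi>)"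

definition monodromy_invariant ::
  "(complex^('n::finite)) set \<Rightarrow> complex^'n \<Rightarrow> 'n germ set \<Rightarrow> bool" where
  "monodromy_invariant X p S \<longleftrightarrow>
     (\<forall>\<gamma>. path \<gamma> \<and> path_image \<gamma> \<subseteq> X \<and> pathstart \<gamma> = p \<and> pathfinish \<gamma> = p \<longrightarrow>
        (\<forall>\<phi>\<in>S. \<exists>\<psi>\<in>S. continues_along \<gamma> \<phi> \<psi>))"

definition extends_multivalued ::
  "(complex^('n::finite)) set \<Rightarrow> complex^'n \<Rightarrow> 'n germ \<Rightarrow> bool" where
  "extends_multivalued X p \<phi> \<longleftrightarrow> p \<in> X \<and>
     (\<forall>\<gamma>. path \<gamma> \<and> path_image \<gamma> \<subseteq> X \<and> pathstart \<gamma> = p \<longrightarrow> (\<exists>\<psi>. continues_along \<gamma> \<phi> \<psi>))"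


section \<open>The hypergeometric system\<close>

definition acol :: "int^'n^'d \<Rightarrow> 'n \<Rightarrow> 'a::ring_1^'d" where
  "acol A j = (\<chi> i. of_int (A$i$j))"

definition box_operator :: "int^('n::finite) \<Rightarrow> 'n weyl" where
  "box_operator u = Poly_Mapping.single (0, \<chi> j. nat (u$j)) 1 - Poly_Mapping.single (0, \<chi> j. nat (- u$j)) 1"

definition euler_operator :: "int^('n::finite)^('d::finite) \<Rightarrow> complex^'d \<Rightarrow> 'd \<Rightarrow> 'n weyl" where
  "euler_operator A \<beta> i =
     (\<Sum>j\<in>UNIV. Poly_Mapping.single (axis j 1, axis j 1) (of_int (A$i$j))) - Poly_Mapping.single (0, 0) (\<beta>$i)"

definition hypergeometric_ideal :: "int^('n::finite)^('d::finite) \<Rightarrow> complex^'d \<Rightarrow> 'n weyl set" where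
  "hypergeometric_ideal A \<beta> =
     weyl_left_ideal hull ({box_operator u | u. A *v u = 0} \<union> range (euler_operator A \<beta>))"

definition sing_A :: "int^('n::finite)^('d::finite) \<Rightarrow> complex^'d \<Rightarrow> (complex^'n) set" where
  "sing_A A \<beta> = singular_locus (hypergeometric_ideal A \<beta>)"


section \<open>Combinatorics\<close>

definition pos_cone :: "int^('n::finite)^('d::finite) \<Rightarrow> 'n set \<Rightarrow> (real^'d) set" where
  "pos_cone A \<tau> = {\<Sum>i\<in>\<tau>. c i *\<^sub>R acol A i | c :: 'n \<Rightarrow> real. \<forall>i\<in>\<tau>. 0 \<le> c i}"

definition nonresonant :: "int^('n::finite)^('d::finite) \<Rightarrow> complex^'d \<Rightarrow> bool" where
  "nonresonant A \<beta> \<longleftrightarrow> (\<forall>F. F facet_of pos_cone A UNIV \<longrightarrow>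
     \<beta> \<notin> {(\<chi> i. of_int (z$i)) + w | (z :: int^'d) w.
             w \<in> vec.span ((\<lambda>y. \<chi> i. complex_of_real (y$i)) ` F)})"

definition normalized_volume :: "int^('n::finite)^('d::finite) \<Rightarrow> 'n set \<Rightarrow> real" where
  "normalized_volume A \<tau> = fact CARD('d) * measure lebesgue (convex hull ((acol A ` \<tau> :: (real^'d) set) \<union> {0}))"

definition subdiv_complex :: "int^('n::finite)^('d::finite) \<Rightarrow> real^'n \<Rightarrow> 'n set set" where
  "subdiv_complex A \<omega> = {\<tau>. \<exists>c::real^'d.
     (\<forall>j\<in>\<tau>. inner c (acol A j) = \<omega>$j) \<and> (\<forall>j. j \<notin> \<tau> \<longrightarrow> inner c (acol A j) < \<omega>$j)}"

definition regular_triangulation :: "int^('n::finite)^('d::finite) \<Rightarrow> 'n set set \<Rightarrow> bool" where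
  "regular_triangulation A T \<longleftrightarrow> (\<exists>\<omega>. T = subdiv_complex A \<omega>) \<and>
     pos_cone A UNIV = (\<Union>\<tau>\<in>T. pos_cone A \<tau>) \<and> (\<forall>\<sigma>\<in>T. \<forall>\<rho>. \<rho> \<subseteq> \<sigma> \<longrightarrow> \<rho> \<in> T)"

definition refines_complex :: "'n set set \<Rightarrow> 'n set set \<Rightarrow> bool" where
  "refines_complex T T' \<longleftrightarrow> (\<forall>\<sigma>\<in>T. \<exists>\<rho>\<in>T'. \<sigma> \<subseteq> \<rho>)"

definition maximal_cells :: "'n set set \<Rightarrow> 'n set set" where
  "maximal_cells T = {\<sigma>\<in>T. \<forall>\<rho>\<in>T. \<sigma> \<subseteq> \<rho> \<longrightarrow> \<rho> = \<sigma>}"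

definition gamma_complex :: "int^('n::finite)^('d::finite) \<Rightarrow> 'n set set" where
  "gamma_complex A = subdiv_complex A 1"

text \<open>
  The zero set, as a subset of \<open>\<complex>\<^sup>n\<close>, of the Gelfand-Kapranov-Zelevinsky principal determinant of
  \<open>A\<^sub>\<tau>\<close>; only the coordinates in \<open>\<tau>\<close> are constrained.
\<close>

definition principal_det_zeros :: "int^('n::finite)^('d::finite) \<Rightarrow> 'n set \<Rightarrow> (complex^'n) set" where
  "principal_det_zeros A \<tau> = {x. \<exists>(F :: (real^'d) set) (t :: complex^'d). F face_of (convex hull (acol A ` \<tau>)) \<and> F \<noteq> {} \<and>
     (\<forall>i. t$i \<noteq> 0) \<and>
     (\<Sum>j\<in>{j\<in>\<tau>. acol A j \<in> F}. (x$j * (\<Prod>i\<in>UNIV. (t$i) powi (A$i$j))) *s acol A j)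
       = (0 :: complex^'d)}"


section \<open>Gamma series\<close>

text \<open>\<open>A\<^sub>\<sigma>\<^sup>-\<^sup>1 b\<close>, extended by \<open>0\<close> outside \<open>\<sigma>\<close>; meaningful if the columns in \<open>\<sigma>\<close> form a basis.\<close>

definition simplex_coords :: "int^('n::finite)^('d::finite) \<Rightarrow> 'n set \<Rightarrow> 'a::field^'d \<Rightarrow> 'a^'n" where
  "simplex_coords A \<sigma> b =
     (THE w. (\<forall>j. j \<notin> \<sigma> \<longrightarrow> w$j = 0) \<and> (\<Sum>i\<in>\<sigma>. w$i *s acol A i) = b)"

text \<open>\<open>\<nat>\<close> to the power of the complement of \<open>\<sigma>\<close>, embedded by zero extension.\<close>

definition off_exponents :: "'n set \<Rightarrow> (nat^'n) set" where
  "off_exponents \<sigma> = {k. \<forall>j\<in>\<sigma>. k$j = 0}"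

definition same_class :: "int^('n::finite)^('d::finite) \<Rightarrow> 'n set \<Rightarrow> nat^'n \<Rightarrow> nat^'n \<Rightarrow> bool" where
  "same_class A \<sigma> k k' \<longleftrightarrow>
     (\<Sum>j\<in>-\<sigma>. int (k$j) *s acol A j) - (\<Sum>j\<in>-\<sigma>. int (k'$j) *s acol A j)
       \<in> {\<Sum>i\<in>\<sigma>. z i *s acol A i | z :: 'n \<Rightarrow> int. True}"

definition representatives :: "int^('n::finite)^('d::finite) \<Rightarrow> 'n set \<Rightarrow> (nat^'n) set \<Rightarrow> bool" where
  "representatives A \<sigma> \<Omega> \<longleftrightarrow> \<Omega> \<subseteq> off_exponents \<sigma> \<and>
     (\<forall>k\<in>off_exponents \<sigma>. \<exists>!k'. k' \<in> \<Omega> \<and> same_class A \<sigma> k k')"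

definition very_generic ::
  "int^('n::finite)^('d::finite) \<Rightarrow> 'n set set \<Rightarrow> ('n set \<Rightarrow> (nat^'n) set) \<Rightarrow> complex^'d \<Rightarrow> bool" where
  "very_generic A T \<Omega> \<beta> \<longleftrightarrow> (\<forall>\<sigma>\<in>maximal_cells T. \<forall>k\<in>\<Omega> \<sigma>. \<forall>i\<in>\<sigma>.
     simplex_coords A \<sigma> (\<beta> - (\<Sum>j\<in>-\<sigma>. of_nat (k$j) *s acol A j)) $ i \<notin> \<int>)"

definition series_exponent ::
  "int^('n::finite)^('d::finite) \<Rightarrow> complex^'d \<Rightarrow> 'n set \<Rightarrow> nat^'n \<Rightarrow> complex^'n" where
  "series_exponent A \<beta> \<sigma> k =
     (THE v. (\<Sum>j\<in>UNIV. v$j *s acol A j) = \<beta> \<and> (\<forall>j. j \<notin> \<sigma> \<longrightarrow> v$j = of_nat (k$j)))"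

text \<open>
  The series are multivalued in \<open>x\<close>; here they are functions of \<open>y = log x\<close>. Changing the branch of
  the logarithms multiplies a series by a nonzero constant.
\<close>

definition gamma_term :: "complex^('n::finite) \<Rightarrow> complex^'n \<Rightarrow> int^'n \<Rightarrow> complex" where
  "gamma_term v y u = exp (\<Sum>j\<in>UNIV. (v$j + of_int (u$j)) * y$j) *
     (\<Prod>j\<in>UNIV. rGamma (v$j + of_int (u$j) + 1))"

definition gamma_series ::
  "int^('n::finite)^('d::finite) \<Rightarrow> complex^'d \<Rightarrow> 'n set \<Rightarrow> nat^'n \<Rightarrow> complex^'n \<Rightarrow> complex" where
  "gamma_series A \<beta> \<sigma> k y = infsum (gamma_term (series_exponent A \<beta> \<sigma> k) y) {u. A *v u = 0}"

definition log_branch_at :: "complex^('n::finite) \<Rightarrow> (complex^'n \<Rightarrow> complex^'n) \<Rightarrow> bool" where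
  "log_branch_at q l \<longleftrightarrow> (\<exists>U. open U \<and> q \<in> U \<and> continuous_on U l \<and> (\<forall>x\<in>U. \<forall>j. exp (l x $ j) = x$j))"

text \<open>\<open>U\<^sub>T(R)\<close> intersected with the torus.\<close>

definition series_domain ::
  "int^('n::finite)^('d::finite) \<Rightarrow> 'n set set \<Rightarrow> real \<Rightarrow> (complex^'n) set" where
  "series_domain A T R = {x. (\<forall>j. x$j \<noteq> 0) \<and> (\<forall>\<sigma>\<in>maximal_cells T. \<forall>j. j \<notin> \<sigma> \<longrightarrow>
     (let b = simplex_coords A \<sigma> (acol A j) :: real^'n in
        (\<Sum>i\<in>\<sigma>. b$i) = 1 \<longrightarrow> cmod (x$j) < R * (\<Prod>i\<in>\<sigma>. cmod (x$i) powr (b$i))))}"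

definition series_converge ::
  "int^('n::finite)^('d::finite) \<Rightarrow> complex^'d \<Rightarrow> 'n set set \<Rightarrow> ('n set \<Rightarrow> (nat^'n) set) \<Rightarrow>
     (complex^'n) set \<Rightarrow> bool" where
  "series_converge A \<beta> T \<Omega> X \<longleftrightarrow> (\<forall>x\<in>X. \<forall>y. (\<forall>j. exp (y$j) = x$j) \<longrightarrow>
     (\<forall>\<sigma>\<in>maximal_cells T. \<forall>k\<in>\<Omega> \<sigma>.
        gamma_term (series_exponent A \<beta> \<sigma> k) y summable_on {u. A *v u = 0}))"

text \<open>
  The space spanned at the endpoint of \<open>\<gamma>\<close> by the series attached to \<open>T(\<tau>)\<close>, taken at the starting
  point of \<open>\<gamma>\<close> with the logarithms \<open>l\<close> and continued analytically along \<open>\<gamma>\<close>.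
\<close>

definition gamma_space ::
  "int^('n::finite)^('d::finite) \<Rightarrow> complex^'d \<Rightarrow> 'n set set \<Rightarrow> ('n set \<Rightarrow> (nat^'n) set) \<Rightarrow> 'n set \<Rightarrow>
     (complex^'n \<Rightarrow> complex^'n) \<Rightarrow> (real \<Rightarrow> complex^'n) \<Rightarrow> 'n germ set" where
  "gamma_space A \<beta> T \<Omega> \<tau> l \<gamma> = germ.span {\<psi>. \<exists>\<sigma>\<in>maximal_cells T. \<exists>k\<in>\<Omega> \<sigma>. \<sigma> \<subseteq> \<tau> \<and>
     continues_along \<gamma> (germ_at (pathstart \<gamma>) (\<lambda>x. gamma_series A \<beta> \<sigma> k (l x))) \<psi>}"


section \<open>The subspaces \<open>S\<^sub>\<tau>\<close>\<close>

definition is_S_tau ::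
  "int^('n::finite)^('d::finite) \<Rightarrow> complex^'d \<Rightarrow> 'n set \<Rightarrow> complex^'n \<Rightarrow> 'n germ set \<Rightarrow> bool" where
  "is_S_tau A \<beta> \<tau> p S \<longleftrightarrow>
     germ.subspace S \<and> S \<subseteq> solution_space (hypergeometric_ideal A \<beta>) p \<and>
     monodromy_invariant (- sing_A A \<beta>) p S \<and>
     real (germ.dim S) = normalized_volume A \<tau> \<and>
     (\<forall>\<phi>\<in>S. extends_multivalued (- principal_det_zeros A \<tau>) p \<phi>)"

end

theory Submission
  imports Defs
begin

text \<open>
  A facet \<open>\<tau>\<close> of \<open>\<Gamma>\<^sub>A\<close> with only \<open>d\<close> columns is a simplex with \<open>|A\<^sub>\<tau>\<^sup>-\<^sup>1 a\<^sub>l| < 1\<close> for all \<open>l \<notin> \<tau>\<close>, so by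
  Stirling-type bounds the \<open>\<Gamma>\<close>-series at \<open>\<tau>\<close> converge wherever \<open>x\<^sub>i \<noteq> 0\<close> for \<open>i \<in> \<tau>\<close>, entirely in the other
  variables. Continuation along a path only changes the logarithms of the \<open>x\<^sub>i\<close>, \<open>i \<in> \<tau>\<close>, which multiplies
  each series by a constant; hence their span is monodromy invariant and singular only along the zero set of
  \<open>\<Prod>\<^bsub>i\<in>\<tau>\<^esub> x\<^sub>i\<close>, which is that of the principal determinant. Each of these hyperplanes lies in
  the singular locus of \<open>M\<^sub>A(\<beta>)\<close>: otherwise estimates of Cauchy-Kovalevskaya type would force the
  coefficients of all powers of \<open>x\<^sub>i\<close> in a nonzero series to vanish. One series for each class of
  \<open>\<int>\<^sup>d / \<int>A\<^sub>\<tau>\<close> gives independent solutions, and the number of classes is \<open>vol(\<tau>)\<close>. If \<open>\<beta>\<close> is only nonresonant, the exponents are first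
  moved by \<open>ker A\<close> so that no leading coefficient vanishes.
\<close>

section \<open>Falling factorials\<close>

text \<open>Membership in the left ideal is used in two ways: the series are solutions, and their
  slices, the coefficients of the powers of one variable x_j, satisfy recursions. Both come from
  linear functionals on D that annihilate the ideal. Only the generators have to be tested, since
  the common kernel over all complex exponents is a left ideal. The functionals carry no Gamma
  factors, so a slice can be studied even where 1/\<Gamma>(v_j + n + 1) vanishes. In coordinates
  that are logarithms for the variables in \<tau> and x_l itself otherwise, a series is an entire
  function, derivatives only shift its exponent vector, and setting the variables outside \<tau> to
  0 isolates one term of a suitable derivative. This evaluation yields both the independence and the
  contradiction at a coordinate hyperplane. The latter also relies on the slice of index -n being
  O(\<theta>^n / n!) for every \<theta> > 0, which is obtained by giving the exponent of x_j the
  artificial value -1/2, where no Gamma factor vanishes.\<close>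

definition ffact :: "complex \<Rightarrow> nat \<Rightarrow> complex" where
  "ffact w n = (\<Prod>i<n. w - of_nat i)"

lemma ffact_0 [simp]: "ffact w 0 = 1"
  by (simp add: ffact_def)

lemma ffact_Suc: "ffact w (Suc n) = ffact w n * (w - of_nat n)"
  by (simp add: ffact_def)

lemma ffact_gbinomial: "ffact w n = fact n * (w gchoose n)"
  by (simp add: ffact_def gbinomial_prod_rev lessThan_atLeast0)

lemma ffact_add: "ffact w (a + b) = ffact w a * ffact (w - of_nat a) b"
  by (induction b) (auto simp: ffact_Suc algebra_simps)

lemma ffact_eq_0_of_nat: "k < a \<Longrightarrow> ffact (of_nat k) a = 0"
  by (auto simp: ffact_def)

lemma ffact_of_nat: "a \<le> k \<Longrightarrow> ffact (of_nat k) a = fact k / fact (k - a)"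
  unfolding ffact_gbinomial by (simp flip: binomial_gbinomial add: binomial_fact)

text \<open>This is where falling factorials come from: x^a times x^(w-a) / \<Gamma>(w - a + 1) is
  \<open>ffact w a\<close> times x^w / \<Gamma>(w + 1).\<close>

lemma rGamma_ffact: "rGamma (w - of_nat a + 1) = ffact w a * rGamma (w + 1)"
proof (induction a)
  case (Suc a)
  have "rGamma (w - of_nat (Suc a) + 1) = (w - of_nat a) * rGamma (w - of_nat a + 1)"
    using rGamma_plus1[of "w - of_nat a"] by (simp add: algebra_simps)
  then show ?case by (simp add: Suc ffact_Suc)
qed simp

lemma ffact_Vandermonde: "ffact (z + w) n = (\<Sum>k\<le>n. of_nat (n choose k) * ffact z k * ffact w (n - k))"
proof -
  have "ffact (z + w) n = (\<Sum>k\<le>n. fact n * ((z gchoose k) * (w gchoose (n - k))))"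
    unfolding ffact_gbinomial gbinomial_Vandermonde[symmetric]
    by (simp add: sum_distrib_left atLeast0AtMost)
  also have "\<dots> = (\<Sum>k\<le>n. of_nat (n choose k) * ffact z k * ffact w (n - k))"
    by (rule sum.cong) (auto simp: ffact_gbinomial binomial_fact field_simps)
  finally show ?thesis .
qed

lemma ffact_of_nat_choose: "ffact (of_nat b) k = of_nat ((b choose k) * fact k)"
  unfolding ffact_gbinomial by (simp flip: binomial_gbinomial)

text \<open>The one-variable form of the fact that x^a \<partial>^b applied after x^c \<partial>^e
  agrees with the normally ordered product. It is Vandermonde's identity for the splitting w - a + b
  = b + (w - a), cut off at b because \<open>ffact (of_nat b) k\<close> vanishes for k > b.\<close>

lemma ffact_Leibniz:
  "(\<Sum>k\<le>min b c. of_nat ((b choose k) * (c choose k) * fact k) * ffact w (a + c - k))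
     = ffact w a * ffact (w - of_nat a + of_nat b) c"
proof -
  have "ffact (w - of_nat a + of_nat b) c
      = (\<Sum>k\<le>c. of_nat (c choose k) * ffact (of_nat b) k * ffact (w - of_nat a) (c - k))"
    by (subst add.commute) (rule ffact_Vandermonde)
  also have "\<dots> = (\<Sum>k\<le>min b c. of_nat (c choose k) * ffact (of_nat b) k * ffact (w - of_nat a) (c - k))"
    by (rule sum.mono_neutral_right) (auto simp: ffact_of_nat_choose)
  finally have "ffact w a * ffact (w - of_nat a + of_nat b) c
     = (\<Sum>k\<le>min b c. ffact w a * (of_nat (c choose k) * ffact (of_nat b) k * ffact (w - of_nat a) (c - k)))"
    by (simp add: sum_distrib_left)
  also have "\<dots> = (\<Sum>k\<le>min b c. of_nat ((b choose k) * (c choose k) * fact k) * ffact w (a + c - k))"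
  proof (rule sum.cong[OF refl])
    fix k assume "k \<in> {..min b c}"
    then have "a + c - k = a + (c - k)" by simp
    then show "ffact w a * (of_nat (c choose k) * ffact (of_nat b) k * ffact (w - of_nat a) (c - k))
      = of_nat ((b choose k) * (c choose k) * fact k) * ffact w (a + c - k)"
      by (simp add: ffact_add ffact_of_nat_choose)
  qed
  finally show ?thesis ..
qed

section \<open>Falling factorials of vectors and the Leibniz rule in several variables\<close>

definition vffact :: "complex^'n::finite \<Rightarrow> nat^'n \<Rightarrow> complex" where
  "vffact w a = (\<Prod>i\<in>UNIV. ffact (w$i) (a$i))"

definition cvec :: "nat^'n \<Rightarrow> complex^'n" where
  "cvec a = (\<chi> i. of_nat (a$i))"

lemma cvec_nth [simp]: "cvec a $ i = of_nat (a$i)"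
  by (simp add: cvec_def)

lemma vffact_0 [simp]: "vffact w 0 = 1"
  by (simp add: vffact_def)

lemma sum_prod_vec_box:
  fixes f :: "'n::finite \<Rightarrow> nat \<Rightarrow> complex"
  shows "(\<Sum>k\<in>{k::nat^'n. \<forall>i. k$i \<le> m i}. \<Prod>i\<in>UNIV. f i (k$i)) = (\<Prod>i\<in>UNIV. \<Sum>j\<le>m i. f i j)"
proof -
  have "(\<Prod>i\<in>UNIV. \<Sum>j\<le>m i. f i j) = (\<Sum>g\<in>PiE UNIV (\<lambda>i. {..m i}). \<Prod>i\<in>UNIV. f i (g i))"
    by (rule prod_sum_PiE) auto
  also have "\<dots> = (\<Sum>k\<in>{k::nat^'n. \<forall>i. k$i \<le> m i}. \<Prod>i\<in>UNIV. f i (k$i))"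
    by (rule sum.reindex_bij_witness[of _ "\<lambda>k i. k$i" "\<lambda>g. \<chi> i. g i"]) auto
  finally show ?thesis ..
qed

lemma vffact_Leibniz:
  fixes a b c :: "nat^'n::finite"
  shows "(\<Sum>k\<in>{k. \<forall>i. k$i \<le> min (b$i) (c$i)}.
      (\<Prod>i\<in>UNIV. of_nat ((b$i choose k$i) * (c$i choose k$i) * fact (k$i))) * vffact w (\<chi> i. a$i + c$i - k$i))
     = vffact w a * vffact (w - cvec a + cvec b) c"
proof -
  have "(\<Sum>k\<in>{k. \<forall>i. k$i \<le> min (b$i) (c$i)}.
      (\<Prod>i\<in>UNIV. of_nat ((b$i choose k$i) * (c$i choose k$i) * fact (k$i))) * vffact w (\<chi> i. a$i + c$i - k$i))
    = (\<Sum>k\<in>{k. \<forall>i. k$i \<le> min (b$i) (c$i)}.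
      (\<Prod>i\<in>UNIV. of_nat ((b$i choose k$i) * (c$i choose k$i) * fact (k$i)) * ffact (w$i) (a$i + c$i - k$i)))"
    by (simp add: vffact_def prod.distrib)
  also have "\<dots> = (\<Prod>i\<in>UNIV. \<Sum>j\<le>min (b$i) (c$i).
      of_nat ((b$i choose j) * (c$i choose j) * fact j) * ffact (w$i) (a$i + c$i - j))"
    by (rule sum_prod_vec_box)
  also have "\<dots> = (\<Prod>i\<in>UNIV. ffact (w$i) (a$i) * ffact (w$i - of_nat (a$i) + of_nat (b$i)) (c$i))"
    by (simp only: ffact_Leibniz)
  also have "\<dots> = vffact w a * vffact (w - cvec a + cvec b) c"
    by (simp add: vffact_def prod.distrib)
  finally show ?thesis .
qed


section \<open>Linear functionals on the Weyl algebra\<close>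

definition weyl_eval :: "((nat^'n) \<times> (nat^'n) \<Rightarrow> complex) \<Rightarrow> ('n::finite) weyl \<Rightarrow> complex" where
  "weyl_eval f P = (\<Sum>m\<in>Poly_Mapping.keys P. Poly_Mapping.lookup P m * f m)"

lemma weyl_eval_superset:
  assumes "finite X" "Poly_Mapping.keys P \<subseteq> X"
  shows "weyl_eval f P = (\<Sum>m\<in>X. Poly_Mapping.lookup P m * f m)"
  unfolding weyl_eval_def using assms
  by (intro sum.mono_neutral_left) (auto simp: in_keys_iff)

lemma weyl_eval_zero [simp]: "weyl_eval f 0 = 0"
  by (simp add: weyl_eval_def)

lemma weyl_eval_add: "weyl_eval f (P + Q) = weyl_eval f P + weyl_eval f Q"
proof -
  let ?X = "Poly_Mapping.keys P \<union> Poly_Mapping.keys Q"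
  have "weyl_eval f (P + Q) = (\<Sum>m\<in>?X. Poly_Mapping.lookup (P + Q) m * f m)"
    by (rule weyl_eval_superset) (use Poly_Mapping.keys_add[of P Q] in auto)
  moreover have "weyl_eval f P = (\<Sum>m\<in>?X. Poly_Mapping.lookup P m * f m)"
    by (rule weyl_eval_superset) auto
  moreover have "weyl_eval f Q = (\<Sum>m\<in>?X. Poly_Mapping.lookup Q m * f m)"
    by (rule weyl_eval_superset) auto
  ultimately show ?thesis by (simp add: lookup_add sum.distrib algebra_simps)
qed

lemma weyl_eval_sum: "weyl_eval f (\<Sum>x\<in>X. P x) = (\<Sum>x\<in>X. weyl_eval f (P x))"
  by (induction X rule: infinite_finite_induct) (auto simp: weyl_eval_add)

lemma weyl_eval_diff: "weyl_eval f (P - Q) = weyl_eval f P - weyl_eval f Q"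
  using weyl_eval_add[of f "P - Q" Q] by simp

lemma weyl_eval_single [simp]: "weyl_eval f (Poly_Mapping.single m c) = c * f m"
  by (simp add: weyl_eval_def)

lemma weyl_eval_scale: "weyl_eval f (Poly_Mapping.map ((*) c) P) = c * weyl_eval f P"
proof -
  have "weyl_eval f (Poly_Mapping.map ((*) c) P)
      = (\<Sum>m\<in>Poly_Mapping.keys P. Poly_Mapping.lookup (Poly_Mapping.map ((*) c) P) m * f m)"
    by (rule weyl_eval_superset) (auto simp: in_keys_iff Poly_Mapping.map.rep_eq)
  then show ?thesis
    by (simp add: weyl_eval_def Poly_Mapping.map.rep_eq sum_distrib_left algebra_simps when_def in_keys_iff)
qed

lemma weyl_eval_times:
  "weyl_eval f (weyl_times P Q)
     = weyl_eval (\<lambda>m. weyl_eval (\<lambda>m'. weyl_eval f (weyl_monom_times m m')) Q) P"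
  unfolding weyl_times_def
  by (simp add: weyl_eval_sum weyl_eval_scale) (simp add: weyl_eval_def sum_distrib_left mult.assoc)

section \<open>Functionals that annihilate the hypergeometric ideal\<close>

definition amul :: "int^'n::finite^'d::finite \<Rightarrow> complex^'n \<Rightarrow> complex^'d" where
  "amul A w = (\<Sum>j\<in>UNIV. w$j *s acol A j)"

lemma amul_nth: "amul A w $ i = (\<Sum>j\<in>UNIV. w$j * of_int (A$i$j))"
  by (simp add: amul_def acol_def)

lemma amul_add: "amul A (v + w) = amul A v + amul A w"
  by (simp add: vec_eq_iff amul_nth algebra_simps sum.distrib)

definition ivec :: "int^'n \<Rightarrow> complex^'n" where
  "ivec u = (\<chi> i. of_int (u$i))"

lemma ivec_nth [simp]: "ivec u $ i = of_int (u$i)"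
  by (simp add: ivec_def)

lemma amul_ivec: "amul A (ivec u) $ i = of_int ((A *v u) $ i)"
  by (simp add: amul_nth matrix_vector_mult_def mult.commute)

text \<open>
  Up to the factor \<open>1 / \<Gamma>(w + 1)\<close>, the value of \<open>coeff_functional A \<beta> w\<close> at \<open>P\<close> is the coefficient of \<open>x\<^sup>w\<close>
  in \<open>P\<close> applied to the formal solution \<open>\<Sum>\<^sub>v x\<^sup>v / \<Gamma>(v + 1)\<close>, where \<open>A v = \<beta>\<close>; it makes sense for all complex \<open>w\<close>.
\<close>

definition coeff_weight :: "int^'n::finite^'d::finite \<Rightarrow> complex^'d \<Rightarrow> complex^'n \<Rightarrow> (nat^'n) \<times> (nat^'n) \<Rightarrow> complex" where
  "coeff_weight A \<beta> w m = (if amul A (w - cvec (fst m) + cvec (snd m)) = \<beta> then vffact w (fst m) else 0)"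

abbreviation coeff_functional ::
  "int^'n::finite^'d::finite \<Rightarrow> complex^'d \<Rightarrow> complex^'n \<Rightarrow> 'n weyl \<Rightarrow> complex" where
  "coeff_functional A \<beta> w \<equiv> weyl_eval (coeff_weight A \<beta> w)"

text \<open>Every term of the normally ordered product lowers both exponents by the same k, so all
  terms pass or fail the test \<open>amul A _ = \<beta>\<close> together, and the Leibniz identity
  applies to the whole sum.\<close>

lemma coeff_functional_monom_times:
  "coeff_functional A \<beta> w (weyl_monom_times (a, b) (c, e))
     = vffact w a * coeff_weight A \<beta> (w - cvec a + cvec b) (c, e)"
proof -
  let ?K = "{k. \<forall>i. k$i \<le> min (b$i) (c$i)}"
  have eq: "w - cvec (\<chi> i. a$i + c$i - k$i) + cvec (\<chi> i. b$i + e$i - k$i)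
      = w - cvec a + cvec b - cvec c + cvec e" if "k \<in> ?K" for k
    using that by (auto simp: vec_eq_iff of_nat_diff trans_le_add2 trans_le_add1)
  have "coeff_functional A \<beta> w (weyl_monom_times (a, b) (c, e)) = (\<Sum>k\<in>?K.
      (\<Prod>i\<in>UNIV. of_nat ((b$i choose k$i) * (c$i choose k$i) * fact (k$i))) *
       (if amul A (w - cvec a + cvec b - cvec c + cvec e) = \<beta> then vffact w (\<chi> i. a$i + c$i - k$i) else 0))"
    unfolding weyl_monom_times_def prod.case weyl_eval_sum weyl_eval_single
    by (rule sum.cong[OF refl]) (simp only: coeff_weight_def fst_conv snd_conv eq)
  also have "\<dots> = (if amul A (w - cvec a + cvec b - cvec c + cvec e) = \<beta>
      then vffact w a * vffact (w - cvec a + cvec b) c else 0)"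
    using vffact_Leibniz[of b c w a] by (simp only: if_distrib[of "\<lambda>x. _ * x"] mult_zero_right split: if_split) simp
  finally show ?thesis by (simp add: coeff_weight_def)
qed

text \<open>Left multiplication by x^a \<partial>^b moves the exponent from w to w - a + b; this is
  why the vanishing is considered for all complex w at once.\<close>

lemma coeff_functional_times_eq_0:
  assumes "\<And>w. coeff_functional A \<beta> w Q = 0"
  shows "coeff_functional A \<beta> w (weyl_times P Q) = 0"
proof -
  have "weyl_eval (\<lambda>m'. coeff_functional A \<beta> w (weyl_monom_times m m')) Q = 0" for m
  proof -
    obtain a b where m: "m = (a, b)" by (cases m)
    have "weyl_eval (\<lambda>m'. coeff_functional A \<beta> w (weyl_monom_times m m')) Q
      = vffact w a * coeff_functional A \<beta> (w - cvec a + cvec b) Q"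
      unfolding weyl_eval_def[of _ Q] sum_distrib_left
    proof (rule sum.cong[OF refl])
      fix m' assume "m' \<in> Poly_Mapping.keys Q"
      show "Poly_Mapping.lookup Q m' * coeff_functional A \<beta> w (weyl_monom_times m m')
        = vffact w a * (Poly_Mapping.lookup Q m' * coeff_weight A \<beta> (w - cvec a + cvec b) m')"
        by (cases m') (simp add: m coeff_functional_monom_times)
    qed
    then show ?thesis using assms by simp
  qed
  then show ?thesis unfolding weyl_eval_times by (simp add: weyl_eval_def)
qed

text \<open>By closure under left multiplication it suffices to test generators. The monomials of a
  box operator have x-exponent 0 and \<partial>-exponents with the same image under A, so their
  weights cancel. An Euler operator yields the i-th coordinate of A w - \<beta>, which is 0 whenever
  the weights are not.\<close>

lemma coeff_functional_hypergeometric_ideal: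
  assumes "P \<in> hypergeometric_ideal A \<beta>"
  shows "coeff_functional A \<beta> w P = 0"
proof -
  let ?G = "{box_operator u | u. A *v u = 0} \<union> range (euler_operator A \<beta>)"
  let ?J = "{P. \<forall>w. coeff_functional A \<beta> w P = 0}"
  have "weyl_left_ideal ?J"
    by (auto simp: weyl_left_ideal_def weyl_eval_add coeff_functional_times_eq_0)
  moreover have "coeff_functional A \<beta> w (box_operator u) = 0" if "A *v u = 0" for u w
  proof -
    have "cvec (\<chi> j. nat (u$j)) = cvec (\<chi> j. nat (- u$j)) + ivec u"
    proof -
      have h: "(of_nat (nat z) :: complex) = of_nat (nat (- z)) + of_int z" for z :: int
        by (cases "0 \<le> z") auto
      show ?thesis
      proof (unfold vec_eq_iff, rule allI)
        fix i show "cvec (\<chi> j. nat (u$j)) $ i = (cvec (\<chi> j. nat (- u$j)) + ivec u) $ i"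
          using h[of "u$i"] by simp
      qed
    qed
    moreover have "amul A (ivec u) = 0"
      using that by (simp add: vec_eq_iff amul_ivec)
    ultimately show ?thesis
      by (simp add: box_operator_def weyl_eval_diff coeff_weight_def amul_add)
  qed
  moreover have "coeff_functional A \<beta> w (euler_operator A \<beta> i) = 0" for i w
  proof -
    have v: "vffact w (axis j 1) = w$j" for j
    proof -
      have "vffact w (axis j 1) = (\<Prod>i\<in>UNIV. if i = j then w$i else 1)"
        unfolding vffact_def by (rule prod.cong) (auto simp: axis_def ffact_def)
      then show ?thesis by simp
    qed
    show ?thesis
    proof (cases "amul A w = \<beta>")
      case True
      then have "\<beta> $ i = (\<Sum>j\<in>UNIV. w$j * of_int (A$i$j))" by (metis amul_nth)
      then show ?thesis
        using True by (simp add: euler_operator_def weyl_eval_diff weyl_eval_sum coeff_weight_def v[simplified] mult.commute)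

    next
      case False
      then show ?thesis
        by (simp add: euler_operator_def weyl_eval_diff weyl_eval_sum coeff_weight_def)
    qed
  qed
  ultimately have "hypergeometric_ideal A \<beta> \<subseteq> ?J"
    unfolding hypergeometric_ideal_def by (intro hull_minimal) auto
  then show ?thesis using assms by auto
qed

section \<open>Growth of the reciprocal Gamma function along integer translates\<close>

lemma power_le_fact_exp: "0 \<le> r \<Longrightarrow> r ^ n \<le> fact n * exp (r::real)"
proof -
  assume r: "0 \<le> r"
  have "r ^ n /\<^sub>R fact n \<le> suminf (\<lambda>n. r ^ n /\<^sub>R fact n)"
    using sum_le_suminf[OF summable_exp_generic[of r], of "{n}"] r by (simp add: field_simps)
  then show ?thesis by (simp add: exp_def field_simps)
qed

lemma le_powr_self: "1 \<le> C \<Longrightarrow> 1 \<le> r \<Longrightarrow> C \<le> C powr (r::real)"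
  using powr_mono[of 1 r C] by simp

lemma norm_pochhammer_ge_fact:
  fixes z :: complex
  assumes "1 \<le> Re z"
  shows "fact n \<le> norm (pochhammer z n)"
proof (induction n)
  case (Suc n)
  have "real n + 1 \<le> norm (z + of_nat n)"
    using assms complex_Re_le_cmod[of "z + of_nat n"] by simp
  then show ?case
    using Suc by (simp add: pochhammer_Suc norm_mult mult_mono mult.commute add.commute)
qed simp

lemma norm_pochhammer_le:
  fixes z :: complex
  shows "norm (pochhammer z n) \<le> (norm z + real n) ^ n"
proof -
  have "norm (pochhammer z n) = (\<Prod>i<n. norm (z + of_nat i))"
    by (simp add: pochhammer_prod prod_norm lessThan_atLeast0)
  also have "\<dots> \<le> (\<Prod>i<n. norm z + real n)"
    by (intro prod_mono conjI order_trans[OF norm_triangle_ineq]) auto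
  finally show ?thesis by simp
qed

text \<open>
  Comparing with powers of a common radius \<open>r \<ge> \<bar>N\<bar> / D\<close> treats the factorial decay for \<open>N \<rightarrow> \<infinity>\<close> and the
  factorial growth for \<open>N \<rightarrow> -\<infinity>\<close> at the same time.
\<close>

lemma rGamma_shift_bound:
  fixes z :: complex and D :: real
  assumes D: "0 \<le> D"
  shows "\<exists>K\<ge>1. \<forall>N::int. \<forall>r::real. 1 \<le> r \<and> \<bar>real_of_int N\<bar> \<le> D * r \<longrightarrow>
           norm (rGamma (z + of_int N)) \<le> K powr r * r powr (- real_of_int N)"
proof -
  \<comment> \<open>From z + M on all real parts are at least 1, so Pochhammer products to the right
    dominate factorials; values to the left are reached from the same base point by
    multiplication.\<close>
  obtain M :: nat where M: "1 - Re z \<le> real M" using real_arch_simple by blast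
  define G where "G = norm (rGamma (z + of_nat M))"
  define E where "E = norm z + 2 * D + real M + 1"
  define K where "K = (1 + G) * fact M * exp 2 * E powr (real M + D)"
  have G: "0 \<le> G" by (simp add: G_def)
  have E: "1 \<le> E" using D by (simp add: E_def)
  have EMD: "1 \<le> E powr (real M + D)" using E D by (simp add: ge_one_powr_ge_zero)
  have GM: "1 \<le> (1 + G) * fact M" using G
    by (smt (verit) fact_ge_1 mult_le_cancel_left1)
  have K1: "1 \<le> K"
  proof -
    have "1 * 1 * 1 \<le> (1 + G) * fact M * exp 2 * E powr (real M + D)"
      using GM EMD by (intro mult_mono) auto
    then show ?thesis by (simp add: K_def)
  qed
  \<comment> \<open>Constants at least 1 may be raised to the power r, which is why 1 + G replaces
    G. The exponential is squared because 1/j! and r^M cost one factor e^r each.\<close>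
  have Kpow: "(1 + G) * fact M * exp (2 * r) * E powr ((real M + D) * r) \<le> K powr r" if "1 \<le> r" for r
  proof -
    have "K powr r = ((1 + G) * fact M) powr r * exp (2 * r) * E powr ((real M + D) * r)"
      using G E by (simp add: K_def powr_mult powr_powr exp_powr_real)
    moreover have "(1 + G) * fact M \<le> ((1 + G) * fact M) powr r"
      by (rule le_powr_self[OF GM that])
    ultimately show ?thesis by (simp add: mult_right_mono)
  qed
  have "norm (rGamma (z + of_int N)) \<le> K powr r * r powr (- real_of_int N)"
    if r: "1 \<le> r" and N: "\<bar>real_of_int N\<bar> \<le> D * r" for N r
  proof (cases "int M \<le> N")
    case True
    then obtain j where j: "N = int M + int j" using zle_iff_zadd by blast
    have "rGamma (z + of_nat M) = pochhammer (z + of_nat M) j * rGamma (z + of_int N)"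
      using pochhammer_rGamma[of "z + of_nat M" j] by (simp add: j add.assoc)
    then have "G = norm (pochhammer (z + of_nat M) j) * norm (rGamma (z + of_int N))"
      by (simp add: G_def norm_mult)
    moreover have "fact j \<le> norm (pochhammer (z + of_nat M) j)"
      using M by (intro norm_pochhammer_ge_fact) simp
    ultimately have "fact j * norm (rGamma (z + of_int N)) \<le> G"
      by (simp add: mult_right_mono)
    then have "norm (rGamma (z + of_int N)) \<le> G / fact j" by (simp add: field_simps)
    also have "1 / fact j \<le> exp r / r ^ j"
      using power_le_fact_exp[of r j] r by (simp add: field_simps)
    then have "G / fact j \<le> G * (exp r / r ^ j)"
      using G mult_left_mono[of "1 / fact j" "exp r / r ^ j" G] by simp
    also have "exp r / r ^ j = exp r * r ^ M * r powr (- real_of_int N)"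
    proof -
      have "r powr (- real_of_int N) = inverse (r ^ M * r ^ j)"
      proof -
        have "- real_of_int N = - (real M + real j)" by (simp add: j)
        then show ?thesis using r by (simp only: powr_minus powr_add) (simp add: powr_realpow)
      qed
      then show ?thesis using r by (simp add: field_simps)
    qed
    also have "G * (exp r * r ^ M * r powr (- real_of_int N))
        \<le> (1 + G) * (exp r * (fact M * exp r) * r powr (- real_of_int N))"
      using power_le_fact_exp[of r M] r G by (intro mult_mono) auto
    also have "\<dots> = ((1 + G) * fact M * exp (2 * r)) * 1 * r powr (- real_of_int N)"
      by (simp add: exp_double power2_eq_square)
    also have "\<dots> \<le> ((1 + G) * fact M * exp (2 * r)) * E powr ((real M + D) * r) * r powr (- real_of_int N)"
    proof (intro mult_right_mono mult_left_mono)
      show "1 \<le> E powr ((real M + D) * r)"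
        using E D r by (intro ge_one_powr_ge_zero mult_nonneg_nonneg) auto
    qed (use G in auto)
    also have "\<dots> \<le> K powr r * r powr (- real_of_int N)"
      by (rule mult_right_mono[OF Kpow[OF r]]) simp
    finally show ?thesis .
  next
    case False
    define j where "j = nat (int M - N)"
    have j: "int j = int M - N" using False by (simp add: j_def)
    then have jr: "real j = real M - real_of_int N" by linarith
    have zj: "z + of_int N + of_nat j = z + of_nat M"
    proof -
      have "(of_nat j :: complex) = of_int (int j)" by simp
      then show ?thesis by (simp only: j) simp
    qed
    have "rGamma (z + of_int N) = pochhammer (z + of_int N) j * rGamma (z + of_nat M)"
      using pochhammer_rGamma[of "z + of_int N" j] by (simp only: zj)
    then have "norm (rGamma (z + of_int N)) = norm (pochhammer (z + of_int N) j) * G"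
      by (simp add: G_def norm_mult)
    also have "norm (pochhammer (z + of_int N) j) \<le> (norm (z + of_int N) + real j) ^ j"
      by (rule norm_pochhammer_le)
    also have "\<dots> \<le> (E * r) ^ j"
    proof (rule power_mono)
      have "norm (z + of_int N) \<le> norm z + \<bar>real_of_int N\<bar>"
        using norm_triangle_ineq[of z "of_int N"] by simp
      then have "norm (z + of_int N) + real j \<le> norm z + 2 * (D * r) + real M"
        using N jr by linarith
      also have "\<dots> \<le> E * r"
      proof -
        have "norm z * 1 + real M * 1 \<le> norm z * r + real M * r"
          using r by (intro add_mono mult_left_mono) auto
        then show ?thesis using r by (simp add: E_def algebra_simps)
      qed
      finally show "norm (z + of_int N) + real j \<le> E * r" .
    qed simp
    also have "(E * r) ^ j = E ^ j * r ^ j" by (rule power_mult_distrib)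
    also have "r ^ j = r ^ M * r powr (- real_of_int N)"
    proof -
      have "r ^ j = r powr (real M + (- real_of_int N))" using r jr by (simp flip: powr_realpow)
      then show ?thesis using r by (simp only: powr_add) (simp add: powr_realpow)
    qed
    also have "E ^ j \<le> E powr ((real M + D) * r)"
    proof -
      have "real j \<le> (real M + D) * r"
      proof -
        have "real M * 1 \<le> real M * r" using r by (intro mult_left_mono) auto
        then show ?thesis using jr N by (simp add: algebra_simps)
      qed
      then have "E powr real j \<le> E powr ((real M + D) * r)" using E by (intro powr_mono) auto
      then show ?thesis using E by (simp add: powr_realpow)
    qed
    finally have "norm (rGamma (z + of_int N)) \<le>
        E powr ((real M + D) * r) * (r ^ M * r powr (- real_of_int N)) * G"
      using G r by (simp add: mult_right_mono)
    also have "\<dots> \<le> E powr ((real M + D) * r) * ((fact M * exp (2 * r)) * r powr (- real_of_int N)) * (1 + G)"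
    proof (intro mult_mono order_refl)
      have "exp r \<le> exp (2 * r)" using r by simp
      then show "r ^ M \<le> fact M * exp (2 * r)"
        using power_le_fact_exp[of r M] r by (smt (verit) fact_ge_zero mult_left_mono)
    qed (use G r in auto)
    also have "\<dots> = ((1 + G) * fact M * exp (2 * r) * E powr ((real M + D) * r)) * r powr (- real_of_int N)"
      by simp
    also have "\<dots> \<le> K powr r * r powr (- real_of_int N)"
      by (rule mult_right_mono[OF Kpow[OF r]]) simp
    finally show ?thesis .
  qed
  then show ?thesis using K1 by blast
qed

text \<open>All Gamma factors are compared with powers of one radius r = 1 + sum of the k_l. Write
  |b_l| for the sum of \<open>b l i\<close> over \<sigma>. As the u_i are linear in the u_l, the
  factors in \<sigma> contribute |b_l| k_l to the exponent of r, up to a bounded amount, and the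
  factorials outside \<sigma> contribute -k_l; what remains is governed by 1 - |b_l|.\<close>

lemma gamma_product_bound:
  fixes v :: "complex^'n::finite" and b :: "'n \<Rightarrow> 'n \<Rightarrow> real" and \<sigma> :: "'n set"
  shows "\<exists>K\<ge>1. \<forall>(u::int^'n) (k::nat^'n). 
     (\<forall>l. l \<notin> \<sigma> \<longrightarrow> v$l + of_int (u$l) = of_nat (k$l)) \<and>
     (\<forall>i\<in>\<sigma>. real_of_int (u$i) = - (\<Sum>l\<in>-\<sigma>. real_of_int (u$l) * b l i)) \<longrightarrow>
     (\<Prod>i\<in>UNIV. norm (rGamma (v$i + of_int (u$i) + 1))) \<le>
     K powr (1 + (\<Sum>l\<in>-\<sigma>. real (k$l))) *
       (1 + (\<Sum>l\<in>-\<sigma>. real (k$l))) powr (\<Sum>l\<in>-\<sigma>. - (1 - (\<Sum>i\<in>\<sigma>. b l i)) * real (k$l))"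
proof -
  define D where "D = (\<Sum>l\<in>UNIV. \<Sum>i\<in>UNIV. \<bar>b l i\<bar> * (1 + norm (v$l)))"
  have D: "0 \<le> D" by (auto simp: D_def intro!: sum_nonneg)
  have "\<forall>i. \<exists>K\<ge>1. \<forall>N::int. \<forall>r::real. 1 \<le> r \<and> \<bar>real_of_int N\<bar> \<le> D * r \<longrightarrow>
           norm (rGamma (v$i + 1 + of_int N)) \<le> K powr r * r powr (- real_of_int N)"
    using rGamma_shift_bound[OF D] by blast
  then obtain Q where Q1: "\<And>i. 1 \<le> Q i" and
    Q: "\<And>i N r. 1 \<le> r \<Longrightarrow> \<bar>real_of_int N\<bar> \<le> D * r \<Longrightarrow>
           norm (rGamma (v$i + 1 + of_int N)) \<le> Q i powr r * r powr (- real_of_int N)"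
    by metis
  define c where "c l = (\<Sum>i\<in>\<sigma>. b l i)" for l
  \<comment> \<open>Absorbs the bounded discrepancy between u_l and k_l in the exponent: r^S is at
    most S! e^r.\<close>
  obtain S :: nat where S: "(\<Sum>l\<in>-\<sigma>. \<bar>Re (v$l)\<bar> * \<bar>c l\<bar>) \<le> real S" using real_arch_simple by blast
  define K where "K = (\<Prod>i\<in>\<sigma>. Q i) * (\<Prod>l\<in>-\<sigma>. exp 1) * (fact S * exp 1)"
  have PQ: "1 \<le> (\<Prod>i\<in>\<sigma>. Q i)" by (rule prod_ge_1) (use Q1 in auto)
  have Pe: "1 \<le> (\<Prod>l\<in>-\<sigma>. exp (1::real))" by (rule prod_ge_1) auto
  have Ps: "1 \<le> fact S * exp (1::real)"
    by (metis fact_ge_1 mult_mono one_le_exp_iff zero_le_one mult_1 fact_ge_zero)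
  have K1: "1 \<le> K"
  proof -
    have "1 * 1 * 1 \<le> (\<Prod>i\<in>\<sigma>. Q i) * (\<Prod>l\<in>-\<sigma>. exp 1) * (fact S * exp (1::real))"
      by (intro mult_mono PQ Pe Ps) (use PQ Pe in auto)
    then show ?thesis by (simp add: K_def)
  qed
  show ?thesis
  proof (intro exI[of _ K] conjI K1 allI impI, elim conjE)
    fix u :: "int^'n" and k :: "nat^'n"
    assume off: "\<forall>l. l \<notin> \<sigma> \<longrightarrow> v$l + of_int (u$l) = of_nat (k$l)"
      and on: "\<forall>i\<in>\<sigma>. real_of_int (u$i) = - (\<Sum>l\<in>-\<sigma>. real_of_int (u$l) * b l i)"
    define r where "r = 1 + (\<Sum>l\<in>-\<sigma>. real (k$l))"
    have r1: "1 \<le> r" by (simp add: r_def sum_nonneg)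
    have kr: "real (k$l) \<le> r" if "l \<notin> \<sigma>" for l
    proof -
      have "real (k$l) \<le> (\<Sum>l\<in>-\<sigma>. real (k$l))" using that by (intro member_le_sum) auto
      then show ?thesis by (simp add: r_def)
    qed
    have ul: "real_of_int (u$l) = real (k$l) - Re (v$l)" if "l \<notin> \<sigma>" for l
    proof -
      have "v$l + of_int (u$l) = of_nat (k$l)" using off that by blast
      then have "Re (v$l + of_int (u$l)) = Re (of_nat (k$l))" by simp
      then show ?thesis by simp
    qed
    have ub: "\<bar>real_of_int (u$l)\<bar> \<le> (1 + norm (v$l)) * r" if "l \<notin> \<sigma>" for l
    proof -
      have "\<bar>real_of_int (u$l)\<bar> \<le> real (k$l) + norm (v$l)"
        using ul[OF that] abs_Re_le_cmod[of "v$l"] by linarith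
      also have "\<dots> \<le> r + norm (v$l) * r"
        using kr[OF that] r1 mult_left_mono[of 1 r "norm (v$l)"] by simp
      finally show ?thesis by (simp add: algebra_simps)
    qed
    have uD: "\<bar>real_of_int (u$i)\<bar> \<le> D * r" if "i \<in> \<sigma>" for i
    proof -
      have "\<bar>real_of_int (u$i)\<bar> \<le> (\<Sum>l\<in>-\<sigma>. \<bar>real_of_int (u$l) * b l i\<bar>)"
        using on that by simp
      also have "\<dots> \<le> (\<Sum>l\<in>-\<sigma>. \<bar>b l i\<bar> * ((1 + norm (v$l)) * r))"
      proof (rule sum_mono)
        fix l assume "l \<in> -\<sigma>"
        then have "\<bar>b l i\<bar> * \<bar>real_of_int (u$l)\<bar> \<le> \<bar>b l i\<bar> * ((1 + norm (v$l)) * r)"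
          using ub by (intro mult_left_mono) auto
        then show "\<bar>real_of_int (u$l) * b l i\<bar> \<le> \<bar>b l i\<bar> * ((1 + norm (v$l)) * r)"
          by (simp only: abs_mult mult.commute[of "\<bar>real_of_int (u$l)\<bar>"])
      qed
      also have "\<dots> = (\<Sum>l\<in>-\<sigma>. \<bar>b l i\<bar> * (1 + norm (v$l))) * r"
        by (simp only: sum_distrib_right mult.assoc)
      also have "\<dots> \<le> D * r"
      proof (rule mult_right_mono)
        have "(\<Sum>l\<in>-\<sigma>. \<bar>b l i\<bar> * (1 + norm (v$l))) \<le> (\<Sum>l\<in>UNIV. \<bar>b l i\<bar> * (1 + norm (v$l)))"
          by (rule sum_mono2) auto
        also have "\<dots> \<le> D" unfolding D_def
          by (rule sum_mono) (rule member_le_sum, auto)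
        finally show "(\<Sum>l\<in>-\<sigma>. \<bar>b l i\<bar> * (1 + norm (v$l))) \<le> D" .
      qed (use r1 in simp)
      finally show ?thesis .
    qed
    have A: "(\<Prod>i\<in>\<sigma>. norm (rGamma (v$i + of_int (u$i) + 1))) \<le>
        (\<Prod>i\<in>\<sigma>. Q i) powr r * r powr (- (\<Sum>i\<in>\<sigma>. real_of_int (u$i)))"
    proof -
      have "(\<Prod>i\<in>\<sigma>. norm (rGamma (v$i + of_int (u$i) + 1))) \<le> (\<Prod>i\<in>\<sigma>. Q i powr r * r powr (- real_of_int (u$i)))"
        using Q[OF r1 uD] by (intro prod_mono) (auto simp: add_ac)
      also have "\<dots> = (\<Prod>i\<in>\<sigma>. Q i) powr r * r powr (\<Sum>i\<in>\<sigma>. - real_of_int (u$i))"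
        using r1 Q1 by (simp add: prod.distrib powr_sum prod_powr_distrib order_trans[OF zero_le_one])
      finally show ?thesis by (simp add: sum_negf)
    qed
    have B: "(\<Prod>l\<in>-\<sigma>. norm (rGamma (v$l + of_int (u$l) + 1))) \<le>
        (\<Prod>l\<in>-\<sigma>. exp 1) powr r * r powr (- (\<Sum>l\<in>-\<sigma>. real (k$l)))"
    proof -
      have "(\<Prod>l\<in>-\<sigma>. norm (rGamma (v$l + of_int (u$l) + 1))) \<le> (\<Prod>l\<in>-\<sigma>. exp 1 powr r * r powr (- real (k$l)))"
      proof (intro prod_mono conjI)
        fix l assume "l \<in> -\<sigma>"
        then have "v$l + of_int (u$l) = of_nat (k$l)" using off by auto
        then have "rGamma (v$l + of_int (u$l) + 1) = inverse (fact (k$l))"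
          using Gamma_fact[of "k$l", where ?'a=complex] by (simp add: rGamma_inverse_Gamma add.commute)
        then have "norm (rGamma (v$l + of_int (u$l) + 1)) = 1 / fact (k$l)"
          by (simp add: norm_inverse divide_inverse)
        also have "\<dots> \<le> exp r / r ^ (k$l)"
          using power_le_fact_exp[of r "k$l"] r1 by (simp add: field_simps)
        also have "\<dots> = exp 1 powr r * r powr (- real (k$l))"
          using r1 by (simp add: exp_powr_real powr_minus powr_realpow divide_inverse)
        finally show "norm (rGamma (v$l + of_int (u$l) + 1)) \<le> exp 1 powr r * r powr (- real (k$l))" .
      qed simp
      also have "\<dots> = (\<Prod>l\<in>-\<sigma>. exp 1) powr r * r powr (\<Sum>l\<in>-\<sigma>. - real (k$l))"
        using r1 unfolding prod.distrib by (simp add: powr_sum flip: prod_powr_distrib powr_realpow prod_constant)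
      finally show ?thesis by (simp add: sum_negf)
    qed
    have sumu: "- (\<Sum>i\<in>\<sigma>. real_of_int (u$i)) = (\<Sum>l\<in>-\<sigma>. c l * real (k$l)) + (\<Sum>l\<in>-\<sigma>. - Re (v$l) * c l)"
    proof -
      have "- (\<Sum>i\<in>\<sigma>. real_of_int (u$i)) = (\<Sum>i\<in>\<sigma>. \<Sum>l\<in>-\<sigma>. real_of_int (u$l) * b l i)"
        using on by (simp flip: sum_negf)
      also have "\<dots> = (\<Sum>l\<in>-\<sigma>. real_of_int (u$l) * c l)"
        by (subst sum.swap) (simp add: c_def sum_distrib_left)
      also have "\<dots> = (\<Sum>l\<in>-\<sigma>. c l * real (k$l) + - Re (v$l) * c l)"
        by (rule sum.cong) (auto simp: ul algebra_simps)
      finally show ?thesis by (simp only: sum.distrib)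
    qed
    have C: "r powr (\<Sum>l\<in>-\<sigma>. - Re (v$l) * c l) \<le> (fact S * exp 1) powr r"
    proof -
      have "(\<Sum>l\<in>-\<sigma>. - Re (v$l) * c l) \<le> (\<Sum>l\<in>-\<sigma>. \<bar>Re (v$l)\<bar> * \<bar>c l\<bar>)"
        by (intro sum_mono) (metis abs_ge_self abs_minus_cancel abs_mult)
      then have "r powr (\<Sum>l\<in>-\<sigma>. - Re (v$l) * c l) \<le> r powr (real S)"
        using S r1 by (intro powr_mono) auto
      also have "\<dots> \<le> fact S * exp r"
        using r1 power_le_fact_exp[of r S] by (simp add: powr_realpow)
      also have "\<dots> \<le> fact S powr r * exp r"
        using r1 by (intro mult_right_mono le_powr_self) auto
      also have "\<dots> = (fact S * exp 1) powr r"
        by (simp add: powr_mult exp_powr_real)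
      finally show ?thesis .
    qed
    have "(\<Prod>i\<in>UNIV. norm (rGamma (v$i + of_int (u$i) + 1)))
       = (\<Prod>i\<in>\<sigma>. norm (rGamma (v$i + of_int (u$i) + 1))) * (\<Prod>l\<in>-\<sigma>. norm (rGamma (v$l + of_int (u$l) + 1)))"
      by (subst prod.union_disjoint[symmetric]) (auto simp: Compl_partition)
    also have "\<dots> \<le> ((\<Prod>i\<in>\<sigma>. Q i) powr r * r powr (- (\<Sum>i\<in>\<sigma>. real_of_int (u$i)))) *
       ((\<Prod>l\<in>-\<sigma>. exp 1) powr r * r powr (- (\<Sum>l\<in>-\<sigma>. real (k$l))))"
      by (intro mult_mono A B prod_nonneg) auto
    also have "\<dots> = ((\<Prod>i\<in>\<sigma>. Q i) powr r * (\<Prod>l\<in>-\<sigma>. exp 1) powr r) * r powr (\<Sum>l\<in>-\<sigma>. - Re (v$l) * c l) *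
       (r powr (\<Sum>l\<in>-\<sigma>. c l * real (k$l)) * r powr (- (\<Sum>l\<in>-\<sigma>. real (k$l))))"
      unfolding sumu powr_add by (simp only: mult_ac)
    also have "\<dots> \<le> ((\<Prod>i\<in>\<sigma>. Q i) powr r * (\<Prod>l\<in>-\<sigma>. exp 1) powr r) * (fact S * exp 1) powr r *
       (r powr (\<Sum>l\<in>-\<sigma>. c l * real (k$l)) * r powr (- (\<Sum>l\<in>-\<sigma>. real (k$l))))"
      by (intro mult_right_mono mult_left_mono C) auto
    also have "((\<Prod>i\<in>\<sigma>. Q i) powr r * (\<Prod>l\<in>-\<sigma>. exp 1) powr r) * (fact S * exp 1) powr r = K powr r"
      using PQ Pe powr_mult[of "(\<Prod>i\<in>\<sigma>. Q i) * (\<Prod>l\<in>-\<sigma>. exp 1)" "fact S * exp 1" r]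
        powr_mult[of "\<Prod>i\<in>\<sigma>. Q i" "\<Prod>l\<in>-\<sigma>. exp 1" r] by (simp add: K_def del: prod_constant)
    also have "r powr (\<Sum>l\<in>-\<sigma>. c l * real (k$l)) * r powr (- (\<Sum>l\<in>-\<sigma>. real (k$l)))
       = r powr (\<Sum>l\<in>-\<sigma>. - (1 - c l) * real (k$l))"
      by (simp only: powr_add[symmetric] sum_negf[symmetric] sum.distrib[symmetric])
         (simp add: algebra_simps)
    finally show "(\<Prod>i\<in>UNIV. norm (rGamma (v$i + of_int (u$i) + 1))) \<le>
     K powr (1 + (\<Sum>l\<in>-\<sigma>. real (k$l))) *
       (1 + (\<Sum>l\<in>-\<sigma>. real (k$l))) powr (\<Sum>l\<in>-\<sigma>. - (1 - (\<Sum>i\<in>\<sigma>. b l i)) * real (k$l))"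
      by (simp only: r_def c_def)
  qed
qed


section \<open>From growth bounds to unordered summability\<close>

lemma superexp_summable:
  fixes \<delta> X :: real
  assumes "0 < \<delta>" "0 \<le> X"
  shows "summable (\<lambda>k. X ^ k * (1 + real k) powr (- \<delta> * real k))"
proof (rule summable_comparison_test_ev)
  have lim: "((\<lambda>k. X * (1 + real k) powr (- \<delta>)) \<longlongrightarrow> X * 0) sequentially"
    using assms by (intro tendsto_mult tendsto_const tendsto_neg_powr
      filterlim_tendsto_add_at_top[OF tendsto_const] filterlim_real_sequentially) auto
  have "eventually (\<lambda>k. X * (1 + real k) powr (- \<delta>) < 1/2) sequentially"
    by (rule order_tendstoD(2)[OF lim]) simp
  then show "eventually (\<lambda>k. norm (X ^ k * (1 + real k) powr (- \<delta> * real k)) \<le> (1/2) ^ k) sequentially"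
  proof eventually_elim
    case (elim k)
    have "(1 + real k) powr (- \<delta> * real k) = ((1 + real k) powr (- \<delta>)) ^ k"
      by (simp add: powr_power mult.commute)
    then have "X ^ k * (1 + real k) powr (- \<delta> * real k) = (X * (1 + real k) powr (- \<delta>)) ^ k"
      by (simp add: power_mult_distrib)
    also have "\<dots> \<le> (1/2) ^ k" using elim assms by (intro power_mono) auto
    finally show ?case using assms by simp
  qed
qed (simp add: summable_geometric)

text \<open>The keys embed a finite part of the index set into a box of natural numbers, where a sum
  of products is a product of sums, and each factor is a partial sum of a convergent series.\<close>

lemma summable_on_prod_bound:
  fixes f :: "'a \<Rightarrow> real" and key :: "'a \<Rightarrow> 'n \<Rightarrow> nat" and g :: "'n \<Rightarrow> nat \<Rightarrow> real"
  assumes I: "finite I" and inj: "inj_on (\<lambda>u. restrict (key u) I) W"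
    and g: "\<And>l. l \<in> I \<Longrightarrow> summable (g l)" "\<And>l m. l \<in> I \<Longrightarrow> 0 \<le> g l m"
    and f: "\<And>u. u \<in> W \<Longrightarrow> 0 \<le> f u" "\<And>u. u \<in> W \<Longrightarrow> f u \<le> C * (\<Prod>l\<in>I. g l (key u l))"
    and C: "0 \<le> C"
  shows "f summable_on W"
proof (rule nonneg_bdd_above_summable_on)
  show "bdd_above (sum f ` {F. F \<subseteq> W \<and> finite F})"
  proof (rule bdd_aboveI2)
    fix F assume "F \<in> {F. F \<subseteq> W \<and> finite F}"
    then have F: "F \<subseteq> W" "finite F" by auto
    define N where "N = Max (insert 0 ((\<lambda>(u, l). key u l) ` (F \<times> I)))"
    have N: "key u l \<le> N" if "u \<in> F" "l \<in> I" for u l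
      unfolding N_def by (rule Max_ge) (use that F I in \<open>auto simp: image_iff\<close>)
    have "sum f F \<le> (\<Sum>u\<in>F. C * (\<Prod>l\<in>I. g l (restrict (key u) I l)))"
      using f F by (intro sum_mono) (auto cong: prod.cong)
    also have "\<dots> = C * (\<Sum>h\<in>(\<lambda>u. restrict (key u) I) ` F. \<Prod>l\<in>I. g l (h l))"
      using inj F by (subst sum.reindex) (auto intro: inj_on_subset simp: sum_distrib_left)
    also have "\<dots> \<le> C * (\<Sum>h\<in>PiE I (\<lambda>_. {..N}). \<Prod>l\<in>I. g l (h l))"
      using N C I g(2) by (intro mult_left_mono sum_mono2) (auto intro!: finite_PiE prod_nonneg)
    also have "\<dots> = C * (\<Prod>l\<in>I. \<Sum>m\<le>N. g l m)"
      using I by (subst prod_sum_PiE) auto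
    also have "\<dots> \<le> C * (\<Prod>l\<in>I. suminf (g l))"
      using g C by (intro mult_left_mono prod_mono conjI sum_nonneg sum_le_suminf) auto
    finally show "sum f F \<le> C * (\<Prod>l\<in>I. suminf (g l))" .
  qed
qed (use f in auto)

text \<open>Where the \<open>b l i\<close> sum to less than 1 the bound decays faster than any
  geometric sequence, whatever \<open>L l\<close> is; where they sum to 1 a geometric series is
  left, whence the condition \<open>K * L l < 1\<close>. At a simplicial facet of \<Gamma>_A only
  the former case occurs, at a cell of a refining triangulation possibly both.\<close>

lemma gamma_terms_summable:
  fixes v :: "complex^'n::finite" and b :: "'n \<Rightarrow> 'n \<Rightarrow> real" and \<sigma> :: "'n set"
  assumes c: "\<And>l. l \<notin> \<sigma> \<Longrightarrow> (\<Sum>i\<in>\<sigma>. b l i) \<le> 1"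
  shows "\<exists>K\<ge>1. \<forall>L::'n \<Rightarrow> real. (\<forall>l. 0 \<le> L l) \<and> (\<forall>l. l \<notin> \<sigma> \<longrightarrow> (\<Sum>i\<in>\<sigma>. b l i) = 1 \<longrightarrow> K * L l < 1) \<longrightarrow>
    (\<lambda>u::int^'n. (\<Prod>i\<in>UNIV. norm (rGamma (v$i + of_int (u$i) + 1))) *
        (\<Prod>l\<in>-\<sigma>. L l ^ nat \<lfloor>Re (v$l + of_int (u$l))\<rfloor>))
     summable_on {u. (\<forall>l. l \<notin> \<sigma> \<longrightarrow> v$l + of_int (u$l) \<in> \<nat>) \<and>
                     (\<forall>i\<in>\<sigma>. real_of_int (u$i) = - (\<Sum>l\<in>-\<sigma>. real_of_int (u$l) * b l i))}"
proof -
  define c where "c l = (\<Sum>i\<in>\<sigma>. b l i)" for l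
  obtain K where K1: "1 \<le> K" and
    K0: "\<forall>(u::int^'n) (k::nat^'n). (\<forall>l. l \<notin> \<sigma> \<longrightarrow> v$l + of_int (u$l) = of_nat (k$l)) \<and>
     (\<forall>i\<in>\<sigma>. real_of_int (u$i) = - (\<Sum>l\<in>-\<sigma>. real_of_int (u$l) * b l i)) \<longrightarrow>
     (\<Prod>i\<in>UNIV. norm (rGamma (v$i + of_int (u$i) + 1))) \<le>
     K powr (1 + (\<Sum>l\<in>-\<sigma>. real (k$l))) *
       (1 + (\<Sum>l\<in>-\<sigma>. real (k$l))) powr (\<Sum>l\<in>-\<sigma>. - (1 - (\<Sum>i\<in>\<sigma>. b l i)) * real (k$l))"
    using gamma_product_bound[of \<sigma> v b] by (elim exE conjE) (rule that)
  have K: "(\<Prod>i\<in>UNIV. norm (rGamma (v$i + of_int (u$i) + 1))) \<le>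
     K powr (1 + (\<Sum>l\<in>-\<sigma>. real (k$l))) *
       (1 + (\<Sum>l\<in>-\<sigma>. real (k$l))) powr (\<Sum>l\<in>-\<sigma>. - (1 - c l) * real (k$l))"
    if "\<forall>l. l \<notin> \<sigma> \<longrightarrow> v$l + of_int (u$l) = of_nat (k$l)"
       "\<forall>i\<in>\<sigma>. real_of_int (u$i) = - (\<Sum>l\<in>-\<sigma>. real_of_int (u$l) * b l i)"
    for u :: "int^'n" and k :: "nat^'n"
    unfolding c_def by (rule K0[rule_format]) (use that in blast)
  show ?thesis
  proof (intro exI[of _ K] conjI K1 allI impI, elim conjE)
    fix L :: "'n \<Rightarrow> real"
    assume L0: "\<forall>l. 0 \<le> L l" and L1: "\<forall>l. l \<notin> \<sigma> \<longrightarrow> (\<Sum>i\<in>\<sigma>. b l i) = 1 \<longrightarrow> K * L l < 1"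
    let ?W = "{u. (\<forall>l. l \<notin> \<sigma> \<longrightarrow> v$l + of_int (u$l) \<in> \<nat>) \<and>
                     (\<forall>i\<in>\<sigma>. real_of_int (u$i) = - (\<Sum>l\<in>-\<sigma>. real_of_int (u$l) * b l i))}"
    define key where "key u l = nat \<lfloor>Re (v$l + of_int (u$l))\<rfloor>" for u :: "int^'n" and l
    define g where "g l m = (K * L l) ^ m * (1 + real m) powr (- (1 - c l) * real m)" for l m
    have key: "v$l + of_int (u$l) = of_nat (key u l)" if "u \<in> ?W" "l \<notin> \<sigma>" for u l
    proof -
      have "v$l + of_int (u$l) \<in> \<nat>" using that by blast
      then obtain m where m: "v$l + of_int (u$l) = of_nat m" by (rule Nats_cases)
      then show ?thesis by (simp add: key_def)
    qed
    have "(\<lambda>u. (\<Prod>i\<in>UNIV. norm (rGamma (v$i + of_int (u$i) + 1))) * (\<Prod>l\<in>-\<sigma>. L l ^ key u l)) summable_on ?W"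
    proof (rule summable_on_prod_bound[where I = "-\<sigma>" and key = key and g = g and C = K])
      show "inj_on (\<lambda>u. restrict (key u) (- \<sigma>)) ?W"
      proof (rule inj_onI)
        fix u u' assume u: "u \<in> ?W" "u' \<in> ?W" and eq: "restrict (key u) (-\<sigma>) = restrict (key u') (-\<sigma>)"
        have off: "u$l = u'$l" if "l \<notin> \<sigma>" for l
        proof -
          have "key u l = key u' l" using eq that by (metis ComplI restrict_apply')
          then have "v$l + of_int (u$l) = v$l + of_int (u'$l)" using key[OF u(1) that] key[OF u(2) that] by simp
          then show ?thesis by simp
        qed
        have "u$i = u'$i" if "i \<in> \<sigma>" for i
        proof -
          have "real_of_int (u$i) = - (\<Sum>l\<in>-\<sigma>. real_of_int (u$l) * b l i)" using u(1) that by simp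
          also have "\<dots> = - (\<Sum>l\<in>-\<sigma>. real_of_int (u'$l) * b l i)"
            using off by (auto intro!: sum.cong)
          also have "\<dots> = real_of_int (u'$i)" using u(2) that by simp
          finally show ?thesis by simp
        qed
        then show "u = u'" using off by (metis vec_eq_iff)
      qed
      show "summable (g l)" if "l \<in> -\<sigma>" for l
      proof (cases "c l = 1")
        case True
        then have "g l = (\<lambda>m. (K * L l) ^ m)" by (auto simp: g_def fun_eq_iff)
        then show ?thesis using L0 L1 K1 that True by (auto simp: c_def intro!: summable_geometric)
      next
        case False
        then have "c l < 1" using c[of l] that by (auto simp: c_def)
        then show ?thesis
          unfolding g_def using L0 K1 by (intro superexp_summable) auto
      qed
      show "0 \<le> g l m" for l m using L0 K1 by (simp add: g_def)
      show "(\<Prod>i\<in>UNIV. norm (rGamma (v$i + of_int (u$i) + 1))) * (\<Prod>l\<in>-\<sigma>. L l ^ key u l)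
          \<le> K * (\<Prod>l\<in>-\<sigma>. g l (key u l))" if u: "u \<in> ?W" for u
      proof -
        define r where "r = 1 + (\<Sum>l\<in>-\<sigma>. real (key u l))"
        have "(\<Prod>i\<in>UNIV. norm (rGamma (v$i + of_int (u$i) + 1)))
            \<le> K powr r * r powr (\<Sum>l\<in>-\<sigma>. - (1 - c l) * real (key u l))"
          using K[of u "\<chi> l. key u l"] key[OF u] u by (simp add: r_def)
        also have "r powr (\<Sum>l\<in>-\<sigma>. - (1 - c l) * real (key u l)) = (\<Prod>l\<in>-\<sigma>. r powr (- (1 - c l) * real (key u l)))"
        proof (rule powr_sum)
          have "1 \<le> r" by (simp add: r_def sum_nonneg)
          then show "r \<noteq> 0" by linarith
        qed
        \<comment> \<open>The exponents are nonpositive, so r may be replaced by the smaller 1 +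
          key; this separates the variables.\<close>
        also have "\<dots> \<le> (\<Prod>l\<in>-\<sigma>. (1 + real (key u l)) powr (- (1 - c l) * real (key u l)))"
        proof (intro prod_mono conjI powr_mono2')
          fix l assume l: "l \<in> -\<sigma>"
          show "- (1 - c l) * real (key u l) \<le> 0"
            using c[of l] l by (auto simp: c_def intro!: mult_nonpos_nonneg)
          show "1 + real (key u l) \<le> r" unfolding r_def
            using l by (intro add_left_mono member_le_sum) auto
        qed auto
        also have "K powr r = K * (\<Prod>l\<in>-\<sigma>. K ^ key u l)"
        proof -
          have "(\<Prod>l\<in>-\<sigma>. K ^ key u l) = K powr (\<Sum>l\<in>-\<sigma>. real (key u l))"
            using K1 by (simp add: powr_sum powr_realpow)
          then show ?thesis using K1 by (simp add: r_def powr_add)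
        qed
        finally have "(\<Prod>i\<in>UNIV. norm (rGamma (v$i + of_int (u$i) + 1))) * (\<Prod>l\<in>-\<sigma>. L l ^ key u l) \<le>
           K * (\<Prod>l\<in>-\<sigma>. K ^ key u l) *
            (\<Prod>l\<in>-\<sigma>. (1 + real (key u l)) powr (- (1 - c l) * real (key u l))) * (\<Prod>l\<in>-\<sigma>. L l ^ key u l)"
          using L0 K1 by (simp add: mult_left_mono mult_right_mono prod_nonneg)
        also have "\<dots> = K * (\<Prod>l\<in>-\<sigma>. g l (key u l))"
          by (simp only: g_def prod.distrib power_mult_distrib mult_ac)
        finally show ?thesis .
      qed
    qed (use L0 K1 in \<open>auto intro!: mult_nonneg_nonneg prod_nonneg\<close>)
    then show "(\<lambda>u. (\<Prod>i\<in>UNIV. norm (rGamma (v$i + of_int (u$i) + 1))) *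
        (\<Prod>l\<in>-\<sigma>. L l ^ nat \<lfloor>Re (v$l + of_int (u$l))\<rfloor>)) summable_on ?W"
      by (simp only: key_def)
  qed
qed

section \<open>Termwise differentiation of unordered sums\<close>

lemma summable_on_norm_le:
  fixes f :: "'i \<Rightarrow> 'b::banach"
  assumes "M summable_on U" "\<And>u. u \<in> U \<Longrightarrow> norm (f u) \<le> M u"
  shows "f summable_on U"
  by (rule abs_summable_summable, rule Infinite_Sum.abs_summable_on_comparison_test'[OF assms])

lemma has_sum_finite_sum:
  fixes f :: "'i \<Rightarrow> 'j \<Rightarrow> 'b::topological_comm_monoid_add"
  assumes "\<And>j. j \<in> J \<Longrightarrow> ((\<lambda>u. f u j) has_sum s j) U"
  shows "((\<lambda>u. \<Sum>j\<in>J. f u j) has_sum (\<Sum>j\<in>J. s j)) U"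
  using assms by (induction J rule: infinite_finite_induct) (auto intro!: has_sum_add)

lemma summable_on_finite_sum:
  fixes f :: "'i \<Rightarrow> 'j \<Rightarrow> 'b::topological_comm_monoid_add"
  assumes "\<And>j. j \<in> J \<Longrightarrow> (\<lambda>u. f u j) summable_on U"
  shows "(\<lambda>u. \<Sum>j\<in>J. f u j) summable_on U"
  using assms has_sum_finite_sum[of J f] unfolding summable_on_def by metis

lemma has_sum_diff:
  fixes f g :: "'i \<Rightarrow> 'b::real_normed_vector"
  assumes "(f has_sum a) U" "(g has_sum b) U"
  shows "((\<lambda>u. f u - g u) has_sum (a - b)) U"
proof -
  have "((\<lambda>u. - g u) has_sum (- b)) U" using assms(2) by (simp add: has_sum_uminus)
  then show ?thesis using has_sum_add[OF assms(1)] by force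
qed

text \<open>The summable majorant of the derivatives is also a Lipschitz majorant of the terms, so a
  finite part is differentiated exactly and the tail contributes at most twice its majorant.\<close>

lemma has_derivative_infsum:
  fixes f :: "'i \<Rightarrow> 'a::real_normed_vector \<Rightarrow> 'b::banach"
  assumes S: "convex S" and x: "x \<in> S"
    and f': "\<And>u x. u \<in> U \<Longrightarrow> x \<in> S \<Longrightarrow> (f u has_derivative f' u x) (at x within S)"
    and M: "\<And>u x h. u \<in> U \<Longrightarrow> x \<in> S \<Longrightarrow> norm (f' u x h) \<le> M u * norm h" "M summable_on U"
    and M0: "\<And>u. u \<in> U \<Longrightarrow> 0 \<le> M u"
    and f: "\<And>x. x \<in> S \<Longrightarrow> (\<lambda>u. f u x) summable_on U"
  shows "((\<lambda>x. infsum (\<lambda>u. f u x) U) has_derivative (\<lambda>h. infsum (\<lambda>u. f' u x h) U)) (at x within S)"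
proof -
  have f's: "(\<lambda>u. f' u x h) summable_on U" for h
    by (rule summable_on_norm_le[OF summable_on_cmult_left[OF M(2)]]) (use M(1) x in blast)
  have lin: "linear (f' u x)" if "u \<in> U" for u
    using has_derivative_linear[OF f'[OF that x]] .
  have diff: "norm (f u y - f u x) \<le> M u * norm (y - x)" if "u \<in> U" "y \<in> S" for u y
  proof (rule differentiable_bound[OF S, of "f u" "f' u" "M u" y x])
    show "onorm (f' u z) \<le> M u" if "z \<in> S" for z
      by (rule onorm_bound[OF M0[OF \<open>u \<in> U\<close>]]) (rule M(1)[OF \<open>u \<in> U\<close> that])
  qed (use f' that x in auto)
  show ?thesis
    unfolding has_derivative_within_alt
  proof (intro conjI allI impI)
    show "bounded_linear (\<lambda>h. infsum (\<lambda>u. f' u x h) U)"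
    proof (rule bounded_linear_intro[where K = "infsum M U"])
      show "infsum (\<lambda>u. f' u x (a + b)) U = infsum (\<lambda>u. f' u x a) U + infsum (\<lambda>u. f' u x b) U" for a b
        using lin by (subst infsum_add[OF f's f's, symmetric]) (auto intro!: infsum_cong simp: linear_add)
      show "infsum (\<lambda>u. f' u x (r *\<^sub>R a)) U = r *\<^sub>R infsum (\<lambda>u. f' u x a) U" for r a
        using lin by (subst infsum_scaleR_right[symmetric]) (auto intro!: infsum_cong simp: linear_cmul)
      show "norm (infsum (\<lambda>u. f' u x h) U) \<le> norm h * infsum M U" for h
      proof -
        have "norm (infsum (\<lambda>u. f' u x h) U) \<le> infsum (\<lambda>u. M u * norm h) U"
          by (rule norm_infsum_le[OF has_sum_infsum[OF f's] has_sum_infsum]) 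
             (use M x in \<open>auto intro!: summable_on_cmult_left\<close>)
        also have "\<dots> = norm h * infsum M U" by (simp add: infsum_cmult_left' mult.commute)
        finally show ?thesis .
      qed
    qed
    fix e :: real assume e: "0 < e"
    \<comment> \<open>Half of e is spent on the finite part; e / 4 suffices for the tail, where the
      increment and the derivative both count.\<close>
    obtain F where F: "finite F" "F \<subseteq> U" "dist (sum M F) (infsum M U) \<le> e / 4"
      using infsum_finite_approximation[OF M(2), of "e / 4"] e by auto
    have MF: "M summable_on (U - F)" using M(2) by (rule summable_on_subset_banach) auto
    have "infsum M U = infsum M F + infsum M (U - F)"
      using infsum_Un_disjoint[of M F "U - F"] F MF by (auto simp: Un_absorb1 Un_Diff_cancel)
    then have tail: "infsum M (U - F) \<le> e / 4" using F by (simp add: dist_real_def)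
    have "((\<lambda>x. \<Sum>u\<in>F. f u x) has_derivative (\<lambda>h. \<Sum>u\<in>F. f' u x h)) (at x within S)"
      using f' F x by (intro has_derivative_sum) blast
    then obtain d where d: "0 < d" "\<And>y. y \<in> S \<Longrightarrow> norm (y - x) < d \<Longrightarrow>
        norm ((\<Sum>u\<in>F. f u y) - (\<Sum>u\<in>F. f u x) - (\<Sum>u\<in>F. f' u x (y - x))) \<le> e / 2 * norm (y - x)"
      unfolding has_derivative_within_alt using e half_gt_zero[OF e] by metis
    show "\<exists>d>0. \<forall>y\<in>S. norm (y - x) < d \<longrightarrow>
        norm (infsum (\<lambda>u. f u y) U - infsum (\<lambda>u. f u x) U - infsum (\<lambda>u. f' u x (y - x)) U) \<le> e * norm (y - x)"
    proof (intro exI[of _ d] conjI d(1) ballI impI)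
      fix y assume y: "y \<in> S" "norm (y - x) < d"
      define R where "R u = f u y - f u x - f' u x (y - x)" for u
      have Rsum: "(R has_sum (infsum (\<lambda>u. f u y) U - infsum (\<lambda>u. f u x) U - infsum (\<lambda>u. f' u x (y - x)) U)) U"
        unfolding R_def by (intro has_sum_diff has_sum_infsum f y x f's)
      then have Rs: "R summable_on U" by (auto simp: summable_on_def)
      have "infsum (\<lambda>u. f u y) U - infsum (\<lambda>u. f u x) U - infsum (\<lambda>u. f' u x (y - x)) U = infsum R U"
        using infsumI[OF Rsum] by simp
      also have RF: "R summable_on (U - F)" using Rs by (rule summable_on_subset_banach) auto
      have "infsum R U = sum R F + infsum R (U - F)"
        using infsum_Un_disjoint[of R F "U - F"] F RF by (auto simp: Un_absorb1 Un_Diff_cancel)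
      also have "norm \<dots> \<le> norm (sum R F) + norm (infsum R (U - F))" by (rule norm_triangle_ineq)
      also have "norm (sum R F) \<le> e / 2 * norm (y - x)"
        using d(2)[OF y] by (simp add: R_def sum_subtractf)
      also have "norm (infsum R (U - F)) \<le> infsum (\<lambda>u. M u * (2 * norm (y - x))) (U - F)"
      proof (rule norm_infsum_le[OF has_sum_infsum[OF RF] has_sum_infsum])
        fix u assume u: "u \<in> U - F"
        have "norm (R u) \<le> norm (f u y - f u x) + norm (f' u x (y - x))"
          unfolding R_def by (rule norm_triangle_ineq4)
        then show "norm (R u) \<le> M u * (2 * norm (y - x))"
          using diff[of u y] M(1)[of u x "y - x"] u x y by auto
      qed (use MF in \<open>auto intro!: summable_on_cmult_left\<close>)
      also have "\<dots> = infsum M (U - F) * (2 * norm (y - x))" by (simp add: infsum_cmult_left')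
      also have "\<dots> \<le> e / 4 * (2 * norm (y - x))" by (intro mult_right_mono tail) auto
      finally show "norm (infsum (\<lambda>u. f u y) U - infsum (\<lambda>u. f u x) U - infsum (\<lambda>u. f' u x (y - x)) U) \<le> e * norm (y - x)"
        by simp
    qed
  qed
qed


section \<open>Gamma series in mixed coordinates\<close>

text \<open>
  For \<open>l \<in> \<tau>\<close> the coordinate \<open>z\<^sub>l\<close> stands for \<open>log x\<^sub>l\<close>, for \<open>l \<notin> \<tau>\<close> it is \<open>x\<^sub>l\<close> itself; then
  \<open>hfac \<tau> l w z\<^sub>l\<close> is \<open>x\<^sub>l\<^sup>w / \<Gamma>(w + 1)\<close>, and the series become entire functions of \<open>z\<close>.
\<close>

definition hfac :: "'n set \<Rightarrow> 'n \<Rightarrow> complex \<Rightarrow> complex \<Rightarrow> complex" where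
  "hfac \<tau> l w z = (if l \<in> \<tau> then exp (w * z) * rGamma (w + 1)
     else if w \<in> \<nat> then z ^ nat \<lfloor>Re w\<rfloor> * rGamma (w + 1) else 0)"

definition hbound :: "'n set \<Rightarrow> 'n \<Rightarrow> complex \<Rightarrow> real \<Rightarrow> real" where
  "hbound \<tau> l w B = (if l \<in> \<tau> then exp (norm w * B) * norm (rGamma (w + 1))
     else if w \<in> \<nat> then B ^ nat \<lfloor>Re w\<rfloor> * norm (rGamma (w + 1)) else 0)"

definition hbase :: "'n set \<Rightarrow> 'n \<Rightarrow> complex \<Rightarrow> complex" where
  "hbase \<tau> l z = (if l \<in> \<tau> then exp z else z)"

text \<open>The derivative of \<open>hbase\<close>, that is, the chain rule factor between
  derivatives in z_l and in x_l.\<close>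

definition hjac :: "'n set \<Rightarrow> 'n \<Rightarrow> complex \<Rightarrow> complex" where
  "hjac \<tau> l z = (if l \<in> \<tau> then exp z else 1)"

text \<open>Integers rather than naturals, so that the condition is stable under differentiation and
  under shifts by the kernel.\<close>

definition integral_off :: "'n set \<Rightarrow> complex^'n \<Rightarrow> bool" where
  "integral_off \<tau> v \<longleftrightarrow> (\<forall>l. l \<notin> \<tau> \<longrightarrow> v$l \<in> \<int>)"

lemma hbound_nonneg: "0 \<le> B \<Longrightarrow> 0 \<le> hbound \<tau> l w B"
  by (simp add: hbound_def)

lemma norm_hfac_le:
  assumes "norm z \<le> B"
  shows "norm (hfac \<tau> l w z) \<le> hbound \<tau> l w B"
proof -
  have "norm (exp (w * z)) \<le> exp (norm w * B)"
  proof -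
    have "norm (exp (w * z)) \<le> exp (norm (w * z))" by (rule norm_exp)
    also have "\<dots> \<le> exp (norm w * B)" using assms by (simp add: norm_mult mult_left_mono)
    finally show ?thesis .
  qed
  moreover have "norm z ^ n \<le> B ^ n" for n using assms by (intro power_mono) auto
  ultimately show ?thesis
    by (auto simp: hfac_def hbound_def norm_mult norm_power intro!: mult_right_mono)
qed

lemma Nats_of_nat_or_nonpos:
  assumes "w \<in> \<int>"
  obtains (nat) k where "w = of_nat k" | (neg) k where "w = - of_nat (Suc k)"
proof -
  from assms obtain z where z: "w = of_int z" by (elim Ints_cases)
  show ?thesis
  proof (cases "0 \<le> z")
    case True
    then have "w = of_nat (nat z)" by (simp add: z)
    then show ?thesis by (rule nat)
  next
    case False
    then have "w = - of_nat (Suc (nat (- z - 1)))" by (simp add: z)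
    then show ?thesis by (rule neg)
  qed
qed

lemma minus_of_nat_Suc_notin_Nats: "- (of_nat (Suc k) :: complex) \<notin> \<nat>"
proof
  assume "- (of_nat (Suc k) :: complex) \<in> \<nat>"
  then obtain m where "- (of_nat (Suc k) :: complex) = of_nat m" by (elim Nats_cases)
  then have "Re (- of_nat (Suc k)) = Re (of_nat m)" by simp
  then show False by simp
qed

lemma hfac_of_nat: "l \<notin> \<tau> \<Longrightarrow> hfac \<tau> l (of_nat k) z = z ^ k / fact k"
  using Gamma_fact[of k, where ?'a=complex]
  by (simp add: hfac_def rGamma_inverse_Gamma add.commute divide_inverse)

lemma hfac_neg: "l \<notin> \<tau> \<Longrightarrow> hfac \<tau> l (- of_nat (Suc k)) z = 0"
  using minus_of_nat_Suc_notin_Nats[of k] by (simp add: hfac_def del: of_nat_Suc)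

text \<open>For l in \<tau> this is the functional equation of 1/\<Gamma>. Outside \<tau> it is
  compatible with the value 0 at negative integers: both sides vanish for w < 0, and for 0 \<le> w <
  a the factor \<open>ffact w a\<close> is 0.\<close>

lemma hfac_shift:
  assumes w: "l \<notin> \<tau> \<Longrightarrow> w \<in> \<int>"
  shows "hbase \<tau> l z ^ a * hfac \<tau> l (w - of_nat a) z = ffact w a * hfac \<tau> l w z"
proof (cases "l \<in> \<tau>")
  case True
  have "exp z ^ a * exp ((w - of_nat a) * z) = exp (w * z)"
    by (simp add: exp_of_nat_mult[symmetric] exp_add[symmetric] algebra_simps)
  then show ?thesis using True rGamma_ffact[of w a]
    by (simp add: hfac_def hbase_def mult.assoc[symmetric]) 
next
  case False
  with w have "w \<in> \<int>" by blast
  then show ?thesis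
  proof (cases rule: Nats_of_nat_or_nonpos)
    case (nat k)
    show ?thesis
    proof (cases "a \<le> k")
      case True
      then have "w - of_nat a = of_nat (k - a)" by (simp add: nat of_nat_diff)
      then have "hfac \<tau> l (w - of_nat a) z = z ^ (k - a) / fact (k - a)"
        by (simp only: hfac_of_nat[OF False])
      then show ?thesis using False True
        by (simp add: nat hfac_of_nat hbase_def ffact_of_nat power_add[symmetric])
    next
      case a: False
      then have "w - of_nat a = - of_nat (Suc (a - k - 1))" by (simp add: nat of_nat_diff)
      then have "hfac \<tau> l (w - of_nat a) z = 0" by (simp only: hfac_neg[OF False])
      then show ?thesis using a by (simp add: nat ffact_eq_0_of_nat)
    qed
  next
    case (neg k)
    then have "w - of_nat a = - of_nat (Suc (k + a))" by simp
    then have "hfac \<tau> l (w - of_nat a) z = 0" by (simp only: hfac_neg[OF False])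
    moreover have "hfac \<tau> l w z = 0" unfolding neg by (rule hfac_neg[OF False])
    ultimately show ?thesis by simp
  qed
qed

lemma has_field_derivative_hfac:
  assumes w: "l \<notin> \<tau> \<Longrightarrow> w \<in> \<int>"
  shows "(hfac \<tau> l w has_field_derivative hjac \<tau> l z * hfac \<tau> l (w - 1) z) (at z)"
proof (cases "l \<in> \<tau>")
  case True
  have "w * rGamma (w + 1) = rGamma w" by (rule rGamma_plus1)
  then have "exp (w * z) * w * rGamma (w + 1) = exp z * (exp ((w - 1) * z) * rGamma w)"
    by (simp add: exp_add[symmetric] algebra_simps flip: mult.assoc)
  moreover have "((\<lambda>z. exp (w * z) * rGamma (w + 1)) has_field_derivative exp (w * z) * w * rGamma (w + 1)) (at z)"
    by (auto intro!: derivative_eq_intros)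
  moreover have "hfac \<tau> l w = (\<lambda>z. exp (w * z) * rGamma (w + 1))" using True by (auto simp: hfac_def)
  ultimately show ?thesis using True by (simp add: hfac_def hjac_def)
next
  case False
  with w have "w \<in> \<int>" by blast
  then show ?thesis
  proof (cases rule: Nats_of_nat_or_nonpos)
    case (nat k)
    have h: "hfac \<tau> l w = (\<lambda>z. z ^ k / fact k)" using False by (auto simp: nat hfac_of_nat)
    show ?thesis
    proof (cases k)
      case 0
      then have "w - 1 = - of_nat (Suc 0)" by (simp add: nat)
      then have "hfac \<tau> l (w - 1) z = 0" by (simp only: hfac_neg[OF False])
      then show ?thesis by (simp add: h 0)
    next
      case (Suc m)
      then have "w - 1 = of_nat m" by (simp add: nat)
      then have "hjac \<tau> l z * hfac \<tau> l (w - 1) z = of_nat k * z ^ (k - 1) / fact k"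
        using False by (simp only: hfac_of_nat[OF False]) (simp add: hjac_def Suc del: of_nat_Suc)
      moreover have "((\<lambda>z. z ^ k / fact k) has_field_derivative (of_nat k * z ^ (k - 1) / fact k)) (at z)"
        by (auto intro!: derivative_eq_intros)
      ultimately show ?thesis by (simp only: h)
    qed
  next
    case (neg k)
    have "w - 1 = - of_nat (Suc (Suc k))" by (simp add: neg)
    then have "hfac \<tau> l (w - 1) z = 0" by (simp only: hfac_neg[OF False])
    moreover have "hfac \<tau> l w = (\<lambda>z. 0)" unfolding neg by (rule ext) (rule hfac_neg[OF False])
    ultimately show ?thesis by simp
  qed
qed

section \<open>Sums of these products over sets of lattice points\<close>

definition gterm :: "'n set \<Rightarrow> 'n set \<Rightarrow> complex^'n \<Rightarrow> complex^'n \<Rightarrow> int^'n::finite \<Rightarrow> complex" where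
  "gterm \<tau> X v z u = (\<Prod>l\<in>X. hfac \<tau> l (v$l + of_int (u$l)) (z$l))"

definition gsum :: "'n set \<Rightarrow> 'n set \<Rightarrow> (int^'n::finite) set \<Rightarrow> complex^'n \<Rightarrow> complex^'n \<Rightarrow> complex" where
  "gsum \<tau> X U v z = infsum (gterm \<tau> X v z) U"

lemma norm_gterm_le:
  assumes "\<And>l. l \<in> X \<Longrightarrow> norm (z$l) \<le> B"
  shows "norm (gterm \<tau> X v z u) \<le> (\<Prod>l\<in>X. hbound \<tau> l (v$l + of_int (u$l)) B)"
  unfolding gterm_def prod_norm[symmetric] using assms by (intro prod_mono) (auto intro!: norm_hfac_le)

lemma integral_off_minus:
  "integral_off \<tau> v \<Longrightarrow> integral_off \<tau> (v - cvec b)"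
  by (auto simp: integral_off_def intro!: Ints_diff)

lemma cvec_axis [simp]: "cvec (axis i 1) = axis i 1"
  by (simp add: vec_eq_iff axis_def)

lemma cvec_0 [simp]: "cvec 0 = 0"
  by (simp add: vec_eq_iff)

text \<open>The monomials outside \<open>X\<close> are left out of the terms, so that \<open>X\<close> need not be everything.\<close>

locale gseries =
  fixes \<tau> X :: "'n::finite set" and U :: "(int^'n) set"
  assumes maj: "\<And>v B. integral_off \<tau> v \<Longrightarrow> 0 \<le> B \<Longrightarrow>
    (\<lambda>u. \<Prod>l\<in>X. hbound \<tau> l (v$l + of_int (u$l)) B) summable_on U"
begin

lemma gterm_summable:
  assumes v: "integral_off \<tau> v"
  shows "gterm \<tau> X v z summable_on U"
proof (rule summable_on_norm_le[OF maj[OF v, of "norm z"]])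
  show "norm (gterm \<tau> X v z u) \<le> (\<Prod>l\<in>X. hbound \<tau> l (v$l + of_int (u$l)) (norm z))" for u
    by (rule norm_gterm_le) (rule Finite_Cartesian_Product.norm_nth_le)
qed simp

lemma norm_gsum_le:
  assumes v: "integral_off \<tau> v" and B: "0 \<le> B" "\<And>l. l \<in> X \<Longrightarrow> norm (z$l) \<le> B"
  shows "norm (gsum \<tau> X U v z) \<le> infsum (\<lambda>u. \<Prod>l\<in>X. hbound \<tau> l (v$l + of_int (u$l)) B) U"
  unfolding gsum_def
  by (rule norm_infsum_le[OF has_sum_infsum[OF gterm_summable[OF v]] has_sum_infsum[OF maj[OF v B(1)]]])
     (rule norm_gterm_le[OF B(2)])

text \<open>Differentiation only shifts the exponent vector, and \<open>maj\<close> provides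
  majorants for all shifted exponents. On the ball of radius \<open>norm z + 1\<close> they are
  uniform in the point.\<close>

lemma has_derivative_gsum:
  assumes v: "integral_off \<tau> v"
  shows "(gsum \<tau> X U v has_derivative
     (\<lambda>h. \<Sum>i\<in>X. hjac \<tau> i (z$i) * gsum \<tau> X U (v - axis i 1) z * h$i)) (at z)"
proof -
  define B where "B = norm z + 1"
  have B: "0 \<le> B" by (simp add: B_def)
  let ?S = "ball 0 B :: (complex^'n) set"
  have z: "z \<in> ?S" by (simp add: B_def)
  have vi: "integral_off \<tau> (v - axis i 1)" for i
    using integral_off_minus[OF v, of "axis i 1"] by (simp only: cvec_axis)
  define f' where "f' u x h = (\<Sum>i\<in>X. hjac \<tau> i (x$i) * gterm \<tau> X (v - axis i 1) x u * h$i)" for u x and h :: "complex^'n"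
  define M where "M u = (\<Sum>i\<in>X. exp B * (\<Prod>l\<in>X. hbound \<tau> l ((v - axis i 1)$l + of_int (u$l)) B))" for u
  have M: "M summable_on U"
    unfolding M_def by (intro summable_on_finite_sum summable_on_cmult_right maj[OF vi B])
  have bnd: "norm (f' u x h) \<le> M u * norm h" if x: "x \<in> ?S" for u x h
  proof -
    have xl: "norm (x$l) \<le> B" for l
      using x Finite_Cartesian_Product.norm_nth_le[of x l] by simp
    have "norm (f' u x h) \<le> (\<Sum>i\<in>X. norm (hjac \<tau> i (x$i) * gterm \<tau> X (v - axis i 1) x u * h$i))"
      unfolding f'_def by (rule norm_sum)
    also have "\<dots> \<le> (\<Sum>i\<in>X. exp B * (\<Prod>l\<in>X. hbound \<tau> l ((v - axis i 1)$l + of_int (u$l)) B) * norm h)"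
    proof (rule sum_mono)
      fix i assume "i \<in> X"
      have "norm (hjac \<tau> i (x$i)) \<le> exp B"
        using xl[of i] norm_exp[of "x$i"] B by (auto simp: hjac_def intro: order_trans)
      then show "norm (hjac \<tau> i (x$i) * gterm \<tau> X (v - axis i 1) x u * h$i)
          \<le> exp B * (\<Prod>l\<in>X. hbound \<tau> l ((v - axis i 1)$l + of_int (u$l)) B) * norm h"
        unfolding norm_mult using xl
        by (intro mult_mono norm_gterm_le Finite_Cartesian_Product.norm_nth_le mult_nonneg_nonneg prod_nonneg)
           (auto intro!: hbound_nonneg B)
    qed
    finally show ?thesis by (simp add: M_def sum_distrib_right)
  qed
  have der: "((\<lambda>x. gterm \<tau> X v x u) has_derivative f' u x) (at x within ?S)" for u x
  proof -
    have D: "((\<lambda>x. hfac \<tau> l (v$l + of_int (u$l)) (x$l)) has_derivative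
        (\<lambda>h. hjac \<tau> l (x$l) * hfac \<tau> l (v$l + of_int (u$l) - 1) (x$l) * h$l)) (at x within ?S)" if "l \<in> X" for l
    proof -
      have "(hfac \<tau> l (v$l + of_int (u$l)) has_field_derivative
         hjac \<tau> l (x$l) * hfac \<tau> l (v$l + of_int (u$l) - 1) (x$l)) (at (x$l))"
        by (rule has_field_derivative_hfac) (use v in \<open>auto simp: integral_off_def intro!: Ints_add\<close>)
      then have "(hfac \<tau> l (v$l + of_int (u$l)) has_derivative
         (*) (hjac \<tau> l (x$l) * hfac \<tau> l (v$l + of_int (u$l) - 1) (x$l))) (at (x$l))"
        by (simp add: has_field_derivative_def)
      from has_derivative_compose[OF bounded_linear.has_derivative[OF bounded_linear_vec_nth has_derivative_ident] this]
      show ?thesis by simp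
    qed
    have "((\<lambda>x. \<Prod>l\<in>X. hfac \<tau> l (v$l + of_int (u$l)) (x$l)) has_derivative
       (\<lambda>h. \<Sum>i\<in>X. hjac \<tau> i (x$i) * hfac \<tau> i (v$i + of_int (u$i) - 1) (x$i) * h$i *
            (\<Prod>l\<in>X - {i}. hfac \<tau> l (v$l + of_int (u$l)) (x$l)))) (at x within ?S)"
      by (rule has_derivative_prod) (rule D)
    moreover have "hfac \<tau> i (v$i + of_int (u$i) - 1) (x$i) * (\<Prod>l\<in>X - {i}. hfac \<tau> l (v$l + of_int (u$l)) (x$l))
        = gterm \<tau> X (v - axis i 1) x u" if "i \<in> X" for i
    proof -
      have "gterm \<tau> X (v - axis i 1) x u = hfac \<tau> i ((v - axis i 1)$i + of_int (u$i)) (x$i) *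
         (\<Prod>l\<in>X - {i}. hfac \<tau> l ((v - axis i 1)$l + of_int (u$l)) (x$l))"
        unfolding gterm_def using that by (intro prod.remove) auto
      also have "(\<Prod>l\<in>X - {i}. hfac \<tau> l ((v - axis i 1)$l + of_int (u$l)) (x$l))
          = (\<Prod>l\<in>X - {i}. hfac \<tau> l (v$l + of_int (u$l)) (x$l))"
        by (rule prod.cong) (auto simp: axis_def)
      finally show ?thesis by (simp add: algebra_simps)
    qed
    ultimately show ?thesis
      unfolding f'_def gterm_def[of \<tau> X v] by (simp add: mult_ac cong: sum.cong)
  qed
  have "((\<lambda>x. infsum (\<lambda>u. gterm \<tau> X v x u) U) has_derivative (\<lambda>h. infsum (\<lambda>u. f' u z h) U)) (at z within ?S)"
  proof (rule has_derivative_infsum[OF convex_ball z])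
    show "0 \<le> M u" for u
      unfolding M_def by (intro sum_nonneg mult_nonneg_nonneg prod_nonneg) (auto intro!: hbound_nonneg B)
  qed (use der bnd M gterm_summable[OF v] in auto)
  moreover have "at z within ?S = at z" using z by (intro at_within_open) auto
  moreover have "infsum (\<lambda>u. f' u z h) U = (\<Sum>i\<in>X. hjac \<tau> i (z$i) * gsum \<tau> X U (v - axis i 1) z * h$i)" for h
    unfolding f'_def gsum_def
    by (rule infsumI, rule has_sum_finite_sum)
       (intro has_sum_cmult_left has_sum_cmult_right has_sum_infsum gterm_summable[OF vi])
  ultimately show ?thesis by (simp add: gsum_def[abs_def])
qed

end

section \<open>Gamma series are solutions\<close>

definition zker :: "int^'n::finite^'d::finite \<Rightarrow> (int^'n) set" where
  "zker A = {u. A *v u = 0}"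

lemma amul_ivec_eq_0_iff: "amul A (ivec u) = 0 \<longleftrightarrow> u \<in> zker A"
  by (simp add: vec_eq_iff amul_ivec zker_def)

text \<open>The order of summation is exchanged. For each monomial the sum over the kernel becomes a
  sum over the coset v + Z^n, on which \<open>coeff_weight\<close> vanishes away from the exponents
  that the monomial reaches; at a fixed w the finite sum over the monomials of P is
  \<open>T w\<close> times a vanishing functional. T is arbitrary, so that it can be the full term
  or a part of it.\<close>

lemma coeff_functional_sum:
  fixes T :: "complex^'n::finite \<Rightarrow> complex" and A :: "int^'n^'d::finite"
  assumes P: "P \<in> hypergeometric_ideal A \<beta>" and v: "amul A v = \<beta>"
    and s: "\<And>a b. (a, b) \<in> Poly_Mapping.keys P \<Longrightarrow>
      (\<lambda>u. T (v + ivec u + cvec a - cvec b) * vffact (v + ivec u + cvec a - cvec b) a) summable_on zker A"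
  shows "(\<Sum>(a, b)\<in>Poly_Mapping.keys P. Poly_Mapping.lookup P (a, b) *
     infsum (\<lambda>u. T (v + ivec u + cvec a - cvec b) * vffact (v + ivec u + cvec a - cvec b) a) (zker A)) = 0"
proof -
  define W where "W = range (\<lambda>z. v + ivec z)"
  define S where "S m = infsum (\<lambda>u. T (v + ivec u + cvec (fst m) - cvec (snd m)) *
      vffact (v + ivec u + cvec (fst m) - cvec (snd m)) (fst m)) (zker A)" for m
  have S: "((\<lambda>w. T w * coeff_weight A \<beta> w m) has_sum S m) W" if m: "m \<in> Poly_Mapping.keys P" for m
  proof -
    obtain a b where ab: "m = (a, b)" by (cases m)
    define h where "h u = v + ivec u + cvec a - cvec b" for u
    define \<delta> where "\<delta> = (\<chi> i. int (a$i) - int (b$i))"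
    have \<delta>: "ivec \<delta> = cvec a - cvec b" by (simp add: vec_eq_iff \<delta>_def)
    have ivec_add: "ivec (y + z) = ivec y + ivec z" for y z :: "int^'n" by (simp add: vec_eq_iff)
    have inj: "inj_on h (zker A)"
      by (auto simp: h_def inj_on_def vec_eq_iff)
    have "((\<lambda>u. T (h u) * vffact (h u) a) has_sum S m) (zker A)"
      using s[of a b] m by (simp add: ab h_def S_def)
    then have "((\<lambda>w. T w * vffact w a) has_sum S m) (h ` zker A)"
      by (subst has_sum_reindex[OF inj]) (simp add: o_def)
    moreover have "h ` zker A = {w \<in> W. amul A (w - cvec a + cvec b) = \<beta>}"
    proof (intro equalityI subsetI)
      fix w assume "w \<in> h ` zker A"
      then obtain u where u: "u \<in> zker A" "w = h u" by blast
      have "w = v + ivec (u + \<delta>)" by (simp add: u h_def ivec_add \<delta>)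
      moreover have "w - cvec a + cvec b = v + ivec u" by (simp add: u h_def)
      then have "amul A (w - cvec a + cvec b) = \<beta>"
        using u v amul_ivec_eq_0_iff[of A u] by (simp add: amul_add)
      ultimately show "w \<in> {w \<in> W. amul A (w - cvec a + cvec b) = \<beta>}" by (auto simp: W_def)
    next
      fix w assume "w \<in> {w \<in> W. amul A (w - cvec a + cvec b) = \<beta>}"
      then obtain z where z: "w = v + ivec z" "amul A (w - cvec a + cvec b) = \<beta>" by (auto simp: W_def)
      have zz: "ivec z = ivec (z - \<delta>) + (cvec a - cvec b)"
        using ivec_add[of "z - \<delta>" \<delta>] by (simp add: \<delta>)
      then have "w = h (z - \<delta>)" by (simp add: z h_def)
      moreover have e: "w - cvec a + cvec b = v + ivec (z - \<delta>)" by (simp add: z zz)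
      have "amul A (v + ivec (z - \<delta>)) = amul A v"
        using z(2) unfolding e v .
      then have "z - \<delta> \<in> zker A"
        by (simp add: amul_add flip: amul_ivec_eq_0_iff)
      ultimately show "w \<in> h ` zker A" by blast
    qed
    ultimately have "((\<lambda>w. T w * vffact w a) has_sum S m) {w \<in> W. amul A (w - cvec a + cvec b) = \<beta>}"
      by simp
    then show ?thesis
      by (rule iffD1[OF has_sum_cong_neutral, rotated -1]) (auto simp: coeff_weight_def ab)
  qed
  have "((\<lambda>w. \<Sum>m\<in>Poly_Mapping.keys P. Poly_Mapping.lookup P m * (T w * coeff_weight A \<beta> w m)) has_sum
      (\<Sum>m\<in>Poly_Mapping.keys P. Poly_Mapping.lookup P m * S m)) W"
    by (intro has_sum_finite_sum has_sum_cmult_right S)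
  moreover have "(\<Sum>m\<in>Poly_Mapping.keys P. Poly_Mapping.lookup P m * (T w * coeff_weight A \<beta> w m)) = 0" for w
  proof -
    have "(\<Sum>m\<in>Poly_Mapping.keys P. Poly_Mapping.lookup P m * (T w * coeff_weight A \<beta> w m))
        = T w * coeff_functional A \<beta> w P"
      by (simp add: weyl_eval_def sum_distrib_left mult_ac)
    then show ?thesis using coeff_functional_hypergeometric_ideal[OF P] by simp
  qed
  ultimately have "((\<lambda>w. 0) has_sum (\<Sum>m\<in>Poly_Mapping.keys P. Poly_Mapping.lookup P m * S m)) W"
    by (simp only:)
  from infsumI[OF this] have "(\<Sum>m\<in>Poly_Mapping.keys P. Poly_Mapping.lookup P m * S m) = 0" by simp
  then show ?thesis by (simp add: S_def case_prod_unfold)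
qed

lemma hfac_shift_prod:
  assumes "\<And>l. l \<in> X \<Longrightarrow> l \<notin> \<tau> \<Longrightarrow> w$l \<in> \<int>"
  shows "(\<Prod>l\<in>X. hbase \<tau> l (z$l) ^ (a$l)) * (\<Prod>l\<in>X. hfac \<tau> l (w$l - of_nat (a$l)) (z$l))
     = (\<Prod>l\<in>X. hfac \<tau> l (w$l) (z$l)) * (\<Prod>l\<in>X. ffact (w$l) (a$l))"
  unfolding prod.distrib[symmetric]
  by (rule prod.cong[OF refl], subst mult.commute[of "hfac _ _ _ _"], rule hfac_shift) (use assms in blast)

lemma gsum_weyl:
  fixes A :: "int^'n::finite^'d::finite"
  assumes P: "P \<in> hypergeometric_ideal A \<beta>" and v: "amul A v = \<beta>" "integral_off \<tau> v"
    and g: "gseries \<tau> UNIV (zker A)" and x: "\<And>l. hbase \<tau> l (z$l) = x$l"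
  shows "(\<Sum>(a, b)\<in>Poly_Mapping.keys P. Poly_Mapping.lookup P (a, b) * mono_eval x a *
     gsum \<tau> UNIV (zker A) (v - cvec b) z) = 0"
proof -
  interpret gseries \<tau> UNIV "zker A" by (rule g)
  define T where "T w = (\<Prod>l\<in>UNIV. hfac \<tau> l (w$l) (z$l))" for w :: "complex^'n"
  have eq: "mono_eval x a * gterm \<tau> UNIV (v - cvec b) z u
      = T (v + ivec u + cvec a - cvec b) * vffact (v + ivec u + cvec a - cvec b) a" for a b u
  proof -
    have "(\<Prod>l\<in>UNIV. hbase \<tau> l (z$l) ^ (a$l)) *
       (\<Prod>l\<in>UNIV. hfac \<tau> l ((v + ivec u + cvec a - cvec b)$l - of_nat (a$l)) (z$l))
     = T (v + ivec u + cvec a - cvec b) * vffact (v + ivec u + cvec a - cvec b) a"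
      unfolding T_def vffact_def
      by (rule hfac_shift_prod) (use v(2) in \<open>auto simp: integral_off_def\<close>)
    then show ?thesis by (simp add: mono_eval_def x gterm_def algebra_simps)
  qed
  have "(\<lambda>u. mono_eval x a * gterm \<tau> UNIV (v - cvec b) z u) summable_on zker A" for a b
    by (intro summable_on_cmult_right gterm_summable integral_off_minus v)
  then have "(\<Sum>(a, b)\<in>Poly_Mapping.keys P. Poly_Mapping.lookup P (a, b) *
     infsum (\<lambda>u. mono_eval x a * gterm \<tau> UNIV (v - cvec b) z u) (zker A)) = 0"
    using coeff_functional_sum[OF P v(1), of T] by (simp only: eq)
  then show ?thesis by (simp add: infsum_cmult_right' gsum_def mult.assoc)
qed

text \<open>T keeps the exponents with w_j = v_j + n and drops the factor of index j. The result is
  the coefficient of x_j to the power v_j + n in P applied to the series, divided by 1/\<Gamma>(v_j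
  + n + 1), and it stays valid where that factor is 0.\<close>

lemma gsum_slice_relation:
  fixes A :: "int^'n::finite^'d::finite"
  assumes P: "P \<in> hypergeometric_ideal A \<beta>" and v: "amul A v = \<beta>" "integral_off \<tau> v"
    and g: "\<And>m. gseries \<tau> (-{j}) {u \<in> zker A. u$j = m}"
  shows "(\<Sum>(a, b)\<in>Poly_Mapping.keys P. Poly_Mapping.lookup P (a, b) *
     ((\<Prod>l\<in>-{j}. hbase \<tau> l (z$l) ^ (a$l)) * ffact (v$j + of_int n) (a$j) *
     gsum \<tau> (-{j}) {u \<in> zker A. u$j = n - int (a$j) + int (b$j)} (v - cvec b) z)) = 0"
proof -
  define T where "T w = (if w$j = v$j + of_int n then \<Prod>l\<in>-{j}. hfac \<tau> l (w$l) (z$l) else 0)" for w :: "complex^'n"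
  define c where "c a = (\<Prod>l\<in>-{j}. hbase \<tau> l (z$l) ^ (a$l)) * ffact (v$j + of_int n) (a$j)" for a :: "nat^'n"
  define h where "h a b u = v + ivec u + cvec a - cvec b" for a b and u :: "int^'n"
  have hj: "h a b u $ j = v$j + of_int n \<longleftrightarrow> u$j = n - int (a$j) + int (b$j)" for a b u
  proof -
    have "h a b u $ j = v$j + of_int n \<longleftrightarrow> of_int (u$j) = (of_int (n - int (a$j) + int (b$j)) :: complex)"
      by (auto simp: h_def algebra_simps)
    then show ?thesis by (simp only: of_int_eq_iff)
  qed
  have eq: "c a * gterm \<tau> (-{j}) (v - cvec b) z u = T (h a b u) * vffact (h a b u) a"
    if "u$j = n - int (a$j) + int (b$j)" for a b u
  proof -
    have "(\<Prod>l\<in>-{j}. hbase \<tau> l (z$l) ^ (a$l)) *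
       (\<Prod>l\<in>-{j}. hfac \<tau> l (h a b u $l - of_nat (a$l)) (z$l))
     = (\<Prod>l\<in>-{j}. hfac \<tau> l (h a b u$l) (z$l)) * (\<Prod>l\<in>-{j}. ffact (h a b u$l) (a$l))"
      by (rule hfac_shift_prod) (use v(2) in \<open>auto simp: integral_off_def h_def\<close>)
    moreover have "vffact (h a b u) a = ffact (h a b u$j) (a$j) * (\<Prod>l\<in>-{j}. ffact (h a b u$l) (a$l))"
      unfolding vffact_def Compl_eq_Diff_UNIV by (rule prod.remove) auto
    moreover have "gterm \<tau> (-{j}) (v - cvec b) z u = (\<Prod>l\<in>-{j}. hfac \<tau> l (h a b u $l - of_nat (a$l)) (z$l))"
      unfolding gterm_def h_def by (simp add: algebra_simps)
    ultimately show ?thesis using that hj[of a b u] by (simp add: T_def c_def mult_ac)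
  qed
  have T0: "T (h a b u) = 0" if "u$j \<noteq> n - int (a$j) + int (b$j)" for a b u
    using that hj[of a b u] by (simp add: T_def)
  have S: "((\<lambda>u. T (h a b u) * vffact (h a b u) a) has_sum
      (c a * gsum \<tau> (-{j}) {u \<in> zker A. u$j = n - int (a$j) + int (b$j)} (v - cvec b) z)) (zker A)" for a b
  proof -
    let ?U = "{u \<in> zker A. u$j = n - int (a$j) + int (b$j)}"
    have "((\<lambda>u. c a * gterm \<tau> (-{j}) (v - cvec b) z u) has_sum (c a * gsum \<tau> (-{j}) ?U (v - cvec b) z)) ?U"
      unfolding gsum_def
      by (intro has_sum_cmult_right has_sum_infsum gseries.gterm_summable[OF g] integral_off_minus v)
    then show ?thesis
      by (rule iffD1[OF has_sum_cong_neutral, rotated -1]) (use eq T0 in auto)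
  qed
  have "(\<Sum>(a, b)\<in>Poly_Mapping.keys P. Poly_Mapping.lookup P (a, b) *
     infsum (\<lambda>u. T (h a b u) * vffact (h a b u) a) (zker A)) = 0"
    unfolding h_def
    by (rule coeff_functional_sum[OF P v(1)]) (use S in \<open>auto simp: summable_on_def h_def\<close>)
  then show ?thesis by (simp add: infsumI[OF S] c_def)
qed


section \<open>Branches of the series in the original variables\<close>

definition local_log :: "'n set \<Rightarrow> complex^'n \<Rightarrow> complex^'n \<Rightarrow> complex^'n \<Rightarrow> complex^'n::finite" where
  "local_log \<tau> c p x = (\<chi> i. if i \<in> \<tau> then c$i + Ln (x$i / p$i) else x$i)"

text \<open>The points where no quotient meets the cut of \<open>Ln\<close>. Division by zero gives
  0, which lies on the cut, so points with a zero coordinate in \<tau> are excluded, and the domain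
  is empty if p has one.\<close>

definition log_domain :: "'n set \<Rightarrow> complex^'n \<Rightarrow> (complex^'n::finite) set" where
  "log_domain \<tau> p = {x. \<forall>i\<in>\<tau>. x$i / p$i \<notin> \<real>\<^sub>\<le>\<^sub>0}"

lemma open_log_domain: "open (log_domain \<tau> p)"
proof -
  have "log_domain \<tau> p = (\<Inter>i\<in>\<tau>. (\<lambda>x. x$i / p$i) -` (- \<real>\<^sub>\<le>\<^sub>0))"
    by (auto simp: log_domain_def)
  moreover have "open ((\<lambda>x::complex^'a. x$i / p$i) -` (- \<real>\<^sub>\<le>\<^sub>0))" for i
  proof (cases "p$i = 0")
    case False
    then show ?thesis
      by (intro open_vimage) (auto intro!: continuous_intros)
  qed (simp add: vimage_def)
  ultimately show ?thesis by (simp add: open_INT)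
qed

lemma mem_log_domain: "(\<And>i. i \<in> \<tau> \<Longrightarrow> p$i \<noteq> 0) \<Longrightarrow> p \<in> log_domain \<tau> p"
  by (auto simp: log_domain_def)

lemma log_domain_nonzero: "x \<in> log_domain \<tau> p \<Longrightarrow> i \<in> \<tau> \<Longrightarrow> x$i \<noteq> 0 \<and> p$i \<noteq> 0"
  by (force simp: log_domain_def)

lemma hbase_local_log:
  assumes c: "\<And>i. i \<in> \<tau> \<Longrightarrow> exp (c$i) = p$i" and x: "x \<in> log_domain \<tau> p"
  shows "hbase \<tau> l (local_log \<tau> c p x $ l) = x$l"
  using c log_domain_nonzero[OF x, of l] by (auto simp: hbase_def local_log_def exp_add)

lemma has_derivative_vec_lambda:
  fixes f :: "'i::finite \<Rightarrow> 'a::real_normed_vector \<Rightarrow> 'b::euclidean_space"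
  assumes "\<And>i. (f i has_derivative f' i) (at x within S)"
  shows "((\<lambda>x. \<chi> i. f i x) has_derivative (\<lambda>h. \<chi> i. f' i h)) (at x within S)"
  unfolding has_derivative_componentwise_within[of "\<lambda>x. \<chi> i. f i x"]
  using assms by (auto simp: Basis_vec_def inner_axis intro!: has_derivative_inner_left)

lemma has_derivative_local_log:
  assumes x: "x \<in> log_domain \<tau> p"
  shows "(local_log \<tau> c p has_derivative (\<lambda>h. \<chi> i. if i \<in> \<tau> then h$i / x$i else h$i)) (at x)"
  unfolding local_log_def
proof (rule has_derivative_vec_lambda)
  fix i
  have id: "((\<lambda>x. x$i) has_derivative (\<lambda>h. h$i)) (at x)"
    by (rule bounded_linear.has_derivative[OF bounded_linear_vec_nth has_derivative_ident])
  show "((\<lambda>x. if i \<in> \<tau> then c$i + Ln (x$i / p$i) else x$i) has_derivative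
      (\<lambda>h. if i \<in> \<tau> then h$i / x$i else h$i)) (at x)"
  proof (cases "i \<in> \<tau>")
    case True
    then have nz: "x$i \<noteq> 0" "p$i \<noteq> 0" and xp: "x$i / p$i \<notin> \<real>\<^sub>\<le>\<^sub>0"
      using x log_domain_nonzero[OF x] by (auto simp: log_domain_def)
    have "((\<lambda>t. c$i + Ln (t / p$i)) has_field_derivative (1 / x$i)) (at (x$i))"
      using nz xp by (auto intro!: derivative_eq_intros)
    then have "((\<lambda>t. c$i + Ln (t / p$i)) has_derivative (*) (1 / x$i)) (at (x$i))"
      by (simp only: has_field_derivative_def)
    from has_derivative_compose[OF id this] show ?thesis using True by simp
  next
    case False
    then show ?thesis using id by simp
  qed
qed

text \<open>The germ at \<open>p\<close> of the series, where \<open>c\<close> is a choice of logarithms of \<open>p\<close>.\<close>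

definition local_series ::
  "int^'n::finite^'d::finite \<Rightarrow> 'n set \<Rightarrow> complex^'n \<Rightarrow> complex^'n \<Rightarrow> complex^'n \<Rightarrow> complex^'n \<Rightarrow> complex" where
  "local_series A \<tau> v c p x = gsum \<tau> UNIV (zker A) v (local_log \<tau> c p x)"

text \<open>For i in \<tau> the factor \<open>hjac\<close> is x_i and cancels the derivative 1 / x_i
  of the logarithm; in the original variables a derivative is a bare shift of the exponent.\<close>

lemma has_derivative_local_series:
  assumes g: "gseries \<tau> UNIV (zker A)" and v: "integral_off \<tau> v"
    and c: "\<And>i. i \<in> \<tau> \<Longrightarrow> exp (c$i) = p$i" and x: "x \<in> log_domain \<tau> p"
  shows "(local_series A \<tau> v c p has_derivative
     (\<lambda>h. \<Sum>i\<in>UNIV. local_series A \<tau> (v - axis i 1) c p x * h$i)) (at x)"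
proof -
  have "(local_series A \<tau> v c p has_derivative
     (\<lambda>h. \<Sum>i\<in>UNIV. hjac \<tau> i (local_log \<tau> c p x$i) * local_series A \<tau> (v - axis i 1) c p x *
        (\<chi> i. if i \<in> \<tau> then h$i / x$i else h$i)$i)) (at x)"
    using has_derivative_compose[OF has_derivative_local_log[OF x, of c] gseries.has_derivative_gsum[OF g v]]
    by (simp add: local_series_def[abs_def])
  moreover have "hjac \<tau> i (local_log \<tau> c p x$i) * local_series A \<tau> (v - axis i 1) c p x *
        (\<chi> i. if i \<in> \<tau> then h$i / x$i else h$i)$i = local_series A \<tau> (v - axis i 1) c p x * h$i"
    for i and h :: "complex^'a"
    using hbase_local_log[OF c x, of i] log_domain_nonzero[OF x, of i]
    by (auto simp: hjac_def hbase_def)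
  ultimately show ?thesis by (simp only:)
qed

lemma cpartial_eq:
  fixes f :: "complex^'n::finite \<Rightarrow> complex"
  assumes "(f has_derivative (\<lambda>h. \<Sum>i\<in>UNIV. d i * h$i)) (at x)"
  shows "cpartial i f x = d i"
proof -
  let ?g = "\<lambda>z::complex. (\<chi> j. if j = i then z else x$j) :: complex^'n"
  have g: "(?g has_derivative (\<lambda>h. \<chi> j. if j = i then h else 0)) (at (x$i))"
  proof (rule has_derivative_vec_lambda)
    fix j show "((\<lambda>z. if j = i then z else x$j) has_derivative (\<lambda>h. if j = i then h else 0)) (at (x$i))"
      by (cases "j = i") auto
  qed
  have gx: "?g (x$i) = x" by (simp add: vec_eq_iff)
  have "((\<lambda>z. f (?g z)) has_derivative (\<lambda>h. \<Sum>k\<in>UNIV. d k * (\<chi> j. if j = i then h else 0)$k)) (at (x$i))"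
    by (rule has_derivative_compose[OF g]) (use assms in \<open>simp only: gx\<close>)
  moreover have "(\<Sum>k\<in>UNIV. d k * (\<chi> j. if j = i then h else 0)$k) = d i * h" for h
    by (simp add: if_distrib[of "\<lambda>x. _ * x"] cong: if_cong)
  ultimately have "((\<lambda>z. f (?g z)) has_field_derivative d i) (at (x$i))"
    by (simp add: has_field_derivative_def)
  then show ?thesis unfolding cpartial_def by (rule DERIV_imp_deriv)
qed

lemma has_derivative_local_series_combination:
  assumes g: "gseries \<tau> UNIV (zker A)" and v: "\<And>k. k \<in> J \<Longrightarrow> integral_off \<tau> (v k)"
    and c: "\<And>i. i \<in> \<tau> \<Longrightarrow> exp (c$i) = p$i" and x: "x \<in> log_domain \<tau> p"
  shows "((\<lambda>x. \<Sum>k\<in>J. \<alpha> k * local_series A \<tau> (v k) c p x) has_derivative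
     (\<lambda>h. \<Sum>i\<in>UNIV. (\<Sum>k\<in>J. \<alpha> k * local_series A \<tau> (v k - axis i 1) c p x) * h$i)) (at x)"
proof -
  have "((\<lambda>x. \<Sum>k\<in>J. \<alpha> k * local_series A \<tau> (v k) c p x) has_derivative
     (\<lambda>h. \<Sum>k\<in>J. \<alpha> k * (\<Sum>i\<in>UNIV. local_series A \<tau> (v k - axis i 1) c p x * h$i))) (at x)"
    using v by (intro has_derivative_sum has_derivative_mult_right has_derivative_local_series[OF g _ c x])
  moreover have "(\<Sum>k\<in>J. \<alpha> k * (\<Sum>i\<in>UNIV. local_series A \<tau> (v k - axis i 1) c p x * h$i)) =
     (\<Sum>i\<in>UNIV. (\<Sum>k\<in>J. \<alpha> k * local_series A \<tau> (v k - axis i 1) c p x) * h$i)" for h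
  proof -
    have "(\<Sum>k\<in>J. \<alpha> k * (\<Sum>i\<in>UNIV. local_series A \<tau> (v k - axis i 1) c p x * h$i)) =
       (\<Sum>k\<in>J. \<Sum>i\<in>UNIV. \<alpha> k * local_series A \<tau> (v k - axis i 1) c p x * h$i)"
      by (simp add: sum_distrib_left mult.assoc)
    also have "\<dots> = (\<Sum>i\<in>UNIV. \<Sum>k\<in>J. \<alpha> k * local_series A \<tau> (v k - axis i 1) c p x * h$i)"
      by (rule sum.swap)
    finally show ?thesis by (simp add: sum_distrib_right)
  qed
  ultimately show ?thesis by (simp only:)
qed

lemma mholomorphic_local_series_combination:
  assumes g: "gseries \<tau> UNIV (zker A)" and v: "\<And>k. k \<in> J \<Longrightarrow> integral_off \<tau> (v k)"
    and c: "\<And>i. i \<in> \<tau> \<Longrightarrow> exp (c$i) = p$i"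
  shows "(\<lambda>x. \<Sum>k\<in>J. \<alpha> k * local_series A \<tau> (v k) c p x) mholomorphic_on log_domain \<tau> p"
  unfolding mholomorphic_on_def
proof
  fix x assume x: "x \<in> log_domain \<tau> p"
  have "((\<lambda>x. \<Sum>k\<in>J. \<alpha> k * local_series A \<tau> (v k) c p x) has_derivative
     (\<lambda>h. \<Sum>i\<in>UNIV. (\<chi> i. \<Sum>k\<in>J. \<alpha> k * local_series A \<tau> (v k - axis i 1) c p x)$i * h$i)) (at x)"
    using has_derivative_local_series_combination[where J = J and v = v and \<alpha> = \<alpha>, OF g v c x] by simp
  then show "\<exists>c'. ((\<lambda>x. \<Sum>k\<in>J. \<alpha> k * local_series A \<tau> (v k) c p x) has_derivative
     (\<lambda>h. \<Sum>i\<in>UNIV. c'$i * h$i)) (at x within log_domain \<tau> p)"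
    by (intro exI) (rule has_derivative_at_withinI)
qed

lemma foldr_cpartial_local_series:
  assumes g: "gseries \<tau> UNIV (zker A)" and v: "\<And>k. k \<in> J \<Longrightarrow> integral_off \<tau> (v k)"
    and c: "\<And>i. i \<in> \<tau> \<Longrightarrow> exp (c$i) = p$i" and x: "x \<in> log_domain \<tau> p"
  shows "foldr cpartial l (\<lambda>x. \<Sum>k\<in>J. \<alpha> k * local_series A \<tau> (v k) c p x) x
    = (\<Sum>k\<in>J. \<alpha> k * local_series A \<tau> (v k - cvec (\<chi> i. count_list l i)) c p x)"
  using x
proof (induction l arbitrary: x)
  case Nil
  have "v k - cvec (\<chi> i. count_list [] i) = v k" for k by (simp add: vec_eq_iff)
  then show ?case by (simp only: foldr.simps id_apply)
next
  case (Cons i l)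
  let ?v = "\<lambda>k. v k - cvec (\<chi> i. count_list l i)"
  let ?F = "\<lambda>x. \<Sum>k\<in>J. \<alpha> k * local_series A \<tau> (v k) c p x"
  have "(foldr cpartial l ?F has_derivative
      (\<lambda>h. \<Sum>i\<in>UNIV. (\<Sum>k\<in>J. \<alpha> k * local_series A \<tau> (?v k - axis i 1) c p x) * h$i)) (at x)"
  \<comment> \<open>The induction hypothesis holds on the whole open domain, so it may be
    differentiated.\<close>
  proof (rule has_derivative_transform_within_open[OF _ open_log_domain Cons.prems])
    show "((\<lambda>x. \<Sum>k\<in>J. \<alpha> k * local_series A \<tau> (?v k) c p x) has_derivative
      (\<lambda>h. \<Sum>i\<in>UNIV. (\<Sum>k\<in>J. \<alpha> k * local_series A \<tau> (?v k - axis i 1) c p x) * h$i)) (at x)"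
      by (rule has_derivative_local_series_combination[OF g _ c Cons.prems]) (use v in \<open>auto intro: integral_off_minus\<close>)
  qed (use Cons.IH in auto)
  then have "cpartial i (foldr cpartial l ?F) x = (\<Sum>k\<in>J. \<alpha> k * local_series A \<tau> (?v k - axis i 1) c p x)"
    by (rule cpartial_eq)
  moreover have "?v k - axis i 1 = v k - cvec (\<chi> k. count_list (i # l) k)" for k
    by (auto simp: vec_eq_iff axis_def)
  ultimately show ?case by simp
qed

lemma cpartials_local_series:
  fixes A :: "int^'n::finite^'d::finite"
  assumes g: "gseries \<tau> UNIV (zker A)" and v: "\<And>k. k \<in> J \<Longrightarrow> integral_off \<tau> (v k)"
    and c: "\<And>i. i \<in> \<tau> \<Longrightarrow> exp (c$i) = p$i" and x: "x \<in> log_domain \<tau> p"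
  shows "cpartials b (\<lambda>x. \<Sum>k\<in>J. \<alpha> k * local_series A \<tau> (v k) c p x) x
    = (\<Sum>k\<in>J. \<alpha> k * local_series A \<tau> (v k - cvec b) c p x)"
proof -
  obtain xs :: "'n list" where xs: "set xs = UNIV" "distinct xs"
    using finite_distinct_list[of "UNIV :: 'n set"] by auto
  have count: "count_list (concat (map (\<lambda>i. replicate (b$i) i) ys)) i = (if i \<in> set ys then b$i else 0)"
    if "distinct ys" for ys i
  proof -
    have "count_list (replicate n i) k = (if i = k then n else 0)" for n and i k :: 'n
      by (induction n) auto
    then show ?thesis using that by (induction ys) auto
  qed
  \<comment> \<open>Some list realizes the multi-index b, hence so does the one chosen in
    \<open>cpartials\<close>.\<close>
  have "\<exists>l. \<forall>i. count_list l i = b$i"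
    using count[OF xs(2)] xs(1) by (intro exI[of _ "concat (map (\<lambda>i. replicate (b$i) i) xs)"]) simp
  then have "\<forall>i. count_list (SOME l. \<forall>i. count_list l i = b$i) i = b$i" by (rule someI_ex)
  then show ?thesis
    by (simp add: cpartials_def foldr_cpartial_local_series[where J = J and v = v, OF g v c x])
qed

lemma local_series_solution:
  assumes g: "gseries \<tau> UNIV (zker A)" and v: "\<And>k. k \<in> J \<Longrightarrow> amul A (v k) = \<beta>" "\<And>k. k \<in> J \<Longrightarrow> integral_off \<tau> (v k)"
    and c: "\<And>i. i \<in> \<tau> \<Longrightarrow> exp (c$i) = p$i"
  shows "germ_at p (\<lambda>x. \<Sum>k\<in>J. \<alpha> k * local_series A \<tau> (v k) c p x) \<in> solution_space (hypergeometric_ideal A \<beta>) p"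
proof -
  let ?F = "\<lambda>x. \<Sum>k\<in>J. \<alpha> k * local_series A \<tau> (v k) c p x"
  have hol: "?F mholomorphic_on log_domain \<tau> p"
    by (rule mholomorphic_local_series_combination[OF g v(2) c])
  have p: "p \<in> log_domain \<tau> p"
    by (rule mem_log_domain) (metis c exp_not_eq_zero)
  have zero: "weyl_apply P ?F x = 0"
    if P: "P \<in> hypergeometric_ideal A \<beta>" and x: "x \<in> log_domain \<tau> p" for P x
  proof -
    let ?t = "\<lambda>m k. Poly_Mapping.lookup P m * mono_eval x (fst m) * local_series A \<tau> (v k - cvec (snd m)) c p x"
    have "weyl_apply P ?F x = (\<Sum>m\<in>Poly_Mapping.keys P. \<Sum>k\<in>J. \<alpha> k * ?t m k)"
      by (simp add: weyl_apply_def cpartials_local_series[where J = J and v = v, OF g v(2) c x]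
          case_prod_unfold sum_distrib_left mult_ac)
    also have "\<dots> = (\<Sum>k\<in>J. \<alpha> k * (\<Sum>m\<in>Poly_Mapping.keys P. ?t m k))"
      by (subst sum.swap) (simp add: sum_distrib_left)
    also have "\<dots> = 0"
    proof (rule sum.neutral, rule ballI)
      fix k assume k: "k \<in> J"
      have "(\<Sum>m\<in>Poly_Mapping.keys P. ?t m k) = 0"
        using gsum_weyl[OF P v(1)[OF k] v(2)[OF k] g hbase_local_log[OF c x]]
        by (simp add: case_prod_unfold local_series_def)
      then show "\<alpha> k * (\<Sum>m\<in>Poly_Mapping.keys P. ?t m k) = 0" by simp
    qed
    finally show ?thesis .
  qed
  have "\<forall>P\<in>hypergeometric_ideal A \<beta>. \<forall>\<^sub>F x in nhds p. weyl_apply P ?F x = 0"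
    using eventually_nhds_in_open[OF open_log_domain p] zero by (auto elim: eventually_mono)
  then show ?thesis
    unfolding solution_space_def using hol p open_log_domain by blast
qed

section \<open>Identity theorem and uniqueness of analytic continuation\<close>

text \<open>Restricted to the complex line through a and x, f is a function of one variable on a
  convex, hence connected, open set, and it vanishes near the parameter of a.\<close>

lemma mholomorphic_eq_0_convex:
  fixes f :: "complex^'n::finite \<Rightarrow> complex"
  assumes f: "f mholomorphic_on S" and S: "open S" "convex S"
    and a: "a \<in> S" "\<forall>\<^sub>F x in nhds a. f x = 0" and x: "x \<in> S"
  shows "f x = 0"
proof -
  define L where "L = (\<lambda>z::complex. \<chi> i. a$i + z * (x$i - a$i))"
  have L: "(L has_derivative (\<lambda>h. \<chi> i. h * (x$i - a$i))) (at z)" for z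
    unfolding L_def by (rule has_derivative_vec_lambda) (auto intro!: derivative_eq_intros)
  have contL: "continuous_on UNIV L"
    by (intro continuous_at_imp_continuous_on ballI has_derivative_continuous) (rule L)
  define D where "D = L -` S"
  have D: "open D" unfolding D_def using contL S(1) by (rule open_vimage[rotated])
  have "convex D"
  proof (rule convexI)
    fix y z and u v :: real assume yz: "y \<in> D" "z \<in> D" and uv: "0 \<le> u" "0 \<le> v" "u + v = 1"
    have "L (u *\<^sub>R y + v *\<^sub>R z) = u *\<^sub>R L y + v *\<^sub>R L z"
    proof -
      have "a$i = u *\<^sub>R a$i + v *\<^sub>R a$i" for i using uv by (simp flip: scaleR_left_distrib)
      then show ?thesis by (simp add: vec_eq_iff L_def algebra_simps)
    qed
    then show "u *\<^sub>R y + v *\<^sub>R z \<in> D" using yz uv S(2) by (simp add: D_def convexD)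
  qed
  then have "connected D" by (rule convex_connected)
  have hol: "(f \<circ> L) holomorphic_on D"
  proof (rule holomorphic_onI)
    fix z assume z: "z \<in> D"
    obtain c where c: "(f has_derivative (\<lambda>h. \<Sum>i\<in>UNIV. c$i * h$i)) (at (L z) within S)"
      using f z unfolding mholomorphic_on_def D_def vimage_def by blast
    have "(f has_derivative (\<lambda>h. \<Sum>i\<in>UNIV. c$i * h$i)) (at (L z))"
      using c at_within_open[OF _ S(1), of "L z"] z by (simp add: D_def)
    from has_derivative_compose[OF L this]
    have "((\<lambda>z. f (L z)) has_derivative (\<lambda>h. \<Sum>i\<in>UNIV. c$i * (h * (x$i - a$i)))) (at z)" by simp
    moreover have "(\<lambda>h. \<Sum>i\<in>UNIV. c$i * (h * (x$i - a$i))) = (*) (\<Sum>i\<in>UNIV. c$i * (x$i - a$i))"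
      by (rule ext, subst sum_distrib_right) (simp add: mult_ac)
    ultimately have "((f \<circ> L) has_field_derivative (\<Sum>i\<in>UNIV. c$i * (x$i - a$i))) (at z)"
      by (simp add: has_field_derivative_def o_def)
    then show "(f \<circ> L) field_differentiable at z within D"
      using field_differentiable_def field_differentiable_at_within by blast
  qed
  have L0: "L 0 = a" and L1: "L 1 = x" by (simp_all add: L_def vec_eq_iff)
  obtain V where V: "open V" "a \<in> V" "\<And>y. y \<in> V \<Longrightarrow> f y = 0"
    using a(2) unfolding eventually_nhds by blast
  have "open (L -` V)" using contL V(1) by (rule open_vimage[rotated])
  have "0 islimpt (D \<inter> L -` V)"
    using D \<open>open (L -` V)\<close> a V by (intro interior_limit_point) (simp add: interior_open open_Int D_def L0)
  have "(f \<circ> L) 1 = 0"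
  proof (rule Conformal_Mappings.analytic_continuation[OF hol D \<open>connected D\<close> _ _ \<open>0 islimpt (D \<inter> L -` V)\<close>])
    show "1 \<in> D" "0 \<in> D" using x a by (simp_all add: D_def L0 L1)
  qed (use V in auto)
  then show ?thesis by (simp add: L1)
qed

lemma mholomorphic_on_diff:
  assumes "f mholomorphic_on S" "g mholomorphic_on S"
  shows "(\<lambda>x. f x - g x) mholomorphic_on S"
  unfolding mholomorphic_on_def
proof
  fix x assume "x \<in> S"
  then obtain c d where "(f has_derivative (\<lambda>h. \<Sum>i\<in>UNIV. c$i * h$i)) (at x within S)"
    "(g has_derivative (\<lambda>h. \<Sum>i\<in>UNIV. d$i * h$i)) (at x within S)"
    using assms unfolding mholomorphic_on_def by blast
  from has_derivative_diff[OF this]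
  show "\<exists>c. ((\<lambda>x. f x - g x) has_derivative (\<lambda>h. \<Sum>i\<in>UNIV. c$i * h$i)) (at x within S)"
    by (intro exI[of _ "c - d"]) (simp add: left_diff_distrib sum_subtractf)
qed

lemma mholomorphic_on_subset: "f mholomorphic_on S \<Longrightarrow> T \<subseteq> S \<Longrightarrow> f mholomorphic_on T"
  unfolding mholomorphic_on_def by (meson has_derivative_subset subsetD)

text \<open>By the identity theorem on a small ball, two continuations agree at all nearby
  parameters or at none; connectedness of the interval spreads the agreement from 0 to 1.\<close>

lemma continues_along_unique:
  assumes "continues_along \<gamma> \<phi> \<psi>" "continues_along \<gamma> \<phi> \<psi>'"
  shows "\<psi> = \<psi>'"
proof -
  obtain F where F: "Defs.analytic_continuation \<gamma> F" "F 0 = \<phi>" "F 1 = \<psi>"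
    using assms(1) by (auto simp: continues_along_def)
  obtain G where G: "Defs.analytic_continuation \<gamma> G" "G 0 = \<phi>" "G 1 = \<psi>'"
    using assms(2) by (auto simp: continues_along_def)
  have cont: "continuous_on {0..1} \<gamma>"
    using F(1) by (simp add: analytic_continuation_def path_def)
  define R where "R s t \<longleftrightarrow> (F s = G s \<longleftrightarrow> F t = G t)" for s t
  have "R 0 1"
  proof (rule connected_equivalence_relation[where S = "{0..1::real}" and R = R])
    fix t :: real assume t: "t \<in> {0..1}"
    obtain U h e where U: "open U" "\<gamma> t \<in> U" "h mholomorphic_on U" "0 < e"
      "\<And>s. s \<in> {0..1} \<Longrightarrow> \<bar>s - t\<bar> < e \<Longrightarrow> \<gamma> s \<in> U \<and> F s = germ_at (\<gamma> s) h"
      using F(1) t unfolding analytic_continuation_def by blast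
    obtain U' h' e' where U': "open U'" "\<gamma> t \<in> U'" "h' mholomorphic_on U'" "0 < e'"
      "\<And>s. s \<in> {0..1} \<Longrightarrow> \<bar>s - t\<bar> < e' \<Longrightarrow> \<gamma> s \<in> U' \<and> G s = germ_at (\<gamma> s) h'"
      using G(1) t unfolding analytic_continuation_def by blast
    obtain r where r: "0 < r" "ball (\<gamma> t) r \<subseteq> U \<inter> U'"
      using U U' by (meson IntI open_Int open_contains_ball)
    obtain d where d: "0 < d" "\<And>s. s \<in> {0..1} \<Longrightarrow> \<bar>s - t\<bar> < d \<Longrightarrow> dist (\<gamma> s) (\<gamma> t) < r"
      using cont t r(1) unfolding continuous_on_iff by (metis dist_real_def)
    define \<epsilon> where "\<epsilon> = min d (min e e')"
    have \<epsilon>: "0 < \<epsilon>" using d U U' by (simp add: \<epsilon>_def)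
    have hol: "(\<lambda>x. h x - h' x) mholomorphic_on ball (\<gamma> t) r"
      using U U' r by (intro mholomorphic_on_diff) (auto intro: mholomorphic_on_subset)
    have iff: "F s = G s \<longleftrightarrow> (\<forall>x\<in>ball (\<gamma> t) r. h x - h' x = 0)" if s: "s \<in> {0..1}" "\<bar>s - t\<bar> < \<epsilon>" for s
    proof -
      have sb: "\<gamma> s \<in> ball (\<gamma> t) r" using d(2)[of s] s by (simp add: \<epsilon>_def dist_commute)
      have FG: "F s = germ_at (\<gamma> s) h" "G s = germ_at (\<gamma> s) h'" using U U' s by (auto simp: \<epsilon>_def)
      show ?thesis
      proof
        assume "F s = G s"
        then have "\<forall>\<^sub>F x in nhds (\<gamma> s). h x - h' x = 0" by (simp add: FG germ_at_eq_iff)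
        then show "\<forall>x\<in>ball (\<gamma> t) r. h x - h' x = 0"
          using mholomorphic_eq_0_convex[OF hol open_ball convex_ball sb] by blast
      next
        assume *: "\<forall>x\<in>ball (\<gamma> t) r. h x - h' x = 0"
        have "\<forall>\<^sub>F x in nhds (\<gamma> s). x \<in> ball (\<gamma> t) r" using sb by (intro eventually_nhds_in_open) auto
        then show "F s = G s" using * by (auto simp: FG germ_at_eq_iff elim!: eventually_mono)
      qed
    qed
    show "\<exists>T. openin (top_of_set {0..1}) T \<and> t \<in> T \<and> (\<forall>x\<in>T. R t x)"
    proof (intro exI conjI ballI)
      show "openin (top_of_set {0..1}) ({0..1} \<inter> ball t \<epsilon>)" by (rule openin_open_Int) simp
      show "R t s" if "s \<in> {0..1} \<inter> ball t \<epsilon>" for s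
        using that iff[of s] iff[of t] t \<epsilon> by (auto simp: R_def dist_real_def abs_minus_commute)
    qed (use t \<epsilon> in auto)
  qed (auto simp: R_def)
  then show ?thesis using F G by (simp add: R_def)
qed


section \<open>A vanishing lemma of Cauchy-Kovalevskaya type\<close>

text \<open>
  Think of \<open>H n\<close> as the coefficients of a Laurent series in one variable that solves a linear differential
  equation for which the hyperplane is noncharacteristic: \<open>H n\<close> is determined by derivatives of the
  \<open>H (n - s)\<close>, at most \<open>s\<close> of them. Shrinking the radius by \<open>O(1/N)\<close> at each of the steps from \<open>-N\<close> to \<open>0\<close>
  costs a factor \<open>(C N)\<^sup>N\<close>, which the decay of \<open>H (-N)\<close> beats.
\<close>

lemma nagumo_vanishing:
  fixes H :: "int \<Rightarrow> 'z \<Rightarrow> complex" and K :: "real \<Rightarrow> 'z set" and q :: "'z \<Rightarrow> complex"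
    and D :: "'k \<Rightarrow> int \<Rightarrow> 'z \<Rightarrow> complex" and co :: "'k \<Rightarrow> int \<Rightarrow> 'z \<Rightarrow> complex"
    and s a e :: "'k \<Rightarrow> nat"
  assumes Ks: "finite Ks" and r: "0 < r" and M: "1 \<le> M" and W: "0 \<le> W" and c0: "0 \<le> c0" and C1: "0 \<le> C1"
    and mono: "\<And>\<rho> \<rho>'. \<rho> \<le> \<rho>' \<Longrightarrow> K \<rho> \<subseteq> K \<rho>'"
    and rel: "\<And>n z. z \<in> K r \<Longrightarrow> q z * H n z = - (\<Sum>k\<in>Ks. co k n z * D k (n - int (s k)) z)"
    and q: "0 < \<eta>" "\<And>z. z \<in> K r \<Longrightarrow> \<eta> \<le> norm (q z)"
    and co: "\<And>k n z. k \<in> Ks \<Longrightarrow> z \<in> K r \<Longrightarrow> norm (co k n z) \<le> W * (c0 + \<bar>real_of_int n\<bar>) ^ a k"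
    and der: "\<And>k n \<rho> \<delta> S. k \<in> Ks \<Longrightarrow> 0 < \<delta> \<Longrightarrow> M * \<delta> \<le> \<rho> \<Longrightarrow> \<rho> \<le> r \<Longrightarrow>
       (\<And>z. z \<in> K \<rho> \<Longrightarrow> norm (H n z) \<le> S) \<Longrightarrow>
       (\<And>z. z \<in> K (\<rho> - M * \<delta>) \<Longrightarrow> norm (D k n z) \<le> (C1 / \<delta>) ^ e k * S)"
    and s: "\<And>k. k \<in> Ks \<Longrightarrow> 1 \<le> s k" "\<And>k. k \<in> Ks \<Longrightarrow> a k + e k \<le> s k"
    and apriori: "\<And>\<theta>. 0 < \<theta> \<Longrightarrow> \<exists>C\<ge>0. \<forall>n z. z \<in> K r \<longrightarrow> norm (H (- int n) z) \<le> C * \<theta> ^ n / fact n"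
    and z: "z \<in> K (r / 2)"
  shows "H 0 z = 0"
proof -
  \<comment> \<open>With \<delta> proportional to 1/N below, both c0 + |n| for |n| \<le> N and the
    cost C1 / \<delta> of a derivative are at most C4 * N.\<close>
  define C4 where "C4 = max 1 (max (c0 + 1) (C1 * 2 * M / r))"
  have C4: "1 \<le> C4" "c0 + 1 \<le> C4" "C1 * 2 * M / r \<le> C4" by (auto simp: C4_def)
  \<comment> \<open>The additional factor makes \<open>W * card Ks * (C4 / C2)\<close> at most
    \<eta>, which absorbs the number of terms and the division by q.\<close>
  define C2 where "C2 = C4 * (1 + W * real (card Ks) / \<eta>)"
  have C24: "C4 \<le> C2"
    unfolding C2_def using C4 W q by (simp add: algebra_simps)
  have C2: "1 \<le> C2" using C24 C4 by linarith
  \<comment> \<open>Chosen so that (\<theta> C2 N)^N / N! \<le> (\<theta> C2 e)^N = 2^(-N).\<close>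
  define \<theta> where "\<theta> = 1 / (2 * exp 1 * C2)"
  have \<theta>: "0 < \<theta>" using C2 by (simp add: \<theta>_def)
  have \<theta>C2: "\<theta> * C2 \<le> 1"
  proof -
    have "\<theta> * C2 = 1 / (2 * exp 1)" using C2 by (simp add: \<theta>_def)
    also have "\<dots> \<le> 1" using exp_ge_add_one_self[of "1::real"] by (simp add: divide_le_eq)
    finally show ?thesis .
  qed
  obtain C where C: "0 \<le> C" "\<And>n z. z \<in> K r \<Longrightarrow> norm (H (- int n) z) \<le> C * \<theta> ^ n / fact n"
    using apriori[OF \<theta>] by blast
  have bound: "norm (H 0 z) \<le> C * (1/2) ^ N" if N: "1 \<le> N" for N :: nat
  proof -
    define X where "X = C * \<theta> ^ N / fact N"
    define \<delta> where "\<delta> = r / (2 * M * real N)"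
    \<comment> \<open>The radius shrinks from r at i = 0 to r / 2 at i = N; \<open>nat i\<close>
      keeps it equal to r for negative i.\<close>
    define \<rho> where "\<rho> i = r - real (nat i) * (M * \<delta>)" for i :: int
    have X: "0 \<le> X" using C \<theta> by (simp add: X_def)
    have \<delta>: "0 < \<delta>" using r M N by (simp add: \<delta>_def)
    have MN: "real N * (M * \<delta>) = r / 2" using M N by (simp add: \<delta>_def)
    have CN: "1 \<le> C2 * real N" using C2 N by (metis mult_mono of_nat_1 of_nat_le_iff mult_1 zero_le_one order_trans)
    have \<rho>r: "\<rho> i \<le> r" for i using M \<delta> by (simp add: \<rho>_def)
    \<comment> \<open>The bound grows by the factor C2 * N per step. A step of length s_k may lead
      to a negative index; there the same formula, with \<open>powi\<close>, follows from the a
      priori decay.\<close>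
    have claim: "\<forall>z\<in>K (\<rho> i). norm (H (i - int N) z) \<le> X * (C2 * real N) powi i" if "i \<le> int N" for i
      using that
    proof (induction "nat i" arbitrary: i rule: less_induct)
      case less
      show ?case
      proof (cases "i \<le> 0")
        case True
        then have "\<forall>z\<in>K r. norm (H (i - int N) z) \<le> X * (C2 * real N) powi i"
        proof (intro ballI)
          fix z assume z: "z \<in> K r"
          define k where "k = nat (- i)"
          have i: "i = - int k" using True by (simp add: k_def)
          have "norm (H (i - int N) z) \<le> C * \<theta> ^ (N + k) / fact (N + k)"
          proof -
            have "i - int N = - int (N + k)" by (simp add: i)
            then show ?thesis using C(2)[OF z, of "N + k"] by (simp only:)
          qed
          \<comment> \<open>Turns the decay 1 / (N + k)! into the negative power of N that the claim
            demands.\<close>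
          also have "fact N * real N ^ k \<le> fact (N + k)"
          proof (induction k)
            case (Suc k)
            have "fact N * real N ^ Suc k = (fact N * real N ^ k) * real N" by simp
            also have "\<dots> \<le> fact (N + k) * real (Suc (N + k))" using Suc by (intro mult_mono) auto
            finally show ?case by (simp add: mult.commute)
          qed simp
          then have "C * \<theta> ^ (N + k) / fact (N + k) \<le> C * \<theta> ^ (N + k) / (fact N * real N ^ k)"
            using C \<theta> N by (intro divide_left_mono mult_pos_pos) auto
          also have "\<dots> = X * ((\<theta> * C2) ^ k * inverse ((C2 * real N) ^ k))"
            using C2 N by (simp add: X_def power_add power_mult_distrib field_simps)
          also have "\<dots> \<le> X * (1 * inverse ((C2 * real N) ^ k))"
            using X \<theta>C2 \<theta> C2 by (intro mult_left_mono mult_right_mono power_le_one) auto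
          also have "\<dots> = X * (C2 * real N) powi i"
            by (simp add: i power_int_minus)
          finally show "norm (H (i - int N) z) \<le> X * (C2 * real N) powi i" .
        qed
        then show ?thesis using mono[OF \<rho>r[of i]] by blast
      next
        case False
        then have i1: "1 \<le> i" by simp
        define Y where "Y = X * (C2 * real N) powi i"
        have Y: "0 \<le> Y" using X C2 by (simp add: Y_def)
        have Ni: "real (nat i) \<le> real N" using less.prems by simp
        show ?thesis
        proof
          fix z assume z: "z \<in> K (\<rho> i)"
          have zr: "z \<in> K r" using z mono[OF \<rho>r[of i]] by blast
          have term_le: "norm (co k (i - int N) z * D k (i - int N - int (s k)) z) \<le> W * (C4 / C2) * Y" if k: "k \<in> Ks" for k
          proof -
            define i' where "i' = i - int (s k)"
            have i': "i' < i" "nat i' < nat i" "i' \<le> int N" using s(1)[OF k] i1 less.prems by (auto simp: i'_def)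
            have "real (nat i') + 1 \<le> real (nat i)" using i' by linarith
            then have nat_le: "(real (nat i') + 1) * (M * \<delta>) \<le> real (nat i) * (M * \<delta>)"
              using M \<delta> by (intro mult_right_mono) auto
            have "real (nat i) * (M * \<delta>) \<le> r / 2"
              using mult_right_mono[OF Ni, of "M * \<delta>"] M \<delta> MN by simp
            then have d1: "M * \<delta> \<le> \<rho> i'" using nat_le r by (simp add: \<rho>_def algebra_simps)
            have "\<rho> i \<le> \<rho> i' - M * \<delta>" using nat_le by (simp add: \<rho>_def algebra_simps)
            then have zi: "z \<in> K (\<rho> i' - M * \<delta>)" using z mono by blast
            have "norm (D k (i' - int N) z) \<le> (C1 / \<delta>) ^ e k * (X * (C2 * real N) powi i')"
              by (rule der[OF k \<delta> d1 \<rho>r _ zi]) (use less.hyps[OF i'(2,3)] in blast)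
            also have "\<dots> \<le> (C4 * real N) ^ e k * (X * (C2 * real N) powi i')"
            proof (intro mult_right_mono power_mono)
              have "C1 / \<delta> = (C1 * 2 * M / r) * real N" using r M N by (simp add: \<delta>_def)
              also have "\<dots> \<le> C4 * real N" using C4 by (intro mult_right_mono) auto
              finally show "C1 / \<delta> \<le> C4 * real N" .
            qed (use C1 \<delta> X C2 in auto)
            finally have D: "norm (D k (i' - int N) z) \<le> (C4 * real N) ^ e k * (X * (C2 * real N) powi i')" .
            have "norm (co k (i - int N) z) \<le> W * (c0 + \<bar>real_of_int (i - int N)\<bar>) ^ a k"
              by (rule co[OF k zr])
            also have "\<dots> \<le> W * (C4 * real N) ^ a k"
            proof (intro mult_left_mono power_mono)
              have "c0 * 1 \<le> c0 * real N" using c0 N by (intro mult_left_mono) auto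
              moreover have "\<bar>real_of_int (i - int N)\<bar> \<le> real N" using i1 less.prems by linarith
              ultimately have "c0 + \<bar>real_of_int (i - int N)\<bar> \<le> (c0 + 1) * real N" by (simp add: algebra_simps)
              also have "\<dots> \<le> C4 * real N" using C4 by (intro mult_right_mono) auto
              finally show "c0 + \<bar>real_of_int (i - int N)\<bar> \<le> C4 * real N" .
            qed (use W c0 in auto)
            finally have co': "norm (co k (i - int N) z) \<le> W * (C4 * real N) ^ a k" .
            have "norm (co k (i - int N) z * D k (i' - int N) z)
                \<le> (W * (C4 * real N) ^ a k) * ((C4 * real N) ^ e k * (X * (C2 * real N) powi i'))"
              unfolding norm_mult using co' D W C4 by (intro mult_mono) auto
            also have "\<dots> = W * X * (C4 * real N) ^ (a k + e k) * (C2 * real N) powi i'"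
              by (simp add: power_add)
            \<comment> \<open>Here a + e \<le> s enters: the powers of N lost to the coefficient and
              to the derivatives do not exceed the number of steps gained.\<close>
            also have "\<dots> \<le> W * X * (C4 * real N) ^ s k * (C2 * real N) powi i'"
            proof (intro mult_right_mono mult_left_mono power_increasing s(2)[OF k])
              show "1 \<le> C4 * real N" using C4(1) N by (metis mult_mono of_nat_1 of_nat_le_iff mult_1 zero_le_one order_trans)
            qed (use W X C2 in auto)
            also have "\<dots> = W * (C4 / C2) ^ s k * Y"
            proof -
              have "(C2 * real N) powi i = (C2 * real N) ^ s k * (C2 * real N) powi i'"
              proof -
                have "C2 * real N \<noteq> 0" using CN by linarith
                then have "(C2 * real N) powi i = (C2 * real N) powi int (s k) * (C2 * real N) powi i'"
                  by (subst power_int_add[symmetric]) (auto simp: i'_def)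
                then show ?thesis by (simp only: power_int_of_nat)
              qed
              moreover have "(C4 * real N) ^ s k = (C4 / C2) ^ s k * (C2 * real N) ^ s k"
                using C2 by (simp add: power_mult_distrib[symmetric])
              ultimately show ?thesis by (simp add: Y_def)
            qed
            also have "\<dots> \<le> W * (C4 / C2) ^ 1 * Y"
              using W Y C24 C2 C4 s(1)[OF k] by (intro mult_right_mono mult_left_mono power_decreasing) auto
            finally show ?thesis by (simp add: i'_def algebra_simps)
          qed
          have "\<eta> * norm (H (i - int N) z) \<le> norm (q z) * norm (H (i - int N) z)"
            using q(2)[OF zr] by (intro mult_right_mono) auto
          also have "\<dots> = norm (\<Sum>k\<in>Ks. co k (i - int N) z * D k (i - int N - int (s k)) z)"
            using rel[OF zr, of "i - int N"] by (metis norm_minus_cancel norm_mult)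
          also have "\<dots> \<le> (\<Sum>k\<in>Ks. W * (C4 / C2) * Y)"
            by (rule order_trans[OF norm_sum sum_mono]) (rule term_le)
          also have "\<dots> = (W * real (card Ks)) * (C4 / C2) * Y" by simp
          also have "C4 / C2 = \<eta> / (\<eta> + W * real (card Ks))"
          proof -
            have "C4 / C2 = 1 / (1 + W * real (card Ks) / \<eta>)" using C4(1) by (simp add: C2_def)
            then show ?thesis using q(1) by (simp add: field_simps)
          qed
          also have "W * real (card Ks) * (\<eta> / (\<eta> + W * real (card Ks))) * Y \<le> \<eta> * Y"
          proof (rule mult_right_mono[OF _ Y])
            show "W * real (card Ks) * (\<eta> / (\<eta> + W * real (card Ks))) \<le> \<eta>"
              using q W by (simp add: divide_le_eq add_pos_nonneg algebra_simps)
          qed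
          finally show "norm (H (i - int N) z) \<le> X * (C2 * real N) powi i"
            using q(1) by (simp add: Y_def)
        qed
      qed
    qed
    have "\<rho> (int N) = r / 2" using MN by (simp add: \<rho>_def)
    then have "z \<in> K (\<rho> (int N))" using z by (simp only:)
    then have "norm (H (int N - int N) z) \<le> X * (C2 * real N) powi int N"
      using claim[of "int N"] by blast
    then have "norm (H 0 z) \<le> X * (C2 * real N) ^ N" by simp
    also have "\<dots> = C * (\<theta> * C2) ^ N * (real N ^ N / fact N)"
      by (simp add: X_def power_mult_distrib)
    also have "\<dots> \<le> C * (\<theta> * C2) ^ N * exp (real N)"
      using power_le_fact_exp[of "real N" N] C \<theta> C2 by (intro mult_left_mono) (auto simp: divide_le_eq mult.commute)
    also have "\<dots> = C * (\<theta> * C2 * exp 1) ^ N"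
      by (simp add: power_mult_distrib exp_of_nat_mult[symmetric])
    also have "\<theta> * C2 * exp 1 = 1 / 2" using C2 by (simp add: \<theta>_def)
    finally show ?thesis .
  qed
  have "(\<lambda>N. C * (1/2) ^ N) \<longlonglongrightarrow> C * 0"
    by (intro tendsto_mult tendsto_const LIMSEQ_power_zero) simp
  then have "norm (H 0 z) \<le> 0"
    using bound by (intro tendsto_lowerbound[of "\<lambda>N. C * (1/2) ^ N" 0 sequentially])
      (auto simp: eventually_sequentially intro!: exI[of _ 1])
  then show ?thesis by simp
qed

section \<open>Volume and lattice index\<close>

definition unit_cell :: "(real^'d::finite) set" where
  "unit_cell = {x. \<forall>i. 0 \<le> x$i \<and> x$i < 1}"

lemma unit_cell_borel [measurable]: "unit_cell \<in> sets borel"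
proof -
  have "unit_cell = (\<Inter>i. {x::real^'d. 0 \<le> x$i} \<inter> {x. x$i < 1})" by (auto simp: unit_cell_def)
  have "closed {x::real^'d. 0 \<le> x$i}" "open {x::real^'d. x$i < 1}" for i
    by (auto intro!: closed_Collect_le open_Collect_less continuous_intros)
  then have "{x::real^'d. 0 \<le> x$i} \<inter> {x. x$i < 1} \<in> sets borel" for i by (intro sets.Int) auto
  then have "(\<Inter>i. {x::real^'d. 0 \<le> x$i} \<inter> {x. x$i < 1}) \<in> sets borel"
    by (intro sets.finite_INT) auto
  then show ?thesis by (simp only: \<open>unit_cell = _\<close>)
qed

text \<open>Covers at once the unit cell and its reflections, which differ in the faces that they
  contain.\<close>

lemma emeasure_between_boxes:
  fixes a :: "real^'d::finite"
  assumes "S \<in> sets borel" "box a (\<chi> i. a$i + 1) \<subseteq> S" "S \<subseteq> cbox a (\<chi> i. a$i + 1)"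
  shows "emeasure lborel S = 1"
proof (rule antisym)
  have le: "\<And>b. b \<in> Basis \<Longrightarrow> a \<bullet> b \<le> (\<chi> i. a$i + 1) \<bullet> b"
    by (auto simp: Basis_vec_def inner_axis)
  have 1: "(\<Prod>b\<in>Basis. ((\<chi> i. a$i + 1) - a) \<bullet> b) = 1"
    by (rule prod.neutral) (auto simp: Basis_vec_def inner_axis)
  have "emeasure lborel S \<le> emeasure lborel (cbox a (\<chi> i. a$i + 1))"
    using assms by (intro emeasure_mono) auto
  also have "\<dots> = 1" using emeasure_lborel_cbox[OF le] 1 by simp
  finally show "emeasure lborel S \<le> 1" .
  have "1 = emeasure lborel (box a (\<chi> i. a$i + 1))" using emeasure_lborel_box[OF le] 1 by simp
  also have "\<dots> \<le> emeasure lborel S" using assms by (intro emeasure_mono) auto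
  finally show "1 \<le> emeasure lborel S" .
qed

lemma emeasure_lborel_translate:
  fixes c :: "'a::euclidean_space"
  assumes "S \<in> sets borel"
  shows "emeasure lborel ((\<lambda>x. c + x) -` S) = emeasure lborel S"
proof -
  have "emeasure lborel S = emeasure (distr lborel borel ((+) c)) S" by (simp add: lborel_distr_plus)
  also have "\<dots> = emeasure lborel ((+) c -` S)" using assms by (subst emeasure_distr) auto
  finally show ?thesis by simp
qed

text \<open>
  Uniqueness of translation invariant measures, applied to \<open>S \<mapsto> vol (L S)\<close>; this avoids determinants,
  whose relation to volumes is only available for well-ordered index types.
\<close>

lemma linear_volume_ratio:
  fixes L g :: "real^'d::finite \<Rightarrow> real^'d"
  assumes L: "linear L" and g: "linear g" and Lg: "\<And>x. L (g x) = x" and gL: "\<And>x. g (L x) = x"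
    and T: "T \<in> sets borel"
  shows "emeasure lborel (L ` T) = emeasure lborel (L ` unit_cell) * emeasure lborel T"
proof -
  have gm [measurable]: "g \<in> borel_measurable borel"
    using g by (intro borel_measurable_continuous_onI linear_continuous_on linear_conv_bounded_linear[THEN iffD1])
  define \<mu> where "\<mu> = distr lborel borel g"
  have sets_\<mu> [simp, measurable_cong]: "sets \<mu> = sets borel" and space_\<mu> [simp]: "space \<mu> = UNIV"
    by (simp_all add: \<mu>_def)
  have vimage: "g -` S = L ` S" for S using Lg gL by (auto simp: image_iff) (metis Lg)
  have \<mu>: "emeasure \<mu> S = emeasure lborel (L ` S)" if "S \<in> sets borel" for S
    using that by (simp add: \<mu>_def emeasure_distr vimage)
  have trans: "distr \<mu> borel ((+) c) = \<mu>" for c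
  proof -
    have "distr \<mu> borel ((+) c) = distr lborel borel ((+) c \<circ> g)"
      unfolding \<mu>_def by (rule distr_distr) auto
    also have "(+) c \<circ> g = g \<circ> (+) (L c)" using g gL by (auto simp: linear_add)
    also have "distr lborel borel (g \<circ> (+) (L c)) = distr (distr lborel borel ((+) (L c))) borel g"
      by (rule distr_distr[symmetric]) auto
    also have "\<dots> = \<mu>" by (simp add: lborel_distr_plus \<mu>_def)
    finally show ?thesis .
  qed
  have fin: "emeasure \<mu> (ball 0 (real n)) \<noteq> \<infinity>" for n
  proof -
    have "bounded (L ` ball 0 (real n))" using L by (intro bounded_linear_image) (auto simp: linear_conv_bounded_linear)
    then show ?thesis using emeasure_bounded_finite[of "L ` ball 0 (real n)"] \<mu>[of "ball 0 (real n)"] by auto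
  qed
  have "sigma_finite_measure \<mu>"
  proof
    show "\<exists>B. countable B \<and> B \<subseteq> sets \<mu> \<and> \<Union>B = space \<mu> \<and> (\<forall>a\<in>B. emeasure \<mu> a \<noteq> \<infinity>)"
    proof (intro exI[of _ "range (\<lambda>n. ball 0 (real n))"] conjI)
      show "\<Union>(range (\<lambda>n. ball 0 (real n))) = space \<mu>" by (auto simp: reals_Archimedean2)
    qed (use fin in auto)
  qed
  then interpret pair_sigma_finite \<mu> "lborel :: (real^'d) measure"
    by (simp add: pair_sigma_finite_def sigma_finite_lborel)
  let ?Q = "unit_cell :: (real^'d) set"
  \<comment> \<open>Integrating over y on the inside gives \<mu>(Q) times the volume of T.
    Integrating over x on the inside and translating by y, which preserves \<mu>, gives \<mu>(T),
    because a reflected unit cell has volume 1.\<close>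
  let ?f = "\<lambda>x y. indicator ?Q x * indicator T (x + y) :: ennreal"
  have meas [measurable]: "case_prod ?f \<in> borel_measurable (\<mu> \<Otimes>\<^sub>M lborel)"
  proof -
    have "(\<lambda>p::(real^'d) \<times> (real^'d). indicator ?Q (fst p) * indicator T (fst p + snd p) :: ennreal)
        \<in> borel_measurable (borel \<Otimes>\<^sub>M borel)"
    proof -
      have "(\<lambda>p::(real^'d) \<times> (real^'d). fst p + snd p) \<in> borel \<Otimes>\<^sub>M borel \<rightarrow>\<^sub>M borel" by measurable
      from measurable_compose[OF this borel_measurable_indicator[OF T]] show ?thesis
        by (intro borel_measurable_times_ennreal measurable_compose[OF measurable_fst borel_measurable_indicator]) auto
    qed
    moreover have "sets (\<mu> \<Otimes>\<^sub>M lborel) = sets (borel \<Otimes>\<^sub>M (borel :: (real^'d) measure))"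
      by (intro sets_pair_measure_cong) auto
    ultimately show ?thesis by (simp add: case_prod_unfold cong: measurable_cong_sets)
  qed
  have "(\<integral>\<^sup>+ x. (\<integral>\<^sup>+ y. ?f x y \<partial>lborel) \<partial>\<mu>) = (\<integral>\<^sup>+ x. indicator ?Q x * emeasure lborel T \<partial>\<mu>)"
  proof (rule nn_integral_cong)
    fix x
    have "(\<integral>\<^sup>+ y. ?f x y \<partial>lborel) = (\<integral>\<^sup>+ y. indicator ?Q x * indicator ((\<lambda>y. x + y) -` T) y \<partial>lborel)"
      by (rule nn_integral_cong) (auto simp: indicator_def)
    also have "\<dots> = indicator ?Q x * emeasure lborel ((\<lambda>y. x + y) -` T)"
      using T by (subst nn_integral_cmult_indicator) (auto intro!: measurable_sets_borel[of "(+) x"])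
    also have "emeasure lborel ((\<lambda>y. x + y) -` T) = emeasure lborel T" by (rule emeasure_lborel_translate[OF T])
    finally show "(\<integral>\<^sup>+ y. ?f x y \<partial>lborel) = indicator ?Q x * emeasure lborel T" .
  qed
  also have "\<dots> = emeasure \<mu> ?Q * emeasure lborel T"
    by (subst nn_integral_multc) auto
  finally have 1: "(\<integral>\<^sup>+ x. (\<integral>\<^sup>+ y. ?f x y \<partial>lborel) \<partial>\<mu>) = emeasure \<mu> ?Q * emeasure lborel T" .
  have "(\<integral>\<^sup>+ y. (\<integral>\<^sup>+ x. ?f x y \<partial>\<mu>) \<partial>lborel) = (\<integral>\<^sup>+ y. (\<integral>\<^sup>+ x. indicator ?Q (x - y) * indicator T x \<partial>\<mu>) \<partial>lborel)"
  proof (rule nn_integral_cong)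
    fix y :: "real^'d"
    have "(\<integral>\<^sup>+ x. ?f x y \<partial>\<mu>) = (\<integral>\<^sup>+ x. indicator ?Q (y + x - y) * indicator T (y + x) \<partial>\<mu>)"
      by (simp add: add.commute)
    also have "\<dots> = (\<integral>\<^sup>+ x. indicator ?Q (x - y) * indicator T x \<partial>(distr \<mu> borel ((+) y)))"
      using T by (subst nn_integral_distr) auto
    finally show "(\<integral>\<^sup>+ x. ?f x y \<partial>\<mu>) = (\<integral>\<^sup>+ x. indicator ?Q (x - y) * indicator T x \<partial>\<mu>)" by (simp add: trans)
  qed
  also have "\<dots> = (\<integral>\<^sup>+ x. (\<integral>\<^sup>+ y. indicator ?Q (x - y) * indicator T x \<partial>lborel) \<partial>\<mu>)"
  proof (rule Fubini')
    have "(\<lambda>p::(real^'d) \<times> (real^'d). indicator ?Q (fst p - snd p) * indicator T (fst p) :: ennreal)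
        \<in> borel_measurable (borel \<Otimes>\<^sub>M borel)"
    proof -
      have "(\<lambda>p::(real^'d) \<times> (real^'d). fst p - snd p) \<in> borel \<Otimes>\<^sub>M borel \<rightarrow>\<^sub>M borel" by measurable
      from measurable_compose[OF this borel_measurable_indicator[OF unit_cell_borel]] show ?thesis
        by (intro borel_measurable_times_ennreal measurable_compose[OF measurable_fst borel_measurable_indicator] T)
    qed
    moreover have "sets (\<mu> \<Otimes>\<^sub>M lborel) = sets (borel \<Otimes>\<^sub>M (borel :: (real^'d) measure))"
      by (intro sets_pair_measure_cong) auto
    ultimately show "(\<lambda>(x, y). indicator ?Q (x - y) * indicator T x :: ennreal) \<in> borel_measurable (\<mu> \<Otimes>\<^sub>M lborel)"
      by (simp add: case_prod_unfold cong: measurable_cong_sets)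
  qed
  also have "\<dots> = (\<integral>\<^sup>+ x. indicator T x \<partial>\<mu>)"
  proof (rule nn_integral_cong)
    fix x :: "real^'d"
    let ?S = "(\<lambda>y. x - y) -` ?Q"
    have S: "?S \<in> sets borel" by (rule measurable_sets_borel[of "\<lambda>y. x - y" borel]) auto
    have "emeasure lborel ?S = 1"
    proof (rule emeasure_between_boxes[OF S, of "\<chi> i. x$i - 1"])
      show "box (\<chi> i. x$i - 1) (\<chi> i. (\<chi> i. x$i - 1)$i + 1) \<subseteq> ?S"
        by (simp add: subset_iff mem_box_cart unit_cell_def) (smt (verit))
      show "?S \<subseteq> cbox (\<chi> i. x$i - 1) (\<chi> i. (\<chi> i. x$i - 1)$i + 1)"
        by (simp add: subset_iff mem_box_cart unit_cell_def) (smt (verit))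
    qed
    moreover have "(\<integral>\<^sup>+ y. indicator ?Q (x - y) * indicator T x \<partial>lborel) = (\<integral>\<^sup>+ y. indicator T x * indicator ?S y \<partial>lborel)"
      by (rule nn_integral_cong) (auto simp: indicator_def)
    ultimately show "(\<integral>\<^sup>+ y. indicator ?Q (x - y) * indicator T x \<partial>lborel) = indicator T x"
      using S by (subst (asm) nn_integral_cmult_indicator) auto
  qed
  also have "\<dots> = emeasure \<mu> T" using T by simp
  also have "(\<integral>\<^sup>+ y. (\<integral>\<^sup>+ x. ?f x y \<partial>\<mu>) \<partial>lborel) = (\<integral>\<^sup>+ x. (\<integral>\<^sup>+ y. ?f x y \<partial>lborel) \<partial>\<mu>)"
    by (rule Fubini') (use meas in simp)
  finally show ?thesis using 1 T by (simp add: \<mu>)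
qed


section \<open>The index of a lattice as the volume of its parallelepiped\<close>

definition rvec :: "int^'d \<Rightarrow> real^'d" where
  "rvec z = (\<chi> i. of_int (z$i))"

lemma rvec_nth [simp]: "rvec z $ i = of_int (z$i)"
  by (simp add: rvec_def)

lemma rvec_add: "rvec (y + z) = rvec y + rvec z"
  and rvec_diff: "rvec (y - z) = rvec y - rvec z"
  and rvec_uminus: "rvec (- z) = - rvec z"
  and rvec_0 [simp]: "rvec 0 = 0"
  and rvec_eq_iff [simp]: "rvec y = rvec z \<longleftrightarrow> y = z"
  by (auto simp: vec_eq_iff)

lemma countable_int_vec: "countable (S :: (int^'d::finite) set)"
proof -
  have "countable (PiE (UNIV :: 'd set) (\<lambda>_. UNIV :: int set))" by (rule countable_PiE) auto
  then have "countable ((\<lambda>f. \<chi> i. f i) ` PiE (UNIV :: 'd set) (\<lambda>_. UNIV :: int set))" by (rule countable_image)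
  moreover have "(\<lambda>f. \<chi> i. f i) ` PiE (UNIV :: 'd set) (\<lambda>_. UNIV :: int set) = (UNIV :: (int^'d) set)"
  proof (intro equalityI subsetI UNIV_I)
    fix x :: "int^'d"
    have "x = (\<chi> i. x$i)" by (simp add: vec_eq_iff)
    then show "x \<in> (\<lambda>f. \<chi> i. f i) ` PiE (UNIV :: 'd set) (\<lambda>_. UNIV :: int set)" by blast
  qed
  ultimately show ?thesis by (metis countable_subset top_greatest)
qed

lemma unit_cell_decomp: "\<exists>!z. x - rvec z \<in> unit_cell"
proof (rule ex1I[of _ "\<chi> i. \<lfloor>x$i\<rfloor>"])
  show "x - rvec (\<chi> i. \<lfloor>x$i\<rfloor>) \<in> unit_cell"
    by (auto simp: unit_cell_def) linarith
  show "z = (\<chi> i. \<lfloor>x$i\<rfloor>)" if "x - rvec z \<in> unit_cell" for z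
    using that by (auto simp: unit_cell_def vec_eq_iff) (metis diff_ge_0_iff_ge diff_less_eq floor_unique add.commute)
qed

text \<open>
  Both the parallelepiped \<open>L ` unit_cell\<close> and a union of unit cells based at representatives of
  \<open>\<int>\<^sup>d / L \<int>\<^sup>d\<close> are fundamental domains of the lattice \<open>L \<int>\<^sup>d\<close>.
\<close>

lemma lattice_index:
  fixes L g :: "real^'d::finite \<Rightarrow> real^'d" and \<Omega> :: "(int^'d) set"
  assumes L: "linear L" and g: "linear g" and Lg: "\<And>x. L (g x) = x" and gL: "\<And>x. g (L x) = x"
    and \<Lambda>: "\<Lambda> = {z. \<exists>y. rvec z = L (rvec y)}" and Lint: "\<And>y. \<exists>z. rvec z = L (rvec y)"
    and reps: "\<And>z. \<exists>!\<omega>. \<omega> \<in> \<Omega> \<and> z - \<omega> \<in> \<Lambda>"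
  shows "finite \<Omega>" and "emeasure lborel (L ` unit_cell) = of_nat (card \<Omega>)"
proof -
  have gm: "g \<in> borel_measurable borel"
    using g by (intro borel_measurable_continuous_onI linear_continuous_on linear_conv_bounded_linear[THEN iffD1])
  let ?Q = "unit_cell :: (real^'d) set"
  define F where "F = L ` ?Q"
  have Fg: "x \<in> F \<longleftrightarrow> g x \<in> ?Q" for x
    unfolding F_def using Lg gL by (metis image_iff)
  have F: "F \<in> sets borel"
  proof -
    have "F = g -` ?Q" using Fg by auto
    then show ?thesis using measurable_sets_borel[OF gm unit_cell_borel] by simp
  qed
  define D where "D = (\<Union>\<omega>\<in>\<Omega>. {x. x - rvec \<omega> \<in> ?Q})"
  have shift: "{x. x - c \<in> S} \<in> sets borel" "emeasure lborel {x. x - c \<in> S} = emeasure lborel S"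
    if "S \<in> sets borel" for c and S :: "(real^'d) set"
  proof -
    have eq: "{x. x - c \<in> S} = (\<lambda>x. - c + x) -` S" by auto
    show "{x. x - c \<in> S} \<in> sets borel"
      unfolding eq using that by (intro measurable_sets_borel[of "\<lambda>x. - c + x"]) auto
    show "emeasure lborel {x. x - c \<in> S} = emeasure lborel S"
      unfolding eq by (rule emeasure_lborel_translate[OF that])
  qed
  have D: "D \<in> sets borel"
    unfolding D_def by (intro sets.countable_UN' countable_int_vec) (auto intro: shift)
  have Q1: "emeasure lborel ?Q = 1"
    by (rule emeasure_between_boxes[of _ 0]) (auto simp: mem_box_cart unit_cell_def, (meson less_imp_le)+)
  have "disjoint_family_on (\<lambda>\<omega>. {x. x - rvec \<omega> \<in> ?Q}) \<Omega>"
    using unit_cell_decomp by (auto simp: disjoint_family_on_def)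
  then have "emeasure lborel D = (\<integral>\<^sup>+ \<omega>. emeasure lborel {x. x - rvec \<omega> \<in> ?Q} \<partial>count_space \<Omega>)"
    unfolding D_def by (intro emeasure_UN_countable countable_int_vec) (auto intro: shift)
  also have "\<dots> = (\<integral>\<^sup>+ \<omega>. 1 \<partial>count_space \<Omega>)"
    using shift(2)[OF unit_cell_borel] Q1 by (intro nn_integral_cong) auto
  also have "\<dots> = emeasure (count_space \<Omega>) \<Omega>" by simp
  finally have D\<Omega>: "emeasure lborel D = emeasure (count_space \<Omega>) \<Omega>" .
  have \<Lambda>uminus: "- z \<in> \<Lambda> \<longleftrightarrow> z \<in> \<Lambda>" for z
  proof -
    have "- z \<in> \<Lambda>" if z: "z \<in> \<Lambda>" for z
    proof -
      obtain y where "rvec z = L (rvec y)" using z unfolding \<Lambda> by blast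
      then have "rvec (- z) = L (rvec (- y))" using L by (simp add: rvec_uminus linear_neg)
      then show ?thesis unfolding \<Lambda> by blast
    qed
    from this[of z] this[of "- z"] show ?thesis by auto
  qed
  have tileF: "\<exists>!\<kappa>. \<kappa> \<in> \<Lambda> \<and> x - rvec \<kappa> \<in> F" for x
  proof -
    obtain y where y: "g x - rvec y \<in> ?Q" "\<And>y'. g x - rvec y' \<in> ?Q \<Longrightarrow> y' = y"
      using unit_cell_decomp[of "g x"] by blast
    obtain z where z: "rvec z = L (rvec y)" using Lint by blast
    show ?thesis
    proof (rule ex1I[of _ z])
      show "z \<in> \<Lambda> \<and> x - rvec z \<in> F"
        using y(1) z g by (auto simp: \<Lambda> Fg linear_diff gL)
      fix z' assume z': "z' \<in> \<Lambda> \<and> x - rvec z' \<in> F"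
      then obtain y' where y': "rvec z' = L (rvec y')" unfolding \<Lambda> by blast
      then have "g x - rvec y' \<in> ?Q" using z' g by (auto simp: Fg linear_diff gL)
      then show "z' = z" using y(2) y' z by (metis rvec_eq_iff)
    qed
  qed
  have \<Lambda>diff: "a - b \<in> \<Lambda>" if ab: "a \<in> \<Lambda>" "b \<in> \<Lambda>" for a b
  proof -
    obtain y y' where "rvec a = L (rvec y)" "rvec b = L (rvec y')" using ab unfolding \<Lambda> by blast
    then have "rvec (a - b) = L (rvec (y - y'))" using L by (simp add: rvec_diff linear_diff)
    then show ?thesis unfolding \<Lambda> by blast
  qed
  have tileD: "\<exists>!\<kappa>. \<kappa> \<in> \<Lambda> \<and> x - rvec \<kappa> \<in> D" for x
  proof -
    obtain z where z: "x - rvec z \<in> ?Q" "\<And>z'. x - rvec z' \<in> ?Q \<Longrightarrow> z' = z"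
      using unit_cell_decomp[of x] by blast
    obtain \<omega> where \<omega>: "\<omega> \<in> \<Omega>" "z - \<omega> \<in> \<Lambda>" "\<And>\<omega>'. \<omega>' \<in> \<Omega> \<Longrightarrow> z - \<omega>' \<in> \<Lambda> \<Longrightarrow> \<omega>' = \<omega>"
      using reps[of z] by blast
    show ?thesis
    proof (rule ex1I[of _ "z - \<omega>"])
      show "z - \<omega> \<in> \<Lambda> \<and> x - rvec (z - \<omega>) \<in> D"
      proof
        have e: "x - rvec (z - \<omega>) - rvec \<omega> = x - rvec z" by (simp add: rvec_diff)
        show "x - rvec (z - \<omega>) \<in> D"
          unfolding D_def UN_iff mem_Collect_eq by (rule bexI[OF _ \<omega>(1)]) (simp only: e z(1))
      qed (rule \<omega>(2))
      fix \<kappa> assume \<kappa>: "\<kappa> \<in> \<Lambda> \<and> x - rvec \<kappa> \<in> D"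
      then obtain \<omega>' where \<omega>': "\<omega>' \<in> \<Omega>" "x - rvec \<kappa> - rvec \<omega>' \<in> ?Q" unfolding D_def by blast
      have e: "x - rvec (\<kappa> + \<omega>') = x - rvec \<kappa> - rvec \<omega>'" by (simp add: rvec_add)
      have zl: "z = \<kappa> + \<omega>'" by (rule z(2)[symmetric]) (simp only: e \<omega>'(2))
      then have "\<omega>' = \<omega>" using \<omega>(3)[of \<omega>'] \<omega>'(1) \<kappa> by simp
      then show "\<kappa> = z - \<omega>" using zl by simp
    qed
  qed
  have tile: "emeasure lborel S = (\<integral>\<^sup>+ \<kappa>. emeasure lborel (S \<inter> {x. x - rvec \<kappa> \<in> E}) \<partial>count_space \<Lambda>)"
    if S: "S \<in> sets borel" and E: "E \<in> sets borel" and tiles: "\<And>x. \<exists>!\<kappa>. \<kappa> \<in> \<Lambda> \<and> x - rvec \<kappa> \<in> E" for S E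
  proof -
    have "S = (\<Union>\<kappa>\<in>\<Lambda>. S \<inter> {x. x - rvec \<kappa> \<in> E})" using tiles by blast
    then have "emeasure lborel S = emeasure lborel (\<Union>\<kappa>\<in>\<Lambda>. S \<inter> {x. x - rvec \<kappa> \<in> E})" by simp
    also have "\<dots> = (\<integral>\<^sup>+ \<kappa>. emeasure lborel (S \<inter> {x. x - rvec \<kappa> \<in> E}) \<partial>count_space \<Lambda>)"
    proof (rule emeasure_UN_countable[OF _ countable_int_vec])
      show "disjoint_family_on (\<lambda>\<kappa>. S \<inter> {x. x - rvec \<kappa> \<in> E}) \<Lambda>"
        using tiles by (auto simp: disjoint_family_on_def) 
    qed (use S shift(1)[OF E] in auto)
    finally show ?thesis .
  qed
  \<comment> \<open>F is cut along the lattice translates of D and the pieces are moved back into D.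
    They fill D because the translates of F tile the space as well; negating the lattice vector
    exchanges the two roles.\<close>
  have "emeasure lborel F = (\<integral>\<^sup>+ \<kappa>. emeasure lborel (F \<inter> {x. x - rvec \<kappa> \<in> D}) \<partial>count_space \<Lambda>)"
    by (rule tile[OF F D tileD])
  also have "\<dots> = (\<integral>\<^sup>+ \<kappa>. emeasure lborel (D \<inter> {x. x - rvec (- \<kappa>) \<in> F}) \<partial>count_space \<Lambda>)"
  proof (rule nn_integral_cong)
    fix \<kappa>
    have "{x. x - rvec \<kappa> \<in> D \<inter> {x. x - rvec (- \<kappa>) \<in> F}} = F \<inter> {x. x - rvec \<kappa> \<in> D}"
      by (auto simp: rvec_uminus)
    then show "emeasure lborel (F \<inter> {x. x - rvec \<kappa> \<in> D}) = emeasure lborel (D \<inter> {x. x - rvec (- \<kappa>) \<in> F})"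
      using shift(2)[OF sets.Int[OF D shift(1)[OF F]], of "rvec \<kappa>" "rvec (- \<kappa>)"] by simp
  qed
  also have "\<dots> = (\<integral>\<^sup>+ \<kappa>. emeasure lborel (D \<inter> {x. x - rvec \<kappa> \<in> F}) \<partial>count_space \<Lambda>)"
    by (rule nn_integral_bij_count_space[of uminus \<Lambda> \<Lambda> "\<lambda>\<kappa>. emeasure lborel (D \<inter> {x. x - rvec \<kappa> \<in> F})"])
       (auto intro!: bij_betwI[of _ _ _ uminus] simp: \<Lambda>uminus)
  also have "\<dots> = emeasure lborel D" by (rule tile[OF D F tileF, symmetric])
  finally have FD: "emeasure lborel F = emeasure (count_space \<Omega>) \<Omega>" using D\<Omega> by simp
  \<comment> \<open>A parallelepiped has finite volume, so the number of classes is finite.\<close>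
  have "bounded F" unfolding F_def
  proof (rule bounded_linear_image)
    have "?Q \<subseteq> cbox 0 (\<chi> i. 1)" by (auto simp: mem_box_cart unit_cell_def) (meson less_imp_le)
    then show "bounded ?Q" using bounded_cbox bounded_subset by blast
  qed (use L in \<open>simp add: linear_conv_bounded_linear\<close>)
  then have "emeasure lborel F \<noteq> \<infinity>" using emeasure_bounded_finite[of F] by auto
  then show fin: "finite \<Omega>" using FD by (metis emeasure_count_space_infinite subset_refl)
  show "emeasure lborel (L ` unit_cell) = of_nat (card \<Omega>)"
    using FD fin by (simp add: F_def)
qed

section \<open>Dual bases of simplices\<close>

text \<open>The vectors \<open>\<delta> i\<close> are the rows of the inverse of A_\<sigma>, indexed
  by the columns themselves, so that no bijection between \<sigma> and the coordinates of the space
  has to be carried along.\<close>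

definition dual_basis :: "int^'n::finite^'d::finite \<Rightarrow> 'n set \<Rightarrow> ('n \<Rightarrow> real^'d) \<Rightarrow> bool" where
  "dual_basis A \<sigma> \<delta> \<longleftrightarrow> (\<forall>i\<in>\<sigma>. \<forall>i'\<in>\<sigma>. \<delta> i \<bullet> acol A i' = (if i = i' then 1 else 0)) \<and>
     (\<forall>y. (\<Sum>i\<in>\<sigma>. (\<delta> i \<bullet> y) *\<^sub>R acol A i) = y)"

definition lattice_of :: "int^'n::finite^'d::finite \<Rightarrow> 'n set \<Rightarrow> (int^'d) set" where
  "lattice_of A \<sigma> = {\<Sum>i\<in>\<sigma>. z i *s acol A i | z :: 'n \<Rightarrow> int. True}"

text \<open>The inner product with a real vector, extended complex linearly and without
  conjugation.\<close>

definition cdot :: "real^'d::finite \<Rightarrow> complex^'d \<Rightarrow> complex" where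
  "cdot d y = (\<Sum>r\<in>UNIV. of_real (d$r) * y$r)"

lemma acol_nth [simp]: "acol A j $ i = of_int (A$i$j)"
  by (simp add: acol_def)

lemma rvec_acol [simp]: "rvec (acol A j) = acol A j"
  by (simp add: vec_eq_iff)

lemma inner_vec_real: "(d::real^'d::finite) \<bullet> y = (\<Sum>r\<in>UNIV. d$r * y$r)"
  by (simp add: inner_vec_def)

lemma dual_basisD:
  assumes "dual_basis A \<sigma> \<delta>"
  shows "\<And>i i'. i \<in> \<sigma> \<Longrightarrow> i' \<in> \<sigma> \<Longrightarrow> \<delta> i \<bullet> acol A i' = (if i = i' then 1 else 0)"
    and "\<And>y. (\<Sum>i\<in>\<sigma>. (\<delta> i \<bullet> y) *\<^sub>R acol A i) = y"
  using assms by (auto simp: dual_basis_def)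

lemma dual_basis_exists:
  fixes A :: "int^'n::finite^'d::finite"
  assumes card: "card \<sigma> = CARD('d)" and span: "span (acol A ` \<sigma> :: (real^'d) set) = UNIV"
  shows "\<exists>\<delta>. dual_basis A \<sigma> \<delta>"
proof -
  obtain e where e: "bij_betw e (UNIV :: 'd set) \<sigma>"
    using finite_same_card_bij[of "UNIV :: 'd set" \<sigma>] card by auto
  define L :: "real^'d \<Rightarrow> real^'d" where "L y = (\<Sum>r\<in>UNIV. y$r *\<^sub>R acol A (e r))" for y
  have L: "linear L"
    by (rule linearI) (simp_all add: L_def algebra_simps sum.distrib scaleR_right.sum)
  have L_axis: "L (axis r 1) = acol A (e r)" for r
  proof -
    have "L (axis r 1) = (\<Sum>s\<in>UNIV. if s = r then acol A (e s) else 0)"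
      unfolding L_def by (rule sum.cong) (auto simp: axis_def vec_eq_iff)
    then show ?thesis by simp
  qed
  have "surj L"
  proof -
    have "acol A ` \<sigma> \<subseteq> range L" using L_axis e by (auto simp: bij_betw_def) (metis rangeI)
    then have "span (acol A ` \<sigma>) \<subseteq> range L"
      by (intro span_minimal linear_subspace_image[OF L]) (simp_all add: subspace_UNIV)
    then show ?thesis using span by auto
  qed
  then have inj: "inj L" using linear_surjective_imp_injective[OF L] by simp
  obtain g where g: "linear g" "g \<circ> L = id"
    using linear_injective_left_inverse[OF L inj] by blast
  have gL: "g (L x) = x" for x using g(2) by (metis comp_apply id_apply)
  have Lg: "L (g x) = x" for x using \<open>surj L\<close> gL by (metis surjD)
  define \<delta> where "\<delta> i = matrix g $ (inv_into UNIV e i)" for i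
  have \<delta>: "\<delta> (e r) \<bullet> y = g y $ r" for r y
  proof -
    have "inv_into UNIV e (e r) = r" using e by (metis UNIV_I bij_betw_inv_into_left)
    then have "\<delta> (e r) \<bullet> y = (matrix g *v y) $ r" by (simp add: \<delta>_def matrix_vector_mul_component)
    then show ?thesis using g(1) by (simp add: matrix_works)
  qed
  have sur: "\<And>i. i \<in> \<sigma> \<Longrightarrow> \<exists>r. i = e r" and inje: "inj e" using e by (auto simp: bij_betw_def)
  have "dual_basis A \<sigma> \<delta>"
    unfolding dual_basis_def
  proof (intro conjI ballI allI)
    fix i i' assume "i \<in> \<sigma>" "i' \<in> \<sigma>"
    then obtain r s where rs: "i = e r" "i' = e s" using sur by blast
    have "\<delta> i \<bullet> acol A i' = g (L (axis s 1)) $ r" by (simp add: rs \<delta> L_axis)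
    also have "\<dots> = (if i = i' then 1 else 0)" using inje by (auto simp: gL rs axis_def inj_eq)
    finally show "\<delta> i \<bullet> acol A i' = (if i = i' then 1 else 0)" .
  next
    fix y
    have "(\<Sum>i\<in>\<sigma>. (\<delta> i \<bullet> y) *\<^sub>R acol A i) = (\<Sum>r\<in>UNIV. (\<delta> (e r) \<bullet> y) *\<^sub>R acol A (e r))"
      by (rule sum.reindex_bij_betw[OF e, symmetric])
    also have "\<dots> = L (g y)" by (simp add: L_def \<delta>)
    finally show "(\<Sum>i\<in>\<sigma>. (\<delta> i \<bullet> y) *\<^sub>R acol A i) = y" by (simp add: Lg)
  qed
  then show ?thesis by blast
qed

lemma dual_basis_complex:
  fixes A :: "int^'n::finite^'d::finite"
  assumes d: "dual_basis A \<sigma> \<delta>"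
  shows cdot_acol: "\<And>i i'. i \<in> \<sigma> \<Longrightarrow> i' \<in> \<sigma> \<Longrightarrow> cdot (\<delta> i) (acol A i') = (if i = i' then 1 else 0)"
    and cdot_expand: "\<And>y. (\<Sum>i\<in>\<sigma>. cdot (\<delta> i) y *s acol A i) = y"
proof -
  show "cdot (\<delta> i) (acol A i') = (if i = i' then 1 else 0)" if "i \<in> \<sigma>" "i' \<in> \<sigma>" for i i'
  proof -
    have "cdot (\<delta> i) (acol A i') = of_real (\<delta> i \<bullet> acol A i')"
      by (simp add: cdot_def inner_vec_real)
    then show ?thesis using dual_basisD(1)[OF d that] by simp
  qed
  \<comment> \<open>The real expansion evaluated at unit vectors is a matrix identity, which carries
    over to the complex numbers.\<close>
  have id: "(\<Sum>i\<in>\<sigma>. \<delta> i $ r * of_int (A$s$i)) = (if s = r then 1 else 0)" for r s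
  proof -
    have "(\<Sum>i\<in>\<sigma>. (\<delta> i \<bullet> axis r 1) *\<^sub>R acol A i) $ s = (axis r 1 :: real^'d) $ s"
      using dual_basisD(2)[OF d] by simp
    moreover have "\<delta> i \<bullet> axis r 1 = \<delta> i $ r" for i by (simp add: inner_axis)
    ultimately show ?thesis by simp (simp add: axis_def)
  qed
  have idc: "(\<Sum>i\<in>\<sigma>. complex_of_real (\<delta> i $ r) * of_int (A$s$i)) = (if s = r then 1 else 0)" for r s
  proof -
    have "(\<Sum>i\<in>\<sigma>. complex_of_real (\<delta> i $ r) * of_int (A$s$i)) = of_real (\<Sum>i\<in>\<sigma>. \<delta> i $ r * of_int (A$s$i))"
      by simp
    then show ?thesis by (simp only: id) simp
  qed
  show "(\<Sum>i\<in>\<sigma>. cdot (\<delta> i) y *s acol A i) = y" for y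
  proof (subst vec_eq_iff, rule allI)
    fix s
    have "(\<Sum>i\<in>\<sigma>. cdot (\<delta> i) y *s acol A i) $ s = (\<Sum>i\<in>\<sigma>. \<Sum>r\<in>UNIV. of_real (\<delta> i $ r) * y$r * of_int (A$s$i))"
      by (simp add: cdot_def sum_distrib_right)
    also have "\<dots> = (\<Sum>r\<in>UNIV. y$r * (\<Sum>i\<in>\<sigma>. of_real (\<delta> i $ r) * of_int (A$s$i)))"
      by (subst sum.swap) (simp add: sum_distrib_left mult_ac)
    also have "\<dots> = y $ s" by (simp add: idc if_distrib[of "\<lambda>x. _ * x"] cong: if_cong)
    finally show "(\<Sum>i\<in>\<sigma>. cdot (\<delta> i) y *s acol A i) $ s = y $ s" .
  qed
qed

lemma cdot_add: "cdot d (x + y) = cdot d x + cdot d y"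
  and cdot_scale: "cdot d (c *s x) = c * cdot d x"
  and cdot_0 [simp]: "cdot d 0 = 0"
  by (simp_all add: cdot_def algebra_simps sum.distrib sum_subtractf sum_distrib_left)

lemma cdot_sum: "cdot d (\<Sum>i\<in>I. f i) = (\<Sum>i\<in>I. cdot d (f i))"
  by (induction I rule: infinite_finite_induct) (auto simp: cdot_add)

lemma cdot_coord:
  fixes A :: "int^'n::finite^'d::finite"
  assumes d: "dual_basis A \<sigma> \<delta>" and i: "i \<in> \<sigma>"
  shows "cdot (\<delta> i) (\<Sum>j\<in>\<sigma>. w j *s acol A j) = w i"
proof -
  have "cdot (\<delta> i) (\<Sum>j\<in>\<sigma>. w j *s acol A j) = (\<Sum>j\<in>\<sigma>. if i = j then w j else 0)"
    unfolding cdot_sum cdot_scale using cdot_acol[OF d i] by (intro sum.cong) auto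
  then show ?thesis using i by simp
qed

lemma inner_coord:
  fixes A :: "int^'n::finite^'d::finite"
  assumes d: "dual_basis A \<sigma> \<delta>" and i: "i \<in> \<sigma>"
  shows "\<delta> i \<bullet> (\<Sum>j\<in>\<sigma>. w j *\<^sub>R acol A j) = w i"
proof -
  have "\<delta> i \<bullet> (\<Sum>j\<in>\<sigma>. w j *\<^sub>R acol A j) = (\<Sum>j\<in>\<sigma>. if i = j then w j else 0)"
    unfolding inner_sum_right inner_scaleR_right using dual_basisD(1)[OF d i] by (intro sum.cong) auto
  then show ?thesis using i by simp
qed

lemma simplex_coords_complex:
  fixes A :: "int^'n::finite^'d::finite"
  assumes d: "dual_basis A \<sigma> \<delta>"
  shows "simplex_coords A \<sigma> (b :: complex^'d) $ i = (if i \<in> \<sigma> then cdot (\<delta> i) b else 0)"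
proof -
  have "simplex_coords A \<sigma> b = (\<chi> i. if i \<in> \<sigma> then cdot (\<delta> i) b else 0)"
    unfolding simplex_coords_def
  proof (rule the_equality)
    show "(\<forall>j. j \<notin> \<sigma> \<longrightarrow> (\<chi> i. if i \<in> \<sigma> then cdot (\<delta> i) b else 0) $ j = 0) \<and>
        (\<Sum>i\<in>\<sigma>. (\<chi> i. if i \<in> \<sigma> then cdot (\<delta> i) b else 0) $ i *s acol A i) = b"
      using cdot_expand[OF d, of b] by simp
    fix w :: "complex^'n" assume w: "(\<forall>j. j \<notin> \<sigma> \<longrightarrow> w$j = 0) \<and> (\<Sum>i\<in>\<sigma>. w$i *s acol A i) = b"
    show "w = (\<chi> i. if i \<in> \<sigma> then cdot (\<delta> i) b else 0)"
    proof -
      have "cdot (\<delta> i) b = w$i" if "i \<in> \<sigma>" for i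
        using cdot_coord[OF d that, of "\<lambda>i. w$i"] w by metis
      then show ?thesis using w by (simp add: vec_eq_iff)
    qed
  qed
  then show ?thesis by simp
qed

lemma simplex_coords_real:
  fixes A :: "int^'n::finite^'d::finite"
  assumes d: "dual_basis A \<sigma> \<delta>"
  shows "simplex_coords A \<sigma> (b :: real^'d) $ i = (if i \<in> \<sigma> then \<delta> i \<bullet> b else 0)"
proof -
  have "simplex_coords A \<sigma> b = (\<chi> i. if i \<in> \<sigma> then \<delta> i \<bullet> b else 0)"
    unfolding simplex_coords_def
  proof (rule the_equality)
    show "(\<forall>j. j \<notin> \<sigma> \<longrightarrow> (\<chi> i. if i \<in> \<sigma> then \<delta> i \<bullet> b else 0) $ j = 0) \<and>
        (\<Sum>i\<in>\<sigma>. (\<chi> i. if i \<in> \<sigma> then \<delta> i \<bullet> b else 0) $ i *s acol A i) = b"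
      using dual_basisD(2)[OF d, of b] by (simp add: scalar_mult_eq_scaleR)
    fix w :: "real^'n" assume w: "(\<forall>j. j \<notin> \<sigma> \<longrightarrow> w$j = 0) \<and> (\<Sum>i\<in>\<sigma>. w$i *s acol A i) = b"
    show "w = (\<chi> i. if i \<in> \<sigma> then \<delta> i \<bullet> b else 0)"
    proof -
      have "\<delta> i \<bullet> b = w$i" if "i \<in> \<sigma>" for i
        using inner_coord[OF d that, of "\<lambda>i. w$i"] w by (metis (no_types, lifting) scalar_mult_eq_scaleR sum.cong)
      then show ?thesis using w by (simp add: vec_eq_iff)
    qed
  qed
  then show ?thesis by simp
qed

lemma amul_split: "amul A v = (\<Sum>i\<in>\<sigma>. v$i *s acol A i) + (\<Sum>l\<in>-\<sigma>. v$l *s acol A l)"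
  unfolding amul_def by (subst sum.union_disjoint[symmetric]) (auto simp: Compl_partition)

lemma series_exponent_props:
  fixes A :: "int^'n::finite^'d::finite"
  assumes d: "dual_basis A \<sigma> \<delta>"
  shows "amul A (series_exponent A \<beta> \<sigma> k) = \<beta>"
    and "\<And>l. l \<notin> \<sigma> \<Longrightarrow> series_exponent A \<beta> \<sigma> k $ l = of_nat (k$l)"
    and "\<And>i. i \<in> \<sigma> \<Longrightarrow> series_exponent A \<beta> \<sigma> k $ i = cdot (\<delta> i) (\<beta> - (\<Sum>j\<in>-\<sigma>. of_nat (k$j) *s acol A j))"
proof -
  let ?b = "\<beta> - (\<Sum>j\<in>-\<sigma>. of_nat (k$j) *s acol A j)"
  define v where "v = (\<chi> i. if i \<in> \<sigma> then cdot (\<delta> i) ?b else of_nat (k$i))"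
  have off: "(\<Sum>l\<in>-\<sigma>. w$l *s acol A l) = (\<Sum>j\<in>-\<sigma>. of_nat (k$j) *s acol A j :: complex^'d)"
    if "\<And>l. l \<notin> \<sigma> \<Longrightarrow> w$l = of_nat (k$l)" for w :: "complex^'n"
    using that by (intro sum.cong) auto
  have v: "amul A v = \<beta>"
    using off[of v] cdot_expand[OF d, of ?b] by (simp add: amul_split[of A _ \<sigma>] v_def)
  have "series_exponent A \<beta> \<sigma> k = v"
    unfolding series_exponent_def amul_def[symmetric]
  proof (rule the_equality)
    show "amul A v = \<beta> \<and> (\<forall>j. j \<notin> \<sigma> \<longrightarrow> v$j = of_nat (k$j))" using v by (simp add: v_def)
    fix w assume w: "amul A w = \<beta> \<and> (\<forall>j. j \<notin> \<sigma> \<longrightarrow> w$j = of_nat (k$j))"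
    then have "(\<Sum>i\<in>\<sigma>. w$i *s acol A i) = ?b"
    proof -
      have "(\<Sum>l\<in>-\<sigma>. w$l *s acol A l) = (\<Sum>j\<in>-\<sigma>. of_nat (k$j) *s acol A j)"
        by (rule off) (use w in blast)
      then show ?thesis using w amul_split[of A w \<sigma>] by (simp only: eq_diff_eq)
    qed
    then have "cdot (\<delta> i) ?b = w$i" if "i \<in> \<sigma>" for i
      using cdot_coord[OF d that, of "\<lambda>i. w$i"] by simp
    then show "w = v" using w by (auto simp: vec_eq_iff v_def)
  qed
  then show "amul A (series_exponent A \<beta> \<sigma> k) = \<beta>"
    and "\<And>l. l \<notin> \<sigma> \<Longrightarrow> series_exponent A \<beta> \<sigma> k $ l = of_nat (k$l)"
    and "\<And>i. i \<in> \<sigma> \<Longrightarrow> series_exponent A \<beta> \<sigma> k $ i = cdot (\<delta> i) ?b"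
    using v by (simp_all add: v_def)
qed

text \<open>Pairing A u = 0 with the dual vector of i solves for u_i; this parametrizes the kernel
  by the coordinates outside \<sigma>.\<close>

lemma zker_coord:
  fixes A :: "int^'n::finite^'d::finite"
  assumes d: "dual_basis A \<sigma> \<delta>" and u: "u \<in> zker A" and i: "i \<in> \<sigma>"
  shows "real_of_int (u$i) = - (\<Sum>l\<in>-\<sigma>. real_of_int (u$l) * (\<delta> i \<bullet> acol A l))"
proof -
  have "(\<Sum>l\<in>UNIV. real_of_int (u$l) *\<^sub>R acol A l) = (0 :: real^'d)"
  proof (subst vec_eq_iff, rule allI)
    fix r
    have "(\<Sum>l\<in>UNIV. real_of_int (u$l) *\<^sub>R acol A l :: real^'d) $ r = of_int ((A *v u) $ r)"
      by (simp add: matrix_vector_mult_def mult.commute)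
    then show "(\<Sum>l\<in>UNIV. real_of_int (u$l) *\<^sub>R acol A l :: real^'d) $ r = 0 $ r"
      using u by (simp add: zker_def)
  qed
  moreover have "(\<Sum>l\<in>UNIV. real_of_int (u$l) *\<^sub>R acol A l :: real^'d) =
      (\<Sum>l\<in>\<sigma>. real_of_int (u$l) *\<^sub>R acol A l) + (\<Sum>l\<in>-\<sigma>. real_of_int (u$l) *\<^sub>R acol A l)"
    by (subst sum.union_disjoint[symmetric]) (auto simp: Compl_partition)
  ultimately have "\<delta> i \<bullet> (\<Sum>l\<in>\<sigma>. real_of_int (u$l) *\<^sub>R acol A l) + \<delta> i \<bullet> (\<Sum>l\<in>-\<sigma>. real_of_int (u$l) *\<^sub>R acol A l) = 0"
    by (simp add: inner_add_right[symmetric])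
  then have "real_of_int (u$i) + (\<Sum>l\<in>-\<sigma>. real_of_int (u$l) * (\<delta> i \<bullet> acol A l)) = 0"
    unfolding inner_coord[OF d i] by (simp add: inner_sum_right)
  then show ?thesis by linarith
qed

lemma zker_determined:
  fixes A :: "int^'n::finite^'d::finite"
  assumes d: "dual_basis A \<sigma> \<delta>" and u: "u \<in> zker A" "\<And>l. l \<notin> \<sigma> \<Longrightarrow> u$l = 0"
  shows "u = 0"
proof -
  have "real_of_int (u$i) = 0" if "i \<in> \<sigma>" for i
    using zker_coord[OF d u(1) that] u(2) by simp
  then show ?thesis using u(2) by (auto simp: vec_eq_iff)
qed

text \<open>The simplex with apex 0 is the image of the standard simplex, of volume 1 / d!, under
  the linear map L taking unit vectors to the columns in \<sigma>, and L scales volumes by the index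
  of the lattice that these columns generate.\<close>

lemma simplex_volume:
  fixes A :: "int^'n::finite^'d::finite" and R :: "(int^'d) set"
  assumes d: "dual_basis A \<sigma> \<delta>" and card: "card \<sigma> = CARD('d)"
    and R: "\<And>z. \<exists>!\<omega>. \<omega> \<in> R \<and> z - \<omega> \<in> lattice_of A \<sigma>"
  shows "finite R" and "normalized_volume A \<sigma> = real (card R)"
proof -
  obtain e where e: "bij_betw e (UNIV :: 'd set) \<sigma>"
    using finite_same_card_bij[of "UNIV :: 'd set" \<sigma>] card by auto
  have es: "e r \<in> \<sigma>" for r using e by (auto simp: bij_betw_def)
  have inje: "e r = e s \<longleftrightarrow> r = s" for r s using e by (auto simp: bij_betw_def inj_eq)
  define L :: "real^'d \<Rightarrow> real^'d" where "L y = (\<Sum>r\<in>UNIV. y$r *\<^sub>R acol A (e r))" for y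
  define g where "g y = (\<chi> r. \<delta> (e r) \<bullet> y)" for y :: "real^'d"
  have L: "linear L"
    by (rule linearI) (simp_all add: L_def algebra_simps sum.distrib scaleR_right.sum)
  have g: "linear g"
    by (rule linearI) (simp_all add: g_def vec_eq_iff inner_add_right)
  have sum\<sigma>: "(\<Sum>r\<in>UNIV. f (e r)) = sum f \<sigma>" for f :: "'n \<Rightarrow> real^'d"
    by (rule sum.reindex_bij_betw[OF e])
  have Lg: "L (g x) = x" for x
    using dual_basisD(2)[OF d, of x] sum\<sigma>[of "\<lambda>i. (\<delta> i \<bullet> x) *\<^sub>R acol A i"] by (simp add: L_def g_def)
  have gL: "g (L x) = x" for x
  proof (subst vec_eq_iff, rule allI)
    fix s
    have "g (L x) $ s = (\<Sum>r\<in>UNIV. x$r * (\<delta> (e s) \<bullet> acol A (e r)))"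
      by (simp add: g_def L_def inner_sum_right)
    also have "\<dots> = (\<Sum>r\<in>UNIV. if r = s then x$r else 0)"
      using dual_basisD(1)[OF d es es] by (intro sum.cong) (auto simp: inje)
    finally show "g (L x) $ s = x $ s" by simp
  qed
  have Lr: "L (rvec y) = rvec (\<Sum>r\<in>UNIV. y$r *s acol A (e r))" for y
    by (simp add: vec_eq_iff L_def)
  have lat: "lattice_of A \<sigma> = {z. \<exists>y. rvec z = L (rvec y)}"
  proof (intro equalityI subsetI)
    fix z assume "z \<in> lattice_of A \<sigma>"
    then obtain w where w: "z = (\<Sum>i\<in>\<sigma>. w i *s acol A i)" by (auto simp: lattice_of_def)
    also have "\<dots> = (\<Sum>r\<in>UNIV. w (e r) *s acol A (e r))"
      by (rule sum.reindex_bij_betw[OF e, symmetric])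
    finally have "rvec z = L (rvec (\<chi> r. w (e r)))" by (simp add: Lr)
    then show "z \<in> {z. \<exists>y. rvec z = L (rvec y)}" by blast
  next
    fix z assume "z \<in> {z. \<exists>y. rvec z = L (rvec y)}"
    then obtain y where "z = (\<Sum>r\<in>UNIV. y$r *s acol A (e r))" unfolding Lr by auto
    also have "\<dots> = (\<Sum>r\<in>UNIV. y$(inv_into UNIV e (e r)) *s acol A (e r))"
      using e by (intro sum.cong) (auto simp: bij_betw_def)
    also have "\<dots> = (\<Sum>i\<in>\<sigma>. y$(inv_into UNIV e i) *s acol A i)"
      by (rule sum.reindex_bij_betw[OF e])
    finally show "z \<in> lattice_of A \<sigma>"
      unfolding lattice_of_def by (intro CollectI exI[of _ "\<lambda>i. y$(inv_into UNIV e i)"] conjI TrueI)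
  qed
  have Lint: "\<exists>z. rvec z = L (rvec y)" for y using Lr by metis
  note idx = lattice_index[OF L g Lg gL lat Lint R]
  show "finite R" by (rule idx(1))
  let ?S = "convex hull (insert 0 Basis) :: (real^'d) set"
  have Sc: "compact ?S" by (intro finite_imp_compact_convex_hull) auto
  have S: "?S \<in> sets borel" using Sc by (intro borel_closed compact_imp_closed)
  have LS: "L ` ?S = convex hull (acol A ` \<sigma> \<union> {0})"
  proof -
    have "L ` ?S = convex hull (L ` insert 0 Basis)" by (rule convex_hull_linear_image[OF L])
    also have "L ` insert 0 Basis = insert 0 (range (\<lambda>r. L (axis r 1)))"
      using linear_0[OF L] by (auto simp: Basis_vec_def)
    also have "(\<lambda>r. L (axis r 1)) = (\<lambda>r. acol A (e r))"
    proof
      fix r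
      have "L (axis r 1) = (\<Sum>s\<in>UNIV. if s = r then acol A (e s) else 0)"
        unfolding L_def by (rule sum.cong) (auto simp: axis_def vec_eq_iff)
      then show "L (axis r 1) = acol A (e r)" by simp
    qed
    also have "range (\<lambda>r. acol A (e r)) = acol A ` \<sigma>" using e by (auto simp: bij_betw_def)
    finally show ?thesis by simp
  qed
  have "closed (convex hull (acol A ` \<sigma> \<union> {0}) :: (real^'d) set)"
    by (intro compact_imp_closed finite_imp_compact_convex_hull) auto
  then have b: "(convex hull (acol A ` \<sigma> \<union> {0}) :: (real^'d) set) \<in> sets borel" by simp
  have "emeasure lborel (convex hull (acol A ` \<sigma> \<union> {0}) :: (real^'d) set) = of_nat (card R) * emeasure lborel ?S"
    using linear_volume_ratio[OF L g Lg gL S] by (simp only: LS idx(2))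
  also have "\<dots> = ennreal (real (card R) * (1 / fact CARD('d)))"
    by (simp add: emeasure_std_simplex ennreal_of_nat_eq_real_of_nat ennreal_mult'[symmetric])
  finally have "measure lborel (convex hull (acol A ` \<sigma> \<union> {0}) :: (real^'d) set) = real (card R) * (1 / fact CARD('d))"
    by (simp add: measure_def)
  moreover have "measure lebesgue (convex hull (acol A ` \<sigma> \<union> {0}) :: (real^'d) set) =
      measure lborel (convex hull (acol A ` \<sigma> \<union> {0}) :: (real^'d) set)"
    by (rule measure_completion) (use b in simp)
  ultimately show "normalized_volume A \<sigma> = real (card R)"
    by (simp add: normalized_volume_def)
qed


section \<open>Classes modulo the lattice of a simplex\<close>

lemma lattice_of_diff: "x \<in> lattice_of A \<sigma> \<Longrightarrow> y \<in> lattice_of A \<sigma> \<Longrightarrow> x - y \<in> lattice_of A \<sigma>"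
proof -
  assume "x \<in> lattice_of A \<sigma>" "y \<in> lattice_of A \<sigma>"
  then obtain a b where "x = (\<Sum>i\<in>\<sigma>. a i *s acol A i)" "y = (\<Sum>i\<in>\<sigma>. b i *s acol A i)"
    by (auto simp: lattice_of_def)
  then have "x - y = (\<Sum>i\<in>\<sigma>. (a i - b i) *s acol A i)"
    by (simp add: vec_eq_iff sum_subtractf algebra_simps)
  then show ?thesis unfolding lattice_of_def
    by (intro CollectI exI[of _ "\<lambda>i. a i - b i"] conjI TrueI)
qed

lemma lattice_of_0: "0 \<in> lattice_of A \<sigma>"
  unfolding lattice_of_def by (intro CollectI exI[of _ "\<lambda>_. 0"]) (simp add: vec_eq_iff)

lemma lattice_of_add: "x \<in> lattice_of A \<sigma> \<Longrightarrow> y \<in> lattice_of A \<sigma> \<Longrightarrow> x + y \<in> lattice_of A \<sigma>"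
  using lattice_of_diff[OF _ lattice_of_diff[OF lattice_of_0], of x A \<sigma> y] by simp

lemma lattice_of_scale: "x \<in> lattice_of A \<sigma> \<Longrightarrow> c *s x \<in> lattice_of A \<sigma>"
proof -
  assume "x \<in> lattice_of A \<sigma>"
  then obtain a where "x = (\<Sum>i\<in>\<sigma>. a i *s acol A i)" by (auto simp: lattice_of_def)
  then have "c *s x = (\<Sum>i\<in>\<sigma>. (c * a i) *s acol A i)"
    by (simp add: vec_eq_iff sum_distrib_left algebra_simps)
  then show ?thesis unfolding lattice_of_def
    by (intro CollectI exI[of _ "\<lambda>i. c * a i"] conjI TrueI)
qed

lemma lattice_of_sum: "(\<And>j. j \<in> J \<Longrightarrow> f j \<in> lattice_of A \<sigma>) \<Longrightarrow> (\<Sum>j\<in>J. f j) \<in> lattice_of A \<sigma>"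
  by (induction J rule: infinite_finite_induct) (auto intro: lattice_of_0 lattice_of_add)

lemma lattice_transversal: "\<exists>R. \<forall>z. \<exists>!\<omega>. \<omega> \<in> R \<and> z - \<omega> \<in> lattice_of A \<sigma>"
proof -
  define f where "f z = (SOME \<omega>. z - \<omega> \<in> lattice_of A \<sigma>)" for z
  have f: "z - f z \<in> lattice_of A \<sigma>" for z
    unfolding f_def by (rule someI[of _ z]) (simp add: lattice_of_0)
  have iff: "z - \<omega> \<in> lattice_of A \<sigma> \<longleftrightarrow> z' - \<omega> \<in> lattice_of A \<sigma>" if "z - z' \<in> lattice_of A \<sigma>" for z z' \<omega>
  proof -
    have "z - \<omega> = (z - z') + (z' - \<omega>)" "z' - \<omega> = (z - \<omega>) - (z - z')" by simp_all
    then show ?thesis using that lattice_of_add lattice_of_diff by metis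
  qed
  show ?thesis
  proof (intro exI[of _ "range f"] allI)
    fix z
    show "\<exists>!\<omega>. \<omega> \<in> range f \<and> z - \<omega> \<in> lattice_of A \<sigma>"
    proof (rule ex1I[of _ "f z"])
      fix \<omega> assume "\<omega> \<in> range f \<and> z - \<omega> \<in> lattice_of A \<sigma>"
      then obtain y where y: "\<omega> = f y" "z - f y \<in> lattice_of A \<sigma>" by blast
      have "z - y = (z - f y) - (y - f y)" by simp
      then have "z - y \<in> lattice_of A \<sigma>" using lattice_of_diff[OF y(2) f[of y]] by simp
      then show "\<omega> = f z" using iff[of z y] by (simp add: y(1) f_def)
    qed (use f in auto)
  qed
qed

text \<open>Among card R + 1 multiples of z two lie in one class, so some positive number at most
  card R carries z into the lattice. The factorial of card R is a multiple of all such numbers and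
  does not depend on z.\<close>

lemma lattice_multiple:
  fixes A :: "int^'n::finite^'d::finite"
  assumes d: "dual_basis A \<sigma> \<delta>" and card: "card \<sigma> = CARD('d)"
  shows "\<exists>D::nat. 1 \<le> D \<and> (\<forall>z. int D *s z \<in> lattice_of A \<sigma>)"
proof -
  obtain R where R: "\<And>z. \<exists>!\<omega>. \<omega> \<in> R \<and> z - \<omega> \<in> lattice_of A \<sigma>"
    using lattice_transversal[of A \<sigma>] by blast
  have fin: "finite R" by (rule simplex_volume(1)[OF d card R])
  obtain f where f: "\<And>z. f z \<in> R \<and> z - f z \<in> lattice_of A \<sigma>" using R by metis
  show ?thesis
  proof (intro exI[of _ "fact (card R)"] conjI allI)
    fix z
    have "\<not> inj_on (\<lambda>n. f (int n *s z)) {..card R}"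
    proof (rule pigeonhole)
      have "card ((\<lambda>n. f (int n *s z)) ` {..card R}) \<le> card R"
        by (rule card_mono[OF fin]) (use f in auto)
      then show "card ((\<lambda>n. f (int n *s z)) ` {..card R}) < card {..card R}" by simp
    qed
    then obtain n n' where n: "n < n'" "n' \<le> card R" "f (int n *s z) = f (int n' *s z)"
      by (auto simp: inj_on_def) (metis linorder_neqE_nat)
    have "int n' *s z - int n *s z \<in> lattice_of A \<sigma>"
    proof -
      have "int n' *s z - int n *s z = (int n' *s z - f (int n' *s z)) - (int n *s z - f (int n *s z))"
        using n(3) by simp
      then show ?thesis using f lattice_of_diff by metis
    qed
    moreover have "int n' *s z - int n *s z = int (n' - n) *s z"
      using n(1) by (simp add: vec_eq_iff of_nat_diff algebra_simps)
    ultimately have m: "int (n' - n) *s z \<in> lattice_of A \<sigma>" by simp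
    have "n' - n dvd fact (card R)" using n by (intro dvd_fact) auto
    then obtain c where c: "fact (card R) = (n' - n) * c" by (elim dvdE)
    have "int (fact (card R)) *s z = int c *s (int (n' - n) *s z)"
      unfolding c by (simp add: vec_eq_iff mult_ac)
    then show "int (fact (card R)) *s z \<in> lattice_of A \<sigma>" using lattice_of_scale[OF m] by simp
  qed simp
qed

definition kcol :: "int^'n::finite^'d::finite \<Rightarrow> 'n set \<Rightarrow> nat^'n \<Rightarrow> int^'d" where
  "kcol A \<sigma> k = (\<Sum>j\<in>-\<sigma>. int (k$j) *s acol A j)"

lemma same_class_iff: "same_class A \<sigma> k k' \<longleftrightarrow> kcol A \<sigma> k - kcol A \<sigma> k' \<in> lattice_of A \<sigma>"
  by (simp add: same_class_def kcol_def lattice_of_def)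

lemma kcol_surj:
  fixes A :: "int^'n::finite^'d::finite"
  assumes lattice: "range (\<lambda>u::int^'n. A *v u) = UNIV"
    and d: "dual_basis A \<sigma> \<delta>" and card: "card \<sigma> = CARD('d)"
  shows "\<exists>k\<in>off_exponents \<sigma>. z - kcol A \<sigma> k \<in> lattice_of A \<sigma>"
proof -
  obtain u where u: "z = A *v u" using lattice by (metis rangeE UNIV_I)
  obtain D :: nat where D: "1 \<le> D" "\<And>z. int D *s z \<in> lattice_of A \<sigma>"
    using lattice_multiple[OF d card] by blast
  \<comment> \<open>Adding D |u_j| makes the coordinate nonnegative without changing the
    class.\<close>
  define k where "k = (\<chi> j. if j \<in> \<sigma> then 0 else nat (u$j + int D * \<bar>u$j\<bar>))"
  have k: "int (k$j) = u$j + int D * \<bar>u$j\<bar>" if "j \<notin> \<sigma>" for j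
  proof -
    have "1 * \<bar>u$j\<bar> \<le> int D * \<bar>u$j\<bar>" using D(1) by (intro mult_right_mono) auto
    then show ?thesis using that by (simp add: k_def)
  qed
  have "z = (\<Sum>j\<in>UNIV. u$j *s acol A j)"
    by (simp add: u vec_eq_iff matrix_vector_mult_def mult.commute)
  also have "\<dots> = (\<Sum>j\<in>\<sigma>. u$j *s acol A j) + (\<Sum>j\<in>-\<sigma>. u$j *s acol A j)"
    by (subst sum.union_disjoint[symmetric]) (auto simp: Compl_partition)
  finally have "z - kcol A \<sigma> k = (\<Sum>j\<in>\<sigma>. u$j *s acol A j) + (\<Sum>j\<in>-\<sigma>. u$j *s acol A j - int (k$j) *s acol A j)"
    by (simp add: kcol_def sum_subtractf)
  also have "(\<Sum>j\<in>-\<sigma>. u$j *s acol A j - int (k$j) *s acol A j) = (\<Sum>j\<in>-\<sigma>. int D *s ((- \<bar>u$j\<bar>) *s acol A j))"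
    by (rule sum.cong) (auto simp: k vec_eq_iff algebra_simps)
  finally have "z - kcol A \<sigma> k = (\<Sum>j\<in>\<sigma>. u$j *s acol A j) + (\<Sum>j\<in>-\<sigma>. int D *s ((- \<bar>u$j\<bar>) *s acol A j))" .
  moreover have "(\<Sum>j\<in>\<sigma>. u$j *s acol A j) \<in> lattice_of A \<sigma>"
    unfolding lattice_of_def by (intro CollectI exI[of _ "\<lambda>j. u$j"] conjI TrueI refl)
  ultimately have "z - kcol A \<sigma> k \<in> lattice_of A \<sigma>"
    by (simp only:) (rule lattice_of_add, assumption, rule lattice_of_sum, rule D(2))
  moreover have "k \<in> off_exponents \<sigma>" by (simp add: off_exponents_def k_def)
  ultimately show ?thesis by blast
qed

text \<open>Every class of Z^d modulo the lattice is reached by nonnegative exponents, so the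
  vectors \<open>kcol A \<sigma> k\<close> of the representatives form a transversal, to which the
  volume formula applies.\<close>

lemma representatives_card:
  fixes A :: "int^'n::finite^'d::finite"
  assumes lattice: "range (\<lambda>u::int^'n. A *v u) = UNIV"
    and d: "dual_basis A \<sigma> \<delta>" and card: "card \<sigma> = CARD('d)" and \<Omega>: "representatives A \<sigma> \<Omega>"
  shows "finite \<Omega>" and "normalized_volume A \<sigma> = real (card \<Omega>)"
proof -
  have sub: "\<Omega> \<subseteq> off_exponents \<sigma>"
    and ex1: "\<And>k. k \<in> off_exponents \<sigma> \<Longrightarrow> \<exists>!k'. k' \<in> \<Omega> \<and> same_class A \<sigma> k k'"
    using \<Omega> by (auto simp: representatives_def)
  have uniq: "k = k'" if "k \<in> \<Omega>" "k' \<in> \<Omega>" "kcol A \<sigma> k - kcol A \<sigma> k' \<in> lattice_of A \<sigma>" for k k'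
  proof -
    have "same_class A \<sigma> k k" "same_class A \<sigma> k k'"
      using that lattice_of_0[of A \<sigma>] by (simp_all add: same_class_iff)
    then show ?thesis using ex1[of k] sub that by blast
  qed
  have inj: "inj_on (kcol A \<sigma>) \<Omega>"
    using uniq lattice_of_0[of A \<sigma>] by (auto simp: inj_on_def)
  have R: "\<exists>!\<omega>. \<omega> \<in> kcol A \<sigma> ` \<Omega> \<and> z - \<omega> \<in> lattice_of A \<sigma>" for z
  proof -
    obtain k where k: "k \<in> off_exponents \<sigma>" "z - kcol A \<sigma> k \<in> lattice_of A \<sigma>"
      using kcol_surj[OF lattice d card] by blast
    obtain k' where k': "k' \<in> \<Omega>" "kcol A \<sigma> k - kcol A \<sigma> k' \<in> lattice_of A \<sigma>"
      using ex1[OF k(1)] by (auto simp: same_class_iff)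
    have "z - kcol A \<sigma> k' = (z - kcol A \<sigma> k) + (kcol A \<sigma> k - kcol A \<sigma> k')" by simp
    then have zk': "z - kcol A \<sigma> k' \<in> lattice_of A \<sigma>" using lattice_of_add k(2) k'(2) by metis
    show ?thesis
    proof (rule ex1I[of _ "kcol A \<sigma> k'"])
      fix \<omega> assume \<omega>: "\<omega> \<in> kcol A \<sigma> ` \<Omega> \<and> z - \<omega> \<in> lattice_of A \<sigma>"
      then obtain k'' where k'': "k'' \<in> \<Omega>" "\<omega> = kcol A \<sigma> k''" by blast
      have "kcol A \<sigma> k'' - kcol A \<sigma> k' = (z - kcol A \<sigma> k') - (z - kcol A \<sigma> k'')" by simp
      then have "kcol A \<sigma> k'' - kcol A \<sigma> k' \<in> lattice_of A \<sigma>" using lattice_of_diff zk' \<omega> k''(2) by metis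
      then show "\<omega> = kcol A \<sigma> k'" using uniq k'' k' by blast
    qed (use k' zk' in blast)
  qed
  have "finite (kcol A \<sigma> ` \<Omega>)" by (rule simplex_volume(1)[OF d card R])
  then show "finite \<Omega>" using inj by (rule finite_imageD)
  show "normalized_volume A \<sigma> = real (card \<Omega>)"
    using simplex_volume(2)[OF d card R] by (simp add: card_image inj)
qed

lemma representatives_exist: "\<exists>\<Omega>. representatives A \<sigma> \<Omega>"
proof -
  obtain R where R: "\<And>z. \<exists>!\<omega>. \<omega> \<in> R \<and> z - \<omega> \<in> lattice_of A \<sigma>"
    using lattice_transversal[of A \<sigma>] by blast
  define c where "c k = (THE \<omega>. \<omega> \<in> R \<and> kcol A \<sigma> k - \<omega> \<in> lattice_of A \<sigma>)" for k
  have c: "c k \<in> R \<and> kcol A \<sigma> k - c k \<in> lattice_of A \<sigma>" for k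
    unfolding c_def by (rule theI') (rule R)
  have ceq: "same_class A \<sigma> k k' \<longleftrightarrow> c k = c k'" for k k'
  proof
    assume "same_class A \<sigma> k k'"
    then have *: "kcol A \<sigma> k - kcol A \<sigma> k' \<in> lattice_of A \<sigma>" by (simp add: same_class_iff)
    have "kcol A \<sigma> k - c k' = (kcol A \<sigma> k - kcol A \<sigma> k') + (kcol A \<sigma> k' - c k')" by simp
    then have "kcol A \<sigma> k - c k' \<in> lattice_of A \<sigma>" using lattice_of_add[OF *] c[of k'] by metis
    then show "c k = c k'" using R[of "kcol A \<sigma> k"] c[of k] c[of k'] by blast
  next
    assume eq: "c k = c k'"
    have "kcol A \<sigma> k - kcol A \<sigma> k' = (kcol A \<sigma> k - c k) - (kcol A \<sigma> k' - c k')" using eq by simp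
    then show "same_class A \<sigma> k k'" unfolding same_class_iff using lattice_of_diff c[of k] c[of k'] by metis
  qed
  define f where "f \<omega> = (SOME k. k \<in> off_exponents \<sigma> \<and> c k = \<omega>)" for \<omega>
  have f: "f (c k) \<in> off_exponents \<sigma> \<and> c (f (c k)) = c k" if "k \<in> off_exponents \<sigma>" for k
    unfolding f_def by (rule someI[of _ k]) (use that in simp)
  have "representatives A \<sigma> ((\<lambda>k. f (c k)) ` off_exponents \<sigma>)"
    unfolding representatives_def
  proof (intro conjI ballI)
    fix k assume k: "k \<in> off_exponents \<sigma>"
    show "\<exists>!k'. k' \<in> (\<lambda>k. f (c k)) ` off_exponents \<sigma> \<and> same_class A \<sigma> k k'"
    proof (rule ex1I[of _ "f (c k)"])
      show "f (c k) \<in> (\<lambda>k. f (c k)) ` off_exponents \<sigma> \<and> same_class A \<sigma> k (f (c k))"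
        using k f[OF k] by (simp add: ceq)
      fix k' assume "k' \<in> (\<lambda>k. f (c k)) ` off_exponents \<sigma> \<and> same_class A \<sigma> k k'"
      then obtain k0 where "k0 \<in> off_exponents \<sigma>" "k' = f (c k0)" "c k = c k'" by (auto simp: ceq)
      then show "k' = f (c k)" using f[of k0] by simp
    qed
  qed (use f in auto)
  then show ?thesis by blast
qed

section \<open>Convergence for facets of \<open>\<Gamma>\<^sub>A\<close> that are simplices\<close>

locale simplicial_facet =
  fixes A :: "int^'n::finite^'d::finite" and \<tau> :: "'n set" and \<delta> :: "'n \<Rightarrow> real^'d"
  assumes dual: "dual_basis A \<tau> \<delta>"
    and below: "\<And>l. l \<notin> \<tau> \<Longrightarrow> (\<Sum>i\<in>\<tau>. \<delta> i \<bullet> acol A l) < 1"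
begin

text \<open>The strict inequality \<open>below\<close> makes the Gamma factors decay faster than any
  geometric sequence in the exponents outside \<tau>, while the powers of the variables grow only
  geometrically in them; hence there is a majorant for every B.\<close>

lemma gseries_full: "gseries \<tau> UNIV (zker A)"
proof
  fix v :: "complex^'n" and B :: real
  assume v: "integral_off \<tau> v" and B: "0 \<le> B"
  define b where "b l i = \<delta> i \<bullet> acol A l" for l i
  define c where "c l = (\<Sum>i\<in>\<tau>. \<bar>b l i\<bar>)" for l
  \<comment> \<open>B bounds |x_l|, and \<open>exp (B * c l)\<close> bounds the effect of one unit
    of the exponent k_l on the powers of the variables in \<tau>.\<close>
  define L where "L l = B * exp (B * c l)" for l
  \<comment> \<open>On the rest of the kernel some factor \<open>hbound\<close> outside \<tau> is
    0.\<close>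
  define W where "W = {u \<in> zker A. \<forall>l. l \<notin> \<tau> \<longrightarrow> v$l + of_int (u$l) \<in> \<nat>}"
  define k where "k u l = nat \<lfloor>Re (v$l + of_int (u$l))\<rfloor>" for u :: "int^'n" and l
  define f where "f u = (\<Prod>i\<in>UNIV. norm (rGamma (v$i + of_int (u$i) + 1))) * (\<Prod>l\<in>-\<tau>. L l ^ k u l)" for u
  have b1: "(\<Sum>i\<in>\<tau>. b l i) < 1" if "l \<notin> \<tau>" for l using below[OF that] by (simp add: b_def)
  have "f summable_on {u. (\<forall>l. l \<notin> \<tau> \<longrightarrow> v$l + of_int (u$l) \<in> \<nat>) \<and>
                     (\<forall>i\<in>\<tau>. real_of_int (u$i) = - (\<Sum>l\<in>-\<tau>. real_of_int (u$l) * b l i))}"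
  proof -
    have 1: "\<And>l. l \<notin> \<tau> \<Longrightarrow> (\<Sum>i\<in>\<tau>. b l i) \<le> 1" using b1 by (auto intro: less_imp_le)
    have L: "(\<forall>l. 0 \<le> L l) \<and> (\<forall>l. l \<notin> \<tau> \<longrightarrow> (\<Sum>i\<in>\<tau>. b l i) = 1 \<longrightarrow> K * L l < 1)" for K
      using B by (auto simp: L_def dest: b1)
    show ?thesis unfolding f_def k_def using gamma_terms_summable[of \<tau> b v, OF 1] L by blast
  qed
  then have fW: "f summable_on W"
    by (rule summable_on_subset_banach) (use zker_coord[OF dual] in \<open>auto simp: W_def b_def\<close>)
  define C where "C = exp (B * (\<Sum>i\<in>\<tau>. norm (v$i) + (\<Sum>l\<in>-\<tau>. norm (v$l) * \<bar>b l i\<bar>)))"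
  have bound: "(\<Prod>l\<in>UNIV. hbound \<tau> l (v$l + of_int (u$l)) B) \<le> C * f u" if u: "u \<in> W" for u
  proof -
    have kN: "v$l + of_int (u$l) = of_nat (k u l)" if "l \<notin> \<tau>" for l
    proof -
      have "v$l + of_int (u$l) \<in> \<nat>" using u that by (simp add: W_def)
      then obtain m where "v$l + of_int (u$l) = of_nat m" by (rule Nats_cases)
      then show ?thesis by (simp add: k_def)
    qed
    have ul: "\<bar>real_of_int (u$l)\<bar> \<le> real (k u l) + norm (v$l)" if "l \<notin> \<tau>" for l
    proof -
      have "of_int (u$l) = of_nat (k u l) - v$l" using kN[OF that] by (simp add: algebra_simps)
      then have "norm (of_int (u$l) :: complex) \<le> norm (of_nat (k u l) :: complex) + norm (v$l)"
        using norm_triangle_ineq4 by metis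
      then show ?thesis by simp
    qed
    have "(\<Sum>i\<in>\<tau>. norm (v$i + of_int (u$i))) \<le>
        (\<Sum>i\<in>\<tau>. norm (v$i) + (\<Sum>l\<in>-\<tau>. (real (k u l) + norm (v$l)) * \<bar>b l i\<bar>))"
    proof (rule sum_mono)
      fix i assume i: "i \<in> \<tau>"
      have "norm (v$i + of_int (u$i)) \<le> norm (v$i) + \<bar>real_of_int (u$i)\<bar>"
        using norm_triangle_ineq[of "v$i" "of_int (u$i)"] by simp
      also have "real_of_int (u$i) = - (\<Sum>l\<in>-\<tau>. real_of_int (u$l) * b l i)"
        using zker_coord[OF dual _ i] u by (simp add: W_def b_def)
      also have "\<bar>- (\<Sum>l\<in>-\<tau>. real_of_int (u$l) * b l i)\<bar> \<le> (\<Sum>l\<in>-\<tau>. (real (k u l) + norm (v$l)) * \<bar>b l i\<bar>)"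
        unfolding abs_minus_cancel
        by (rule order_trans[OF sum_abs sum_mono]) (auto simp: abs_mult intro!: mult_right_mono ul)
      finally show "norm (v$i + of_int (u$i)) \<le> norm (v$i) + (\<Sum>l\<in>-\<tau>. (real (k u l) + norm (v$l)) * \<bar>b l i\<bar>)"
        by simp
    qed
    also have "\<dots> = (\<Sum>i\<in>\<tau>. norm (v$i) + (\<Sum>l\<in>-\<tau>. norm (v$l) * \<bar>b l i\<bar>)) + (\<Sum>l\<in>-\<tau>. real (k u l) * c l)"
    proof -
      have "(\<Sum>l\<in>-\<tau>. real (k u l) * c l) = (\<Sum>i\<in>\<tau>. \<Sum>l\<in>-\<tau>. real (k u l) * \<bar>b l i\<bar>)"
        unfolding c_def sum_distrib_left by (rule sum.swap)
      then show ?thesis by (simp add: sum.distrib algebra_simps)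
    qed
    finally have "exp (B * (\<Sum>i\<in>\<tau>. norm (v$i + of_int (u$i)))) \<le>
        exp (B * ((\<Sum>i\<in>\<tau>. norm (v$i) + (\<Sum>l\<in>-\<tau>. norm (v$l) * \<bar>b l i\<bar>)) + (\<Sum>l\<in>-\<tau>. real (k u l) * c l)))"
      using B by (simp add: mult_left_mono)
    also have "\<dots> = C * (\<Prod>l\<in>-\<tau>. exp (B * c l) ^ k u l)"
      by (simp add: C_def algebra_simps exp_add exp_sum sum_distrib_left exp_of_nat_mult[symmetric])
    finally have E: "(\<Prod>i\<in>\<tau>. exp (norm (v$i + of_int (u$i)) * B)) \<le> C * (\<Prod>l\<in>-\<tau>. exp (B * c l) ^ k u l)"
      by (simp add: exp_sum sum_distrib_left mult.commute)
    let ?g = "\<lambda>l. norm (rGamma (v$l + of_int (u$l) + 1))"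
    have split: "(\<Prod>l\<in>UNIV. h l) = (\<Prod>l\<in>\<tau>. h l) * (\<Prod>l\<in>-\<tau>. h l)" for h :: "'n \<Rightarrow> real"
      by (subst prod.union_disjoint[symmetric]) (auto simp: Compl_partition)
    have "(\<Prod>l\<in>UNIV. hbound \<tau> l (v$l + of_int (u$l)) B) =
        (\<Prod>i\<in>\<tau>. exp (norm (v$i + of_int (u$i)) * B) * ?g i) * (\<Prod>l\<in>-\<tau>. B ^ k u l * ?g l)"
      unfolding split using u
      by (intro arg_cong2[where f = "(*)"] prod.cong) (auto simp: hbound_def W_def k_def)
    also have "\<dots> = (\<Prod>i\<in>\<tau>. exp (norm (v$i + of_int (u$i)) * B)) * ((\<Prod>l\<in>UNIV. ?g l) * (\<Prod>l\<in>-\<tau>. B ^ k u l))"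
      unfolding split[of ?g] prod.distrib by (simp add: mult_ac)
    also have "\<dots> \<le> (C * (\<Prod>l\<in>-\<tau>. exp (B * c l) ^ k u l)) * ((\<Prod>l\<in>UNIV. ?g l) * (\<Prod>l\<in>-\<tau>. B ^ k u l))"
      using E B by (intro mult_right_mono mult_nonneg_nonneg prod_nonneg) auto
    also have "\<dots> = C * f u"
      by (simp add: f_def L_def power_mult_distrib prod.distrib mult_ac)
    finally show ?thesis .
  qed
  have "(\<lambda>u. \<Prod>l\<in>UNIV. hbound \<tau> l (v$l + of_int (u$l)) B) summable_on W"
    by (rule summable_on_comparison_test[OF summable_on_cmult_right[OF fW, of C]])
       (use bound B in \<open>auto intro!: prod_nonneg hbound_nonneg\<close>)
  then show "(\<lambda>u. \<Prod>l\<in>UNIV. hbound \<tau> l (v$l + of_int (u$l)) B) summable_on zker A"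
    by (rule iffD1[OF summable_on_cong_neutral, rotated -1]) (auto simp: W_def hbound_def)
qed

section \<open>Slices with a fixed exponent of one variable\<close>

lemma rGamma_half_minus: "fact n * (1/2) ^ n * norm (rGamma (1/2 :: complex)) \<le> norm (rGamma (1/2 - of_nat n :: complex))"
proof (induction n)
  case (Suc n)
  have "rGamma (1/2 - of_nat (Suc n) :: complex) = (1/2 - of_nat (Suc n)) * rGamma (1/2 - of_nat n)"
    using rGamma_plus1[of "1/2 - of_nat (Suc n) :: complex"] by (simp add: algebra_simps)
  then have eq: "norm (rGamma (1/2 - of_nat (Suc n) :: complex)) = norm (1/2 - of_nat (Suc n) :: complex) * norm (rGamma (1/2 - of_nat n :: complex))"
    by (simp only: norm_mult)
  have "real (Suc n) * (1/2) \<le> norm (1/2 - of_nat (Suc n) :: complex)"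
    using abs_Re_le_cmod[of "1/2 - of_nat (Suc n) :: complex"] by simp
  from mult_mono[OF this Suc] show ?case unfolding eq by (simp add: mult_ac)
qed simp

text \<open>The majorant of the full series is taken with v_j replaced by -1/2. Then the Gamma
  factor of index j is evaluated at half-integers, never vanishes, and can be divided out on each
  slice.\<close>

lemma slice_summable:
  assumes v: "integral_off \<tau> v" and B: "0 \<le> B" and j: "j \<in> \<tau>"
  shows "(\<lambda>u. (\<Prod>l\<in>-{j}. hbound \<tau> l (v$l + of_int (u$l)) B) * exp (norm (of_int (u$j) - 1/2 :: complex) * B) *
      norm (rGamma (of_int (u$j) + 1/2 :: complex))) summable_on zker A"
proof -
  define v' where "v' = (\<chi> l. if l = j then - 1/2 else v$l)"
  have "integral_off \<tau> v'" using v j by (auto simp: integral_off_def v'_def)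
  then have "(\<lambda>u. \<Prod>l\<in>UNIV. hbound \<tau> l (v'$l + of_int (u$l)) B) summable_on zker A"
    by (rule gseries.maj[OF gseries_full]) (rule B)
  moreover have "(\<Prod>l\<in>UNIV. hbound \<tau> l (v'$l + of_int (u$l)) B) =
     (\<Prod>l\<in>-{j}. hbound \<tau> l (v$l + of_int (u$l)) B) * exp (norm (of_int (u$j) - 1/2 :: complex) * B) *
      norm (rGamma (of_int (u$j) + 1/2 :: complex))" for u :: "int^'n"
  proof -
    have "(\<Prod>l\<in>UNIV. hbound \<tau> l (v'$l + of_int (u$l)) B) =
      hbound \<tau> j (v'$j + of_int (u$j)) B * (\<Prod>l\<in>-{j}. hbound \<tau> l (v'$l + of_int (u$l)) B)"
      unfolding Compl_eq_Diff_UNIV by (rule prod.remove) auto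
    also have "(\<Prod>l\<in>-{j}. hbound \<tau> l (v'$l + of_int (u$l)) B) = (\<Prod>l\<in>-{j}. hbound \<tau> l (v$l + of_int (u$l)) B)"
      by (rule prod.cong) (auto simp: v'_def)
    also have "v'$j + of_int (u$j) = of_int (u$j) - 1/2" by (simp add: v'_def)
    finally show ?thesis using j by (simp add: hbound_def algebra_simps)
  qed
  ultimately show ?thesis by simp
qed

lemma gseries_slice:
  assumes j: "j \<in> \<tau>"
  shows "gseries \<tau> (-{j}) {u \<in> zker A. u$j = m}"
proof
  fix v :: "complex^'n" and B :: real
  assume v: "integral_off \<tau> v" and B: "0 \<le> B"
  define c where "c = exp (norm (of_int m - 1/2 :: complex) * B) * norm (rGamma (of_int m + 1/2 :: complex))"
  have c: "c \<noteq> 0"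
  proof -
    have "(of_int m + 1/2 :: complex) \<notin> \<int>\<^sub>\<le>\<^sub>0"
    proof
      assume "(of_int m + 1/2 :: complex) \<in> \<int>\<^sub>\<le>\<^sub>0"
      then obtain i where "(of_int m + 1/2 :: complex) = of_int i" by (auto elim!: nonpos_Ints_cases)
      then have "Re (of_int m + 1/2) = Re (of_int i)" by simp
      then have "real_of_int (2 * m + 1) = real_of_int (2 * i)" by simp
      then have "2 * m + 1 = 2 * i" by (simp only: of_int_eq_iff)
      then show False by presburger
    qed
    then show ?thesis by (simp add: c_def rGamma_eq_zero_iff)
  qed
  have "(\<lambda>u. (\<Prod>l\<in>-{j}. hbound \<tau> l (v$l + of_int (u$l)) B) * exp (norm (of_int (u$j) - 1/2 :: complex) * B) *
      norm (rGamma (of_int (u$j) + 1/2 :: complex))) summable_on {u \<in> zker A. u$j = m}"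
    by (rule summable_on_subset_banach[OF slice_summable[OF v B j]]) auto
  then have "(\<lambda>u. (\<Prod>l\<in>-{j}. hbound \<tau> l (v$l + of_int (u$l)) B) * c) summable_on {u \<in> zker A. u$j = m}"
    by (rule iffD1[OF summable_on_cong, rotated]) (auto simp: c_def)
  then have "(\<lambda>u. (\<Prod>l\<in>-{j}. hbound \<tau> l (v$l + of_int (u$l)) B) * c * inverse c) summable_on {u \<in> zker A. u$j = m}"
    by (rule summable_on_cmult_left)
  then show "(\<lambda>u. \<Prod>l\<in>-{j}. hbound \<tau> l (v$l + of_int (u$l)) B) summable_on {u \<in> zker A. u$j = m}"
    using c by (simp add: mult.assoc)
qed

text \<open>In the summable family of the full series the slice u_j = -n carries the weight
  \<open>w (- n)\<close>, which is at least c n! (e^B0 / 2)^n, so the slice itself must decay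
  accordingly. The radius B0 is at our disposal because the full series has a majorant for every
  radius.\<close>

lemma slice_decay:
  assumes v: "integral_off \<tau> v" and B: "0 \<le> B" and j: "j \<in> \<tau>" and \<theta>: "0 < \<theta>"
  shows "\<exists>C\<ge>0. \<forall>n z. (\<forall>l. norm (z$l) \<le> B) \<longrightarrow>
     norm (gsum \<tau> (-{j}) {u \<in> zker A. u$j = - int n} v z) \<le> C * \<theta> ^ n / fact n"
proof -
  \<comment> \<open>Beyond B, and so large that 2 / e^B0 \<le> \<theta>.\<close>
  define B0 where "B0 = max B (ln (2 / \<theta>))"
  have B0: "0 \<le> B0" "B \<le> B0" using B by (auto simp: B0_def)
  have "2 / \<theta> \<le> exp B0"
    using \<theta> by (metis B0_def exp_le_cancel_iff exp_ln max.cobounded2 divide_pos_pos zero_less_numeral)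
  then have \<theta>0: "2 / exp B0 \<le> \<theta>" using \<theta> by (simp add: field_simps)
  define g where "g u = (\<Prod>l\<in>-{j}. hbound \<tau> l (v$l + of_int (u$l)) B0)" for u :: "int^'n"
  define w where "w m = exp (norm (of_int m - 1/2 :: complex) * B0) * norm (rGamma (of_int m + 1/2 :: complex))" for m
  have g0: "0 \<le> g u" for u unfolding g_def by (intro prod_nonneg hbound_nonneg B0 ballI)
  have w0: "0 \<le> w m" for m by (simp add: w_def)
  have gw: "(\<lambda>u. g u * w (u$j)) summable_on zker A"
    using slice_summable[OF v B0(1) j] by (simp add: g_def w_def mult.assoc)
  define G where "G = infsum (\<lambda>u. g u * w (u$j)) (zker A)"
  have G: "0 \<le> G" unfolding G_def by (intro infsum_nonneg mult_nonneg_nonneg g0 w0)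
  define c where "c = norm (rGamma (1/2 :: complex))"
  have c: "0 < c"
  proof -
    have "(1/2 :: complex) \<notin> \<int>\<^sub>\<le>\<^sub>0"
      by (metis Re_complex_of_real nonpos_Ints_nonpos complex_nonpos_Reals_iff nonpos_Ints_subset_nonpos_Reals subsetD
          Re_divide_numeral one_complex.sel(1) not_le half_gt_zero_iff zero_less_one)
    then show ?thesis by (simp add: c_def rGamma_eq_zero_iff)
  qed
  have w: "exp B0 ^ n * (fact n * (1/2) ^ n * c) \<le> w (- int n)" for n
    unfolding w_def
  proof (rule mult_mono)
    have "real n \<le> norm (of_int (- int n) - 1/2 :: complex)"
      using abs_Re_le_cmod[of "of_int (- int n) - 1/2 :: complex"] by simp
    then have "real n * B0 \<le> norm (of_int (- int n) - 1/2 :: complex) * B0"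
      using B0(1) by (rule mult_right_mono)
    then show "exp B0 ^ n \<le> exp (norm (of_int (- int n) - 1/2 :: complex) * B0)"
      by (simp add: exp_of_nat_mult[symmetric])
    show "fact n * (1/2) ^ n * c \<le> norm (rGamma (of_int (- int n) + 1/2 :: complex))"
      using rGamma_half_minus[of n] by (simp add: c_def)
  qed (use c in auto)
  show ?thesis
  proof (intro exI[of _ "G / c"] conjI allI impI)
    fix n and z :: "complex^'n" assume z: "\<forall>l. norm (z$l) \<le> B"
    let ?U = "{u \<in> zker A. u$j = - int n}"
    have gU: "g summable_on ?U"
      unfolding g_def by (rule gseries.maj[OF gseries_slice[OF j] v B0(1)])
    have "norm (gsum \<tau> (-{j}) ?U v z) \<le> infsum g ?U"
      unfolding g_def
      by (rule gseries.norm_gsum_le[OF gseries_slice[OF j] v B0(1)]) (use z B0 order_trans in blast)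
    moreover have "infsum g ?U * w (- int n) \<le> G"
    proof -
      have "infsum g ?U * w (- int n) = infsum (\<lambda>u. g u * w (u$j)) ?U"
        by (subst infsum_cmult_left'[symmetric]) (auto intro: infsum_cong)
      also have "\<dots> \<le> G" unfolding G_def
        by (rule infsum_mono_neutral) (use gw g0 w0 in \<open>auto intro: summable_on_subset_banach\<close>)
      finally show ?thesis .
    qed
    moreover have "infsum g ?U * (exp B0 ^ n * (fact n * (1/2) ^ n * c)) \<le> infsum g ?U * w (- int n)"
      by (intro mult_left_mono w infsum_nonneg g0)
    ultimately have "norm (gsum \<tau> (-{j}) ?U v z) * (exp B0 ^ n * (fact n * (1/2) ^ n * c)) \<le> G"
      using c by (smt (verit, best) mult_right_mono zero_le_mult_iff exp_ge_zero fact_ge_zero zero_le_power half_gt_zero)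
    then have "norm (gsum \<tau> (-{j}) ?U v z) \<le> (G / c) * (2 / exp B0) ^ n / fact n"
      using c by (simp add: field_simps power_divide)
    also have "\<dots> \<le> (G / c) * \<theta> ^ n / fact n"
      using \<theta>0 G c by (intro divide_right_mono mult_left_mono power_mono) auto
    finally show "norm (gsum \<tau> (-{j}) ?U v z) \<le> G / c * \<theta> ^ n / fact n" .
  qed (use G c in simp)
qed

end

section \<open>Derivatives of Gamma series\<close>

context gseries
begin

lemma gsum_cong_exponent:
  assumes "\<And>l. l \<in> X \<Longrightarrow> v$l = v'$l"
  shows "gsum \<tau> X U v z = gsum \<tau> X U v' z"
  unfolding gsum_def gterm_def using assms by (intro infsum_cong prod.cong) auto

lemma gsum_coord_derivative:
  fixes z :: "complex^'n"
  assumes v: "integral_off \<tau> v" and i: "i \<in> X"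
  shows "((\<lambda>t. gsum \<tau> X U v (\<chi> l. if l = i then t else z$l)) has_field_derivative
     hjac \<tau> i t * gsum \<tau> X U (v - axis i 1) (\<chi> l. if l = i then t else z$l)) (at t)"
proof -
  let ?g = "\<lambda>t::complex. (\<chi> l. if l = i then t else z$l) :: complex^'n"
  have g: "(?g has_derivative (\<lambda>h. \<chi> j. if j = i then h else 0)) (at t)"
  proof (rule has_derivative_vec_lambda)
    fix j show "((\<lambda>t. if j = i then t else z$j) has_derivative (\<lambda>h. if j = i then h else 0)) (at t)"
      by (cases "j = i") auto
  qed
  have "((\<lambda>t. gsum \<tau> X U v (?g t)) has_derivative
      (\<lambda>h. \<Sum>k\<in>X. hjac \<tau> k (?g t $ k) * gsum \<tau> X U (v - axis k 1) (?g t) * (\<chi> j. if j = i then h else 0)$k)) (at t)"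
    by (rule has_derivative_compose[OF g has_derivative_gsum[OF v]])
  moreover have "(\<Sum>k\<in>X. hjac \<tau> k (?g t $ k) * gsum \<tau> X U (v - axis k 1) (?g t) * (\<chi> j. if j = i then h else 0)$k)
      = hjac \<tau> i t * gsum \<tau> X U (v - axis i 1) (?g t) * h" for h
    using i by (simp add: if_distrib[of "\<lambda>x. _ * x"] cong: if_cong)
  ultimately show ?thesis by (simp add: has_field_derivative_def)
qed

text \<open>Cauchy's inequality in one variable at a time: each derivative costs \<delta> of the
  polyradius and a factor C1 / \<delta>, where C1 accounts for the passage from z_i to x_i.\<close>

lemma gsum_derivative_bound:
  fixes y :: "complex^'n" and b :: "nat^'n"
  assumes v: "integral_off \<tau> v" and \<delta>: "0 < \<delta>" and \<rho>: "\<rho> \<le> r" and C1: "0 \<le> C1"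
    and jac: "\<And>z i. (\<forall>l. norm (z$l - y$l) \<le> r) \<Longrightarrow> norm (inverse (hjac \<tau> i (z$i))) \<le> C1"
    and S: "\<And>z. (\<forall>l. norm (z$l - y$l) \<le> \<rho>) \<Longrightarrow> norm (gsum \<tau> X U v z) \<le> S"
  shows "(\<Sum>i\<in>X. b$i) = N \<Longrightarrow> (\<forall>l. norm (z$l - y$l) \<le> \<rho> - real N * \<delta>) \<Longrightarrow>
     norm (gsum \<tau> X U (v - cvec b) z) \<le> (C1 / \<delta>) ^ N * S"
proof (induction N arbitrary: b z)
  case 0
  have "gsum \<tau> X U (v - cvec b) z = gsum \<tau> X U v z"
    by (rule gsum_cong_exponent) (use 0 in simp)
  then show ?case using S 0 by simp
next
  case (Suc N)
  obtain i where i: "i \<in> X" "0 < b$i"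
    using Suc.prems(1) by (metis gr0I sum.neutral nat.distinct(1))
  define b0 where "b0 = (\<chi> l. if l = i then b$i - 1 else b$l)"
  have b: "b$l = b0$l + axis i 1 $ l" for l using i by (auto simp: b0_def axis_def)
  have "(\<Sum>l\<in>X. b$l) = (\<Sum>l\<in>X. b0$l) + 1"
    using i unfolding b by (simp add: sum.distrib axis_def)
  then have N: "(\<Sum>l\<in>X. b0$l) = N" using Suc.prems(1) by simp
  have vb: "v - cvec b = v - cvec b0 - axis i 1"
    by (simp add: vec_eq_iff b) (simp add: axis_def)
  let ?g = "\<lambda>t::complex. (\<chi> l. if l = i then t else z$l) :: complex^'n"
  let ?f = "\<lambda>t. gsum \<tau> X U (v - cvec b0) (?g t)"
  have D: "(?f has_field_derivative hjac \<tau> i t * gsum \<tau> X U (v - cvec b) (?g t)) (at t)" for t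
    unfolding vb by (rule gsum_coord_derivative[OF integral_off_minus[OF v] i(1)])
  have near: "norm (?f t) \<le> (C1 / \<delta>) ^ N * S" if "norm (z$i - t) = \<delta>" for t
  proof (rule Suc.IH[OF N], rule allI)
    fix l
    show "norm (?g t $ l - y$l) \<le> \<rho> - real N * \<delta>"
    proof (cases "l = i")
      case True
      have "norm (t - y$i) \<le> norm (z$i - t) + norm (z$i - y$i)"
        by (metis norm_minus_commute norm_triangle_sub add.commute diff_add_cancel norm_triangle_ineq diff_add_eq add_diff_eq)
      also have "\<dots> \<le> \<delta> + (\<rho> - real (Suc N) * \<delta>)" using Suc.prems(2) that by (intro add_mono) auto
      finally show ?thesis using True by (simp add: algebra_simps)
    next
      case False
      have "norm (z$l - y$l) \<le> \<rho> - real (Suc N) * \<delta>" using Suc.prems(2) by blast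
      then show ?thesis using False \<delta> by (simp add: algebra_simps)
    qed
  qed
  have "norm ((deriv ^^ 1) ?f (z$i)) \<le> fact 1 * ((C1 / \<delta>) ^ N * S) / \<delta> ^ 1"
  proof (rule Cauchy_inequality[OF _ _ \<delta>])
    have "?f field_differentiable at t" for t using D field_differentiable_def by blast
    then have "?f holomorphic_on UNIV" by (simp add: holomorphic_on_def)
    then show "?f holomorphic_on ball (z$i) \<delta>" "continuous_on (cball (z$i) \<delta>) ?f"
      by (auto intro: holomorphic_on_subset holomorphic_on_imp_continuous_on)
  qed (use near in auto)
  moreover have "?g (z$i) = z" by (simp add: vec_eq_iff)
  then have "deriv ?f (z$i) = hjac \<tau> i (z$i) * gsum \<tau> X U (v - cvec b) z"
    using DERIV_imp_deriv[OF D[of "z$i"]] by (simp only:)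
  ultimately have d: "norm (hjac \<tau> i (z$i) * gsum \<tau> X U (v - cvec b) z) \<le> (C1 / \<delta>) ^ N * S / \<delta>" by simp
  have zr: "\<forall>l. norm (z$l - y$l) \<le> r"
  proof
    fix l
    have "norm (z$l - y$l) \<le> \<rho> - real (Suc N) * \<delta>" using Suc.prems(2) by blast
    also have "\<dots> \<le> r"
    proof -
      have "0 \<le> real (Suc N) * \<delta>" using \<delta> by (intro mult_nonneg_nonneg) auto
      then show ?thesis using \<rho> by linarith
    qed
    finally show "norm (z$l - y$l) \<le> r" .
  qed
  have nz: "hjac \<tau> i (z$i) \<noteq> 0" by (simp add: hjac_def)
  have "norm (gsum \<tau> X U (v - cvec b) z) = norm (inverse (hjac \<tau> i (z$i))) * norm (hjac \<tau> i (z$i) * gsum \<tau> X U (v - cvec b) z)"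
    using nz by (simp add: norm_mult[symmetric] mult.assoc[symmetric])
  also have "\<dots> \<le> C1 * ((C1 / \<delta>) ^ N * S / \<delta>)"
    using jac[OF zr] d C1 by (intro mult_mono) auto
  finally show ?case by simp
qed

lemma mholomorphic_gsum_combination:
  assumes v: "\<And>k. k \<in> J \<Longrightarrow> integral_off \<tau> (v k)"
  shows "((\<lambda>z. \<Sum>k\<in>J. \<alpha> k * gsum \<tau> X U (v k) z) has_derivative
     (\<lambda>h. \<Sum>i\<in>UNIV. (if i \<in> X then hjac \<tau> i (z$i) * (\<Sum>k\<in>J. \<alpha> k * gsum \<tau> X U (v k - axis i 1) z) else 0) * h$i)) (at z)"
proof -
  have "((\<lambda>z. \<Sum>k\<in>J. \<alpha> k * gsum \<tau> X U (v k) z) has_derivative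
     (\<lambda>h. \<Sum>k\<in>J. \<alpha> k * (\<Sum>i\<in>X. hjac \<tau> i (z$i) * gsum \<tau> X U (v k - axis i 1) z * h$i))) (at z)"
    using v by (intro has_derivative_sum has_derivative_mult_right has_derivative_gsum)
  moreover have "(\<Sum>k\<in>J. \<alpha> k * (\<Sum>i\<in>X. hjac \<tau> i (z$i) * gsum \<tau> X U (v k - axis i 1) z * h$i)) =
      (\<Sum>i\<in>UNIV. (if i \<in> X then hjac \<tau> i (z$i) * (\<Sum>k\<in>J. \<alpha> k * gsum \<tau> X U (v k - axis i 1) z) else 0) * h$i)" for h
  proof -
    have "(\<Sum>i\<in>UNIV. (if i \<in> X then hjac \<tau> i (z$i) * (\<Sum>k\<in>J. \<alpha> k * gsum \<tau> X U (v k - axis i 1) z) else 0) * h$i)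
        = (\<Sum>i\<in>X. hjac \<tau> i (z$i) * (\<Sum>k\<in>J. \<alpha> k * gsum \<tau> X U (v k - axis i 1) z) * h$i)"
      by (rule sum.mono_neutral_cong_right) auto
    also have "\<dots> = (\<Sum>i\<in>X. \<Sum>k\<in>J. \<alpha> k * (hjac \<tau> i (z$i) * gsum \<tau> X U (v k - axis i 1) z * h$i))"
      by (simp add: sum_distrib_left sum_distrib_right mult_ac)
    also have "\<dots> = (\<Sum>k\<in>J. \<alpha> k * (\<Sum>i\<in>X. hjac \<tau> i (z$i) * gsum \<tau> X U (v k - axis i 1) z * h$i))"
      by (subst sum.swap) (simp add: sum_distrib_left)
    finally show ?thesis ..
  qed
  ultimately show ?thesis by (simp only:)
qed

text \<open>An entire function that vanishes near a point vanishes identically, and so do its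
  derivatives. Since the factors \<open>hjac\<close> are nonzero, the relation passes to all shifted
  exponents.\<close>

lemma gsum_combination_zero:
  assumes v: "\<And>k. k \<in> J \<Longrightarrow> integral_off \<tau> (v k)"
    and zero: "\<forall>\<^sub>F z in nhds y. (\<Sum>k\<in>J. \<alpha> k * gsum \<tau> X U (v k) z) = 0"
    and b: "\<And>l. l \<notin> X \<Longrightarrow> b$l = 0"
  shows "(\<Sum>k\<in>J. \<alpha> k * gsum \<tau> X U (v k - cvec b) z) = 0"
  using b
proof (induction "\<Sum>l\<in>UNIV. b$l" arbitrary: b z)
  case 0
  then have b0: "b = 0" by (simp add: vec_eq_iff)
  have "(\<lambda>z. \<Sum>k\<in>J. \<alpha> k * gsum \<tau> X U (v k) z) mholomorphic_on UNIV"
    unfolding mholomorphic_on_def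
  proof (rule ballI)
    fix z :: "complex^'n"
    show "\<exists>c. ((\<lambda>z. \<Sum>k\<in>J. \<alpha> k * gsum \<tau> X U (v k) z) has_derivative (\<lambda>h. \<Sum>i\<in>UNIV. c$i * h$i)) (at z)"
      by (intro exI[of _ "\<chi> i. if i \<in> X then hjac \<tau> i (z$i) * (\<Sum>k\<in>J. \<alpha> k * gsum \<tau> X U (v k - axis i 1) z) else 0"])
         (use mholomorphic_gsum_combination[where J = J and v = v, OF v, of \<alpha> z] in simp)
  qed
  from mholomorphic_eq_0_convex[OF this open_UNIV convex_UNIV UNIV_I zero UNIV_I]
  show ?case by (simp add: b0)
next
  case (Suc N)
  have "(\<Sum>l\<in>UNIV. b$l) \<noteq> 0" using Suc(2) by linarith
  then obtain i where i: "b$i \<noteq> 0" by (meson sum.neutral)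
  have iX: "i \<in> X" by (rule ccontr) (use Suc.prems[of i] i in simp)
  define b0 where "b0 = (\<chi> l. if l = i then b$i - 1 else b$l)"
  have b: "b$l = b0$l + axis i 1 $ l" for l using i by (auto simp: b0_def axis_def)
  have "(\<Sum>l\<in>UNIV. b$l) = (\<Sum>l\<in>UNIV. b0$l) + 1"
    unfolding b by (simp add: sum.distrib axis_def)
  then have N: "N = (\<Sum>l\<in>UNIV. b0$l)" using Suc(2) by simp
  have b00: "\<And>l. l \<notin> X \<Longrightarrow> b0$l = 0" using Suc.prems iX by (auto simp: b0_def)
  have vb: "v k - cvec b = v k - cvec b0 - axis i 1" for k
    by (simp add: vec_eq_iff b) (simp add: axis_def)
  have IH: "(\<Sum>k\<in>J. \<alpha> k * gsum \<tau> X U (v k - cvec b0) z) = 0" for z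
    by (rule Suc(1)[OF N b00])
  have "((\<lambda>z. \<Sum>k\<in>J. \<alpha> k * gsum \<tau> X U (v k - cvec b0) z) has_derivative
     (\<lambda>h. \<Sum>i\<in>UNIV. (if i \<in> X then hjac \<tau> i (z$i) * (\<Sum>k\<in>J. \<alpha> k * gsum \<tau> X U (v k - cvec b0 - axis i 1) z) else 0) * h$i)) (at z)"
    by (rule mholomorphic_gsum_combination) (use v in \<open>auto intro: integral_off_minus\<close>)
  then have "cpartial i (\<lambda>z. \<Sum>k\<in>J. \<alpha> k * gsum \<tau> X U (v k - cvec b0) z) z =
     (if i \<in> X then hjac \<tau> i (z$i) * (\<Sum>k\<in>J. \<alpha> k * gsum \<tau> X U (v k - cvec b0 - axis i 1) z) else 0)"
    by (rule cpartial_eq)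
  then have "hjac \<tau> i (z$i) * (\<Sum>k\<in>J. \<alpha> k * gsum \<tau> X U (v k - cvec b) z) = 0"
    using iX by (simp add: IH vb cpartial_def)
  moreover have "hjac \<tau> i (z$i) \<noteq> 0" by (simp add: hjac_def)
  ultimately show ?case by simp
qed

text \<open>At x_l = 0 the only surviving power of x_l is the one with exponent 0.\<close>

lemma gterm_nonzero_at_origin:
  assumes X: "- \<tau> \<subseteq> X" and w: "integral_off \<tau> w" and z: "\<And>l. l \<notin> \<tau> \<Longrightarrow> z$l = 0"
    and nz: "gterm \<tau> X w z u \<noteq> 0" and l: "l \<notin> \<tau>"
  shows "w$l + of_int (u$l) = 0"
proof -
  have h: "hfac \<tau> l (w$l + of_int (u$l)) 0 \<noteq> 0"
  proof -
    have "l \<in> X" using X l by blast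
    then show ?thesis using nz z[OF l] by (auto simp: gterm_def)
  qed
  have "w$l + of_int (u$l) \<in> \<int>" using w l by (simp add: integral_off_def)
  then show ?thesis
  proof (cases rule: Nats_of_nat_or_nonpos)
    case (nat k)
    have "hfac \<tau> l (of_nat k) 0 \<noteq> 0" using h unfolding nat .
    then have "k = 0" using hfac_of_nat[OF l, of k 0] by (cases k) auto
    then show ?thesis using nat by simp
  next
    case (neg k)
    have "hfac \<tau> l (- of_nat (Suc k)) 0 \<noteq> 0" using h unfolding neg .
    then show ?thesis using hfac_neg[OF l] by metis
  qed
qed

text \<open>A kernel vector that is 0 outside \<tau> is 0. So at x_l = 0 for all l outside \<tau>
  only the term u = 0 is left, and none of its Gamma factors vanishes. This evaluation is how series
  are shown to be nonzero.\<close>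

lemma gsum_origin_single:
  assumes d: "dual_basis A \<tau> \<delta>" and U: "U \<subseteq> zker A" "0 \<in> U" and X: "- \<tau> \<subseteq> X"
    and w: "\<And>l. l \<notin> \<tau> \<Longrightarrow> w$l = 0" and z: "\<And>l. l \<notin> \<tau> \<Longrightarrow> z$l = 0"
    and nz: "\<And>i. i \<in> \<tau> \<Longrightarrow> i \<in> X \<Longrightarrow> rGamma (w$i + 1) \<noteq> 0"
  shows "gsum \<tau> X U w z \<noteq> 0"
proof -
  have wi: "integral_off \<tau> w" using w by (simp add: integral_off_def)
  have "gterm \<tau> X w z u = 0" if "u \<in> U" "u \<noteq> 0" for u
  proof (rule ccontr)
    assume "gterm \<tau> X w z u \<noteq> 0"
    then have "\<And>l. l \<notin> \<tau> \<Longrightarrow> u$l = 0"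
      using gterm_nonzero_at_origin[OF X wi z] w by fastforce
    then show False using zker_determined[OF d] U that by blast
  qed
  then have "gsum \<tau> X U w z = infsum (gterm \<tau> X w z) {0}"
    unfolding gsum_def using U by (intro infsum_cong_neutral) auto
  also have "\<dots> = gterm \<tau> X w z 0" by simp
  also have "\<dots> \<noteq> 0"
    unfolding gterm_def
  proof (subst prod_zero_iff, simp, safe)
    fix l assume l: "l \<in> X" "hfac \<tau> l (w$l + of_int ((0 :: int^'n)$l)) (z$l) = 0"
    show False
    proof (cases "l \<in> \<tau>")
      case True
      then show ?thesis using l nz by (simp add: hfac_def)
    next
      case False
      then show ?thesis using l w z by (simp add: hfac_def)
    qed
  qed
  finally show ?thesis .
qed

end



section \<open>Singularities along coordinate hyperplanes\<close>

lemma norm_vec_le_card: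
  fixes x :: "complex^'n::finite"
  assumes "\<And>l. norm (x$l) \<le> r"
  shows "norm x \<le> real CARD('n) * r"
proof -
  have "norm x \<le> (\<Sum>l\<in>UNIV. norm (x$l))"
    unfolding norm_vec_def by (rule L2_set_le_sum) auto
  also have "\<dots> \<le> (\<Sum>l\<in>(UNIV :: 'n set). r)" by (rule sum_mono) (rule assms)
  finally show ?thesis by simp
qed

lemma continuous_nonvanishing_polydisc:
  fixes q :: "complex^'n::finite \<Rightarrow> complex"
  assumes "continuous (at y) q" "q y \<noteq> 0"
  shows "\<exists>r>0. \<forall>z. (\<forall>l. norm (z$l - y$l) \<le> r) \<longrightarrow> norm (q y) / 2 \<le> norm (q z)"
proof -
  have "0 < norm (q y) / 2" using assms(2) by simp
  then obtain d where d: "0 < d" "\<And>z. dist z y < d \<Longrightarrow> dist (q z) (q y) < norm (q y) / 2"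
    using assms(1) unfolding continuous_at_eps_delta by (metis dist_commute)
  define r where "r = d / (2 * real CARD('n))"
  have r: "0 < r" using d by (simp add: r_def)
  have "norm (q y) / 2 \<le> norm (q z)" if "\<forall>l. norm (z$l - y$l) \<le> r" for z
  proof -
    have "norm (z - y) \<le> real CARD('n) * r" by (rule norm_vec_le_card) (use that in simp)
    also have "\<dots> < d" using d by (simp add: r_def)
    finally have "norm (q z - q y) < norm (q y) / 2" using d(2)[of z] by (simp add: dist_norm)
    then show ?thesis using norm_triangle_ineq2[of "q y" "q z"] by (simp add: norm_minus_commute)
  qed
  then show ?thesis using r by blast
qed

lemma norm_ffact_le: "norm (ffact w a) \<le> (norm w + real a) ^ a"
proof -
  have "norm (ffact w a) = (\<Prod>i<a. norm (w - of_nat i))" by (simp add: ffact_def prod_norm)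
  also have "\<dots> \<le> (\<Prod>i<a. norm w + real a)"
    by (intro prod_mono conjI order_trans[OF norm_triangle_ineq4]) auto
  finally show ?thesis by simp
qed

context simplicial_facet
begin

text \<open>At a nonsingular p some P in the ideal has nonzero symbol in the conormal direction of
  x_j = 0. Its terms in \<partial>_j^m express each slice by earlier ones, with growth and
  derivatives matched by the number of steps, so the slice of index 0 vanishes; but a derivative of
  it is nonzero at the origin. The condition on v excludes i = j because slices carry no Gamma
  factor of index j.\<close>

lemma coordinate_hyperplane_singular:
  assumes j: "j \<in> \<tau>" and pj: "p$j = 0"
    and v: "amul A v = \<beta>" "\<And>l. l \<notin> \<tau> \<Longrightarrow> v$l \<in> \<nat>" "\<And>i. i \<in> \<tau> \<Longrightarrow> i \<noteq> j \<Longrightarrow> rGamma (v$i + 1) \<noteq> 0"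
  shows "p \<in> sing_A A \<beta>"
proof (rule ccontr)
  assume "p \<notin> sing_A A \<beta>"
  moreover have "axis j 1 \<noteq> (0 :: complex^'n)" by (simp add: axis_eq_0_iff)
  ultimately obtain P where P: "P \<in> hypergeometric_ideal A \<beta>" and sym: "principal_symbol P p (axis j 1) \<noteq> 0"
    unfolding sing_A_def singular_locus_def characteristic_variety_def by blast
  define m where "m = weyl_order P"
  \<comment> \<open>At a point with p_j = 0 and in the direction of j, the symbol only sees
    monomials free of x_j whose derivative part is \<partial>_j^m.\<close>
  define Top where "Top = {(a, b) \<in> Poly_Mapping.keys P. a$j = 0 \<and> b$j = m \<and> (\<forall>i. i \<noteq> j \<longrightarrow> b$i = 0)}"
  define pc where "pc k = Poly_Mapping.lookup P k" for k
  define q0 where "q0 x = (\<Sum>k\<in>Top. pc k * (\<Prod>l\<in>-{j}. (x$l) ^ (fst k $ l)))" for x :: "complex^'n"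
  have fin: "finite (Poly_Mapping.keys P)" by simp
  have Topk: "Top \<subseteq> Poly_Mapping.keys P" by (auto simp: Top_def)
  have order: "(\<Sum>i\<in>UNIV. snd k $ i) \<le> m" if "k \<in> Poly_Mapping.keys P" for k
    unfolding m_def weyl_order_def by (rule Max_ge) (use that in \<open>auto simp: image_iff case_prod_unfold\<close>)
  have split_j: "(\<Prod>l\<in>UNIV. f l) = f j * (\<Prod>l\<in>-{j}. f l)" for f :: "'n \<Rightarrow> complex"
    unfolding Compl_eq_Diff_UNIV by (rule prod.remove) auto
  have sum_j: "(\<Sum>l\<in>UNIV. f l) = f j + (\<Sum>l\<in>-{j}. f l)" for f :: "'n \<Rightarrow> nat"
    unfolding Compl_eq_Diff_UNIV by (rule sum.remove) auto
  have "principal_symbol P p (axis j 1) = q0 p"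
  proof -
    let ?S = "{k \<in> Poly_Mapping.keys P. (\<Sum>i\<in>UNIV. snd k $ i) = m}"
    have "principal_symbol P p (axis j 1) = (\<Sum>k\<in>?S. pc k * mono_eval p (fst k) * mono_eval (axis j 1) (snd k))"
      by (simp add: principal_symbol_def m_def pc_def case_prod_unfold)
    also have "\<dots> = (\<Sum>k\<in>Top. pc k * (\<Prod>l\<in>-{j}. (p$l) ^ (fst k $ l)))"
    proof (rule sum.mono_neutral_cong_right)
      show "finite ?S" using fin by simp
      show "Top \<subseteq> ?S"
      proof
        fix k assume k: "k \<in> Top"
        then have "(\<Sum>i\<in>-{j}. snd k $ i) = 0" "snd k $ j = m" by (auto simp: Top_def)
        then show "k \<in> ?S" using k Topk sum_j[of "\<lambda>i. snd k $ i"] by auto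
      qed
      show "\<forall>k\<in>?S - Top. pc k * mono_eval p (fst k) * mono_eval (axis j 1) (snd k) = 0"
      proof
        fix k assume k: "k \<in> ?S - Top"
        show "pc k * mono_eval p (fst k) * mono_eval (axis j 1) (snd k) = 0"
        proof (cases "\<exists>i. i \<noteq> j \<and> snd k $ i \<noteq> 0")
          case True
          then obtain i where "i \<noteq> j" "snd k $ i \<noteq> 0" by blast
          then have "mono_eval (axis j 1) (snd k) = (0::complex)"
            by (auto simp: mono_eval_def axis_def intro!: bexI[of _ i])
          then show ?thesis by simp
        next
          case False
          then have "(\<Sum>i\<in>-{j}. snd k $ i) = 0" by auto
          then have "snd k $ j = m" using k sum_j[of "\<lambda>i. snd k $ i"] by auto
          then have "fst k $ j \<noteq> 0" using k False by (cases k) (auto simp: Top_def)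
          then have "mono_eval p (fst k) = 0" using pj by (auto simp: mono_eval_def intro!: bexI[of _ j])
          then show ?thesis by simp
        qed
      qed
      show "pc k * mono_eval p (fst k) * mono_eval (axis j 1) (snd k) = pc k * (\<Prod>l\<in>-{j}. (p$l) ^ (fst k $ l))"
        if k: "k \<in> Top" for k
      proof -
        have "mono_eval (axis j 1) (snd k) = 1" unfolding mono_eval_def
          by (rule prod.neutral) (use k in \<open>auto simp: Top_def axis_def\<close>)
        moreover have "mono_eval p (fst k) = (\<Prod>l\<in>-{j}. (p$l) ^ (fst k $ l))"
          unfolding mono_eval_def split_j using k by (auto simp: Top_def)
        ultimately show ?thesis by simp
      qed
    qed
    finally show ?thesis by (simp add: q0_def)
  qed
  then have q0p: "q0 p \<noteq> 0" using sym by simp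
  \<comment> \<open>Further coordinates of p may be 0. A small diagonal shift makes all coordinates
    nonzero, so that they have logarithms, and keeps q0 nonzero by continuity.\<close>
  obtain x0 where x0: "q0 x0 \<noteq> 0" "\<And>l. x0$l \<noteq> 0"
  proof -
    define x where "x t = (\<chi> l. p$l + t)" for t :: complex
    have "isCont (\<lambda>t. q0 (x t)) 0" unfolding q0_def x_def by (simp, intro continuous_intros)
    then have "((\<lambda>t. q0 (x t)) \<longlongrightarrow> q0 (x 0)) (at 0)" by (simp add: isCont_def)
    moreover have "x 0 = p" by (simp add: x_def vec_eq_iff)
    ultimately have 1: "\<forall>\<^sub>F t in at 0. q0 (x t) \<noteq> 0" using q0p by (intro tendsto_imp_eventually_ne) auto
    have 2: "\<forall>\<^sub>F t in at 0. \<forall>l\<in>UNIV. x t $ l \<noteq> 0"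
    proof (rule eventually_ball_finite)
      show "\<forall>l\<in>UNIV. \<forall>\<^sub>F t in at 0. x t $ l \<noteq> 0"
      proof
        fix l
        show "\<forall>\<^sub>F t in at 0. x t $ l \<noteq> 0"
        proof (cases "p$l = 0")
          case True
          then show ?thesis by (simp add: x_def eventually_at_filter)
        next
          case False
          have "((\<lambda>t. p$l + t) \<longlongrightarrow> p$l + 0) (at 0)" by (intro tendsto_intros)
          then show ?thesis using False unfolding x_def by (auto intro: tendsto_imp_eventually_ne)
        qed
      qed
    qed simp
    have "\<exists>t. q0 (x t) \<noteq> 0 \<and> (\<forall>l\<in>UNIV. x t $ l \<noteq> 0)"
      using eventually_happens[OF eventually_conj[OF 1 2]] by simp
    then show ?thesis using that by blast
  qed
  define y where "y = (\<chi> l. if l \<in> \<tau> then Ln (x0$l) else x0$l)"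
  define q where "q z = (\<Sum>k\<in>Top. pc k * (\<Prod>l\<in>-{j}. hbase \<tau> l (z$l) ^ (fst k $ l)))" for z :: "complex^'n"
  have "hbase \<tau> l (y$l) = x0$l" for l using x0 by (simp add: hbase_def y_def)
  then have qy: "q y \<noteq> 0" using x0 by (simp add: q_def q0_def)
  have cont: "continuous (at z) (\<lambda>z::complex^'n. hbase \<tau> l (z$l))" for l z
    by (cases "l \<in> \<tau>") (auto simp: hbase_def intro!: continuous_intros)
  have "continuous (at y) q"
    unfolding q_def by (intro continuous_intros cont)
  then obtain r where r: "0 < r" "\<And>z. (\<forall>l. norm (z$l - y$l) \<le> r) \<Longrightarrow> norm (q y) / 2 \<le> norm (q z)"
    using continuous_nonvanishing_polydisc[of y q] qy by blast
  define K where "K \<rho> = {z. \<forall>l. norm (z$l - y$l) \<le> \<rho>}" for \<rho>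
  define B where "B = norm y + r"
  have B: "0 \<le> B" using r by (simp add: B_def)
  have zB: "norm (z$l) \<le> B" if "z \<in> K r" for z l
  proof -
    have "norm (z$l) \<le> norm (y$l) + norm (z$l - y$l)" by (rule norm_triangle_sub)
    also have "\<dots> \<le> B" unfolding B_def
      using that Finite_Cartesian_Product.norm_nth_le[of y l] by (intro add_mono) (auto simp: K_def)
    finally show ?thesis .
  qed
  have vi: "integral_off \<tau> v"
    using v(2) by (auto simp: integral_off_def) (meson Nats_subset_Ints subsetD)
  interpret S: gseries \<tau> "-{j}" "{u \<in> zker A. u$j = n}" for n
    by (rule gseries_slice[OF j])
  define U where "U n = {u \<in> zker A. u$j = n}" for n
  define H where "H n z = gsum \<tau> (-{j}) (U n) v z" for n z
  define Ks where "Ks = Poly_Mapping.keys P - Top"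
  define D where "D k n z = gsum \<tau> (-{j}) (U n) (v - cvec (snd k)) z" for k :: "(nat^'n) \<times> (nat^'n)" and n z
  \<comment> \<open>The relation is read off at n - m, so that the monomials in \<open>Top\<close>
    multiply the slice n itself.\<close>
  define co where "co k n z = pc k * ((\<Prod>l\<in>-{j}. hbase \<tau> l (z$l) ^ (fst k $ l)) * ffact (v$j + of_int (n - int m)) (fst k $ j))"
    for k n and z :: "complex^'n"
  \<comment> \<open>How far back a monomial reaches: x_j^a raises and \<partial>_j^b lowers the
    exponent of x_j. Among the monomials of P it is 0 exactly on \<open>Top\<close>.\<close>
  define s where "s k = m - snd k $ j + fst k $ j" for k :: "(nat^'n) \<times> (nat^'n)"
  define e where "e k = (\<Sum>i\<in>-{j}. snd k $ i)" for k :: "(nat^'n) \<times> (nat^'n)"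
  have bj: "snd k $ j \<le> m" "e k \<le> m - snd k $ j" if "k \<in> Poly_Mapping.keys P" for k
    using order[OF that] sum_j[of "\<lambda>i. snd k $ i"] by (auto simp: e_def)
  define W where "W = (\<Sum>k\<in>Poly_Mapping.keys P. norm (pc k) * (\<Prod>l\<in>-{j}. exp B ^ (fst k $ l)))"
  define c0 where "c0 = norm (v$j) + real m + real (\<Sum>k\<in>Poly_Mapping.keys P. fst k $ j)"
  have H0: "H 0 z = 0" if "z \<in> K (r / 2)" for z
  proof (rule nagumo_vanishing[where Ks = Ks and r = r and M = "real m + 1" and W = W and ?c0.0 = c0 and ?C1.0 = "exp B"
        and K = K and q = q and H = H and co = co and D = D and s = s and \<eta> = "norm (q y) / 2"
        and a = "\<lambda>k. fst k $ j" and e = e])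
    show "finite Ks" by (simp add: Ks_def)
    show "0 \<le> W" unfolding W_def by (intro sum_nonneg mult_nonneg_nonneg prod_nonneg) auto
    show "0 \<le> c0" by (simp add: c0_def sum_nonneg)
    show "K \<rho> \<subseteq> K \<rho>'" if "\<rho> \<le> \<rho>'" for \<rho> \<rho>' using that by (auto simp: K_def intro: order_trans)
    show "q z * H n z = - (\<Sum>k\<in>Ks. co k n z * D k (n - int (s k)) z)" for n z
    proof -
      have "(\<Sum>k\<in>Poly_Mapping.keys P. co k n z * D k (n - int (s k)) z) = 0"
      proof -
        have "co k n z * D k (n - int (s k)) z = pc k * ((\<Prod>l\<in>-{j}. hbase \<tau> l (z$l) ^ (fst k$l)) *
            ffact (v$j + of_int (n - int m)) (fst k$j) *
            gsum \<tau> (-{j}) {u \<in> zker A. u$j = (n - int m) - int (fst k$j) + int (snd k$j)} (v - cvec (snd k)) z)"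
          if "k \<in> Poly_Mapping.keys P" for k
        proof -
          have eqn: "n - int (s k) = (n - int m) - int (fst k$j) + int (snd k$j)"
            using bj(1)[OF that] by (simp add: s_def of_nat_diff)
          show ?thesis unfolding co_def D_def U_def eqn by (simp only: mult.assoc)
        qed
        then have "(\<Sum>k\<in>Poly_Mapping.keys P. co k n z * D k (n - int (s k)) z) =
           (\<Sum>(a, b)\<in>Poly_Mapping.keys P. Poly_Mapping.lookup P (a, b) *
           ((\<Prod>l\<in>-{j}. hbase \<tau> l (z$l) ^ (a$l)) * ffact (v$j + of_int (n - int m)) (a$j) *
           gsum \<tau> (-{j}) {u \<in> zker A. u$j = (n - int m) - int (a$j) + int (b$j)} (v - cvec b) z))"
          by (intro sum.cong) (auto simp: pc_def)
        also have "\<dots> = 0" by (rule gsum_slice_relation[OF P v(1) vi]) (rule gseries_slice[OF j])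
        finally show ?thesis .
      qed
      moreover have "(\<Sum>k\<in>Poly_Mapping.keys P. co k n z * D k (n - int (s k)) z) =
         (\<Sum>k\<in>Top. co k n z * D k (n - int (s k)) z) + (\<Sum>k\<in>Ks. co k n z * D k (n - int (s k)) z)"
        unfolding Ks_def by (subst add.commute) (rule sum.subset_diff[OF Topk fin])
      moreover have "(\<Sum>k\<in>Top. co k n z * D k (n - int (s k)) z) = q z * H n z"
        unfolding q_def sum_distrib_right
      proof (rule sum.cong[OF refl])
        fix k assume k: "k \<in> Top"
        then have kj: "fst k $ j = 0" "snd k $ j = m" "\<And>i. i \<noteq> j \<Longrightarrow> snd k $ i = 0" by (auto simp: Top_def)
        have "D k n z = H n z"
          unfolding D_def H_def U_def by (rule S.gsum_cong_exponent) (use kj in auto)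
        then show "co k n z * D k (n - int (s k)) z = pc k * (\<Prod>l\<in>-{j}. hbase \<tau> l (z$l) ^ (fst k $ l)) * H n z"
          by (simp add: co_def s_def kj)
      qed
      ultimately show ?thesis by (simp add: eq_neg_iff_add_eq_0)
    qed
    show "0 < norm (q y) / 2" using qy by simp
    show "norm (q y) / 2 \<le> norm (q z)" if "z \<in> K r" for z using r(2) that by (simp add: K_def)
    show "norm (co k n z) \<le> W * (c0 + \<bar>real_of_int n\<bar>) ^ (fst k $ j)" if k: "k \<in> Ks" and z: "z \<in> K r" for k n z
    proof -
      have kk: "k \<in> Poly_Mapping.keys P" using k by (simp add: Ks_def)
      have "norm (pc k) * norm (\<Prod>l\<in>-{j}. hbase \<tau> l (z$l) ^ (fst k $ l)) \<le> norm (pc k) * (\<Prod>l\<in>-{j}. exp B ^ (fst k $ l))"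
        unfolding prod_norm[symmetric] norm_power
      proof (intro mult_left_mono prod_mono conjI power_mono)
        fix l
        have "norm (exp (z$l)) \<le> exp B" using zB[OF z, of l] norm_exp[of "z$l"] by (meson exp_le_cancel_iff order_trans)
        moreover have "norm (z$l) \<le> exp B" using zB[OF z, of l] exp_ge_add_one_self[of B] by linarith
        ultimately show "norm (hbase \<tau> l (z$l)) \<le> exp B" by (simp add: hbase_def)
      qed auto
      also have "\<dots> \<le> W" unfolding W_def
        by (rule member_le_sum[OF kk, of "\<lambda>k. norm (pc k) * (\<Prod>l\<in>-{j}. exp B ^ (fst k $ l))"])
           (auto intro!: mult_nonneg_nonneg prod_nonneg)
      finally have 1: "norm (pc k) * norm (\<Prod>l\<in>-{j}. hbase \<tau> l (z$l) ^ (fst k $ l)) \<le> W" .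
      have "norm (ffact (v$j + of_int (n - int m)) (fst k $ j)) \<le> (norm (v$j + of_int (n - int m)) + real (fst k $ j)) ^ (fst k $ j)"
        by (rule norm_ffact_le)
      also have "\<dots> \<le> (c0 + \<bar>real_of_int n\<bar>) ^ (fst k $ j)"
      proof (rule power_mono)
        have "norm (v$j + of_int (n - int m)) \<le> norm (v$j) + \<bar>real_of_int (n - int m)\<bar>"
          using norm_triangle_ineq[of "v$j" "of_int (n - int m)"] by (metis norm_of_int)
        also have "\<bar>real_of_int (n - int m)\<bar> \<le> \<bar>real_of_int n\<bar> + real m" by simp
        finally have "norm (v$j + of_int (n - int m)) \<le> norm (v$j) + (\<bar>real_of_int n\<bar> + real m)" by simp
        moreover have "fst k $ j \<le> (\<Sum>k\<in>Poly_Mapping.keys P. fst k $ j)"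
          by (rule member_le_sum[OF kk, of "\<lambda>k. fst k $ j"]) auto
        then have "real (fst k $ j) \<le> real (\<Sum>k\<in>Poly_Mapping.keys P. fst k $ j)" by (simp only: of_nat_le_iff)
        ultimately show "norm (v$j + of_int (n - int m)) + real (fst k $ j) \<le> c0 + \<bar>real_of_int n\<bar>"
          unfolding c0_def by linarith
      qed auto
      finally have 2: "norm (ffact (v$j + of_int (n - int m)) (fst k $ j)) \<le> (c0 + \<bar>real_of_int n\<bar>) ^ (fst k $ j)" .
      have "norm (co k n z) = (norm (pc k) * norm (\<Prod>l\<in>-{j}. hbase \<tau> l (z$l) ^ (fst k $ l))) *
          norm (ffact (v$j + of_int (n - int m)) (fst k $ j))"
        unfolding co_def norm_mult by (simp only: mult.assoc)
      also have "\<dots> \<le> W * (c0 + \<bar>real_of_int n\<bar>) ^ (fst k $ j)"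
        using 1 2 \<open>0 \<le> W\<close> by (intro mult_mono) auto
      finally show ?thesis .
    qed
    show "norm (D k n z) \<le> (exp B / \<delta>) ^ e k * S"
      if k: "k \<in> Ks" and \<delta>: "0 < \<delta>" "(real m + 1) * \<delta> \<le> \<rho>" "\<rho> \<le> r"
        and S: "\<And>z. z \<in> K \<rho> \<Longrightarrow> norm (H n z) \<le> S" and z: "z \<in> K (\<rho> - (real m + 1) * \<delta>)" for k n \<rho> \<delta> S z
      unfolding D_def U_def
    proof (rule S.gsum_derivative_bound[where y = y and r = r and \<rho> = \<rho>, OF vi \<delta>(1) \<delta>(3)])
      show "norm (inverse (hjac \<tau> i (z$i))) \<le> exp B" if "\<forall>l. norm (z$l - y$l) \<le> r" for z i
      proof -
        have "norm (z$i) \<le> B" using zB[of z i] that by (simp add: K_def)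
        then have "norm (exp (- (z$i))) \<le> exp B" using norm_exp[of "- (z$i)"] by (metis exp_le_cancel_iff norm_minus_cancel order_trans)
        moreover have "1 \<le> exp B" using B by simp
        ultimately show ?thesis by (simp add: hjac_def exp_minus)
      qed
      show "norm (gsum \<tau> (- {j}) {u \<in> zker A. u $ j = n} v z) \<le> S" if "\<forall>l. norm (z$l - y$l) \<le> \<rho>" for z
        using S[of z] that by (simp add: K_def H_def U_def)
      have "e k \<le> m" using bj(2)[of k] k by (simp add: Ks_def)
      then have "real (e k) * \<delta> \<le> (real m + 1) * \<delta>" using \<delta> by (intro mult_right_mono) auto
      then show "\<forall>l. norm (z$l - y$l) \<le> \<rho> - real (e k) * \<delta>" using z by (auto simp: K_def intro: order_trans)
    qed (simp_all add: e_def)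
    show "1 \<le> s k" "fst k $ j + e k \<le> s k" if k: "k \<in> Ks" for k
    proof -
      have kk: "k \<in> Poly_Mapping.keys P" "k \<notin> Top" using k by (auto simp: Ks_def)
      show "fst k $ j + e k \<le> s k" using bj[OF kk(1)] by (simp add: s_def)
      show "1 \<le> s k"
      proof (rule ccontr)
        assume "\<not> 1 \<le> s k"
        then have "fst k $ j = 0" "snd k $ j = m" using bj[OF kk(1)] by (auto simp: s_def)
        moreover have "e k = 0" using bj(2)[OF kk(1)] calculation by simp
        then have "\<And>i. i \<noteq> j \<Longrightarrow> snd k $ i = 0" by (simp add: e_def)
        ultimately have "k \<in> Top" using kk(1) by (cases k) (auto simp: Top_def)
        then show False using kk(2) by blast
      qed
    qed
    show "\<exists>C\<ge>0. \<forall>n z. z \<in> K r \<longrightarrow> norm (H (- int n) z) \<le> C * \<theta> ^ n / fact n" if \<theta>: "0 < \<theta>" for \<theta>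
      using slice_decay[OF vi B j \<theta>] zB unfolding H_def U_def by blast
  qed (use r that in auto)
  have "\<forall>\<^sub>F z in nhds y. (\<Sum>k\<in>{()}. 1 * gsum \<tau> (-{j}) (U 0) v z) = 0"
    unfolding eventually_nhds_metric
  proof (intro exI[of _ "r / 2"] conjI allI impI)
    fix z assume "dist z y < r / 2"
    then have "norm (z$l - y$l) \<le> r / 2" for l
      using Finite_Cartesian_Product.norm_nth_le[of "z - y" l] by (simp add: dist_norm)
    then show "(\<Sum>k\<in>{()}. 1 * gsum \<tau> (-{j}) (U 0) v z) = 0" using H0[of z] by (simp add: K_def H_def)
  qed (use r in simp)
  then have zero: "(\<Sum>k\<in>{()}. 1 * gsum \<tau> (-{j}) (U 0) (v - cvec b) z) = 0" if "\<And>l. l \<notin> -{j} \<Longrightarrow> b$l = 0" for b z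
    unfolding U_def by (intro S.gsum_combination_zero[of "{()}" "\<lambda>_. v"]) (use vi that in auto)
  have "\<exists>n. v$l = of_nat n" if "l \<notin> \<tau>" for l using v(2)[OF that] by (auto elim: Nats_cases)
  then obtain n where n: "\<And>l. l \<notin> \<tau> \<Longrightarrow> v$l = of_nat (n l)" by metis
  \<comment> \<open>This many derivatives bring all exponents outside \<tau> down to 0, where the
    evaluation at the origin is nonzero.\<close>
  define b where "b = (\<chi> l. if l \<in> \<tau> then 0 else n l)"
  have "gsum \<tau> (-{j}) (U 0) (v - cvec b) 0 \<noteq> 0"
    unfolding U_def
  proof (rule S.gsum_origin_single[OF dual])
    show "rGamma ((v - cvec b)$i + 1) \<noteq> 0" if "i \<in> \<tau>" "i \<in> -{j}" for i
      using v(3)[of i] that by (simp add: b_def)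
  qed (use j n in \<open>auto simp: b_def zker_def\<close>)
  moreover have "gsum \<tau> (-{j}) (U 0) (v - cvec b) 0 = 0"
    using zero[of b 0] j by (simp add: b_def)
  ultimately show False by simp
qed

end

section \<open>Germs and analytic continuation of Gamma series\<close>

lemma germ_at_add: "germ_at p f + germ_at p g = germ_at p (\<lambda>x. f x + g x)"
  by (simp add: germ_at_def plus_germ.abs_eq)

lemma germ_at_scale: "germ_scale c (germ_at p f) = germ_at p (\<lambda>x. c * f x)"
  by (simp add: germ_at_def germ_scale.abs_eq)

lemma germ_at_zero: "germ_at p (\<lambda>x. 0) = 0"
  by (simp add: germ_at_def zero_germ_def)

lemma germ_at_combination:
  "(\<Sum>k\<in>J. germ_scale (\<alpha> k) (germ_at p (f k))) = germ_at p (\<lambda>x. \<Sum>k\<in>J. \<alpha> k * f k x)"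
  by (induction J rule: infinite_finite_induct) (simp_all add: germ_at_zero germ_at_add germ_at_scale)

section \<open>Continuation of logarithms and series along paths\<close>

lemma exp_eq_close:
  fixes a b :: complex
  assumes "exp a = exp b" "norm (a - b) < 2 * pi"
  shows "a = b"
proof -
  obtain n :: int where n: "a = b + (of_int (2 * n) * pi) * \<i>"
    using assms(1) by (auto simp: exp_eq)
  have "norm (a - b) = 2 * pi * \<bar>real_of_int n\<bar>" by (simp add: n norm_mult)
  then have "\<bar>real_of_int n\<bar> < 1" using assms(2) by simp
  then have "n = 0" by linarith
  then show ?thesis by (simp add: n)
qed

text \<open>The difference of the two logarithms is continuous at q, has values in 2 \<pi> \<i>
  \<int> near q and is 0 at q, so it is 0 near q.\<close>

lemma log_chart_unique:
  fixes f :: "complex^'n::finite \<Rightarrow> complex"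
  assumes f: "continuous (at q) f" and ef: "\<forall>\<^sub>F x in nhds q. exp (f x) = x$i" and q: "q$i \<noteq> 0"
  shows "\<forall>\<^sub>F x in nhds q. f x = f q + Ln (x$i / q$i)"
proof -
  define g where "g x = f x - (f q + Ln (x$i / q$i))" for x
  have cLn: "continuous (at q) (\<lambda>x. Ln (x$i / q$i))"
    by (intro continuous_intros) (use q in auto)
  have "continuous (at q) g"
    unfolding g_def by (intro continuous_diff continuous_add continuous_const f cLn)
  then have "(g \<longlongrightarrow> g q) (nhds q)" by (simp add: continuous_at tendsto_nhds_iff)
  moreover have "g q = 0" using q by (simp add: g_def)
  ultimately have "\<forall>\<^sub>F x in nhds q. dist (g x) 0 < 2 * pi" by (intro tendstoD) auto
  moreover have "\<forall>\<^sub>F x in nhds q. x$i \<noteq> 0"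
  proof -
    have "open {x::complex^'n. x$i \<noteq> 0}" by (intro open_Collect_neq continuous_intros)
    then have "\<forall>\<^sub>F x in nhds q. x \<in> {x::complex^'n. x$i \<noteq> 0}" by (rule eventually_nhds_in_open) (use q in simp)
    then show ?thesis by simp
  qed
  ultimately show ?thesis using ef
  proof eventually_elim
    case (elim x)
    have "exp (f q) = q$i" using eventually_nhds_x_imp_x[OF ef] .
    then have "exp (f q + Ln (x$i / q$i)) = x$i" using elim q by (simp add: exp_add)
    then have "exp (f x) = exp (f q + Ln (x$i / q$i))" using elim by simp
    then show ?case by (rule exp_eq_close) (use elim in \<open>simp add: g_def\<close>)
  qed
qed

lemma path_log_lift:
  fixes \<gamma> :: "real \<Rightarrow> complex^'n::finite"
  assumes \<gamma>: "path \<gamma>" and nz: "\<And>t i. t \<in> {0..1} \<Longrightarrow> i \<in> \<tau> \<Longrightarrow> \<gamma> t $ i \<noteq> 0"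
    and c: "\<And>i. i \<in> \<tau> \<Longrightarrow> exp (c$i) = \<gamma> 0 $ i"
  shows "\<exists>\<L>::real \<Rightarrow> complex^'n. (\<forall>i\<in>\<tau>. continuous_on {0..1} (\<lambda>t. \<L> t $ i)) \<and>
     (\<forall>t\<in>{0..1}. \<forall>i\<in>\<tau>. exp (\<L> t $ i) = \<gamma> t $ i) \<and> (\<forall>i\<in>\<tau>. \<L> 0 $ i = c$i)"
proof -
  have cont: "continuous_on {0..1} (\<lambda>t. \<gamma> t $ i)" for i
    using \<gamma> unfolding path_def by (intro continuous_intros)
  have "\<exists>g. continuous_on {0..1} g \<and> (\<forall>t\<in>{0..1}. exp (g t) = \<gamma> t $ i) \<and> g 0 = c$i" if i: "i \<in> \<tau>" for i
  proof -
    have "contractible {0..1::real}" by (intro convex_imp_contractible) simp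
    then obtain g where g: "continuous_on {0..1} g" "\<And>t. t \<in> {0..1} \<Longrightarrow> \<gamma> t $ i = exp (g t)"
      using continuous_logarithm_on_contractible[of "{0..1::real}" "\<lambda>t. \<gamma> t $ i"] cont nz[OF _ i] by blast
    define h where "h t = g t + (c$i - g 0)" for t
    have "exp (c$i) = exp (g 0)" using c[OF i] g(2)[of 0] by simp
    then have "exp (h t) = \<gamma> t $ i" if "t \<in> {0..1}" for t
      using g(2)[OF that] by (simp add: h_def exp_add exp_diff)
    moreover have "continuous_on {0..1} h" unfolding h_def by (intro continuous_intros g)
    moreover have "h 0 = c$i" by (simp add: h_def)
    ultimately show ?thesis by blast
  qed
  then obtain g where g: "\<And>i. i \<in> \<tau> \<Longrightarrow> continuous_on {0..1} (g i) \<and> (\<forall>t\<in>{0..1}. exp (g i t) = \<gamma> t $ i) \<and> g i 0 = c$i"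
    by metis
  show ?thesis
    by (rule exI[of _ "\<lambda>t. \<chi> i. g i t"]) (use g in auto)
qed

text \<open>Two logarithms of q_i are compared whose difference has imaginary part below 1 + \<pi> <
  2 \<pi>; hence they agree at q and, by continuity, near q.\<close>

lemma local_log_change_center:
  fixes p q :: "complex^'n::finite"
  assumes q: "q \<in> log_domain \<tau> p" and c: "\<And>i. i \<in> \<tau> \<Longrightarrow> exp (c$i) = p$i"
    and c': "\<And>i. i \<in> \<tau> \<Longrightarrow> exp (c'$i) = q$i" and close: "\<And>i. i \<in> \<tau> \<Longrightarrow> norm (c'$i - c$i) < 1"
  shows "\<forall>\<^sub>F x in nhds q. local_log \<tau> c' q x = local_log \<tau> c p x"
proof -
  have "\<forall>\<^sub>F x in nhds q. local_log \<tau> c p x $ i = local_log \<tau> c' q x $ i" for i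
  proof (cases "i \<in> \<tau>")
    case True
    let ?f = "\<lambda>x. local_log \<tau> c p x $ i"
    have "continuous (at q) (local_log \<tau> c p)" using has_derivative_continuous[OF has_derivative_local_log[OF q]] .
    then have f: "continuous (at q) ?f" by (intro continuous_intros)
    have e: "exp (?f x) = x$i" if "x \<in> log_domain \<tau> p" for x
      using hbase_local_log[OF c that, of i] True by (simp add: hbase_def)
    have ev: "\<forall>\<^sub>F x in nhds q. exp (?f x) = x$i"
      using eventually_nhds_in_open[OF open_log_domain q] by (rule eventually_mono) (rule e)
    have nz: "q$i \<noteq> 0" "p$i \<noteq> 0" using log_domain_nonzero[OF q True] by auto
    have "?f q = c'$i"
    proof (rule exp_eq_close)
      show "exp (?f q) = exp (c'$i)" using e[OF q] c'[OF True] by simp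
      define d where "d = ?f q - c'$i"
      have "\<bar>Im (Ln (q$i / p$i))\<bar> \<le> pi" using Im_Ln_le_pi[of "q$i/p$i"] mpi_less_Im_Ln[of "q$i/p$i"] nz by auto
      moreover have "\<bar>Im (c$i - c'$i)\<bar> < 1"
        using abs_Im_le_cmod[of "c$i - c'$i"] close[OF True] by (simp add: norm_minus_commute)
      moreover have "d = (c$i - c'$i) + Ln (q$i / p$i)" using True by (simp add: d_def local_log_def)
      ultimately have "\<bar>Im d\<bar> < 1 + pi" by simp
      then have im: "\<bar>Im d\<bar> < 2 * pi" using pi_gt3 by linarith
      have "exp d = 1" unfolding d_def using e[OF q] c'[OF True] nz by (simp add: exp_diff)
      then have "Re d = 0" by (metis norm_exp_eq_Re norm_one exp_eq_one_iff)
      then show "norm (?f q - c'$i) < 2 * pi" using im by (simp add: d_def[symmetric] cmod_def)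
    qed
    then show ?thesis using log_chart_unique[OF f ev nz(1)] True by (simp add: local_log_def)
  next
    case False
    then show ?thesis by (simp add: local_log_def)
  qed
  then have "\<forall>\<^sub>F x in nhds q. \<forall>i\<in>UNIV. local_log \<tau> c p x $ i = local_log \<tau> c' q x $ i"
    by (intro eventually_ball_finite) auto
  then show ?thesis by (rule eventually_mono) (simp add: vec_eq_iff)
qed

text \<open>The germ over t is built from a continuous lift of the logarithms along \<gamma>; nearby
  parameters lead to the same branch. The final logarithms c' serve all coefficients \<alpha> at
  once, so the continuation is visibly linear.\<close>

lemma local_series_continues:
  fixes A :: "int^'n::finite^'d::finite"
  assumes g: "gseries \<tau> UNIV (zker A)" and v: "\<And>k. k \<in> J \<Longrightarrow> integral_off \<tau> (v k)"
    and \<gamma>: "path \<gamma>" and nz: "\<And>t i. t \<in> {0..1} \<Longrightarrow> i \<in> \<tau> \<Longrightarrow> \<gamma> t $ i \<noteq> 0"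
    and c: "\<And>i. i \<in> \<tau> \<Longrightarrow> exp (c$i) = \<gamma> 0 $ i"
  shows "\<exists>c'. (\<forall>i\<in>\<tau>. exp (c'$i) = \<gamma> 1 $ i) \<and> (\<forall>\<alpha>. continues_along \<gamma>
     (germ_at (\<gamma> 0) (\<lambda>x. \<Sum>k\<in>J. \<alpha> k * local_series A \<tau> (v k) c (\<gamma> 0) x))
     (germ_at (\<gamma> 1) (\<lambda>x. \<Sum>k\<in>J. \<alpha> k * local_series A \<tau> (v k) c' (\<gamma> 1) x)))"
proof -
  obtain \<L> :: "real \<Rightarrow> complex^'n" where L0: "(\<forall>i\<in>\<tau>. continuous_on {0..1} (\<lambda>t. \<L> t $ i)) \<and>
     (\<forall>t\<in>{0..1}. \<forall>i\<in>\<tau>. exp (\<L> t $ i) = \<gamma> t $ i) \<and> (\<forall>i\<in>\<tau>. \<L> 0 $ i = c$i)"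
  proof -
    have "\<exists>\<L>::real \<Rightarrow> complex^'n. (\<forall>i\<in>\<tau>. continuous_on {0..1} (\<lambda>t. \<L> t $ i)) \<and>
       (\<forall>t\<in>{0..1}. \<forall>i\<in>\<tau>. exp (\<L> t $ i) = \<gamma> t $ i) \<and> (\<forall>i\<in>\<tau>. \<L> 0 $ i = c$i)"
      by (rule path_log_lift[OF \<gamma>]) (use nz c in auto)
    then show thesis by (elim exE) (rule that)
  qed
  have \<L>: "\<And>i. i \<in> \<tau> \<Longrightarrow> continuous_on {0..1} (\<lambda>t. \<L> t $ i)"
    "\<And>t i. t \<in> {0..1} \<Longrightarrow> i \<in> \<tau> \<Longrightarrow> exp (\<L> t $ i) = \<gamma> t $ i" "\<And>i. i \<in> \<tau> \<Longrightarrow> \<L> 0 $ i = c$i"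
    using L0 by simp_all
  define f where "f \<alpha> t x = (\<Sum>k\<in>J. \<alpha> k * local_series A \<tau> (v k) (\<L> t) (\<gamma> t) x)" for \<alpha> t x
  have cont: "continuous_on {0..1} \<gamma>" using \<gamma> by (simp add: path_def)
  have "Defs.analytic_continuation \<gamma> (\<lambda>t. germ_at (\<gamma> t) (f \<alpha> t))" for \<alpha>
    unfolding analytic_continuation_def
  proof (intro conjI \<gamma> ballI)
    fix t :: real assume t: "t \<in> {0..1}"
    let ?U = "log_domain \<tau> (\<gamma> t)"
    have tU: "\<gamma> t \<in> ?U" by (rule mem_log_domain) (rule nz[OF t])
    have hol: "f \<alpha> t mholomorphic_on ?U"
      unfolding f_def by (rule mholomorphic_local_series_combination[OF g v]) (use \<L>(2)[OF t] in auto)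
    obtain r where r: "0 < r" "ball (\<gamma> t) r \<subseteq> ?U" using open_log_domain tU open_contains_ball by meson
    obtain d where d: "0 < d" "\<And>s. s \<in> {0..1} \<Longrightarrow> \<bar>s - t\<bar> < d \<Longrightarrow> dist (\<gamma> s) (\<gamma> t) < r"
      using cont t r(1) unfolding continuous_on_iff by (metis dist_real_def)
    have "\<exists>d>0. \<forall>s\<in>{0..1}. \<bar>s - t\<bar> < d \<longrightarrow> norm (\<L> s $ i - \<L> t $ i) < 1" if i: "i \<in> \<tau>" for i
      using \<L>(1)[OF i] t unfolding continuous_on_iff dist_norm by (metis real_norm_def zero_less_one)
    then obtain D where D: "\<And>i. i \<in> \<tau> \<Longrightarrow> 0 < D i \<and> (\<forall>s\<in>{0..1}. \<bar>s - t\<bar> < D i \<longrightarrow> norm (\<L> s $ i - \<L> t $ i) < 1)"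
      by metis
    define e where "e = Min (insert d (D ` \<tau>))"
    have e: "0 < e" "e \<le> d" "\<And>i. i \<in> \<tau> \<Longrightarrow> e \<le> D i" using d D by (auto simp: e_def)
    show "\<exists>U h. open U \<and> \<gamma> t \<in> U \<and> h mholomorphic_on U \<and>
        (\<exists>e>0. \<forall>s\<in>{0..1}. \<bar>s - t\<bar> < e \<longrightarrow> \<gamma> s \<in> U \<and> germ_at (\<gamma> s) (f \<alpha> s) = germ_at (\<gamma> s) h)"
    proof (intro exI[of _ ?U] exI[of _ "f \<alpha> t"] conjI open_log_domain tU hol exI[of _ e] e(1) ballI impI)
      fix s :: real assume s: "s \<in> {0..1}" "\<bar>s - t\<bar> < e"
      show sU: "\<gamma> s \<in> ?U" using d(2)[OF s(1)] s(2) e(2) r(2) by (auto simp: dist_commute)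
      have "\<forall>\<^sub>F x in nhds (\<gamma> s). local_log \<tau> (\<L> s) (\<gamma> s) x = local_log \<tau> (\<L> t) (\<gamma> t) x"
      proof (rule local_log_change_center[OF sU \<L>(2)[OF t] \<L>(2)[OF s(1)]])
        fix i assume i: "i \<in> \<tau>"
        have "\<bar>s - t\<bar> < D i" using e(3)[OF i] s(2) by linarith
        then show "norm (\<L> s $ i - \<L> t $ i) < 1" using D[OF i] s(1) by blast
      qed
      then show "germ_at (\<gamma> s) (f \<alpha> s) = germ_at (\<gamma> s) (f \<alpha> t)"
        unfolding germ_at_eq_iff by (rule eventually_mono) (simp add: f_def local_series_def)
    qed
  qed
  then have "continues_along \<gamma> (germ_at (\<gamma> 0) (f \<alpha> 0)) (germ_at (\<gamma> 1) (f \<alpha> 1))" for \<alpha>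
    unfolding continues_along_def by blast
  moreover have "local_log \<tau> (\<L> 0) (\<gamma> 0) x = local_log \<tau> c (\<gamma> 0) x" for x
    using \<L>(3) by (simp add: local_log_def vec_eq_iff)
  then have "f \<alpha> 0 = (\<lambda>x. \<Sum>k\<in>J. \<alpha> k * local_series A \<tau> (v k) c (\<gamma> 0) x)" for \<alpha>
    by (simp add: f_def local_series_def fun_eq_iff)
  moreover have "f \<alpha> 1 = (\<lambda>x. \<Sum>k\<in>J. \<alpha> k * local_series A \<tau> (v k) (\<L> 1) (\<gamma> 1) x)" for \<alpha>
    by (simp add: f_def fun_eq_iff)
  ultimately show ?thesis using \<L>(2)[of 1] by (intro exI[of _ "\<L> 1"]) simp
qed

text \<open>Changing the logarithms by 2 \<pi> \<i> N_l multiplies the term of u by the exponential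
  of 2 \<pi> \<i> times the sum of N_l (v_l + u_l) over \<tau>, in which the integers u_l drop out.
  So every series is an eigenvector of each monodromy operator.\<close>

lemma local_series_monodromy:
  assumes c: "\<And>i. i \<in> \<tau> \<Longrightarrow> exp (c$i) = p$i" and c': "\<And>i. i \<in> \<tau> \<Longrightarrow> exp (c'$i) = p$i"
  shows "\<exists>\<mu>. \<forall>x. local_series A \<tau> v c' p x = \<mu> * local_series A \<tau> v c p x"
proof -
  have "\<exists>n::int. c'$i = c$i + (of_int (2 * n) * pi) * \<i>" if "i \<in> \<tau>" for i
    using c[OF that] c'[OF that] by (metis exp_eq)
  then obtain N :: "'a \<Rightarrow> int" where N: "\<And>i. i \<in> \<tau> \<Longrightarrow> c'$i = c$i + (of_int (2 * N i) * pi) * \<i>" by metis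
  define m where "m l = (if l \<in> \<tau> then exp (v$l * ((of_int (2 * N l) * pi) * \<i>)) else 1)" for l
  have h: "hfac \<tau> l (v$l + of_int (u$l)) (local_log \<tau> c' p x $ l) = m l * hfac \<tau> l (v$l + of_int (u$l)) (local_log \<tau> c p x $ l)"
    for l x and u :: "int^'a"
  proof (cases "l \<in> \<tau>")
    case True
    have "local_log \<tau> c' p x $ l = local_log \<tau> c p x $ l + (of_int (2 * N l) * pi) * \<i>"
      using True N[OF True] by (simp add: local_log_def)
    moreover have "exp (of_int (u$l) * ((of_int (2 * N l) * pi) * \<i>)) = 1"
      unfolding exp_eq_1 by (auto intro!: exI[of _ "u$l * N l"])
    ultimately show ?thesis using True
      by (simp add: hfac_def m_def exp_add ring_distribs)
  qed (simp add: local_log_def m_def)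
  have "gterm \<tau> UNIV v (local_log \<tau> c' p x) u = (\<Prod>l\<in>UNIV. m l) * gterm \<tau> UNIV v (local_log \<tau> c p x) u" for x u
    unfolding gterm_def h by (rule prod.distrib)
  then have "local_series A \<tau> v c' p x = (\<Prod>l\<in>UNIV. m l) * local_series A \<tau> v c p x" for x
    unfolding local_series_def gsum_def by (subst infsum_cmult_right'[symmetric]) (rule infsum_cong)
  then show ?thesis by blast
qed

text \<open>Differentiating by the exponents that one series has outside \<tau> and setting those
  variables to 0 leaves only this series: a surviving term of another one would link the two
  exponents by a kernel vector, against \<open>distinct\<close>.\<close>

lemma local_series_independent:
  fixes A :: "int^'n::finite^'d::finite"
  assumes g: "gseries \<tau> UNIV (zker A)" and d: "dual_basis A \<tau> \<delta>" and J: "finite J"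
    and v: "\<And>k l. k \<in> J \<Longrightarrow> l \<notin> \<tau> \<Longrightarrow> v k $ l \<in> \<nat>"
    and nz: "\<And>k i. k \<in> J \<Longrightarrow> i \<in> \<tau> \<Longrightarrow> rGamma (v k $ i + 1) \<noteq> 0"
    and distinct: "\<And>k k' u. k \<in> J \<Longrightarrow> k' \<in> J \<Longrightarrow> u \<in> zker A \<Longrightarrow> (\<And>l. l \<notin> \<tau> \<Longrightarrow> v k $ l + of_int (u$l) = v k' $ l) \<Longrightarrow> k = k'"
    and c: "\<And>i. i \<in> \<tau> \<Longrightarrow> exp (c$i) = p$i"
    and zero: "\<forall>\<^sub>F x in nhds p. (\<Sum>k\<in>J. \<alpha> k * local_series A \<tau> (v k) c p x) = 0" and k0: "k0 \<in> J"
  shows "\<alpha> k0 = 0"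
proof -
  interpret gseries \<tau> UNIV "zker A" by (rule g)
  have vi: "integral_off \<tau> (v k)" if "k \<in> J" for k
    using v[OF that] by (auto simp: integral_off_def) (meson Nats_subset_Ints subsetD)
  define y where "y = local_log \<tau> c p p"
  \<comment> \<open>Inverse of the chart \<open>local_log\<close>; it carries the identity of germs
    at p to an identity of entire functions near y.\<close>
  define x where "x z = (\<chi> l. hbase \<tau> l (z$l))" for z :: "complex^'n"
  have pnz: "p$i \<noteq> 0" if "i \<in> \<tau>" for i using c[OF that] by (metis exp_not_eq_zero)
  have yi: "y$i = c$i" if "i \<in> \<tau>" for i using pnz[OF that] that by (simp add: y_def local_log_def)
  have xy: "x y = p"
    using hbase_local_log[OF c mem_log_domain[of \<tau> p]] pnz by (simp add: x_def y_def vec_eq_iff)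
  have "continuous (at y) x"
  proof -
    have "continuous (at y) (\<lambda>z::complex^'n. hbase \<tau> l (z$l))" for l
      by (cases "l \<in> \<tau>") (auto simp: hbase_def intro!: continuous_intros)
    then show ?thesis unfolding x_def by (simp add: continuous_def tendsto_vec_lambda)
  qed
  then have "(x \<longlongrightarrow> p) (nhds y)" by (simp add: continuous_at tendsto_nhds_iff xy)
  then have 1: "\<forall>\<^sub>F z in nhds y. (\<Sum>k\<in>J. \<alpha> k * local_series A \<tau> (v k) c p (x z)) = 0"
    using zero by (rule eventually_compose_filterlim[rotated])
  have 2: "\<forall>\<^sub>F z in nhds y. dist z y < pi" unfolding eventually_nhds_metric by (auto intro!: exI[of _ pi])
  have "\<forall>\<^sub>F z in nhds y. (\<Sum>k\<in>J. \<alpha> k * gsum \<tau> UNIV (zker A) (v k) z) = 0"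
    using 1 2
  proof eventually_elim
    case (elim z)
    have "local_log \<tau> c p (x z) $ l = z$l" for l
    proof (cases "l \<in> \<tau>")
      case True
      have "\<bar>Im (z$l - c$l)\<bar> < pi"
        using abs_Im_le_cmod[of "z$l - c$l"] Finite_Cartesian_Product.norm_nth_le[of "z - y" l] elim(2) yi[OF True]
        by (simp add: dist_norm)
      then have "Ln (exp (z$l - c$l)) = z$l - c$l" by (intro Ln_exp) auto
      then show ?thesis using True c[OF True] by (simp add: local_log_def x_def hbase_def exp_diff)
    qed (simp add: local_log_def x_def hbase_def)
    then have "local_log \<tau> c p (x z) = z" by (simp add: vec_eq_iff)
    then show ?case using elim(1) by (simp add: local_series_def)
  qed
  then have van: "(\<Sum>k\<in>J. \<alpha> k * gsum \<tau> UNIV (zker A) (v k - cvec b) z) = 0" for b z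
    by (intro gsum_combination_zero[where v = v]) (use vi in auto)
  have "\<exists>n. v k0 $ l = of_nat n" if "l \<notin> \<tau>" for l using v[OF k0 that] by (auto elim: Nats_cases)
  then obtain n where n: "\<And>l. l \<notin> \<tau> \<Longrightarrow> v k0 $ l = of_nat (n l)" by metis
  define b where "b = (\<chi> l. if l \<in> \<tau> then 0 else n l)"
  have other: "gsum \<tau> UNIV (zker A) (v k - cvec b) 0 = 0" if k: "k \<in> J" "k \<noteq> k0" for k
  proof -
    have "gterm \<tau> UNIV (v k - cvec b) 0 u = 0" if u: "u \<in> zker A" for u
    proof (rule ccontr)
      assume nz: "gterm \<tau> UNIV (v k - cvec b) 0 u \<noteq> 0"
      have "v k $ l + of_int (u$l) = v k0 $ l" if l: "l \<notin> \<tau>" for l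
      proof -
        have "(v k - cvec b) $ l + of_int (u$l) = 0"
          by (rule gterm_nonzero_at_origin[OF _ integral_off_minus[OF vi[OF k(1)]] _ nz l]) auto
        then show ?thesis using l n by (simp add: b_def algebra_simps)
      qed
      then show False using distinct[OF k(1) k0 u] k(2) by blast
    qed
    then show ?thesis unfolding gsum_def by (intro infsum_0) 
  qed
  have "(\<Sum>k\<in>J. \<alpha> k * gsum \<tau> UNIV (zker A) (v k - cvec b) 0) = (\<Sum>k\<in>{k0}. \<alpha> k * gsum \<tau> UNIV (zker A) (v k - cvec b) 0)"
    using J k0 other by (intro sum.mono_neutral_right) auto
  then have "\<alpha> k0 * gsum \<tau> UNIV (zker A) (v k0 - cvec b) 0 = 0" using van[of b 0] by simp
  moreover have "gsum \<tau> UNIV (zker A) (v k0 - cvec b) 0 \<noteq> 0"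
    by (rule gsum_origin_single[OF d]) (use n nz[OF k0] in \<open>auto simp: b_def zker_def\<close>)
  ultimately show ?thesis by simp
qed



section \<open>The zeros of the principal determinant of a simplex\<close>

text \<open>A nonempty face of a simplex contains a vertex, and by linear independence of the
  columns the equation of the face forces the coordinate of that vertex to be 0. Conversely a vertex
  is a face, cut out by its dual vector, and t can be taken to be 1 in all coordinates.\<close>

lemma principal_det_zeros_simplex:
  fixes A :: "int^'n::finite^'d::finite"
  assumes d: "dual_basis A \<tau> \<delta>"
  shows "x \<in> principal_det_zeros A \<tau> \<longleftrightarrow> (\<exists>j\<in>\<tau>. x$j = 0)"
proof
  assume "x \<in> principal_det_zeros A \<tau>"
  then obtain F :: "(real^'d) set" and t :: "complex^'d" where
    F: "F face_of (convex hull (acol A ` \<tau>))" "F \<noteq> {}" and t: "\<And>i. t$i \<noteq> 0" and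
    sum: "(\<Sum>j\<in>{j\<in>\<tau>. acol A j \<in> F}. (x$j * (\<Prod>i\<in>UNIV. (t$i) powi (A$i$j))) *s acol A j) = (0 :: complex^'d)"
    unfolding principal_det_zeros_def by blast
  have "compact (acol A ` \<tau> :: (real^'d) set)" by (simp add: finite_imp_compact)
  then obtain S' where S': "S' \<subseteq> acol A ` \<tau>" "F = convex hull S'"
    using face_of_convex_hull_subset[OF _ F(1)] by blast
  then have "S' \<noteq> {}" using F(2) by auto
  then obtain i where i: "i \<in> \<tau>" "acol A i \<in> F" using S' hull_subset[of S' convex] by blast
  define w where "w j = (if acol A j \<in> F then x$j * (\<Prod>i\<in>UNIV. (t$i) powi (A$i$j)) else 0)" for j
  have "(\<Sum>j\<in>\<tau>. w j *s acol A j) = (\<Sum>j\<in>{j\<in>\<tau>. acol A j \<in> F}. (x$j * (\<Prod>i\<in>UNIV. (t$i) powi (A$i$j))) *s acol A j)"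
    by (rule sum.mono_neutral_cong_right) (auto simp: w_def)
  then have "w i = 0" using cdot_coord[OF d i(1), of w] sum by simp
  then have "x$i = 0" using i t by (auto simp: w_def)
  then show "\<exists>j\<in>\<tau>. x$j = 0" using i by blast
next
  assume "\<exists>j\<in>\<tau>. x$j = 0"
  then obtain j where j: "j \<in> \<tau>" "x$j = 0" by blast
  let ?H = "convex hull (acol A ` \<tau>) :: (real^'d) set"
  let ?F = "?H \<inter> {y. \<delta> j \<bullet> y = 1}"
  have le: "\<delta> j \<bullet> y \<le> 1" if "y \<in> ?H" for y
  proof -
    have "?H \<subseteq> {y. \<delta> j \<bullet> y \<le> 1}"
      using dual_basisD(1)[OF d j(1)] by (intro hull_minimal convex_halfspace_le) auto
    then show ?thesis using that by blast
  qed
  have "?F face_of ?H" by (rule face_of_Int_supporting_hyperplane_le[OF convex_convex_hull le])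
  moreover have mem: "acol A i \<in> ?F \<longleftrightarrow> i = j" if "i \<in> \<tau>" for i
    using dual_basisD(1)[OF d j(1) that] that hull_inc[of "acol A i" "acol A ` \<tau>" convex] by auto
  moreover have "?F \<noteq> {}" using mem[OF j(1)] by blast
  moreover have "{i\<in>\<tau>. acol A i \<in> ?F} = {j}" using mem j by blast
  ultimately show "x \<in> principal_det_zeros A \<tau>"
    unfolding principal_det_zeros_def
    by (intro CollectI exI[of _ ?F] exI[of _ "\<chi> i. 1"]) (simp add: j)
qed


section \<open>The subspace spanned by the series of a simplicial facet\<close>

context simplicial_facet
begin

text \<open>Serves both parts of the theorem: v may consist of shifted exponents or of those of the
  \<Gamma>-series. Because the coordinate hyperplanes of \<tau> are singular, logarithms lift along
  every path of nonsingular points, and p avoids the zeros of the principal determinant.\<close>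

lemma is_S_tau_span:
  fixes v :: "'k \<Rightarrow> complex^'n"
  assumes J: "finite J" "J \<noteq> {}" "normalized_volume A \<tau> = real (card J)"
    and v: "\<And>k. k \<in> J \<Longrightarrow> amul A (v k) = \<beta>" "\<And>k l. k \<in> J \<Longrightarrow> l \<notin> \<tau> \<Longrightarrow> v k $ l \<in> \<nat>"
    and nz: "\<And>k i. k \<in> J \<Longrightarrow> i \<in> \<tau> \<Longrightarrow> rGamma (v k $ i + 1) \<noteq> 0"
    and distinct: "\<And>k k' u. k \<in> J \<Longrightarrow> k' \<in> J \<Longrightarrow> u \<in> zker A \<Longrightarrow> (\<And>l. l \<notin> \<tau> \<Longrightarrow> v k $ l + of_int (u$l) = v k' $ l) \<Longrightarrow> k = k'"
    and p: "p \<notin> sing_A A \<beta>" and c: "\<And>i. i \<in> \<tau> \<Longrightarrow> exp (c$i) = p$i"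
  shows "is_S_tau A \<beta> \<tau> p (germ.span ((\<lambda>k. germ_at p (local_series A \<tau> (v k) c p)) ` J))"
proof -
  define G where "G k = germ_at p (local_series A \<tau> (v k) c p)" for k
  define S where "S = germ.span (G ` J)"
  have vi: "integral_off \<tau> (v k)" if "k \<in> J" for k
    using v(2)[OF that] by (auto simp: integral_off_def) (meson Nats_subset_Ints subsetD)
  obtain k1 where k1: "k1 \<in> J" using J by blast
  have sing: "x$j \<noteq> 0" if "x \<notin> sing_A A \<beta>" "j \<in> \<tau>" for x j
    using coordinate_hyperplane_singular[OF that(2) _ v(1)[OF k1] v(2)[OF k1] nz[OF k1]] that by blast
  have comb_germ: "(\<Sum>k\<in>J. germ_scale (\<alpha> k) (G k)) = germ_at p (\<lambda>x. \<Sum>k\<in>J. \<alpha> k * local_series A \<tau> (v k) c p x)" for \<alpha>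
    unfolding G_def by (rule germ_at_combination)
  \<comment> \<open>Coefficients are indexed by J rather than by germs, so that each series can be
    multiplied by its own monodromy factor.\<close>
  have comb: "\<exists>\<alpha>. \<phi> = germ_at p (\<lambda>x. \<Sum>k\<in>J. \<alpha> k * local_series A \<tau> (v k) c p x)" if \<phi>: "\<phi> \<in> S" for \<phi>
  proof -
    let ?C = "range (\<lambda>\<alpha>. \<Sum>k\<in>J. germ_scale (\<alpha> k) (G k))"
    have "G ` J \<subseteq> ?C"
    proof
      fix \<psi> assume "\<psi> \<in> G ` J"
      then obtain k where k: "k \<in> J" "\<psi> = G k" by blast
      have "(\<Sum>k'\<in>J. germ_scale (if k' = k then 1 else 0) (G k')) = (\<Sum>k'\<in>{k}. germ_scale (if k' = k then 1 else 0) (G k'))"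
        using J k by (intro sum.mono_neutral_right) auto
      then have "\<psi> = (\<Sum>k'\<in>J. germ_scale (if k' = k then 1 else 0) (G k'))" using k by simp
      then show "\<psi> \<in> ?C" by (rule range_eqI[where x = "\<lambda>k'. if k' = k then 1 else 0"])
    qed
    moreover have "germ.subspace ?C"
      unfolding germ.subspace_def
    proof (intro conjI ballI allI)
      show "0 \<in> ?C" by (rule range_eqI[of _ _ "\<lambda>_. 0"]) simp
      fix x y assume "x \<in> ?C" "y \<in> ?C"
      then obtain a b where "x = (\<Sum>k\<in>J. germ_scale (a k) (G k))" "y = (\<Sum>k\<in>J. germ_scale (b k) (G k))" by blast
      then have "x + y = (\<Sum>k\<in>J. germ_scale (a k + b k) (G k))" by (simp add: sum.distrib germ.scale_left_distrib)
      then show "x + y \<in> ?C" by (rule range_eqI[where x = "\<lambda>k. a k + b k"])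
    next
      fix r x assume "x \<in> ?C"
      then obtain a where "x = (\<Sum>k\<in>J. germ_scale (a k) (G k))" by blast
      then have "germ_scale r x = (\<Sum>k\<in>J. germ_scale (r * a k) (G k))" by (simp add: germ.scale_sum_right)
      then show "germ_scale r x \<in> ?C" by (rule range_eqI[where x = "\<lambda>k. r * a k"])
    qed
    ultimately have "S \<subseteq> ?C" unfolding S_def by (rule germ.span_minimal)
    then show ?thesis using \<phi> comb_germ by blast
  qed
  have inS: "germ_at p (\<lambda>x. \<Sum>k\<in>J. \<alpha> k * local_series A \<tau> (v k) c p x) \<in> S" for \<alpha>
    unfolding comb_germ[symmetric] S_def by (intro germ.span_sum germ.span_scale germ.span_base) blast
  have cont: "\<exists>c'. (\<forall>i\<in>\<tau>. exp (c'$i) = \<gamma> 1 $ i) \<and> (\<forall>\<alpha>. continues_along \<gamma>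
     (germ_at p (\<lambda>x. \<Sum>k\<in>J. \<alpha> k * local_series A \<tau> (v k) c p x))
     (germ_at (\<gamma> 1) (\<lambda>x. \<Sum>k\<in>J. \<alpha> k * local_series A \<tau> (v k) c' (\<gamma> 1) x)))"
    if \<gamma>: "path \<gamma>" "pathstart \<gamma> = p" and nz: "\<And>x i. x \<in> path_image \<gamma> \<Longrightarrow> i \<in> \<tau> \<Longrightarrow> x $ i \<noteq> 0" for \<gamma>
  proof -
    have 0: "\<gamma> 0 = p" using \<gamma>(2) by (simp add: pathstart_def)
    have "\<exists>c'. (\<forall>i\<in>\<tau>. exp (c'$i) = \<gamma> 1 $ i) \<and> (\<forall>\<alpha>. continues_along \<gamma>
     (germ_at (\<gamma> 0) (\<lambda>x. \<Sum>k\<in>J. \<alpha> k * local_series A \<tau> (v k) c (\<gamma> 0) x))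
     (germ_at (\<gamma> 1) (\<lambda>x. \<Sum>k\<in>J. \<alpha> k * local_series A \<tau> (v k) c' (\<gamma> 1) x)))"
      by (rule local_series_continues[OF gseries_full vi \<gamma>(1)]) (use nz c 0 in \<open>auto simp: path_image_def\<close>)
    then show ?thesis by (simp only: 0)
  qed
  have mono: "monodromy_invariant (- sing_A A \<beta>) p S"
    unfolding monodromy_invariant_def
  proof (intro allI impI ballI, elim conjE)
    fix \<gamma> \<phi> assume \<gamma>: "path \<gamma>" "path_image \<gamma> \<subseteq> - sing_A A \<beta>" "pathstart \<gamma> = p" "pathfinish \<gamma> = p" and \<phi>: "\<phi> \<in> S"
    obtain c' where c': "\<And>i. i \<in> \<tau> \<Longrightarrow> exp (c'$i) = \<gamma> 1 $ i" and cc: "\<And>\<alpha>. continues_along \<gamma>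
       (germ_at p (\<lambda>x. \<Sum>k\<in>J. \<alpha> k * local_series A \<tau> (v k) c p x))
       (germ_at (\<gamma> 1) (\<lambda>x. \<Sum>k\<in>J. \<alpha> k * local_series A \<tau> (v k) c' (\<gamma> 1) x))"
      using cont[OF \<gamma>(1,3)] sing \<gamma>(2) by blast
    have 1: "\<gamma> 1 = p" using \<gamma>(4) by (simp add: pathfinish_def)
    have "\<exists>\<mu>. \<forall>x. local_series A \<tau> (v k) c' p x = \<mu> * local_series A \<tau> (v k) c p x" for k
      by (rule local_series_monodromy) (use c c' 1 in auto)
    then obtain \<mu> where \<mu>: "\<And>k x. local_series A \<tau> (v k) c' p x = \<mu> k * local_series A \<tau> (v k) c p x" by metis
    obtain \<alpha> where \<alpha>: "\<phi> = germ_at p (\<lambda>x. \<Sum>k\<in>J. \<alpha> k * local_series A \<tau> (v k) c p x)" using comb[OF \<phi>] by blast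
    have "continues_along \<gamma> \<phi> (germ_at p (\<lambda>x. \<Sum>k\<in>J. (\<alpha> k * \<mu> k) * local_series A \<tau> (v k) c p x))"
      using cc[of \<alpha>] by (simp add: \<alpha> 1 \<mu> mult.assoc)
    then show "\<exists>\<psi>\<in>S. continues_along \<gamma> \<phi> \<psi>" using inS[of "\<lambda>k. \<alpha> k * \<mu> k"] by (rule bexI)
  qed
  have sol: "S \<subseteq> solution_space (hypergeometric_ideal A \<beta>) p"
  proof
    fix \<phi> assume "\<phi> \<in> S"
    then obtain \<alpha> where \<alpha>: "\<phi> = germ_at p (\<lambda>x. \<Sum>k\<in>J. \<alpha> k * local_series A \<tau> (v k) c p x)" using comb by blast
    show "\<phi> \<in> solution_space (hypergeometric_ideal A \<beta>) p"
      unfolding \<alpha> by (rule local_series_solution[OF gseries_full v(1) vi c])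
  qed
  have indep0: "\<alpha> k = 0" if "(\<Sum>k\<in>J. germ_scale (\<alpha> k) (G k)) = 0" "k \<in> J" for \<alpha> k
  proof (rule local_series_independent[OF gseries_full dual J(1) v(2) nz distinct c _ that(2)])
    show "\<forall>\<^sub>F x in nhds p. (\<Sum>k\<in>J. \<alpha> k * local_series A \<tau> (v k) c p x) = 0"
      using that(1) unfolding comb_germ germ_at_zero[of p, symmetric] germ_at_eq_iff .
  qed
  have inj: "inj_on G J"
  proof (rule inj_onI, rule ccontr)
    fix k k' assume k: "k \<in> J" "k' \<in> J" "G k = G k'" "k \<noteq> k'"
    define \<alpha> where "\<alpha> x = (if x = k then 1 else if x = k' then - 1 else 0 :: complex)" for x
    have "(\<Sum>x\<in>J. germ_scale (\<alpha> x) (G x)) = (\<Sum>x\<in>{k, k'}. germ_scale (\<alpha> x) (G x))"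
      using J k by (intro sum.mono_neutral_right) (auto simp: \<alpha>_def)
    also have "\<dots> = 0" using k by (simp add: \<alpha>_def)
    finally show False using indep0[of \<alpha> k] k by (simp add: \<alpha>_def)
  qed
  have "germ.independent (G ` J)"
  proof
    assume "germ.dependent (G ` J)"
    then obtain w where w: "\<exists>x\<in>G ` J. w x \<noteq> 0" "(\<Sum>x\<in>G ` J. germ_scale (w x) x) = 0"
      using germ.dependent_finite[of "G ` J"] J(1) by auto
    have "(\<Sum>k\<in>J. germ_scale (w (G k)) (G k)) = 0"
      using w(2) by (simp add: sum.reindex[OF inj])
    then show False using indep0[of "\<lambda>k. w (G k)"] w(1) by blast
  qed
  then have "germ.dim S = card (G ` J)" unfolding S_def by (rule germ.dim_span_eq_card_independent)
  then have dim: "real (germ.dim S) = normalized_volume A \<tau>" using J by (simp add: card_image[OF inj])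
  have ext: "extends_multivalued (- principal_det_zeros A \<tau>) p \<phi>" if \<phi>: "\<phi> \<in> S" for \<phi>
    unfolding extends_multivalued_def
  proof (intro conjI allI impI)
    show "p \<in> - principal_det_zeros A \<tau>"
      using sing[OF p] by (auto simp: principal_det_zeros_simplex[OF dual])
    fix \<gamma> assume \<gamma>: "path \<gamma> \<and> path_image \<gamma> \<subseteq> - principal_det_zeros A \<tau> \<and> pathstart \<gamma> = p"
    have "x $ i \<noteq> 0" if "x \<in> path_image \<gamma>" "i \<in> \<tau>" for x i
      using \<gamma> that principal_det_zeros_simplex[OF dual, of x] by blast
    from cont[OF _ _ this] \<gamma> comb[OF \<phi>] show "\<exists>\<psi>. continues_along \<gamma> \<phi> \<psi>" by blast
  qed
  show ?thesis
    unfolding is_S_tau_def G_def[symmetric] S_def[symmetric]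
    using mono sol dim ext germ.subspace_span[of "G ` J"] by (simp add: S_def)
qed

end

section \<open>Cells of regular subdivisions\<close>

lemma lattice_full_rank:
  fixes A :: "int^'n::finite^'d::finite" and w :: "real^'d"
  assumes lattice: "range (\<lambda>u::int^'n. A *v u) = UNIV" and w: "\<And>j. w \<bullet> acol A j = 0"
  shows "w = 0"
proof (subst vec_eq_iff, rule allI)
  fix r
  obtain u :: "int^'n" where u: "axis r 1 = A *v u" using lattice by (metis rangeE UNIV_I)
  have "rvec (A *v u) = (\<Sum>j\<in>UNIV. of_int (u$j) *\<^sub>R (acol A j :: real^'d))"
    by (simp add: vec_eq_iff matrix_vector_mult_def mult.commute)
  then have "w \<bullet> rvec (A *v u) = 0" using w by (simp add: inner_sum_right)
  moreover have "rvec (A *v u) = axis r 1" unfolding u[symmetric] by (simp add: vec_eq_iff axis_def)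
  ultimately show "w $ r = 0 $ r" by (simp add: inner_axis)
qed

text \<open>If the columns of the cell do not span, its supporting functional can be tilted in an
  orthogonal direction until a further column becomes tight, against maximality.\<close>

lemma maximal_cell_spans:
  fixes A :: "int^'n::finite^'d::finite"
  assumes lattice: "range (\<lambda>u::int^'n. A *v u) = UNIV" and \<sigma>: "\<sigma> \<in> maximal_cells (subdiv_complex A \<omega>)"
  shows "span (acol A ` \<sigma> :: (real^'d) set) = UNIV"
proof (rule ccontr)
  assume "span (acol A ` \<sigma> :: (real^'d) set) \<noteq> UNIV"
  then obtain w0 :: "real^'d" where w0: "w0 \<noteq> 0" "\<And>x. x \<in> span (acol A ` \<sigma>) \<Longrightarrow> w0 \<bullet> x = 0"
    using span_not_UNIV_orthogonal by metis
  obtain j0 where j0: "w0 \<bullet> acol A j0 \<noteq> 0" using lattice_full_rank[OF lattice] w0(1) by blast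
  define w where "w = (if w0 \<bullet> acol A j0 > 0 then w0 else - w0)"
  have wj0: "0 < w \<bullet> acol A j0" using j0 by (auto simp: w_def)
  have w\<sigma>: "w \<bullet> acol A j = 0" if "j \<in> \<sigma>" for j
    using w0(2)[OF span_base, of "acol A j"] that by (auto simp: w_def)
  obtain c :: "real^'d" where c: "\<And>j. j \<in> \<sigma> \<Longrightarrow> c \<bullet> acol A j = \<omega>$j" "\<And>j. j \<notin> \<sigma> \<Longrightarrow> c \<bullet> acol A j < \<omega>$j"
    using \<sigma> by (auto simp: maximal_cells_def subdiv_complex_def)
  define J where "J = {j. 0 < w \<bullet> acol A j}"
  have J: "finite J" "J \<noteq> {}" "J \<inter> \<sigma> = {}" using wj0 w\<sigma> by (auto simp: J_def)
  \<comment> \<open>Ratio test: \<open>s j\<close> is the length of the tilt at which column j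
    becomes tight, and the smallest one keeps all inequalities.\<close>
  define s where "s j = (\<omega>$j - c \<bullet> acol A j) / (w \<bullet> acol A j)" for j
  define t where "t = Min (s ` J)"
  have "t \<in> s ` J" unfolding t_def using J by (intro Min_in) auto
  then obtain j1 where j1: "j1 \<in> J" "t = s j1" by blast
  have ts: "t \<le> s j" if "j \<in> J" for j unfolding t_def using J that by (intro Min_le) auto
  have sJ: "0 < s j" if "j \<in> J" for j
  proof -
    have "j \<notin> \<sigma>" using that J by blast
    then show ?thesis using that c(2)[of j] by (simp add: s_def J_def)
  qed
  have t0: "0 < t" using sJ j1 by simp
  define c' where "c' = c + t *\<^sub>R w"
  have c'j: "c' \<bullet> acol A j = c \<bullet> acol A j + t * (w \<bullet> acol A j)" for j
    by (simp add: c'_def inner_add_left)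
  have le: "c' \<bullet> acol A j \<le> \<omega>$j" for j
  proof (cases "j \<in> J")
    case True
    then have "t * (w \<bullet> acol A j) \<le> s j * (w \<bullet> acol A j)" using ts by (intro mult_right_mono) (auto simp: J_def)
    also have "\<dots> = \<omega>$j - c \<bullet> acol A j" using True by (simp add: s_def J_def)
    finally show ?thesis by (simp add: c'j)
  next
    case False
    then have "t * (w \<bullet> acol A j) \<le> 0" using t0 by (simp add: J_def mult_nonneg_nonpos)
    moreover have "c \<bullet> acol A j \<le> \<omega>$j" using c by (metis less_imp_le order_refl)
    ultimately show ?thesis by (simp add: c'j)
  qed
  define \<sigma>' where "\<sigma>' = {j. c' \<bullet> acol A j = \<omega>$j}"
  have "\<sigma>' \<in> subdiv_complex A \<omega>"
    unfolding subdiv_complex_def \<sigma>'_def using le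
    by (intro CollectI exI[of _ c']) (auto simp: order_less_le)
  moreover have "\<sigma> \<subseteq> \<sigma>'" using c(1) w\<sigma> by (auto simp: \<sigma>'_def c'j)
  moreover have "j1 \<in> \<sigma>'" using j1 by (simp add: \<sigma>'_def c'j s_def J_def)
  moreover have "j1 \<notin> \<sigma>" using j1 J by blast
  ultimately show False using \<sigma> unfolding maximal_cells_def by blast
qed

text \<open>All subsets of \<sigma> are cells, in particular the set \<rho> of indices where a
  linear relation \<mu> is not positive. The functional of \<rho> is tight on \<rho> and strict
  elsewhere; pairing the relation with it and with the functional of \<sigma> gives 0 < 0 as soon as
  some \<mu>_i is positive. So the columns are independent, and by maximality they span.\<close>

lemma triangulation_cell_dual_basis:
  fixes A :: "int^'n::finite^'d::finite"
  assumes lattice: "range (\<lambda>u::int^'n. A *v u) = UNIV" and T: "regular_triangulation A T" and \<sigma>: "\<sigma> \<in> maximal_cells T"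
  shows "card \<sigma> = CARD('d)" and "\<exists>\<delta>. dual_basis A \<sigma> \<delta>"
proof -
  obtain \<omega> where \<omega>: "T = subdiv_complex A \<omega>" using T by (auto simp: regular_triangulation_def)
  have sub: "\<rho> \<in> T" if "\<rho> \<subseteq> \<sigma>" for \<rho>
    using T \<sigma> that by (auto simp: regular_triangulation_def maximal_cells_def)
  have \<sigma>T: "\<sigma> \<in> T" using sub by blast
  have span: "span (acol A ` \<sigma> :: (real^'d) set) = UNIV"
    using maximal_cell_spans[OF lattice] \<sigma> unfolding \<omega> .
  have nonpos: "\<mu> i \<le> 0" if sum: "(\<Sum>i\<in>\<sigma>. \<mu> i *\<^sub>R acol A i) = (0 :: real^'d)" and i: "i \<in> \<sigma>" for \<mu> i
  proof (rule ccontr)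
    assume pos: "\<not> \<mu> i \<le> 0"
    define \<rho> where "\<rho> = {i \<in> \<sigma>. \<mu> i \<le> 0}"
    have "\<rho> \<in> subdiv_complex A \<omega>" using sub[of \<rho>] \<omega> by (auto simp: \<rho>_def)
    then obtain c :: "real^'d" where c: "\<And>j. j \<in> \<rho> \<Longrightarrow> c \<bullet> acol A j = \<omega>$j" "\<And>j. j \<notin> \<rho> \<Longrightarrow> c \<bullet> acol A j < \<omega>$j"
      by (auto simp: subdiv_complex_def)
    obtain c1 :: "real^'d" where c1: "\<And>j. j \<in> \<sigma> \<Longrightarrow> c1 \<bullet> acol A j = \<omega>$j" using \<sigma>T by (auto simp: \<omega> subdiv_complex_def)
    have "(\<Sum>i\<in>\<sigma>. \<mu> i * \<omega>$i) = c1 \<bullet> (\<Sum>i\<in>\<sigma>. \<mu> i *\<^sub>R acol A i)"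
      using c1 by (simp add: inner_sum_right)
    then have 1: "(\<Sum>i\<in>\<sigma>. \<mu> i * \<omega>$i) = 0" using sum by simp
    have 2: "(\<Sum>i\<in>\<sigma>. \<mu> i * (c \<bullet> acol A i)) = 0"
    proof -
      have "(\<Sum>i\<in>\<sigma>. \<mu> i * (c \<bullet> acol A i)) = c \<bullet> (\<Sum>i\<in>\<sigma>. \<mu> i *\<^sub>R acol A i)" by (simp add: inner_sum_right)
      then show ?thesis using sum by simp
    qed
    have "(\<Sum>i\<in>\<sigma>. \<mu> i * (c \<bullet> acol A i)) < (\<Sum>i\<in>\<sigma>. \<mu> i * \<omega>$i)"
    proof (rule sum_strict_mono_ex1)
      show "\<forall>i\<in>\<sigma>. \<mu> i * (c \<bullet> acol A i) \<le> \<mu> i * \<omega>$i"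
      proof
        fix i assume i: "i \<in> \<sigma>"
        show "\<mu> i * (c \<bullet> acol A i) \<le> \<mu> i * \<omega>$i"
        proof (cases "\<mu> i \<le> 0")
          case True
          then show ?thesis using c(1)[of i] i by (simp add: \<rho>_def)
        next
          case False
          then have "c \<bullet> acol A i < \<omega>$i" using c(2)[of i] by (simp add: \<rho>_def)
          then show ?thesis using False by (intro mult_left_mono) auto
        qed
      qed
      show "\<exists>i\<in>\<sigma>. \<mu> i * (c \<bullet> acol A i) < \<mu> i * \<omega>$i"
        using i pos c(2)[of i] by (intro bexI[of _ i]) (auto simp: \<rho>_def)
    qed simp
    then show False using 1 2 by simp
  qed
  have zero: "\<mu> i = 0" if sum: "(\<Sum>i\<in>\<sigma>. \<mu> i *\<^sub>R acol A i) = (0 :: real^'d)" and i: "i \<in> \<sigma>" for \<mu> i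
  proof -
    have "(\<Sum>i\<in>\<sigma>. (- \<mu> i) *\<^sub>R acol A i) = (0 :: real^'d)" using sum by (simp add: sum_negf)
    from nonpos[OF this i] nonpos[OF sum i] show ?thesis by simp
  qed
  have inj: "inj_on (acol A :: 'n \<Rightarrow> real^'d) \<sigma>"
  proof (rule inj_onI, rule ccontr)
    fix i i' assume i: "i \<in> \<sigma>" "i' \<in> \<sigma>" "(acol A i :: real^'d) = acol A i'" "i \<noteq> i'"
    define \<mu> where "\<mu> x = (if x = i then 1 else if x = i' then - 1 else 0 :: real)" for x
    have "(\<Sum>x\<in>\<sigma>. \<mu> x *\<^sub>R acol A x) = (\<Sum>x\<in>{i, i'}. \<mu> x *\<^sub>R (acol A x :: real^'d))"
      using i by (intro sum.mono_neutral_right) (auto simp: \<mu>_def)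
    also have "\<dots> = 0" using i by (simp add: \<mu>_def)
    finally show False using zero[of \<mu> i] i by (simp add: \<mu>_def)
  qed
  have "independent (acol A ` \<sigma> :: (real^'d) set)"
  proof
    assume "dependent (acol A ` \<sigma> :: (real^'d) set)"
    then obtain w where w: "\<exists>x\<in>acol A ` \<sigma>. w x \<noteq> 0" "(\<Sum>x\<in>acol A ` \<sigma>. w x *\<^sub>R x) = (0 :: real^'d)"
      using dependent_finite[of "acol A ` \<sigma> :: (real^'d) set"] by auto
    have "(\<Sum>i\<in>\<sigma>. w (acol A i) *\<^sub>R acol A i) = (0 :: real^'d)"
      using w(2) by (simp add: sum.reindex[OF inj])
    from zero[OF this] w(1) show False by blast
  qed
  then have "card (acol A ` \<sigma> :: (real^'d) set) = dim (UNIV :: (real^'d) set)"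
    using dim_eq_card_independent dim_span span by metis
  then show card: "card \<sigma> = CARD('d)" by (simp add: card_image[OF inj])
  show "\<exists>\<delta>. dual_basis A \<sigma> \<delta>" by (rule dual_basis_exists[OF card span])
qed

section \<open>Heights on \<Gamma>_A and triangulations that refine it\<close>

lemma dual_basis_height:
  fixes A :: "int^'n::finite^'d::finite"
  assumes d: "dual_basis A \<sigma> \<delta>" and c: "\<And>i. i \<in> \<sigma> \<Longrightarrow> c \<bullet> acol A i = 1"
  shows "(\<Sum>i\<in>\<sigma>. \<delta> i \<bullet> y) = c \<bullet> y"
proof -
  have "c \<bullet> y = c \<bullet> (\<Sum>i\<in>\<sigma>. (\<delta> i \<bullet> y) *\<^sub>R acol A i)" using dual_basisD(2)[OF d] by simp
  also have "\<dots> = (\<Sum>i\<in>\<sigma>. \<delta> i \<bullet> y)" using c by (simp add: inner_sum_right)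
  finally show ?thesis ..
qed

lemma gamma_facet_simplicial:
  fixes A :: "int^'n::finite^'d::finite"
  assumes lattice: "range (\<lambda>u::int^'n. A *v u) = UNIV"
    and \<tau>: "\<tau> \<in> maximal_cells (gamma_complex A)" "card \<tau> = CARD('d)"
  shows "\<exists>\<delta>. simplicial_facet A \<tau> \<delta>"
proof -
  obtain \<delta> where d: "dual_basis A \<tau> \<delta>"
    using dual_basis_exists[OF \<tau>(2)] maximal_cell_spans[OF lattice] \<tau>(1) unfolding gamma_complex_def by blast
  obtain c :: "real^'d" where c: "\<And>j. j \<in> \<tau> \<Longrightarrow> c \<bullet> acol A j = 1" "\<And>j. j \<notin> \<tau> \<Longrightarrow> c \<bullet> acol A j < 1"
    using \<tau>(1) by (auto simp: maximal_cells_def gamma_complex_def subdiv_complex_def)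
  have "simplicial_facet A \<tau> \<delta>"
    by unfold_locales (use d dual_basis_height[OF d c(1)] c(2) in auto)
  then show ?thesis by blast
qed

lemma refinement_height:
  fixes A :: "int^'n::finite^'d::finite"
  assumes d: "dual_basis A \<sigma> \<delta>" and \<sigma>: "\<sigma> \<in> maximal_cells T" and ref: "refines_complex T (gamma_complex A)"
  shows "(\<Sum>i\<in>\<sigma>. \<delta> i \<bullet> acol A l) \<le> 1"
proof -
  obtain \<rho> where \<rho>: "\<rho> \<in> gamma_complex A" "\<sigma> \<subseteq> \<rho>"
    using ref \<sigma> unfolding refines_complex_def maximal_cells_def by blast
  obtain c :: "real^'d" where c: "\<And>j. j \<in> \<rho> \<Longrightarrow> c \<bullet> acol A j = 1" "\<And>j. j \<notin> \<rho> \<Longrightarrow> c \<bullet> acol A j < 1"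
    using \<rho>(1) by (auto simp: gamma_complex_def subdiv_complex_def)
  have "(\<Sum>i\<in>\<sigma>. \<delta> i \<bullet> acol A l) = c \<bullet> acol A l"
    by (rule dual_basis_height[OF d]) (use c \<rho>(2) in auto)
  also have "\<dots> \<le> 1" using c by (cases "l \<in> \<rho>") (auto intro: less_imp_le)
  finally show ?thesis .
qed

text \<open>A point y inside the cone of \<tau> lies in the cone of some \<sigma> in T. Comparing
  its heights under the functional of \<tau> and under that of a cell of \<Gamma>_A around \<sigma>
  shows that y only uses columns of \<tau>, and by uniqueness of coordinates it uses all of them. So
  \<sigma> contains \<tau>, and the refinement gives equality.\<close>

lemma simplicial_facet_in_triangulation:
  fixes A :: "int^'n::finite^'d::finite"
  assumes T: "regular_triangulation A T" "refines_complex T (gamma_complex A)"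
    and \<tau>: "\<tau> \<in> maximal_cells (gamma_complex A)" and d: "dual_basis A \<tau> \<delta>"
  shows "\<tau> \<in> maximal_cells T" and "\<And>\<sigma>. \<sigma> \<in> maximal_cells T \<Longrightarrow> \<sigma> \<subseteq> \<tau> \<Longrightarrow> \<sigma> = \<tau>"
proof -
  have in_gamma: "\<exists>\<rho>\<in>gamma_complex A. \<sigma> \<subseteq> \<rho>" if "\<sigma> \<in> T" for \<sigma> using T(2) that by (auto simp: refines_complex_def)
  have max: "\<rho> = \<tau>" if "\<rho> \<in> gamma_complex A" "\<tau> \<subseteq> \<rho>" for \<rho> using \<tau> that by (auto simp: maximal_cells_def)
  obtain c :: "real^'d" where c: "\<And>j. j \<in> \<tau> \<Longrightarrow> c \<bullet> acol A j = 1" "\<And>j. j \<notin> \<tau> \<Longrightarrow> c \<bullet> acol A j < 1"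
    using \<tau> by (auto simp: maximal_cells_def gamma_complex_def subdiv_complex_def)
  define y where "y = (\<Sum>i\<in>\<tau>. acol A i :: real^'d)"
  have "y \<in> pos_cone A UNIV"
    unfolding pos_cone_def y_def
    by (intro CollectI exI[of _ "\<lambda>i. if i \<in> \<tau> then 1 else 0"]) (auto simp: if_distrib[of "\<lambda>x. x *\<^sub>R _"] sum.If_cases cong: if_cong)
  then obtain \<sigma> where \<sigma>: "\<sigma> \<in> T" "y \<in> pos_cone A \<sigma>" using T(1) unfolding regular_triangulation_def by blast
  obtain \<mu> where \<mu>: "y = (\<Sum>i\<in>\<sigma>. \<mu> i *\<^sub>R acol A i)" "\<And>i. i \<in> \<sigma> \<Longrightarrow> 0 \<le> \<mu> i" using \<sigma>(2) by (auto simp: pos_cone_def)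
  obtain \<rho> where \<rho>: "\<rho> \<in> gamma_complex A" "\<sigma> \<subseteq> \<rho>" using in_gamma[OF \<sigma>(1)] by blast
  obtain c' :: "real^'d" where c': "\<And>j. j \<in> \<rho> \<Longrightarrow> c' \<bullet> acol A j = 1" "\<And>j. j \<notin> \<rho> \<Longrightarrow> c' \<bullet> acol A j < 1"
    using \<rho>(1) by (auto simp: gamma_complex_def subdiv_complex_def)
  have "(\<Sum>i\<in>\<sigma>. \<mu> i) = c' \<bullet> y"
    using c' \<rho>(2) by (auto simp: \<mu>(1) inner_sum_right intro!: sum.cong)
  also have "\<dots> = (\<Sum>i\<in>\<tau>. c' \<bullet> acol A i)" by (simp add: y_def inner_sum_right)
  also have "\<dots> \<le> (\<Sum>i\<in>\<tau>. c \<bullet> acol A i)"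
    by (rule sum_mono) (use c c' in \<open>metis less_imp_le order_refl\<close>)
  also have "\<dots> = c \<bullet> y" by (simp add: y_def inner_sum_right)
  also have "\<dots> = (\<Sum>i\<in>\<sigma>. \<mu> i * (c \<bullet> acol A i))" by (simp add: \<mu>(1) inner_sum_right)
  finally have le: "(\<Sum>i\<in>\<sigma>. \<mu> i) \<le> (\<Sum>i\<in>\<sigma>. \<mu> i * (c \<bullet> acol A i))" .
  have \<mu>0: "\<mu> i = 0" if i: "i \<in> \<sigma>" "i \<notin> \<tau>" for i
  proof (rule ccontr)
    assume "\<mu> i \<noteq> 0"
    then have pos: "0 < \<mu> i" using \<mu>(2)[OF i(1)] by simp
    have "(\<Sum>i\<in>\<sigma>. \<mu> i * (c \<bullet> acol A i)) < (\<Sum>i\<in>\<sigma>. \<mu> i)"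
    proof (rule sum_strict_mono_ex1)
      have cle: "c \<bullet> acol A k \<le> 1" for k using c by (metis less_imp_le order_refl)
      show "\<forall>k\<in>\<sigma>. \<mu> k * (c \<bullet> acol A k) \<le> \<mu> k"
        using \<mu>(2) mult_left_mono[OF cle] by fastforce
      show "\<exists>k\<in>\<sigma>. \<mu> k * (c \<bullet> acol A k) < \<mu> k"
        using i pos c(2)[OF i(2)] by (intro bexI[of _ i]) auto
    qed simp
    then show False using le by simp
  qed
  have sub: "\<tau> \<subseteq> \<sigma>"
  proof
    fix i assume i: "i \<in> \<tau>"
    show "i \<in> \<sigma>"
    proof (rule ccontr)
      assume ni: "i \<notin> \<sigma>"
      define w where "w k = (if k \<in> \<sigma> then \<mu> k else 0)" for k
      have "y = (\<Sum>k\<in>\<sigma> \<inter> \<tau>. \<mu> k *\<^sub>R acol A k)"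
        unfolding \<mu>(1) using \<mu>0 by (intro sum.mono_neutral_right) auto
      also have "\<dots> = (\<Sum>k\<in>\<tau>. w k *\<^sub>R acol A k)"
        by (rule sum.mono_neutral_cong_left) (auto simp: w_def)
      finally have "\<delta> i \<bullet> y = w i" using inner_coord[OF d i, of w] by simp
      moreover have "\<delta> i \<bullet> y = 1" using inner_coord[OF d i, of "\<lambda>_. 1"] by (simp add: y_def)
      ultimately show False using ni by (simp add: w_def)
    qed
  qed
  have "\<rho> = \<tau>" using max \<rho> sub by blast
  then have "\<sigma> = \<tau>" using sub \<rho> by blast
  then have \<tau>T: "\<tau> \<in> T" using \<sigma> by simp
  show "\<tau> \<in> maximal_cells T"
    unfolding maximal_cells_def
  proof (intro CollectI conjI \<tau>T ballI impI)
    fix \<sigma>' assume "\<sigma>' \<in> T" "\<tau> \<subseteq> \<sigma>'"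
    then show "\<sigma>' = \<tau>" using in_gamma[of \<sigma>'] max by blast
  qed
  show "\<sigma>' = \<tau>" if "\<sigma>' \<in> maximal_cells T" "\<sigma>' \<subseteq> \<tau>" for \<sigma>'
    using that \<tau>T by (auto simp: maximal_cells_def)
qed


section \<open>Nonresonant parameters\<close>

text \<open>Makes the facts on finitely generated convex cones available, in particular that the
  cone is a polyhedron.\<close>

lemma pos_cone_eq_hull:
  fixes A :: "int^'n::finite^'d::finite"
  shows "pos_cone A UNIV = (convex_cone hull (range (acol A)) :: (real^'d) set)"
proof (rule antisym)
  show "pos_cone A UNIV \<subseteq> convex_cone hull (range (acol A))"
  proof
    fix y :: "real^'d" assume "y \<in> pos_cone A UNIV"
    then obtain c where c: "y = (\<Sum>i\<in>UNIV. c i *\<^sub>R acol A i)" "\<And>i. 0 \<le> c i" by (auto simp: pos_cone_def)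
    have "(\<Sum>i\<in>I. c i *\<^sub>R (acol A i :: real^'d)) \<in> convex_cone hull (range (acol A))" if "finite I" for I
      using that
    proof induction
      case empty
      show ?case by (simp add: convex_cone_hull_contains_0)
    next
      case (insert x F)
      have "c x *\<^sub>R (acol A x :: real^'d) \<in> convex_cone hull (range (acol A))"
        by (intro convex_cone_hull_mul c(2)) (simp add: hull_inc)
      then show ?case using insert by (simp add: convex_cone_hull_add)
    qed
    then show "y \<in> convex_cone hull (range (acol A))" by (simp add: c(1))
  qed
  show "convex_cone hull (range (acol A)) \<subseteq> pos_cone A UNIV"
  proof (rule hull_minimal)
    show "range (acol A) \<subseteq> pos_cone A UNIV"
    proof
      fix y :: "real^'d" assume "y \<in> range (acol A)"
      then obtain j where "y = acol A j" by blast
      then show "y \<in> pos_cone A UNIV"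
        unfolding pos_cone_def
        by (intro CollectI exI[of _ "\<lambda>i. if i = j then 1 else 0"]) (auto simp: if_distrib[of "\<lambda>x. x *\<^sub>R _"] cong: if_cong)
    qed
    show "convex_cone (pos_cone A UNIV)"
      unfolding convex_cone_iff
    proof (intro conjI ballI allI impI)
      show "0 \<in> pos_cone A UNIV" unfolding pos_cone_def by (intro CollectI exI[of _ "\<lambda>_. 0"]) simp
      fix x y :: "real^'d" assume "x \<in> pos_cone A UNIV" "y \<in> pos_cone A UNIV"
      then obtain a b where "x = (\<Sum>i\<in>UNIV. a i *\<^sub>R acol A i)" "\<forall>i. 0 \<le> a i" "y = (\<Sum>i\<in>UNIV. b i *\<^sub>R acol A i)" "\<forall>i. 0 \<le> b i"
        by (auto simp: pos_cone_def)
      then show "x + y \<in> pos_cone A UNIV"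
        unfolding pos_cone_def by (intro CollectI exI[of _ "\<lambda>i. a i + b i"]) (auto simp: scaleR_left_distrib sum.distrib)
    next
      fix x :: "real^'d" and c :: real assume "x \<in> pos_cone A UNIV" "0 \<le> c"
      then obtain a where "x = (\<Sum>i\<in>UNIV. a i *\<^sub>R acol A i)" "\<forall>i. 0 \<le> a i" by (auto simp: pos_cone_def)
      then show "c *\<^sub>R x \<in> pos_cone A UNIV"
        unfolding pos_cone_def using \<open>0 \<le> c\<close> by (intro CollectI exI[of _ "\<lambda>i. c * a i"]) (auto simp: scaleR_sum_right)
    qed
  qed
qed

text \<open>
  If no such direction existed, a hyperplane separating \<open>pos(A)\<close> from the cone where these coordinates are
  negative would cut out a proper face of \<open>pos(A)\<close> containing \<open>a\<^sub>i\<close> for all other \<open>i \<in> \<tau>\<close>, and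
  \<open>\<beta>\<close> would be resonant with respect to a facet containing this face.
\<close>

lemma nonresonant_direction:
  fixes A :: "int^'n::finite^'d::finite"
  assumes lattice: "range (\<lambda>u::int^'n. A *v u) = UNIV" and d: "dual_basis A \<tau> \<delta>"
    and nr: "nonresonant A \<beta>" and v: "amul A v = \<beta>" "integral_off \<tau> v"
  shows "\<exists>y\<in>pos_cone A UNIV. \<forall>i\<in>\<tau>. v$i \<in> \<int> \<longrightarrow> \<delta> i \<bullet> y < 0"
proof (rule ccontr)
  assume neg: "\<not> ?thesis"
  define I where "I = {i\<in>\<tau>. v$i \<in> \<int>}"
  define C where "C = (pos_cone A UNIV :: (real^'d) set)"
  define N where "N = {y. \<forall>i\<in>I. \<delta> i \<bullet> y < 0}"
  define s where "s = (\<Sum>i\<in>\<tau>. acol A i :: real^'d)"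
  have \<delta>s: "\<delta> i \<bullet> s = 1" if "i \<in> \<tau>" for i using inner_coord[OF d that, of "\<lambda>_. 1"] by (simp add: s_def)
  have acolC: "acol A j \<in> C" for j by (simp add: C_def pos_cone_eq_hull hull_inc)
  have C0: "0 \<in> C" by (simp add: C_def pos_cone_eq_hull convex_cone_hull_contains_0)
  have convC: "convex C" by (simp add: C_def pos_cone_eq_hull convex_convex_cone_hull)
  have convN: "convex N"
  proof -
    have "N = (\<Inter>i\<in>I. {y. \<delta> i \<bullet> y < 0})" by (auto simp: N_def)
    then show ?thesis by (simp add: convex_INT convex_halfspace_lt)
  qed
  have sN: "- s \<in> N" using \<delta>s by (auto simp: N_def I_def)
  have "N \<inter> C = {}" using neg by (auto simp: N_def C_def I_def)
  then obtain a b where ab: "a \<noteq> 0" "\<And>x. x \<in> N \<Longrightarrow> a \<bullet> x \<le> b" "\<And>x. x \<in> C \<Longrightarrow> b \<le> a \<bullet> x"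
    using separating_hyperplane_sets[OF convN convC] sN C0 by blast
  have b0: "b \<le> 0" using ab(3)[OF C0] by simp
  \<comment> \<open>A linear functional bounded below on a cone is nonnegative there: a negative
    value could be scaled below b.\<close>
  have aC: "0 \<le> a \<bullet> x" if x: "x \<in> C" for x
  proof (rule ccontr)
    assume n: "\<not> 0 \<le> a \<bullet> x"
    have "((b - 1) / (a \<bullet> x)) *\<^sub>R x \<in> C"
      using x n b0 unfolding C_def pos_cone_eq_hull
      by (intro convex_cone_hull_mul) (auto intro!: divide_nonpos_neg)
    from ab(3)[OF this] n show False by simp
  qed
  \<comment> \<open>N is invariant under adding multiples of these columns, and a is bounded above
    on N.\<close>
  have a0: "a \<bullet> acol A i = 0" if i: "i \<in> \<tau>" "i \<notin> I" for i
  proof (rule ccontr)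
    assume n: "a \<bullet> acol A i \<noteq> 0"
    define t where "t = (a \<bullet> s + 1) / (a \<bullet> acol A i)"
    have "t *\<^sub>R acol A i - s \<in> N"
      unfolding N_def
    proof (intro CollectI ballI)
      fix i' assume i': "i' \<in> I"
      then have "i' \<in> \<tau>" "i' \<noteq> i" using i by (auto simp: I_def)
      then show "\<delta> i' \<bullet> (t *\<^sub>R acol A i - s) < 0"
        using dual_basisD(1)[OF d, of i' i] i(1) \<delta>s[of i'] by (simp add: inner_diff_right)
    qed
    from ab(2)[OF this] b0 have "a \<bullet> (t *\<^sub>R acol A i - s) \<le> 0" by simp
    then show False using n by (simp add: inner_diff_right t_def)
  qed
  define F0 where "F0 = C \<inter> {x. a \<bullet> x = 0}"
  have face: "F0 face_of C" unfolding F0_def by (rule face_of_Int_supporting_hyperplane_ge[OF convC aC])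
  have "polyhedron C" unfolding C_def pos_cone_eq_hull by (rule polyhedron_convex_cone_hull) simp
  moreover have "F0 \<noteq> {}" using C0 by (auto simp: F0_def)
  moreover have "F0 \<noteq> C"
  proof -
    obtain j where "a \<bullet> acol A j \<noteq> 0" using lattice_full_rank[OF lattice] ab(1) by blast
    then have "acol A j \<notin> F0" by (simp add: F0_def)
    then show ?thesis using acolC by blast
  qed
  ultimately obtain F where F: "F facet_of C" "F0 \<subseteq> F"
    using face_of_polyhedron_subset_facet[OF _ face] by blast
  \<comment> \<open>Outside E all v_j are integers, so \<beta> is an integral vector plus a
    combination of the columns in E, and those lie in F.\<close>
  define E where "E = \<tau> - I"
  have vE: "v$j \<in> \<int>" if "j \<notin> E" for j using that v(2) by (auto simp: E_def I_def integral_off_def)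
  define z :: "int^'n" where "z = (\<chi> j. if j \<in> E then 0 else \<lfloor>Re (v$j)\<rfloor>)"
  have z: "of_int (z$j) = v$j" if "j \<notin> E" for j
    using vE[OF that] that by (auto simp: z_def elim!: Ints_cases)
  define w where "w = (\<Sum>j\<in>E. v$j *s (acol A j :: complex^'d))"
  have "\<beta> = (\<Sum>j\<in>-E. v$j *s acol A j) + w"
    unfolding v(1)[symmetric] amul_def w_def by (subst sum.union_disjoint[symmetric]) auto
  also have "(\<Sum>j\<in>-E. v$j *s acol A j) = (\<Sum>j\<in>UNIV. of_int (z$j) *s (acol A j :: complex^'d))"
    by (rule sum.mono_neutral_cong_left) (auto simp: z, simp add: z_def)
  also have "\<dots> = (\<chi> i. of_int ((A *v z) $ i))"
    by (simp add: vec_eq_iff matrix_vector_mult_def mult.commute)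
  finally have \<beta>: "\<beta> = (\<chi> i. of_int ((A *v z) $ i)) + w" .
  have "w \<in> vec.span ((\<lambda>y. \<chi> i. complex_of_real (y$i)) ` F)"
    unfolding w_def
  proof (intro vec.span_sum vec.span_scale vec.span_base)
    fix j assume "j \<in> E"
    then have "acol A j \<in> F" using F(2) a0[of j] acolC[of j] by (auto simp: F0_def E_def)
    moreover have "(acol A j :: complex^'d) = (\<chi> i. complex_of_real ((acol A j :: real^'d) $ i))" by (simp add: vec_eq_iff)
    ultimately show "(acol A j :: complex^'d) \<in> (\<lambda>y. \<chi> i. complex_of_real (y$i)) ` F" by blast
  qed
  with \<beta> F(1) nr show False unfolding nonresonant_def C_def by blast
qed

text \<open>With y the sum of \<mu>_j a_j, moving by N \<mu>_l outside \<tau> within the real kernel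
  changes the coordinate i in \<tau> by N \<epsilon>_i, which is positive where v_i is an integer.
  Rounding and multiplying by D produces an integral kernel vector. For large N the integral
  coordinates become nonnegative, and the others stay nonintegral, so no Gamma factor in \<tau>
  vanishes.\<close>

lemma nonresonant_shift:
  fixes A :: "int^'n::finite^'d::finite"
  assumes lattice: "range (\<lambda>u::int^'n. A *v u) = UNIV" and d: "dual_basis A \<tau> \<delta>" and card: "card \<tau> = CARD('d)"
    and nr: "nonresonant A \<beta>" and v: "amul A v = \<beta>" "integral_off \<tau> v"
  shows "\<exists>u\<in>zker A. (\<forall>l. l \<notin> \<tau> \<longrightarrow> v$l + of_int (u$l) \<in> \<nat>) \<and>
    (\<forall>i\<in>\<tau>. rGamma (v$i + of_int (u$i) + 1) \<noteq> 0)"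
proof -
  obtain y where y: "y \<in> pos_cone A UNIV" "\<And>i. i \<in> \<tau> \<Longrightarrow> v$i \<in> \<int> \<Longrightarrow> \<delta> i \<bullet> y < 0"
    using nonresonant_direction[OF lattice d nr v] by blast
  obtain \<mu> where \<mu>: "y = (\<Sum>j\<in>UNIV. \<mu> j *\<^sub>R acol A j)" "\<And>j. 0 \<le> \<mu> j" using y(1) by (auto simp: pos_cone_def)
  define I where "I = {i\<in>\<tau>. v$i \<in> \<int>}"
  define \<epsilon> where "\<epsilon> i = - (\<Sum>l\<in>-\<tau>. \<mu> l * (\<delta> i \<bullet> acol A l))" for i
  have \<epsilon>: "0 < \<epsilon> i" if "i \<in> I" for i
  proof -
    have i: "i \<in> \<tau>" using that by (simp add: I_def)
    have "y = (\<Sum>j\<in>\<tau>. \<mu> j *\<^sub>R acol A j) + (\<Sum>j\<in>-\<tau>. \<mu> j *\<^sub>R acol A j)"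
      unfolding \<mu>(1) by (subst sum.union_disjoint[symmetric]) (auto simp: Compl_partition)
    then have "\<delta> i \<bullet> y = \<mu> i - \<epsilon> i"
      by (simp only: inner_add_right inner_coord[OF d i]) (simp add: \<epsilon>_def inner_sum_right)
    then show ?thesis using y(2)[of i] \<mu>(2)[of i] that by (simp add: I_def)
  qed
  obtain D :: nat where D: "1 \<le> D" "\<And>z. int D *s z \<in> lattice_of A \<tau>" using lattice_multiple[OF d card] by blast
  \<comment> \<open>Bounds the real parts that the shift may have to compensate.\<close>
  define K where "K = nat \<lceil>\<Sum>j\<in>UNIV. norm (v$j)\<rceil>"
  have K: "\<bar>Re (v$j)\<bar> \<le> K" for j
  proof -
    have "\<bar>Re (v$j)\<bar> \<le> norm (v$j)" by (rule abs_Re_le_cmod)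
    also have "\<dots> \<le> (\<Sum>j\<in>UNIV. norm (v$j))" by (rule member_le_sum) auto
    finally show ?thesis unfolding K_def by linarith
  qed
  define M where "M i = (\<Sum>l\<in>-\<tau>. \<bar>\<delta> i \<bullet> acol A l\<bar>)" for i
  have M: "0 \<le> M i" for i unfolding M_def by (intro sum_nonneg) auto
  \<comment> \<open>Large enough to outweigh K together with the rounding error, which is at most K
    + 1 in each \<open>m l\<close> and is weighted by \<open>M i\<close>.\<close>
  define N where "N = (\<Sum>i\<in>I. (K + (K + 1) * M i) / \<epsilon> i)"
  have N0: "0 \<le> N" unfolding N_def using M \<epsilon> by (intro sum_nonneg divide_nonneg_nonneg) (auto intro: less_imp_le)
  have N: "K + (K + 1) * M i \<le> N * \<epsilon> i" if "i \<in> I" for i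
  proof -
    have "(K + (K + 1) * M i) / \<epsilon> i \<le> N"
      unfolding N_def using that M \<epsilon> by (intro member_le_sum[of i I "\<lambda>i. (K + (K + 1) * M i) / \<epsilon> i"]) (auto intro!: divide_nonneg_nonneg intro: less_imp_le)
    then show ?thesis using \<epsilon>[OF that] by (simp add: pos_divide_le_eq)
  qed
  define m where "m l = \<lceil>N * \<mu> l\<rceil> + int K" for l
  define b where "b = (\<Sum>l\<in>-\<tau>. m l *s acol A l)"
  obtain z where z: "int D *s b = (\<Sum>i\<in>\<tau>. z i *s acol A i)"
    using D(2)[of b] by (auto simp: lattice_of_def)
  define u :: "int^'n" where "u = (\<chi> j. if j \<in> \<tau> then - z j else int D * m j)"
  have uz: "u \<in> zker A"
  proof -
    have "A *v u = (\<Sum>j\<in>UNIV. u$j *s acol A j)"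
      by (simp add: vec_eq_iff matrix_vector_mult_def mult.commute)
    also have "\<dots> = (\<Sum>j\<in>\<tau>. u$j *s acol A j) + (\<Sum>j\<in>-\<tau>. u$j *s acol A j)"
      by (subst sum.union_disjoint[symmetric]) (auto simp: Compl_partition)
    also have "(\<Sum>j\<in>\<tau>. u$j *s acol A j) = - (\<Sum>i\<in>\<tau>. z i *s acol A i)"
      by (simp add: u_def vec_eq_iff sum_negf)
    also have "(\<Sum>j\<in>-\<tau>. u$j *s acol A j) = int D *s b"
      by (simp add: u_def b_def vec_eq_iff sum_distrib_left mult.assoc)
    finally show ?thesis using z by (simp add: zker_def)
  qed
  have m0: "0 \<le> m l" "real K \<le> of_int (m l)" for l
  proof -
    have "0 \<le> N * \<mu> l" using N0 \<mu>(2) by simp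
    then have "0 \<le> \<lceil>N * \<mu> l\<rceil>" by linarith
    then show "0 \<le> m l" "real K \<le> of_int (m l)" by (auto simp: m_def)
  qed
  have off: "v$l + of_int (u$l) \<in> \<nat>" if l: "l \<notin> \<tau>" for l
  proof -
    obtain n where n: "v$l = of_int n" using v(2) l by (auto simp: integral_off_def elim: Ints_cases)
    have "- real K \<le> of_int n" using K[of l] by (simp add: n)
    moreover have "1 * m l \<le> int D * m l" using D(1) m0(1) by (intro mult_right_mono) auto
    ultimately have "0 \<le> n + u$l" using m0(2)[of l] l by (simp add: u_def)
    then have "v$l + of_int (u$l) = of_nat (nat (n + u$l))" by (simp add: n flip: of_int_add)
    then show ?thesis by (simp only: of_nat_in_Nats)
  qed
  have on: "rGamma (v$i + of_int (u$i) + 1) \<noteq> 0" if i: "i \<in> \<tau>" for i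
  proof
    assume "rGamma (v$i + of_int (u$i) + 1) = 0"
    then have np: "v$i + of_int (u$i) + 1 \<in> \<int>\<^sub>\<le>\<^sub>0" by (simp add: rGamma_eq_zero_iff)
    then have "v$i + of_int (u$i) + 1 - (of_int (u$i) + 1) \<in> \<int>" by (intro Ints_diff) (auto dest: nonpos_Ints_Int)
    then have vi: "v$i \<in> \<int>" by simp
    then have iI: "i \<in> I" using i by (simp add: I_def)
    have gen: "- (\<Sum>l\<in>-\<tau>. real D * (N * f l + g l)) = D * (N * (- (\<Sum>l\<in>-\<tau>. f l)) - (\<Sum>l\<in>-\<tau>. g l))"
      for f g :: "'n \<Rightarrow> real"
      by (simp add: sum.distrib sum_distrib_left[symmetric] right_diff_distrib distrib_left)
    have "real_of_int (u$i) = - (\<Sum>l\<in>-\<tau>. real_of_int (u$l) * (\<delta> i \<bullet> acol A l))" by (rule zker_coord[OF d uz i])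
    also have "\<dots> = - (\<Sum>l\<in>-\<tau>. D * (N * (\<mu> l * (\<delta> i \<bullet> acol A l)) + (of_int (m l) - N * \<mu> l) * (\<delta> i \<bullet> acol A l)))"
      by (intro arg_cong[of _ _ uminus] sum.cong) (auto simp: u_def algebra_simps)
    also have "\<dots> = D * (N * \<epsilon> i - (\<Sum>l\<in>-\<tau>. (of_int (m l) - N * \<mu> l) * (\<delta> i \<bullet> acol A l)))"
      unfolding \<epsilon>_def by (rule gen)
    finally have ui: "real_of_int (u$i) = D * (N * \<epsilon> i - (\<Sum>l\<in>-\<tau>. (of_int (m l) - N * \<mu> l) * (\<delta> i \<bullet> acol A l)))" .
    have "(\<Sum>l\<in>-\<tau>. (of_int (m l) - N * \<mu> l) * (\<delta> i \<bullet> acol A l)) \<le> (\<Sum>l\<in>-\<tau>. (K + 1) * \<bar>\<delta> i \<bullet> acol A l\<bar>)"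
    proof (rule sum_mono)
      fix l
      have "\<bar>of_int (m l) - N * \<mu> l\<bar> \<le> K + 1" unfolding m_def by (simp add: abs_le_iff) linarith
      then have "\<bar>(of_int (m l) - N * \<mu> l) * (\<delta> i \<bullet> acol A l)\<bar> \<le> (K + 1) * \<bar>\<delta> i \<bullet> acol A l\<bar>"
        unfolding abs_mult by (intro mult_right_mono) auto
      then show "(of_int (m l) - N * \<mu> l) * (\<delta> i \<bullet> acol A l) \<le> (K + 1) * \<bar>\<delta> i \<bullet> acol A l\<bar>" by linarith
    qed
    also have "\<dots> = (K + 1) * M i" by (simp add: M_def sum_distrib_left)
    finally have "real K \<le> N * \<epsilon> i - (\<Sum>l\<in>-\<tau>. (of_int (m l) - N * \<mu> l) * (\<delta> i \<bullet> acol A l))"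
      using N[OF iI] by linarith
    then have "1 * real K \<le> D * (N * \<epsilon> i - (\<Sum>l\<in>-\<tau>. (of_int (m l) - N * \<mu> l) * (\<delta> i \<bullet> acol A l)))"
      using D(1) by (intro mult_mono) auto
    then have "real K \<le> of_int (u$i)" using ui by simp
    moreover obtain n where n: "v$i = of_int n" using vi by (elim Ints_cases)
    moreover have "\<bar>real_of_int n\<bar> \<le> K" using K[of i] by (simp add: n)
    ultimately have "0 \<le> n + u$i" by linarith
    moreover have "of_int (n + u$i + 1) \<in> (\<int>\<^sub>\<le>\<^sub>0 :: complex set)" using np by (simp add: n)
    ultimately show False by (simp only: of_int_in_nonpos_Ints_iff)
  qed
  show ?thesis using uz off on by blast
qed


section \<open>Convergence of the \<Gamma>-series\<close>

text \<open>Solving for the coordinates in \<sigma> turns the modulus of the monomial into a fixed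
  factor times the powers of |x_l| / |x_\<sigma>^(A_\<sigma>^-1 a_l)| with the natural exponents v_l
  + u_l. These are the quotients that occur in \<open>series_domain\<close>.\<close>

lemma norm_gamma_term:
  fixes A :: "int^'n::finite^'d::finite"
  assumes d: "dual_basis A \<sigma> \<delta>" and u: "u \<in> zker A"
    and v: "\<And>l. l \<notin> \<sigma> \<Longrightarrow> v$l + of_int (u$l) \<in> \<nat>"
  shows "norm (gamma_term v y u) =
    exp ((\<Sum>i\<in>\<sigma>. Re (v$i * y$i)) + (\<Sum>l\<in>-\<sigma>. Re (v$l) * (\<Sum>i\<in>\<sigma>. (\<delta> i \<bullet> acol A l) * Re (y$i)))) *
    ((\<Prod>i\<in>UNIV. norm (rGamma (v$i + of_int (u$i) + 1))) *
     (\<Prod>l\<in>-\<sigma>. exp (Re (y$l) - (\<Sum>i\<in>\<sigma>. (\<delta> i \<bullet> acol A l) * Re (y$i))) ^ nat \<lfloor>Re (v$l + of_int (u$l))\<rfloor>))"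
proof -
  define \<Lambda> where "\<Lambda> l = Re (y$l) - (\<Sum>i\<in>\<sigma>. (\<delta> i \<bullet> acol A l) * Re (y$i))" for l
  define c where "c = (\<Sum>i\<in>\<sigma>. Re (v$i * y$i)) + (\<Sum>l\<in>-\<sigma>. Re (v$l) * (\<Sum>i\<in>\<sigma>. (\<delta> i \<bullet> acol A l) * Re (y$i)))"
  have vl: "v$l + of_int (u$l) = of_nat (nat \<lfloor>Re (v$l + of_int (u$l))\<rfloor>)" if l: "l \<notin> \<sigma>" for l
  proof -
    obtain n where n: "v$l + of_int (u$l) = of_nat n" using v[OF l] by (elim Nats_cases)
    show ?thesis unfolding n by simp
  qed
  have Re_l: "Re ((v$l + of_int (u$l)) * y$l) = (Re (v$l) + of_int (u$l)) * Re (y$l)" if "l \<notin> \<sigma>" for l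
  proof -
    have "Im (v$l) = 0" using arg_cong[OF vl[OF that], of Im] by simp
    then show ?thesis by simp
  qed
  have Re_split: "Re ((v$j + of_int (u$j)) * y$j) = Re (v$j * y$j) + of_int (u$j) * Re (y$j)" for j
    by (simp add: algebra_simps)
  have "Re (\<Sum>j\<in>UNIV. (v$j + of_int (u$j)) * y$j) =
      (\<Sum>j\<in>\<sigma>. Re ((v$j + of_int (u$j)) * y$j)) + (\<Sum>j\<in>-\<sigma>. Re ((v$j + of_int (u$j)) * y$j))"
    unfolding Re_sum by (subst sum.union_disjoint[symmetric]) (auto simp: Compl_partition)
  also have "(\<Sum>j\<in>-\<sigma>. Re ((v$j + of_int (u$j)) * y$j)) = (\<Sum>j\<in>-\<sigma>. (Re (v$j) + of_int (u$j)) * Re (y$j))"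
    by (rule sum.cong) (use Re_l in auto)
  also have "(\<Sum>j\<in>\<sigma>. Re ((v$j + of_int (u$j)) * y$j)) = (\<Sum>j\<in>\<sigma>. Re (v$j * y$j)) + (\<Sum>j\<in>\<sigma>. of_int (u$j) * Re (y$j))"
    by (simp only: Re_split sum.distrib)
  also have "(\<Sum>j\<in>\<sigma>. of_int (u$j) * Re (y$j)) = (\<Sum>j\<in>\<sigma>. - (\<Sum>l\<in>-\<sigma>. of_int (u$l) * ((\<delta> j \<bullet> acol A l) * Re (y$j))))"
    by (rule sum.cong) (auto simp: zker_coord[OF d u] sum_distrib_right mult.assoc)
  also have "\<dots> = - (\<Sum>l\<in>-\<sigma>. of_int (u$l) * (\<Sum>j\<in>\<sigma>. (\<delta> j \<bullet> acol A l) * Re (y$j)))"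
    by (simp add: sum_negf sum_distrib_left sum.swap[of _ "-\<sigma>" \<sigma>])
  finally have "Re (\<Sum>j\<in>UNIV. (v$j + of_int (u$j)) * y$j) = c + (\<Sum>l\<in>-\<sigma>. (Re (v$l) + of_int (u$l)) * \<Lambda> l)"
    by (simp add: c_def \<Lambda>_def algebra_simps sum.distrib sum_subtractf)
  also have "(\<Sum>l\<in>-\<sigma>. (Re (v$l) + of_int (u$l)) * \<Lambda> l) = (\<Sum>l\<in>-\<sigma>. real (nat \<lfloor>Re (v$l + of_int (u$l))\<rfloor>) * \<Lambda> l)"
  proof (rule sum.cong)
    fix l assume "l \<in> -\<sigma>"
    then have "Re (v$l + of_int (u$l)) = Re (of_nat (nat \<lfloor>Re (v$l + of_int (u$l))\<rfloor>))" using vl[of l] by simp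
    then show "(Re (v$l) + of_int (u$l)) * \<Lambda> l = real (nat \<lfloor>Re (v$l + of_int (u$l))\<rfloor>) * \<Lambda> l" by simp
  qed simp
  finally have "exp (Re (\<Sum>j\<in>UNIV. (v$j + of_int (u$j)) * y$j)) =
      exp c * (\<Prod>l\<in>-\<sigma>. exp (\<Lambda> l) ^ nat \<lfloor>Re (v$l + of_int (u$l))\<rfloor>)"
    by (simp add: exp_add exp_sum exp_of_nat_mult)
  then show ?thesis
    unfolding gamma_term_def c_def[symmetric] \<Lambda>_def[symmetric]
    by (simp add: norm_mult prod_norm mult_ac)
qed

lemma gamma_term_summable:
  fixes A :: "int^'n::finite^'d::finite"
  assumes d: "dual_basis A \<sigma> \<delta>" and le: "\<And>l. (\<Sum>i\<in>\<sigma>. \<delta> i \<bullet> acol A l) \<le> 1"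
    and v: "integral_off \<sigma> v"
  shows "\<exists>K\<ge>1. \<forall>y. (\<forall>l. l \<notin> \<sigma> \<longrightarrow> (\<Sum>i\<in>\<sigma>. \<delta> i \<bullet> acol A l) = 1 \<longrightarrow>
      K * exp (Re (y$l) - (\<Sum>i\<in>\<sigma>. (\<delta> i \<bullet> acol A l) * Re (y$i))) < 1) \<longrightarrow>
    gamma_term v y summable_on zker A"
proof -
  define b where "b l i = \<delta> i \<bullet> acol A l" for l i
  have "(\<Sum>i\<in>\<sigma>. b l i) \<le> 1" for l using le[of l] by (simp add: b_def)
  from gamma_terms_summable[where \<sigma> = \<sigma> and b = b and v = v, OF this]
  obtain K where K: "1 \<le> K" and summable: "\<forall>L::'n \<Rightarrow> real. (\<forall>l. 0 \<le> L l) \<and> (\<forall>l. l \<notin> \<sigma> \<longrightarrow> (\<Sum>i\<in>\<sigma>. b l i) = 1 \<longrightarrow> K * L l < 1) \<longrightarrow>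
    (\<lambda>u::int^'n. (\<Prod>i\<in>UNIV. norm (rGamma (v$i + of_int (u$i) + 1))) *
        (\<Prod>l\<in>-\<sigma>. L l ^ nat \<lfloor>Re (v$l + of_int (u$l))\<rfloor>))
     summable_on {u. (\<forall>l. l \<notin> \<sigma> \<longrightarrow> v$l + of_int (u$l) \<in> \<nat>) \<and>
                     (\<forall>i\<in>\<sigma>. real_of_int (u$i) = - (\<Sum>l\<in>-\<sigma>. real_of_int (u$l) * b l i))}"
    by (elim exE conjE) (rule that)
  show ?thesis
  proof (intro exI[of _ K] conjI K allI impI)
    fix y :: "complex^'n"
    assume small: "\<forall>l. l \<notin> \<sigma> \<longrightarrow> (\<Sum>i\<in>\<sigma>. \<delta> i \<bullet> acol A l) = 1 \<longrightarrow>
      K * exp (Re (y$l) - (\<Sum>i\<in>\<sigma>. (\<delta> i \<bullet> acol A l) * Re (y$i))) < 1"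
    define L where "L l = exp (Re (y$l) - (\<Sum>i\<in>\<sigma>. (\<delta> i \<bullet> acol A l) * Re (y$i)))" for l
    define W where "W = {u \<in> zker A. \<forall>l. l \<notin> \<sigma> \<longrightarrow> v$l + of_int (u$l) \<in> \<nat>}"
    let ?c = "exp ((\<Sum>i\<in>\<sigma>. Re (v$i * y$i)) + (\<Sum>l\<in>-\<sigma>. Re (v$l) * (\<Sum>i\<in>\<sigma>. (\<delta> i \<bullet> acol A l) * Re (y$i))))"
    have "(\<forall>l. 0 \<le> L l) \<and> (\<forall>l. l \<notin> \<sigma> \<longrightarrow> (\<Sum>i\<in>\<sigma>. b l i) = 1 \<longrightarrow> K * L l < 1)"
      using small by (simp add: L_def b_def)
    from mp[OF spec[OF summable] this]
    have "(\<lambda>u::int^'n. (\<Prod>i\<in>UNIV. norm (rGamma (v$i + of_int (u$i) + 1))) *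
        (\<Prod>l\<in>-\<sigma>. L l ^ nat \<lfloor>Re (v$l + of_int (u$l))\<rfloor>)) summable_on W"
      by (rule summable_on_subset_banach) (auto simp: W_def b_def zker_coord[OF d])
    then have "(\<lambda>u::int^'n. ?c * ((\<Prod>i\<in>UNIV. norm (rGamma (v$i + of_int (u$i) + 1))) *
        (\<Prod>l\<in>-\<sigma>. L l ^ nat \<lfloor>Re (v$l + of_int (u$l))\<rfloor>))) summable_on W"
      by (rule summable_on_cmult_right)
    also have "?this \<longleftrightarrow> (\<lambda>u. norm (gamma_term v y u)) summable_on W"
      by (rule summable_on_cong) (simp add: W_def L_def norm_gamma_term[OF d])
    finally have "gamma_term v y summable_on W" by (rule abs_summable_summable)
    moreover have "gamma_term v y u = 0" if u: "u \<in> zker A - W" for u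
    proof -
      obtain l where l: "l \<notin> \<sigma>" "v$l + of_int (u$l) \<notin> \<nat>" using u by (auto simp: W_def)
      have "v$l + of_int (u$l) \<in> \<int>" using v l(1) by (simp add: integral_off_def)
      then obtain k where k: "v$l + of_int (u$l) = - of_nat (Suc k)"
        using l(2) by (cases rule: Nats_of_nat_or_nonpos) auto
      have "rGamma (v$l + of_int (u$l) + 1) = 0" by (simp add: k rGamma_eq_zero_iff)
      then have "(\<Prod>j\<in>UNIV. rGamma (v$j + of_int (u$j) + 1)) = 0" by (subst prod_zero_iff) auto
      then show ?thesis by (simp add: gamma_term_def)
    qed
    ultimately show "gamma_term v y summable_on zker A"
      by (subst summable_on_cong_neutral[of W "zker A" _ "gamma_term v y"]) (auto simp: W_def)
  qed
qed

text \<open>There are finitely many pairs of a maximal simplex and a representative, so one R below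
  the reciprocals of all their constants serves every series.\<close>

lemma gamma_series_converge:
  fixes A :: "int^'n::finite^'d::finite"
  assumes lattice: "range (\<lambda>u::int^'n. A *v u) = UNIV"
    and T: "regular_triangulation A T" "refines_complex T (gamma_complex A)"
    and \<Omega>: "\<And>\<sigma>. \<sigma> \<in> maximal_cells T \<Longrightarrow> representatives A \<sigma> (\<Omega> \<sigma>)"
  shows "\<exists>R>0. series_converge A \<beta> T \<Omega> (series_domain A T R)"
proof -
  define Z where "Z = Sigma (maximal_cells T) \<Omega>"
  have finZ: "finite Z"
    unfolding Z_def
  proof (rule finite_SigmaI)
    fix \<sigma> assume \<sigma>: "\<sigma> \<in> maximal_cells T"
    obtain \<delta> where d: "dual_basis A \<sigma> \<delta>" using triangulation_cell_dual_basis(2)[OF lattice T(1) \<sigma>] by blast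
    show "finite (\<Omega> \<sigma>)"
      by (rule representatives_card(1)[OF lattice d triangulation_cell_dual_basis(1)[OF lattice T(1) \<sigma>] \<Omega>[OF \<sigma>]])
  qed simp
  have "\<exists>K\<ge>1. \<forall>x y. (\<forall>j. exp (y$j) = x$j) \<longrightarrow> (\<forall>l. l \<notin> \<sigma> \<longrightarrow>
      (\<Sum>i\<in>\<sigma>. (simplex_coords A \<sigma> (acol A l) :: real^'n) $ i) = 1 \<longrightarrow>
      K * cmod (x$l) < (\<Prod>i\<in>\<sigma>. cmod (x$i) powr ((simplex_coords A \<sigma> (acol A l) :: real^'n) $ i))) \<longrightarrow>
      gamma_term (series_exponent A \<beta> \<sigma> k) y summable_on zker A"
    if \<sigma>: "\<sigma> \<in> maximal_cells T" for \<sigma> k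
  proof -
    obtain \<delta> where d: "dual_basis A \<sigma> \<delta>" using triangulation_cell_dual_basis(2)[OF lattice T(1) \<sigma>] by blast
    have le: "(\<Sum>i\<in>\<sigma>. \<delta> i \<bullet> acol A l) \<le> 1" for l by (rule refinement_height[OF d \<sigma> T(2)])
    have v: "integral_off \<sigma> (series_exponent A \<beta> \<sigma> k)"
      by (simp add: integral_off_def series_exponent_props(2)[OF d])
    obtain K where K: "1 \<le> K" "\<And>y. (\<forall>l. l \<notin> \<sigma> \<longrightarrow> (\<Sum>i\<in>\<sigma>. \<delta> i \<bullet> acol A l) = 1 \<longrightarrow>
      K * exp (Re (y$l) - (\<Sum>i\<in>\<sigma>. (\<delta> i \<bullet> acol A l) * Re (y$i))) < 1) \<Longrightarrow>
      gamma_term (series_exponent A \<beta> \<sigma> k) y summable_on zker A"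
      using gamma_term_summable[OF d le v] by blast
    show ?thesis
    proof (intro exI[of _ K] conjI K(1) allI impI)
      fix x y :: "complex^'n"
      assume xy: "\<forall>j. exp (y$j) = x$j" and small: "\<forall>l. l \<notin> \<sigma> \<longrightarrow>
        (\<Sum>i\<in>\<sigma>. (simplex_coords A \<sigma> (acol A l) :: real^'n) $ i) = 1 \<longrightarrow>
        K * cmod (x$l) < (\<Prod>i\<in>\<sigma>. cmod (x$i) powr ((simplex_coords A \<sigma> (acol A l) :: real^'n) $ i))"
      have nx: "cmod (x$j) = exp (Re (y$j))" for j using xy by (metis norm_exp_eq_Re)
      show "gamma_term (series_exponent A \<beta> \<sigma> k) y summable_on zker A"
      proof (rule K(2), intro allI impI)
        fix l assume l: "l \<notin> \<sigma>" "(\<Sum>i\<in>\<sigma>. \<delta> i \<bullet> acol A l) = 1"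
        have "(\<Prod>i\<in>\<sigma>. cmod (x$i) powr ((simplex_coords A \<sigma> (acol A l) :: real^'n) $ i)) =
            exp (\<Sum>i\<in>\<sigma>. (\<delta> i \<bullet> acol A l) * Re (y$i))"
          by (simp add: exp_sum nx powr_def simplex_coords_real[OF d])
        moreover have "(\<Sum>i\<in>\<sigma>. (simplex_coords A \<sigma> (acol A l) :: real^'n) $ i) = 1"
          using l(2) by (simp add: simplex_coords_real[OF d])
        ultimately have "K * exp (Re (y$l)) < exp (\<Sum>i\<in>\<sigma>. (\<delta> i \<bullet> acol A l) * Re (y$i))"
          using small l(1) nx by metis
        then show "K * exp (Re (y$l) - (\<Sum>i\<in>\<sigma>. (\<delta> i \<bullet> acol A l) * Re (y$i))) < 1"
          by (simp add: exp_diff)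
      qed
    qed
  qed
  then have "\<forall>z\<in>Z. \<exists>K\<ge>1. \<forall>x y. (\<forall>j. exp (y$j) = x$j) \<longrightarrow> (\<forall>l. l \<notin> fst z \<longrightarrow>
      (\<Sum>i\<in>fst z. (simplex_coords A (fst z) (acol A l) :: real^'n) $ i) = 1 \<longrightarrow>
      K * cmod (x$l) < (\<Prod>i\<in>fst z. cmod (x$i) powr ((simplex_coords A (fst z) (acol A l) :: real^'n) $ i))) \<longrightarrow>
      gamma_term (series_exponent A \<beta> (fst z) (snd z)) y summable_on zker A"
    by (auto simp: Z_def)
  from bchoice[OF this] obtain K where K1: "\<And>z. z \<in> Z \<Longrightarrow> 1 \<le> K z" and
    K: "\<And>z x y. z \<in> Z \<Longrightarrow> (\<forall>j. exp (y$j) = x$j) \<Longrightarrow> (\<forall>l. l \<notin> fst z \<longrightarrow>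
      (\<Sum>i\<in>fst z. (simplex_coords A (fst z) (acol A l) :: real^'n) $ i) = 1 \<longrightarrow>
      K z * cmod (x$l) < (\<Prod>i\<in>fst z. cmod (x$i) powr ((simplex_coords A (fst z) (acol A l) :: real^'n) $ i))) \<Longrightarrow>
      gamma_term (series_exponent A \<beta> (fst z) (snd z)) y summable_on zker A"
    by (elim exE) blast
  define B where "B = 1 + (\<Sum>z\<in>Z. K z)"
  have "0 \<le> (\<Sum>z\<in>Z. K z)" using K1 by (intro sum_nonneg) force
  then have B: "0 < B" by (simp add: B_def)
  have KB: "K z \<le> B" if "z \<in> Z" for z
  proof -
    have "K z \<le> (\<Sum>z\<in>Z. K z)" using K1 by (intro member_le_sum[OF that _ finZ]) force
    then show ?thesis by (simp add: B_def)
  qed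
  show ?thesis
  proof (intro exI[of _ "1 / B"] conjI)
    show "0 < 1 / B" using B by simp
    show "series_converge A \<beta> T \<Omega> (series_domain A T (1 / B))"
      unfolding series_converge_def zker_def[symmetric]
    proof (intro ballI allI impI)
      fix x y \<sigma> k
      assume x: "x \<in> series_domain A T (1 / B)" and xy: "\<forall>j. exp (y$j) = x$j"
        and \<sigma>: "\<sigma> \<in> maximal_cells T" and k: "k \<in> \<Omega> \<sigma>"
      have z: "(\<sigma>, k) \<in> Z" using \<sigma> k by (simp add: Z_def)
      have dom: "cmod (x$l) < 1 / B * (\<Prod>i\<in>\<sigma>. cmod (x$i) powr ((simplex_coords A \<sigma> (acol A l) :: real^'n) $ i))"
        if "l \<notin> \<sigma>" "(\<Sum>i\<in>\<sigma>. (simplex_coords A \<sigma> (acol A l) :: real^'n) $ i) = 1" for l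
        using x \<sigma> that by (simp add: series_domain_def Let_def)
      have "K (\<sigma>, k) * cmod (x$l) < (\<Prod>i\<in>\<sigma>. cmod (x$i) powr ((simplex_coords A \<sigma> (acol A l) :: real^'n) $ i))"
        if "l \<notin> \<sigma>" "(\<Sum>i\<in>\<sigma>. (simplex_coords A \<sigma> (acol A l) :: real^'n) $ i) = 1" for l
      proof -
        have "K (\<sigma>, k) * cmod (x$l) \<le> B * cmod (x$l)" using KB[OF z] by (intro mult_right_mono) auto
        also have "\<dots> < (\<Prod>i\<in>\<sigma>. cmod (x$i) powr ((simplex_coords A \<sigma> (acol A l) :: real^'n) $ i))"
          using dom[OF that] B by (simp add: field_simps)
        finally show ?thesis .
      qed
      then show "gamma_term (series_exponent A \<beta> \<sigma> k) y summable_on zker A"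
        using K[OF z xy] by simp
    qed
  qed
qed

section \<open>The subspaces attached to a simplicial facet\<close>

text \<open>The part of a kernel vector inside \<tau> exhibits the difference of the two classes as
  an element of the lattice of \<tau>.\<close>

lemma representatives_distinct:
  fixes A :: "int^'n::finite^'d::finite"
  assumes \<Omega>: "representatives A \<tau> \<Omega>" and k: "k \<in> \<Omega>" "k' \<in> \<Omega>" and u: "u \<in> zker A"
    and eq: "\<And>l. l \<notin> \<tau> \<Longrightarrow> int (k$l) + u$l = int (k'$l)"
  shows "k = k'"
proof -
  have "(\<Sum>j\<in>UNIV. u$j *s acol A j) = A *v u"
    by (simp add: vec_eq_iff matrix_vector_mult_def mult.commute)
  then have "(\<Sum>j\<in>\<tau>. u$j *s acol A j) + (\<Sum>j\<in>-\<tau>. u$j *s acol A j) = 0"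
    using u by (subst sum.union_disjoint[symmetric]) (auto simp: Compl_partition zker_def)
  moreover have "kcol A \<tau> k' - kcol A \<tau> k = (\<Sum>j\<in>-\<tau>. u$j *s acol A j)"
    unfolding kcol_def sum_subtractf[symmetric]
    by (rule sum.cong) (auto simp: eq[symmetric] vec_eq_iff algebra_simps)
  ultimately have "kcol A \<tau> k - kcol A \<tau> k' = (\<Sum>j\<in>\<tau>. u$j *s acol A j)"
    by (metis add_eq_0_iff minus_diff_eq add.commute)
  then have "same_class A \<tau> k k'"
    unfolding same_class_iff lattice_of_def by (intro CollectI exI[of _ "\<lambda>j. u$j"]) simp
  moreover have "same_class A \<tau> k k" by (simp add: same_class_iff lattice_of_0)
  moreover have "k \<in> off_exponents \<tau>" using \<Omega> k by (auto simp: representatives_def)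
  ultimately show ?thesis using \<Omega> k unfolding representatives_def by blast
qed

lemma representatives_nonempty: "representatives A \<tau> \<Omega> \<Longrightarrow> \<Omega> \<noteq> {}"
proof -
  assume "representatives A \<tau> \<Omega>"
  moreover have "0 \<in> off_exponents \<tau>" by (simp add: off_exponents_def)
  ultimately show ?thesis unfolding representatives_def by blast
qed

text \<open>Outside \<tau> a natural power does not depend on the branch of the logarithm, and at
  negative integers both sides are 0; so the terms in logarithms and those in mixed coordinates
  coincide.\<close>

lemma gamma_term_eq_gterm:
  assumes v: "integral_off \<tau> v" and y: "\<And>l. l \<notin> \<tau> \<Longrightarrow> exp (y$l) = z$l" "\<And>i. i \<in> \<tau> \<Longrightarrow> y$i = z$i"
  shows "gamma_term v y u = gterm \<tau> UNIV v z u"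
proof -
  have "exp ((v$l + of_int (u$l)) * y$l) * rGamma (v$l + of_int (u$l) + 1) = hfac \<tau> l (v$l + of_int (u$l)) (z$l)" for l
  proof (cases "l \<in> \<tau>")
    case True
    then show ?thesis by (simp add: hfac_def y(2))
  next
    case False
    then have "v$l + of_int (u$l) \<in> \<int>" using v by (simp add: integral_off_def)
    then show ?thesis
    proof (cases rule: Nats_of_nat_or_nonpos)
      case (nat k)
      have "exp (of_nat k * y$l) = z$l ^ k" using y(1)[OF False] by (simp add: exp_of_nat_mult)
      then show ?thesis unfolding nat using False by (simp add: hfac_def)
    next
      case (neg k)
      have "rGamma (- of_nat (Suc k) + 1 :: complex) = 0" by (simp add: rGamma_eq_zero_iff)
      then show ?thesis unfolding neg hfac_neg[OF False] by (simp only: mult_zero_right)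
    qed
  qed
  then show ?thesis by (simp add: gamma_term_def gterm_def exp_sum prod.distrib[symmetric])
qed

lemma gamma_series_eq_local_series:
  fixes A :: "int^'n::finite^'d::finite"
  assumes v: "integral_off \<tau> (series_exponent A \<beta> \<tau> k)" and l: "log_branch_at q l" and q: "\<And>i. i \<in> \<tau> \<Longrightarrow> q$i \<noteq> 0"
  shows "germ_at q (\<lambda>x. gamma_series A \<beta> \<tau> k (l x)) = germ_at q (local_series A \<tau> (series_exponent A \<beta> \<tau> k) (l q) q)"
proof -
  obtain U where U: "open U" "q \<in> U" "continuous_on U l" "\<And>x j. x \<in> U \<Longrightarrow> exp (l x $ j) = x$j"
    using l by (auto simp: log_branch_at_def)
  have exp: "\<forall>\<^sub>F x in nhds q. \<forall>j. exp (l x $ j) = x$j"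
    using eventually_nhds_in_open[OF U(1,2)] by eventually_elim (use U(4) in blast)
  have "continuous (at q) l" using U continuous_on_eq_continuous_at by blast
  then have "continuous (at q) (\<lambda>x. l x $ i)" for i by (intro continuous_intros)
  then have "\<forall>\<^sub>F x in nhds q. l x $ i = l q $ i + Ln (x$i / q$i)" if "i \<in> \<tau>" for i
    using log_chart_unique[of q "\<lambda>x. l x $ i" i] q[OF that] eventually_mono[OF exp] by auto
  then have "\<forall>\<^sub>F x in nhds q. \<forall>i\<in>\<tau>. l x $ i = l q $ i + Ln (x$i / q$i)"
    by (intro eventually_ball_finite) auto
  with exp have "\<forall>\<^sub>F x in nhds q. gamma_series A \<beta> \<tau> k (l x) = local_series A \<tau> (series_exponent A \<beta> \<tau> k) (l q) q x"
  proof eventually_elim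
    case (elim x)
    have "gamma_term (series_exponent A \<beta> \<tau> k) (l x) u = gterm \<tau> UNIV (series_exponent A \<beta> \<tau> k) (local_log \<tau> (l q) q x) u" for u
      by (rule gamma_term_eq_gterm[OF v]) (use elim in \<open>auto simp: local_log_def\<close>)
    then have "gamma_term (series_exponent A \<beta> \<tau> k) (l x) = gterm \<tau> UNIV (series_exponent A \<beta> \<tau> k) (local_log \<tau> (l q) q x)"
      by (rule ext)
    then show ?case by (simp add: gamma_series_def local_series_def gsum_def zker_def)
  qed
  then show ?thesis by (simp add: germ_at_eq_iff)
qed

context simplicial_facet
begin

lemma nonresonant_S_tau:
  assumes lattice: "range (\<lambda>u::int^'n. A *v u) = UNIV" and card: "card \<tau> = CARD('d)"
    and nr: "nonresonant A \<beta>" and p: "p \<notin> sing_A A \<beta>"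
  shows "\<exists>S. is_S_tau A \<beta> \<tau> p S"
proof -
  obtain \<Omega> where \<Omega>: "representatives A \<tau> \<Omega>" using representatives_exist by blast
  define v0 where "v0 k = series_exponent A \<beta> \<tau> k" for k
  have v0: "amul A (v0 k) = \<beta>" "\<And>l. l \<notin> \<tau> \<Longrightarrow> v0 k $ l = of_nat (k$l)" for k
    unfolding v0_def by (rule series_exponent_props[OF dual], assumption?)+
  have "integral_off \<tau> (v0 k)" for k using v0(2) by (simp add: integral_off_def)
  from nonresonant_shift[OF lattice dual card nr v0(1) this]
  have "\<forall>k. \<exists>u. u \<in> zker A \<and> (\<forall>l. l \<notin> \<tau> \<longrightarrow> v0 k $ l + of_int (u$l) \<in> \<nat>) \<and>
    (\<forall>i\<in>\<tau>. rGamma (v0 k $ i + of_int (u$i) + 1) \<noteq> 0)" by blast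
  from choice[OF this] obtain u where u: "\<And>k. u k \<in> zker A"
    "\<And>k l. l \<notin> \<tau> \<Longrightarrow> v0 k $ l + of_int (u k $ l) \<in> \<nat>"
    "\<And>k i. i \<in> \<tau> \<Longrightarrow> rGamma (v0 k $ i + of_int (u k $ i) + 1) \<noteq> 0" by blast
  \<comment> \<open>Kernel shifts do not change classes, so exponents from distinct representatives
    remain unlinked by kernel vectors.\<close>
  define v where "v k = v0 k + ivec (u k)" for k
  have v_nth: "v k $ l = v0 k $ l + of_int (u k $ l)" for k l by (simp add: v_def ivec_def)
  have v1: "amul A (v k) = \<beta>" for k
    using u(1)[of k] by (simp add: v_def amul_add v0(1) amul_ivec_eq_0_iff[symmetric])
  have v2: "v k $ l \<in> \<nat>" if "l \<notin> \<tau>" for k l using u(2)[OF that] by (simp add: v_nth)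
  have v3: "rGamma (v k $ i + 1) \<noteq> 0" if "i \<in> \<tau>" for k i using u(3)[OF that] by (simp add: v_nth)
  have distinct: "k = k'" if kk: "k \<in> \<Omega>" "k' \<in> \<Omega>" and w: "w \<in> zker A"
    and eq: "\<And>l. l \<notin> \<tau> \<Longrightarrow> v k $ l + of_int (w$l) = v k' $ l" for k k' w
  proof (rule representatives_distinct[OF \<Omega> kk, of "u k + w - u k'"])
    show "u k + w - u k' \<in> zker A"
      using u(1)[of k] u(1)[of k'] w
      by (simp add: zker_def matrix_vector_right_distrib matrix_vector_mult_diff_distrib)
    fix l assume l: "l \<notin> \<tau>"
    have "(of_int (int (k$l) + (u k + w - u k') $ l) :: complex) = of_int (int (k'$l))"
      using eq[OF l] by (simp add: v_nth v0(2)[OF l] algebra_simps)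
    then show "int (k$l) + (u k + w - u k') $ l = int (k'$l)" by (simp only: of_int_eq_iff)
  qed
  have p0: "p$i \<noteq> 0" if "i \<in> \<tau>" for i
    using coordinate_hyperplane_singular[OF that _ v1 v2 v3, of p] p by blast
  have "is_S_tau A \<beta> \<tau> p (germ.span ((\<lambda>k. germ_at p (local_series A \<tau> (v k) (\<chi> i. Ln (p$i)) p)) ` \<Omega>))"
  proof (rule is_S_tau_span[OF representatives_card(1)[OF lattice dual card \<Omega>] representatives_nonempty[OF \<Omega>]
      representatives_card(2)[OF lattice dual card \<Omega>] v1 v2 v3 _ p])
    fix k k' w assume "k \<in> \<Omega>" "k' \<in> \<Omega>" "w \<in> zker A" "\<And>l. l \<notin> \<tau> \<Longrightarrow> v k $ l + of_int (w$l) = v k' $ l"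
    then show "k = k'" by (rule distinct)
  next
    fix i assume "i \<in> \<tau>"
    then show "exp ((\<chi> i. Ln (p$i)) $ i) = p$i" using p0 by simp
  qed
  then show ?thesis by blast
qed

text \<open>Only the simplex \<tau> itself contributes generators, and uniqueness of continuation
  identifies them with the germs built from one choice c' of logarithms at the endpoint. Very
  genericity makes the exponents in \<tau> nonintegral, so no Gamma factor there vanishes.\<close>

lemma very_generic_S_tau:
  assumes lattice: "range (\<lambda>u::int^'n. A *v u) = UNIV" and card: "card \<tau> = CARD('d)"
    and \<tau>T: "\<tau> \<in> maximal_cells T" "\<And>\<sigma>. \<sigma> \<in> maximal_cells T \<Longrightarrow> \<sigma> \<subseteq> \<tau> \<Longrightarrow> \<sigma> = \<tau>"
    and \<Omega>: "representatives A \<tau> (\<Omega> \<tau>)" and vg: "very_generic A T \<Omega> \<beta>"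
    and l: "log_branch_at (pathstart \<gamma>) l"
    and \<gamma>: "path \<gamma>" "path_image \<gamma> \<subseteq> - sing_A A \<beta>"
  shows "is_S_tau A \<beta> \<tau> (pathfinish \<gamma>) (gamma_space A \<beta> T \<Omega> \<tau> l \<gamma>)"
proof -
  define v where "v k = series_exponent A \<beta> \<tau> k" for k
  have v1: "amul A (v k) = \<beta>" for k unfolding v_def by (rule series_exponent_props(1)[OF dual])
  have v_off: "v k $ j = of_nat (k$j)" if "j \<notin> \<tau>" for k j
    unfolding v_def by (rule series_exponent_props(2)[OF dual that])
  have v2: "v k $ j \<in> \<nat>" if "j \<notin> \<tau>" for k j by (simp add: v_off[OF that])
  have vi: "integral_off \<tau> (v k)" for k by (simp add: integral_off_def v_off)
  have v3: "rGamma (v k $ i + 1) \<noteq> 0" if k: "k \<in> \<Omega> \<tau>" and i: "i \<in> \<tau>" for k i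
  proof
    assume "rGamma (v k $ i + 1) = 0"
    then have "v k $ i + 1 - 1 \<in> \<int>" by (intro Ints_diff) (auto simp: rGamma_eq_zero_iff dest: nonpos_Ints_Int)
    moreover have "v k $ i \<notin> \<int>"
    proof -
      have "simplex_coords A \<tau> (\<beta> - (\<Sum>j\<in>-\<tau>. of_nat (k$j) *s acol A j)) $ i \<notin> \<int>"
        using vg \<tau>T(1) k i unfolding very_generic_def by blast
      then show ?thesis
        using i by (simp add: v_def simplex_coords_complex[OF dual] series_exponent_props(3)[OF dual i])
    qed
    ultimately show False by simp
  qed
  obtain k1 where k1: "k1 \<in> \<Omega> \<tau>" using representatives_nonempty[OF \<Omega>] by blast
  have nz: "\<gamma> t $ i \<noteq> 0" if t: "t \<in> {0..1}" and i: "i \<in> \<tau>" for t i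
  proof
    assume "\<gamma> t $ i = 0"
    then have "\<gamma> t \<in> sing_A A \<beta>" by (rule coordinate_hyperplane_singular[OF i _ v1 v2 v3[OF k1]])
    moreover have "\<gamma> t \<in> path_image \<gamma>" using t by (simp add: path_image_def)
    ultimately show False using \<gamma>(2) by blast
  qed
  have exp: "exp (l (\<gamma> 0) $ i) = \<gamma> 0 $ i" for i using l by (auto simp: log_branch_at_def pathstart_def)
  have "\<exists>c'. (\<forall>i\<in>\<tau>. exp (c'$i) = \<gamma> 1 $ i) \<and> (\<forall>\<alpha>. continues_along \<gamma>
     (germ_at (\<gamma> 0) (\<lambda>x. \<Sum>k\<in>\<Omega> \<tau>. \<alpha> k * local_series A \<tau> (v k) (l (\<gamma> 0)) (\<gamma> 0) x))
     (germ_at (\<gamma> 1) (\<lambda>x. \<Sum>k\<in>\<Omega> \<tau>. \<alpha> k * local_series A \<tau> (v k) c' (\<gamma> 1) x)))"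
    by (rule local_series_continues[OF gseries_full vi \<gamma>(1) nz exp])
  then obtain c' where c': "\<And>i. i \<in> \<tau> \<Longrightarrow> exp (c'$i) = \<gamma> 1 $ i" "\<And>\<alpha>. continues_along \<gamma>
     (germ_at (\<gamma> 0) (\<lambda>x. \<Sum>k\<in>\<Omega> \<tau>. \<alpha> k * local_series A \<tau> (v k) (l (\<gamma> 0)) (\<gamma> 0) x))
     (germ_at (\<gamma> 1) (\<lambda>x. \<Sum>k\<in>\<Omega> \<tau>. \<alpha> k * local_series A \<tau> (v k) c' (\<gamma> 1) x))"
    by blast
  have fin: "finite (\<Omega> \<tau>)" by (rule representatives_card(1)[OF lattice dual card \<Omega>])
  define G where "G k = germ_at (\<gamma> 1) (local_series A \<tau> (v k) c' (\<gamma> 1))" for k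
  have cont: "continues_along \<gamma> (germ_at (\<gamma> 0) (\<lambda>x. gamma_series A \<beta> \<tau> k (l x))) (G k)" if k: "k \<in> \<Omega> \<tau>" for k
  proof -
    have "germ_at (\<gamma> 0) (\<lambda>x. gamma_series A \<beta> \<tau> k (l x)) = germ_at (\<gamma> 0) (local_series A \<tau> (v k) (l (\<gamma> 0)) (\<gamma> 0))"
      unfolding v_def by (rule gamma_series_eq_local_series) (use vi[of k] l nz[of 0] in \<open>auto simp: v_def pathstart_def\<close>)
    moreover have "(\<lambda>x. \<Sum>k'\<in>\<Omega> \<tau>. (if k' = k then 1 else 0) * f k' x) = f k" for f :: "nat^'n \<Rightarrow> complex^'n \<Rightarrow> complex"
      using fin k by (simp add: if_distrib[of "\<lambda>a. a * _"] cong: if_cong)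
    ultimately show ?thesis using c'(2)[of "\<lambda>k'. if k' = k then 1 else 0"] by (simp only: G_def)
  qed
  have "{\<psi>. \<exists>\<sigma>\<in>maximal_cells T. \<exists>k\<in>\<Omega> \<sigma>. \<sigma> \<subseteq> \<tau> \<and>
      continues_along \<gamma> (germ_at (pathstart \<gamma>) (\<lambda>x. gamma_series A \<beta> \<sigma> k (l x))) \<psi>} = G ` \<Omega> \<tau>"
  proof (intro set_eqI iffI)
    fix \<psi> assume "\<psi> \<in> {\<psi>. \<exists>\<sigma>\<in>maximal_cells T. \<exists>k\<in>\<Omega> \<sigma>. \<sigma> \<subseteq> \<tau> \<and>
      continues_along \<gamma> (germ_at (pathstart \<gamma>) (\<lambda>x. gamma_series A \<beta> \<sigma> k (l x))) \<psi>}"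
    then obtain \<sigma> k where \<sigma>: "\<sigma> \<in> maximal_cells T" "k \<in> \<Omega> \<sigma>" "\<sigma> \<subseteq> \<tau>"
      "continues_along \<gamma> (germ_at (\<gamma> 0) (\<lambda>x. gamma_series A \<beta> \<sigma> k (l x))) \<psi>"
      by (auto simp: pathstart_def)
    have "\<sigma> = \<tau>" by (rule \<tau>T(2)[OF \<sigma>(1,3)])
    then have "k \<in> \<Omega> \<tau>" "\<psi> = G k" using \<sigma> continues_along_unique[OF _ cont] by auto
    then show "\<psi> \<in> G ` \<Omega> \<tau>" by blast
  next
    fix \<psi> assume "\<psi> \<in> G ` \<Omega> \<tau>"
    then show "\<psi> \<in> {\<psi>. \<exists>\<sigma>\<in>maximal_cells T. \<exists>k\<in>\<Omega> \<sigma>. \<sigma> \<subseteq> \<tau> \<and>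
      continues_along \<gamma> (germ_at (pathstart \<gamma>) (\<lambda>x. gamma_series A \<beta> \<sigma> k (l x))) \<psi>}"
      using cont \<tau>T(1) by (auto simp: pathstart_def)
  qed
  then have space: "gamma_space A \<beta> T \<Omega> \<tau> l \<gamma> = germ.span (G ` \<Omega> \<tau>)" by (simp add: gamma_space_def)
  have sing: "\<gamma> 1 \<notin> sing_A A \<beta>" using \<gamma>(2) pathfinish_in_path_image[of \<gamma>] by (auto simp: pathfinish_def)
  have "is_S_tau A \<beta> \<tau> (\<gamma> 1) (germ.span (G ` \<Omega> \<tau>))"
    unfolding G_def
  proof (rule is_S_tau_span[OF fin representatives_nonempty[OF \<Omega>]
      representatives_card(2)[OF lattice dual card \<Omega>] v1 v2 v3 _ sing c'(1)])
    fix k k' u assume kk: "k \<in> \<Omega> \<tau>" "k' \<in> \<Omega> \<tau>" and u: "u \<in> zker A"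
      and eq: "\<And>j. j \<notin> \<tau> \<Longrightarrow> v k $ j + of_int (u$j) = v k' $ j"
    show "k = k'"
    proof (rule representatives_distinct[OF \<Omega> kk u])
      fix j assume j: "j \<notin> \<tau>"
      have "(of_int (int (k$j) + u$j) :: complex) = of_int (int (k'$j))"
        using eq[OF j] by (simp add: v_off[OF j])
      then show "int (k$j) + u$j = int (k'$j)" by (simp only: of_int_eq_iff)
    qed
  qed
  then show ?thesis by (simp add: space pathfinish_def)
qed

end

theorem proposition5p2:
  fixes A :: "int^'n::finite^'d::finite" and \<tau> :: "'n set"
  assumes lattice: "range (\<lambda>u::int^'n. A *v u) = UNIV"
    and facet: "\<tau> \<in> maximal_cells (gamma_complex A)"
    and simplicial: "card \<tau> = CARD('d)"
  shows "(\<forall>\<beta> p. nonresonant A \<beta> \<and> p \<notin> sing_A A \<beta> \<longrightarrow> (\<exists>S. is_S_tau A \<beta> \<tau> p S)) \<and>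
    (\<forall>T \<Omega> \<beta>. regular_triangulation A T \<and> refines_complex T (gamma_complex A) \<and>
       (\<forall>\<sigma>\<in>maximal_cells T. representatives A \<sigma> (\<Omega> \<sigma>)) \<and> very_generic A T \<Omega> \<beta> \<longrightarrow>
       (\<exists>R>0. series_converge A \<beta> T \<Omega> (series_domain A T R) \<and>
         (\<forall>p q l \<gamma>. p \<notin> sing_A A \<beta> \<and> q \<in> series_domain A T R \<and> log_branch_at q l \<and>
            path \<gamma> \<and> path_image \<gamma> \<subseteq> - sing_A A \<beta> \<and> pathstart \<gamma> = q \<and> pathfinish \<gamma> = p \<longrightarrow>
            is_S_tau A \<beta> \<tau> p (gamma_space A \<beta> T \<Omega> \<tau> l \<gamma>))))"
proof -
  obtain \<delta> where "simplicial_facet A \<tau> \<delta>" using gamma_facet_simplicial[OF lattice facet simplicial] by blast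
  then interpret simplicial_facet A \<tau> \<delta> .
  show ?thesis
  proof (intro conjI allI impI)
    fix \<beta> p assume "nonresonant A \<beta> \<and> p \<notin> sing_A A \<beta>"
    then show "\<exists>S. is_S_tau A \<beta> \<tau> p S" using nonresonant_S_tau[OF lattice simplicial] by blast
  next
    fix T \<Omega> \<beta>
    assume asm: "regular_triangulation A T \<and> refines_complex T (gamma_complex A) \<and>
       (\<forall>\<sigma>\<in>maximal_cells T. representatives A \<sigma> (\<Omega> \<sigma>)) \<and> very_generic A T \<Omega> \<beta>"
    then have T: "regular_triangulation A T" "refines_complex T (gamma_complex A)" and vg: "very_generic A T \<Omega> \<beta>"
      and \<Omega>: "\<And>\<sigma>. \<sigma> \<in> maximal_cells T \<Longrightarrow> representatives A \<sigma> (\<Omega> \<sigma>)" by blast+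
    note \<tau>T = simplicial_facet_in_triangulation[OF T facet dual]
    obtain R where R: "0 < R" "series_converge A \<beta> T \<Omega> (series_domain A T R)"
      using gamma_series_converge[OF lattice T, where \<Omega> = \<Omega> and \<beta> = \<beta>] \<Omega> by blast
    show "\<exists>R>0. series_converge A \<beta> T \<Omega> (series_domain A T R) \<and>
         (\<forall>p q l \<gamma>. p \<notin> sing_A A \<beta> \<and> q \<in> series_domain A T R \<and> log_branch_at q l \<and>
            path \<gamma> \<and> path_image \<gamma> \<subseteq> - sing_A A \<beta> \<and> pathstart \<gamma> = q \<and> pathfinish \<gamma> = p \<longrightarrow>
            is_S_tau A \<beta> \<tau> p (gamma_space A \<beta> T \<Omega> \<tau> l \<gamma>))"
    proof (intro exI[of _ R] conjI allI impI R)
      fix p q l \<gamma>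
      assume h: "p \<notin> sing_A A \<beta> \<and> q \<in> series_domain A T R \<and> log_branch_at q l \<and>
            path \<gamma> \<and> path_image \<gamma> \<subseteq> - sing_A A \<beta> \<and> pathstart \<gamma> = q \<and> pathfinish \<gamma> = p"
      have "is_S_tau A \<beta> \<tau> (pathfinish \<gamma>) (gamma_space A \<beta> T \<Omega> \<tau> l \<gamma>)"
      proof (rule very_generic_S_tau[where \<Omega> = \<Omega>, OF lattice simplicial \<tau>T(1) _ \<Omega>[OF \<tau>T(1)] vg])
        fix \<sigma> assume "\<sigma> \<in> maximal_cells T" "\<sigma> \<subseteq> \<tau>"
        then show "\<sigma> = \<tau>" by (rule \<tau>T(2))
      qed (use h in simp_all)
      then show "is_S_tau A \<beta> \<tau> p (gamma_space A \<beta> T \<Omega> \<tau> l \<gamma>)" using h by simp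
    qed
  qed
qed

end
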